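(* Let $S$ be a $0$-reduced simplicial set with $S_0=\{x\}$. The differential graded associative algebras $\Omega Q_{\Delta}(S)$ and $\Gamma(S)(x,x)$ are naturally weakly equivalent.
   Context: $k$ is a fixed commutative unital ring; all chains are over $k$. A simplicial set $S$ is $0$-reduced if $S_0$ is a singleton. Two dga's are weakly equivalent if connected by a zig-zag of quasi-isomorphisms of dga's; naturally means the zig-zag is natural in $S$. $Q_\Delta(S)$ is the dg coalgebra of normalized simplicial chains with the Alexander-Whitney coproduct $\Delta(\sigma)=\sum_{p+q=n}f^p(\sigma)\otimes l^q(\sigma)$, $\sigma\in S_n$, where $f^p$ is the front $p$-face ($[p]\to[p+q]$, $i\mapsto i$) and $l^q$ the last $q$-face ($[q]\to[p+q]$, $i\mapsto i+p$). For $S$ $0$-reduced it is counital and connected (degree $0$ part equal to $k$). Cobar construction of a connected dg coalgebra $(C,\partial,\Delta)$, free over $k$ in each degree: let $\overline C_i=C_i$ for $i>0$, $\overline C_0=0$, $(s\overline C)_i=\overline C_{i+1}$, and $\Delta(c)=c\otimes1+1\otimes c+\sum c'\otimes c''$ for $c\in\overline C$. Then $\Omega C$ is the tensor algebra $k\oplus s\overline C\oplus(s\overline C)^{\otimes2}\oplus\cdots$ with differential the derivation extending $D(sc)=-s\partial c+\sum(-1)^{\deg c'}sc'\otimes sc''$. Functor $\mathfrak C:Set_\Delta\to Cat_\Delta$ (Lurie), from simplicial sets to simplicial categories (small categories enriched over simplicial sets): for $0\le i\le j$ let $P_{i,j}$ be the poset of subsets of $\{i,\dots,j\}$ containing $i$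 and $j$. $\mathfrak C(\Delta^n)$ has objects $0,\dots,n$, mapping spaces $\mathfrak C(\Delta^n)(i,j)=N(P_{i,j})$ (nerve) if $i\le j$ and $\emptyset$ otherwise, and composition induced by union of sets $P_{j,l}\times P_{i,j}\to P_{i,l}$; this is functorial in $[n]$, and $\mathfrak C(S)=\mathrm{colim}_{\Delta^n\to S}\mathfrak C(\Delta^n)$ in $Cat_\Delta$. $\Gamma(S)$ is the dg category obtained by applying normalized simplicial chains to the mapping spaces of $\mathfrak C(S)$, so $\Gamma(S)(x,x)=Q_\Delta(\mathfrak C(S)(x,x))$. It is a dga via the Eilenberg-Zilber shuffle map and the simplicial monoid structure of $\mathfrak C(S)(x,x)$, where endomorphisms are multiplied in path order (the product of $f$ and $g$ is "$f$ followed by $g$"). *)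

theory Defs
  imports "HOL-Library.Poly_Mapping" "HOL-Library.FuncSet"
begin

section \<open>Simplicial sets\<close>

text \<open>The morphisms \<open>[m] \<rightarrow> [n]\<close> of the simplex category, as extensional functions, composed
  with \<^const>\<open>compose\<close>.\<close>

definition mono_maps :: "nat \<Rightarrow> nat \<Rightarrow> (nat \<Rightarrow> nat) set" where
  "mono_maps m n = {\<theta> \<in> {..m} \<rightarrow>\<^sub>E {..n}. mono_on {..m} \<theta>}"

text \<open>\<open>sact S m n \<theta> : S\<^sub>n \<rightarrow> S\<^sub>m\<close> is the operator of \<open>\<theta> : [m] \<rightarrow> [n]\<close>. The sets \<open>spx S n\<close> for different
  \<open>n\<close> may overlap inside the ambient type, so a simplex is only determined together with its
  dimension.\<close>

record 's sset =
  spx :: "nat \<Rightarrow> 's set"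
  sact :: "nat \<Rightarrow> nat \<Rightarrow> (nat \<Rightarrow> nat) \<Rightarrow> 's \<Rightarrow> 's"

definition simplicial_set :: "'s sset \<Rightarrow> bool" where
  "simplicial_set S \<longleftrightarrow>
     (\<forall>m n. \<forall>\<theta>\<in>mono_maps m n. \<forall>\<sigma>\<in>spx S n. sact S m n \<theta> \<sigma> \<in> spx S m) \<and>
     (\<forall>n. \<forall>\<sigma>\<in>spx S n. sact S n n (restrict id {..n}) \<sigma> = \<sigma>) \<and>
     (\<forall>l m n. \<forall>\<phi>\<in>mono_maps l m. \<forall>\<theta>\<in>mono_maps m n. \<forall>\<sigma>\<in>spx S n.
        sact S l m \<phi> (sact S m n \<theta> \<sigma>) = sact S l n (compose {..l} \<theta> \<phi>) \<sigma>)"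

definition simplicial_maps :: "'s sset \<Rightarrow> 't sset \<Rightarrow> (nat \<Rightarrow> 's \<Rightarrow> 't) set" where
  "simplicial_maps S T =
     {f. (\<forall>n. f n \<in> spx S n \<rightarrow>\<^sub>E spx T n) \<and>
         (\<forall>m n. \<forall>\<theta>\<in>mono_maps m n. \<forall>\<sigma>\<in>spx S n.
            f m (sact S m n \<theta> \<sigma>) = sact T m n \<theta> (f n \<sigma>))}"

definition reduced_ssets :: "'s sset set" where
  "reduced_ssets = {S. simplicial_set S \<and> (\<exists>x. spx S 0 = {x})}"

definition coface :: "nat \<Rightarrow> nat \<Rightarrow> nat \<Rightarrow> nat" where
  "coface n i = (\<lambda>t\<in>{..n}. if t < i then t else Suc t)"

definition codegeneracy :: "nat \<Rightarrow> nat \<Rightarrow> nat \<Rightarrow> nat" where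
  "codegeneracy n i = (\<lambda>t\<in>{..Suc n}. if t \<le> i then t else t - 1)"

definition sface :: "'s sset \<Rightarrow> nat \<Rightarrow> nat \<Rightarrow> 's \<Rightarrow> 's" where
  "sface S n i \<sigma> = sact S n (Suc n) (coface n i) \<sigma>"

definition degenerate :: "'s sset \<Rightarrow> nat \<Rightarrow> 's \<Rightarrow> bool" where
  "degenerate S n \<sigma> \<longleftrightarrow>
     (\<exists>m i \<tau>. n = Suc m \<and> i \<le> m \<and> \<tau> \<in> spx S m \<and> \<sigma> = sact S n m (codegeneracy m i) \<tau>)"

definition nondegenerate :: "'s sset \<Rightarrow> (nat \<times> 's) set" where
  "nondegenerate S = {(n, \<sigma>). \<sigma> \<in> spx S n \<and> \<not> degenerate S n \<sigma>}"

definition front_face :: "'s sset \<Rightarrow> nat \<Rightarrow> nat \<Rightarrow> 's \<Rightarrow> 's" where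
  "front_face S n p \<sigma> = sact S p n (\<lambda>t\<in>{..p}. t) \<sigma>"

definition last_face :: "'s sset \<Rightarrow> nat \<Rightarrow> nat \<Rightarrow> 's \<Rightarrow> 's" where
  "last_face S n q \<sigma> = sact S q n (\<lambda>t\<in>{..q}. t + (n - q)) \<sigma>"


section \<open>Differential graded algebras and weak equivalence\<close>

text \<open>The sort \<open>{comm_ring, comm_monoid_mult}\<close> is that of commutative unital rings without the
  requirement \<open>0 \<noteq> 1\<close> of \<^class>\<open>comm_ring_1\<close>. Gradings are homological and indexed by all integers.
  Sums are only ever formed within one degree.\<close>

record ('k, 'a) dg_alg =
  Gr :: "int \<Rightarrow> 'a set"
  Zero :: 'a
  Add :: "'a \<Rightarrow> 'a \<Rightarrow> 'a"
  Scale :: "'k \<Rightarrow> 'a \<Rightarrow> 'a"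
  One :: 'a
  Mul :: "'a \<Rightarrow> 'a \<Rightarrow> 'a"
  Dif :: "'a \<Rightarrow> 'a"

definition Neg :: "('k::{comm_ring,comm_monoid_mult}, 'a) dg_alg \<Rightarrow> 'a \<Rightarrow> 'a" where
  "Neg A a = Scale A (- 1) a"

locale dga =
  fixes A :: "('k::{comm_ring,comm_monoid_mult}, 'a) dg_alg"
  assumes zero_closed: "Zero A \<in> Gr A i"
    and add_closed: "\<lbrakk>a \<in> Gr A i; b \<in> Gr A i\<rbrakk> \<Longrightarrow> Add A a b \<in> Gr A i"
    and scale_closed: "a \<in> Gr A i \<Longrightarrow> Scale A r a \<in> Gr A i"
    and add_assoc: "\<lbrakk>a \<in> Gr A i; b \<in> Gr A i; c \<in> Gr A i\<rbrakk>
          \<Longrightarrow> Add A (Add A a b) c = Add A a (Add A b c)"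
    and add_commute: "\<lbrakk>a \<in> Gr A i; b \<in> Gr A i\<rbrakk> \<Longrightarrow> Add A a b = Add A b a"
    and add_zero: "a \<in> Gr A i \<Longrightarrow> Add A (Zero A) a = a"
    and add_neg: "a \<in> Gr A i \<Longrightarrow> Add A a (Neg A a) = Zero A"
    and scale_add: "\<lbrakk>a \<in> Gr A i; b \<in> Gr A i\<rbrakk>
          \<Longrightarrow> Scale A r (Add A a b) = Add A (Scale A r a) (Scale A r b)"
    and add_scale: "a \<in> Gr A i \<Longrightarrow> Scale A (r + s) a = Add A (Scale A r a) (Scale A s a)"
    and scale_scale: "a \<in> Gr A i \<Longrightarrow> Scale A (r * s) a = Scale A r (Scale A s a)"
    and scale_one: "a \<in> Gr A i \<Longrightarrow> Scale A 1 a = a"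
    and mul_closed: "\<lbrakk>a \<in> Gr A i; b \<in> Gr A j\<rbrakk> \<Longrightarrow> Mul A a b \<in> Gr A (i + j)"
    and mul_add_left: "\<lbrakk>a \<in> Gr A i; b \<in> Gr A i; c \<in> Gr A j\<rbrakk>
          \<Longrightarrow> Mul A (Add A a b) c = Add A (Mul A a c) (Mul A b c)"
    and mul_add_right: "\<lbrakk>a \<in> Gr A i; b \<in> Gr A j; c \<in> Gr A j\<rbrakk>
          \<Longrightarrow> Mul A a (Add A b c) = Add A (Mul A a b) (Mul A a c)"
    and mul_scale_left: "\<lbrakk>a \<in> Gr A i; b \<in> Gr A j\<rbrakk>
          \<Longrightarrow> Mul A (Scale A r a) b = Scale A r (Mul A a b)"
    and mul_scale_right: "\<lbrakk>a \<in> Gr A i; b \<in> Gr A j\<rbrakk>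
          \<Longrightarrow> Mul A a (Scale A r b) = Scale A r (Mul A a b)"
    and mul_assoc: "\<lbrakk>a \<in> Gr A i; b \<in> Gr A j; c \<in> Gr A l\<rbrakk>
          \<Longrightarrow> Mul A (Mul A a b) c = Mul A a (Mul A b c)"
    and one_closed: "One A \<in> Gr A 0"
    and one_mul: "a \<in> Gr A i \<Longrightarrow> Mul A (One A) a = a"
    and mul_one: "a \<in> Gr A i \<Longrightarrow> Mul A a (One A) = a"
    and dif_closed: "a \<in> Gr A i \<Longrightarrow> Dif A a \<in> Gr A (i - 1)"
    and dif_add: "\<lbrakk>a \<in> Gr A i; b \<in> Gr A i\<rbrakk> \<Longrightarrow> Dif A (Add A a b) = Add A (Dif A a) (Dif A b)"
    and dif_scale: "a \<in> Gr A i \<Longrightarrow> Dif A (Scale A r a) = Scale A r (Dif A a)"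
    and dif_dif: "a \<in> Gr A i \<Longrightarrow> Dif A (Dif A a) = Zero A"
    and dif_mul: "\<lbrakk>a \<in> Gr A i; b \<in> Gr A j\<rbrakk> \<Longrightarrow> Dif A (Mul A a b) =
          Add A (Mul A (Dif A a) b)
                (if even i then Mul A a (Dif A b) else Neg A (Mul A a (Dif A b)))"

definition dga_hom ::
  "('k, 'a) dg_alg \<Rightarrow> ('k, 'b) dg_alg \<Rightarrow> ('a \<Rightarrow> 'b) \<Rightarrow> bool" where
  "dga_hom A B \<phi> \<longleftrightarrow>
     (\<forall>i. \<forall>a\<in>Gr A i. \<phi> a \<in> Gr B i) \<and>
     (\<forall>i. \<forall>a\<in>Gr A i. \<forall>b\<in>Gr A i. \<phi> (Add A a b) = Add B (\<phi> a) (\<phi> b)) \<and>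
     (\<forall>i r. \<forall>a\<in>Gr A i. \<phi> (Scale A r a) = Scale B r (\<phi> a)) \<and>
     \<phi> (One A) = One B \<and>
     (\<forall>i j. \<forall>a\<in>Gr A i. \<forall>b\<in>Gr A j. \<phi> (Mul A a b) = Mul B (\<phi> a) (\<phi> b)) \<and>
     (\<forall>i. \<forall>a\<in>Gr A i. \<phi> (Dif A a) = Dif B (\<phi> a))"

definition cycles :: "('k, 'a) dg_alg \<Rightarrow> int \<Rightarrow> 'a set" where
  "cycles A i = {z \<in> Gr A i. Dif A z = Zero A}"

definition homologous :: "('k, 'a) dg_alg \<Rightarrow> int \<Rightarrow> ('a \<times> 'a) set" where
  "homologous A i =
     {(z, w). z \<in> cycles A i \<and> w \<in> cycles A i \<and> (\<exists>b\<in>Gr A (i + 1). w = Add A z (Dif A b))}"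

definition homology :: "('k, 'a) dg_alg \<Rightarrow> int \<Rightarrow> 'a set set" where
  "homology A i = cycles A i // homologous A i"

definition quasi_iso ::
  "('k, 'a) dg_alg \<Rightarrow> ('k, 'b) dg_alg \<Rightarrow> ('a \<Rightarrow> 'b) \<Rightarrow> bool" where
  "quasi_iso A B \<phi> \<longleftrightarrow> dga_hom A B \<phi> \<and>
     (\<forall>i. bij_betw (\<lambda>c. homologous B i `` (\<phi> ` c)) (homology A i) (homology B i))"

text \<open>Functors from the category of \<open>0\<close>-reduced simplicial sets with simplices in the type \<open>'s\<close>
  to dgas with elements in the type \<open>'a\<close>.\<close>

record ('s, 'k, 'a) dga_functor =
  Fob :: "'s sset \<Rightarrow> ('k, 'a) dg_alg"
  Fmap :: "'s sset \<Rightarrow> 's sset \<Rightarrow> (nat \<Rightarrow> 's \<Rightarrow> 's) \<Rightarrow> 'a \<Rightarrow> 'a"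

definition is_dga_functor ::
  "('s, 'k::{comm_ring,comm_monoid_mult}, 'a) dga_functor \<Rightarrow> bool" where
  "is_dga_functor F \<longleftrightarrow>
     (\<forall>S\<in>reduced_ssets. dga (Fob F S)) \<and>
     (\<forall>S\<in>reduced_ssets. \<forall>T\<in>reduced_ssets. \<forall>f\<in>simplicial_maps S T.
        dga_hom (Fob F S) (Fob F T) (Fmap F S T f)) \<and>
     (\<forall>S\<in>reduced_ssets. \<forall>i. \<forall>a\<in>Gr (Fob F S) i.
        Fmap F S S (\<lambda>n. restrict id (spx S n)) a = a) \<and>
     (\<forall>S\<in>reduced_ssets. \<forall>T\<in>reduced_ssets. \<forall>U\<in>reduced_ssets.
        \<forall>f\<in>simplicial_maps S T. \<forall>g\<in>simplicial_maps T U. \<forall>i. \<forall>a\<in>Gr (Fob F S) i.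
          Fmap F S U (\<lambda>n. compose (spx S n) (g n) (f n)) a = Fmap F T U g (Fmap F S T f a))"

definition natural_quasi_iso ::
  "('s, 'k::{comm_ring,comm_monoid_mult}, 'a) dga_functor \<Rightarrow> ('s, 'k, 'b) dga_functor \<Rightarrow> bool"
where
  "natural_quasi_iso F G \<longleftrightarrow> is_dga_functor F \<and> is_dga_functor G \<and>
     (\<exists>\<eta>. (\<forall>S\<in>reduced_ssets. quasi_iso (Fob F S) (Fob G S) (\<eta> S)) \<and>
          (\<forall>S\<in>reduced_ssets. \<forall>T\<in>reduced_ssets. \<forall>f\<in>simplicial_maps S T. \<forall>i.
             \<forall>a\<in>Gr (Fob F S) i. \<eta> T (Fmap F S T f a) = Fmap G S T f (\<eta> S a)))"

text \<open>Existential quantification over types being unavailable, the intermediate functors of the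
  zig-zag \<open>F \<rightarrow> Z 0 \<leftrightarrow> \<dots> \<leftrightarrow> Z n \<leftarrow> G\<close> take their elements in one fixed type, which contains copies
  of \<open>'a\<close> and \<open>'b\<close> and is of strictly larger cardinality. The directions of the two outer arrows
  are no restriction: copies of \<open>F\<close> and \<open>G\<close> may be inserted.\<close>

definition naturally_weakly_equivalent ::
  "('s, 'k::{comm_ring,comm_monoid_mult}, 'a) dga_functor \<Rightarrow> ('s, 'k, 'b) dga_functor \<Rightarrow> bool"
where
  "naturally_weakly_equivalent F G \<longleftrightarrow>
     (\<exists>(Z :: nat \<Rightarrow> ('s, 'k, ('a + 'b) set) dga_functor) n.
        natural_quasi_iso F (Z 0) \<and>
        (\<forall>i<n. natural_quasi_iso (Z i) (Z (Suc i)) \<or> natural_quasi_iso (Z (Suc i)) (Z i)) \<and>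
        natural_quasi_iso G (Z n))"


section \<open>Free modules and normalized chains\<close>

text \<open>\<^typ>\<open>'x \<Rightarrow>\<^sub>0 'k\<close> is the free \<open>'k\<close>-module on \<open>'x\<close>, and the tensor product of the free modules on
  \<open>'x\<close> and \<open>'y\<close> is the free module on \<open>'x \<times> 'y\<close>.\<close>

definition scale :: "'k::comm_ring \<Rightarrow> ('x \<Rightarrow>\<^sub>0 'k) \<Rightarrow> ('x \<Rightarrow>\<^sub>0 'k)" where
  "scale r p = Poly_Mapping.map ((*) r) p"

definition gen :: "'x \<Rightarrow> ('x \<Rightarrow>\<^sub>0 'k::{comm_ring,comm_monoid_mult})" where
  "gen x = Poly_Mapping.single x 1"

definition lin :: "('x \<Rightarrow> ('y \<Rightarrow>\<^sub>0 'k)) \<Rightarrow> ('x \<Rightarrow>\<^sub>0 'k::comm_ring) \<Rightarrow> ('y \<Rightarrow>\<^sub>0 'k)" where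
  "lin f p = (\<Sum>x\<in>Poly_Mapping.keys p. scale (Poly_Mapping.lookup p x) (f x))"

definition bilin ::
  "('x \<Rightarrow> 'y \<Rightarrow> ('z \<Rightarrow>\<^sub>0 'k)) \<Rightarrow> ('x \<Rightarrow>\<^sub>0 'k::comm_ring) \<Rightarrow> ('y \<Rightarrow>\<^sub>0 'k) \<Rightarrow> ('z \<Rightarrow>\<^sub>0 'k)" where
  "bilin f p q = lin (\<lambda>x. lin (f x) q) p"

definition sgn_pow :: "nat \<Rightarrow> 'a::ab_group_add \<Rightarrow> 'a" where
  "sgn_pow n a = (if even n then a else - a)"

text \<open>Normalized chains are chains modulo degenerate simplices, identified with the free module on
  the nondegenerate simplices; \<open>nchain S (n, \<sigma>)\<close> is the class of \<open>\<sigma>\<close>.\<close>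

definition nchain ::
  "'s sset \<Rightarrow> nat \<times> 's \<Rightarrow> (nat \<times> 's \<Rightarrow>\<^sub>0 'k::{comm_ring,comm_monoid_mult})" where
  "nchain S s = (if s \<in> nondegenerate S then gen s else 0)"

fun chain_boundary ::
  "'s sset \<Rightarrow> nat \<times> 's \<Rightarrow> (nat \<times> 's \<Rightarrow>\<^sub>0 'k::{comm_ring,comm_monoid_mult})" where
  "chain_boundary S (0, \<sigma>) = 0"
| "chain_boundary S (Suc n, \<sigma>) = (\<Sum>i\<le>Suc n. sgn_pow i (nchain S (n, sface S n i \<sigma>)))"


section \<open>The cobar construction\<close>

text \<open>A dg coalgebra that is free over \<open>'k\<close> in each degree, given on a homogeneous basis. In the
  connected case, where the part of degree \<open>0\<close> is \<open>'k\<close>, \<open>Cgen\<close> has a single element of degree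
  \<open>0\<close>, the unit, and the counit is the corresponding coordinate.\<close>

record (overloaded) ('b, 'k) dg_coalg =
  Cgen :: "'b set"
  Cdeg :: "'b \<Rightarrow> nat"
  Cdif :: "'b \<Rightarrow> ('b \<Rightarrow>\<^sub>0 'k)"
  Ccop :: "'b \<Rightarrow> ('b \<times> 'b \<Rightarrow>\<^sub>0 'k)"

text \<open>In the connected case the component of \<open>\<Delta> c\<close> outside \<open>c \<otimes> 1 + 1 \<otimes> c\<close> is its projection to
  \<open>C\<^sub>+ \<otimes> C\<^sub>+\<close>, with \<open>C\<^sub>+\<close> the part of positive degree. The word \<open>[b]\<close> stands for \<open>s b\<close>.\<close>

definition cobar_dif_gen ::
  "('b, 'k::{comm_ring,comm_monoid_mult}) dg_coalg \<Rightarrow> 'b \<Rightarrow> ('b list \<Rightarrow>\<^sub>0 'k)" where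
  "cobar_dif_gen C c =
     - lin (\<lambda>b. if 0 < Cdeg C b then gen [b] else 0) (Cdif C c)
     + lin (\<lambda>(b, b'). if 0 < Cdeg C b \<and> 0 < Cdeg C b'
                      then sgn_pow (Cdeg C b) (gen [b, b']) else 0) (Ccop C c)"

definition concat_mul ::
  "('b list \<Rightarrow>\<^sub>0 'k::{comm_ring,comm_monoid_mult}) \<Rightarrow> ('b list \<Rightarrow>\<^sub>0 'k) \<Rightarrow> ('b list \<Rightarrow>\<^sub>0 'k)" where
  "concat_mul = bilin (\<lambda>u v. gen (u @ v))"

fun cobar_dif_word ::
  "('b, 'k::{comm_ring,comm_monoid_mult}) dg_coalg \<Rightarrow> 'b list \<Rightarrow> ('b list \<Rightarrow>\<^sub>0 'k)" where
  "cobar_dif_word C [] = 0"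
| "cobar_dif_word C (b # w) =
     concat_mul (cobar_dif_gen C b) (gen w)
     + sgn_pow (Cdeg C b - 1) (concat_mul (gen [b]) (cobar_dif_word C w))"

definition cobar_words :: "('b, 'k) dg_coalg \<Rightarrow> int \<Rightarrow> 'b list set" where
  "cobar_words C i =
     {w. (\<forall>b\<in>set w. b \<in> Cgen C \<and> 0 < Cdeg C b) \<and> (\<Sum>b\<leftarrow>w. int (Cdeg C b) - 1) = i}"

definition cobar ::
  "('b, 'k::{comm_ring,comm_monoid_mult}) dg_coalg \<Rightarrow> ('k, 'b list \<Rightarrow>\<^sub>0 'k) dg_alg" where
  "cobar C =
     \<lparr> Gr = (\<lambda>i. {p. Poly_Mapping.keys p \<subseteq> cobar_words C i}),
       Zero = 0, Add = (+), Scale = scale, One = gen [], Mul = concat_mul,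
       Dif = lin (cobar_dif_word C) \<rparr>"

text \<open>The algebra map of cobar constructions induced by a map of coalgebras, given on the basis.\<close>

fun cobar_map_word ::
  "('b \<Rightarrow> ('c \<Rightarrow>\<^sub>0 'k)) \<Rightarrow> 'b list \<Rightarrow> ('c list \<Rightarrow>\<^sub>0 'k::{comm_ring,comm_monoid_mult})" where
  "cobar_map_word \<phi> [] = gen []"
| "cobar_map_word \<phi> (b # w) = concat_mul (lin (\<lambda>c. gen [c]) (\<phi> b)) (cobar_map_word \<phi> w)"

definition alexander_whitney ::
  "'s sset \<Rightarrow> nat \<times> 's \<Rightarrow> ((nat \<times> 's) \<times> (nat \<times> 's) \<Rightarrow>\<^sub>0 'k::{comm_ring,comm_monoid_mult})" where
  "alexander_whitney S = (\<lambda>(n, \<sigma>). \<Sum>p\<le>n.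
     bilin (\<lambda>s t. gen (s, t)) (nchain S (p, front_face S n p \<sigma>))
                              (nchain S (n - p, last_face S n (n - p) \<sigma>)))"

definition chain_coalg ::
  "'s sset \<Rightarrow> (nat \<times> 's, 'k::{comm_ring,comm_monoid_mult}) dg_coalg" where
  "chain_coalg S =
     \<lparr> Cgen = nondegenerate S, Cdeg = fst, Cdif = chain_boundary S, Ccop = alexander_whitney S \<rparr>"

definition cobar_functor ::
  "('s, 'k::{comm_ring,comm_monoid_mult}, (nat \<times> 's) list \<Rightarrow>\<^sub>0 'k) dga_functor" where
  "cobar_functor =
     \<lparr> Fob = (\<lambda>S. cobar (chain_coalg S)),
       Fmap = (\<lambda>S T f. lin (cobar_map_word (\<lambda>(n, \<sigma>). nchain T (n, f n \<sigma>)))) \<rparr>"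


section \<open>Simplicial categories and their colimits\<close>

text \<open>Composition is written in path order: \<open>scomp C n x y z f g\<close> is \<open>f : x \<rightarrow> y\<close> followed by
  \<open>g : y \<rightarrow> z\<close>, for \<open>n\<close>-simplices \<open>f\<close>, \<open>g\<close>. The identity of \<open>x\<close> is a vertex \<open>sid C x\<close>, and
  \<open>sidn C n x\<close> is its total degeneracy in dimension \<open>n\<close>.\<close>

record ('o, 'm) scat =
  Ob :: "'o set"
  Map :: "'o \<Rightarrow> 'o \<Rightarrow> 'm sset"
  scomp :: "nat \<Rightarrow> 'o \<Rightarrow> 'o \<Rightarrow> 'o \<Rightarrow> 'm \<Rightarrow> 'm \<Rightarrow> 'm"
  sid :: "'o \<Rightarrow> 'm"

definition sidn :: "('o, 'm) scat \<Rightarrow> nat \<Rightarrow> 'o \<Rightarrow> 'm" where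
  "sidn C n x = sact (Map C x x) n 0 (\<lambda>t\<in>{..n}. 0) (sid C x)"

text \<open>A diagram of simplicial categories; an arrow \<open>e\<close> from \<open>i\<close> to \<open>j\<close> is the triple \<open>(i, e, j)\<close>, and
  \<open>Dmap D (i, e, j) n a b\<close> acts on the \<open>n\<close>-simplices of the mapping space from \<open>a\<close> to \<open>b\<close>.\<close>

record ('j, 'e, 'o, 'm) diagram =
  Dob :: "'j set"
  Darr :: "('j \<times> 'e \<times> 'j) set"
  Dcat :: "'j \<Rightarrow> ('o, 'm) scat"
  Dobmap :: "'j \<times> 'e \<times> 'j \<Rightarrow> 'o \<Rightarrow> 'o"
  Dmap :: "'j \<times> 'e \<times> 'j \<Rightarrow> nat \<Rightarrow> 'o \<Rightarrow> 'o \<Rightarrow> 'm \<Rightarrow> 'm"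

text \<open>The colimit in simplicial categories: objects are the colimit of the sets of objects, and in
  each simplicial dimension \<open>n\<close> the morphisms are those of the colimit of ordinary categories, that
  is, paths of morphisms of the \<open>Dcat D j\<close> modulo the relations of the diagram, of composition and of
  identities.\<close>

inductive colim_ob_eq ::
  "('j, 'e, 'o, 'm) diagram \<Rightarrow> 'j \<times> 'o \<Rightarrow> 'j \<times> 'o \<Rightarrow> bool" for D where
  arrow: "\<lbrakk>(i, e, j) \<in> Darr D; a \<in> Ob (Dcat D i)\<rbrakk>
     \<Longrightarrow> colim_ob_eq D (i, a) (j, Dobmap D (i, e, j) a)"
| refl: "\<lbrakk>j \<in> Dob D; a \<in> Ob (Dcat D j)\<rbrakk> \<Longrightarrow> colim_ob_eq D (j, a) (j, a)"
| sym: "colim_ob_eq D p q \<Longrightarrow> colim_ob_eq D q p"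
| trans: "\<lbrakk>colim_ob_eq D p q; colim_ob_eq D q r\<rbrakk> \<Longrightarrow> colim_ob_eq D p r"

definition colim_obj :: "('j, 'e, 'o, 'm) diagram \<Rightarrow> 'j \<Rightarrow> 'o \<Rightarrow> ('j \<times> 'o) set" where
  "colim_obj D j a = {q. colim_ob_eq D (j, a) q}"

definition colim_Ob :: "('j, 'e, 'o, 'm) diagram \<Rightarrow> ('j \<times> 'o) set set" where
  "colim_Ob D = {colim_obj D j a | j a. j \<in> Dob D \<and> a \<in> Ob (Dcat D j)}"

text \<open>The letter \<open>(j, a, b, f)\<close> stands for the morphism \<open>f : a \<rightarrow> b\<close> of \<open>Dcat D j\<close>.\<close>

type_synonym ('j, 'o, 'm) letter = "'j \<times> 'o \<times> 'o \<times> 'm"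

fun colim_path ::
  "('j, 'e, 'o, 'm) diagram \<Rightarrow> nat \<Rightarrow> ('j \<times> 'o) set \<Rightarrow> ('j, 'o, 'm) letter list
     \<Rightarrow> ('j \<times> 'o) set \<Rightarrow> bool" where
  "colim_path D n X [] Y \<longleftrightarrow> X \<in> colim_Ob D \<and> X = Y"
| "colim_path D n X ((j, a, b, f) # w) Y \<longleftrightarrow>
     j \<in> Dob D \<and> a \<in> Ob (Dcat D j) \<and> b \<in> Ob (Dcat D j) \<and> f \<in> spx (Map (Dcat D j) a b) n \<and>
     X = colim_obj D j a \<and> colim_path D n (colim_obj D j b) w Y"

inductive colim_rule ::
  "('j, 'e, 'o, 'm) diagram \<Rightarrow> nat \<Rightarrow> ('j, 'o, 'm) letter list
     \<Rightarrow> ('j, 'o, 'm) letter list \<Rightarrow> bool" for D n where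
  arrow: "\<lbrakk>(i, e, j) \<in> Darr D; a \<in> Ob (Dcat D i); b \<in> Ob (Dcat D i);
           f \<in> spx (Map (Dcat D i) a b) n\<rbrakk>
     \<Longrightarrow> colim_rule D n [(i, a, b, f)]
           [(j, Dobmap D (i, e, j) a, Dobmap D (i, e, j) b, Dmap D (i, e, j) n a b f)]"
| comp: "\<lbrakk>j \<in> Dob D; a \<in> Ob (Dcat D j); b \<in> Ob (Dcat D j); c \<in> Ob (Dcat D j);
          f \<in> spx (Map (Dcat D j) a b) n; g \<in> spx (Map (Dcat D j) b c) n\<rbrakk>
     \<Longrightarrow> colim_rule D n [(j, a, b, f), (j, b, c, g)] [(j, a, c, scomp (Dcat D j) n a b c f g)]"
| ident: "\<lbrakk>j \<in> Dob D; a \<in> Ob (Dcat D j)\<rbrakk>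
     \<Longrightarrow> colim_rule D n [(j, a, a, sidn (Dcat D j) n a)] []"

inductive colim_eq ::
  "('j, 'e, 'o, 'm) diagram \<Rightarrow> nat \<Rightarrow> ('j \<times> 'o) set \<Rightarrow> ('j \<times> 'o) set
     \<Rightarrow> ('j, 'o, 'm) letter list \<Rightarrow> ('j, 'o, 'm) letter list \<Rightarrow> bool" for D n X Y where
  rule: "\<lbrakk>colim_rule D n s t; colim_path D n X (u @ s @ v) Y; colim_path D n X (u @ t @ v) Y\<rbrakk>
     \<Longrightarrow> colim_eq D n X Y (u @ s @ v) (u @ t @ v)"
| refl: "colim_path D n X w Y \<Longrightarrow> colim_eq D n X Y w w"
| sym: "colim_eq D n X Y v w \<Longrightarrow> colim_eq D n X Y w v"
| trans: "\<lbrakk>colim_eq D n X Y u v; colim_eq D n X Y v w\<rbrakk> \<Longrightarrow> colim_eq D n X Y u w"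

definition colim_rel ::
  "('j, 'e, 'o, 'm) diagram \<Rightarrow> nat \<Rightarrow> ('j \<times> 'o) set \<Rightarrow> ('j \<times> 'o) set
     \<Rightarrow> (('j, 'o, 'm) letter list \<times> ('j, 'o, 'm) letter list) set" where
  "colim_rel D n X Y = {(v, w). colim_eq D n X Y v w}"

definition letter_act ::
  "('j, 'e, 'o, 'm) diagram \<Rightarrow> nat \<Rightarrow> nat \<Rightarrow> (nat \<Rightarrow> nat)
     \<Rightarrow> ('j, 'o, 'm) letter \<Rightarrow> ('j, 'o, 'm) letter" where
  "letter_act D m n \<theta> = (\<lambda>(j, a, b, f). (j, a, b, sact (Map (Dcat D j) a b) m n \<theta> f))"

definition colim ::
  "('j, 'e, 'o, 'm) diagram \<Rightarrow> (('j \<times> 'o) set, ('j, 'o, 'm) letter list set) scat" where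
  "colim D =
     \<lparr> Ob = colim_Ob D,
       Map = (\<lambda>X Y. \<lparr> spx = (\<lambda>n. {w. colim_path D n X w Y} // colim_rel D n X Y),
                      sact = (\<lambda>m n \<theta> c. colim_rel D m X Y `` (map (letter_act D m n \<theta>) ` c)) \<rparr>),
       scomp = (\<lambda>n X Y Z c d. colim_rel D n X Z `` {u @ v | u v. u \<in> c \<and> v \<in> d}),
       sid = (\<lambda>X. colim_rel D 0 X X `` {[]}) \<rparr>"


section \<open>The rigidification functor\<close>

definition nerve :: "'p::order set \<Rightarrow> (nat \<Rightarrow> 'p) sset" where
  "nerve P =
     \<lparr> spx = (\<lambda>n. {U \<in> {..n} \<rightarrow>\<^sub>E P. mono_on {..n} U}),
       sact = (\<lambda>m n \<theta> U. compose {..m} U \<theta>) \<rparr>"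

text \<open>Empty if \<open>j < i\<close>.\<close>

definition cube_poset :: "nat \<Rightarrow> nat \<Rightarrow> nat set set" where
  "cube_poset i j = {A. A \<subseteq> {i..j} \<and> i \<in> A \<and> j \<in> A}"

definition rigid_simplex :: "nat \<Rightarrow> (nat, nat \<Rightarrow> nat set) scat" where
  "rigid_simplex n =
     \<lparr> Ob = {..n},
       Map = (\<lambda>i j. nerve (cube_poset i j)),
       scomp = (\<lambda>r i j l U V. \<lambda>t\<in>{..r}. U t \<union> V t),
       sid = (\<lambda>i. \<lambda>t\<in>{..0}. {i}) \<rparr>"

text \<open>The category of simplices of \<open>S\<close>, with \<open>(n, \<sigma>)\<close> sent to \<open>rigid_simplex n\<close>.\<close>

definition rigid_diagram ::
  "'s sset \<Rightarrow> (nat \<times> 's, nat \<Rightarrow> nat, nat, nat \<Rightarrow> nat set) diagram" where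
  "rigid_diagram S =
     \<lparr> Dob = {(n, \<sigma>). \<sigma> \<in> spx S n},
       Darr = {((m, sact S m n \<theta> \<sigma>), \<theta>, (n, \<sigma>)) | m n \<theta> \<sigma>. \<theta> \<in> mono_maps m n \<and> \<sigma> \<in> spx S n},
       Dcat = (\<lambda>(n, \<sigma>). rigid_simplex n),
       Dobmap = (\<lambda>(s, \<theta>, t). \<theta>),
       Dmap = (\<lambda>(s, \<theta>, t) r i j U. \<lambda>q\<in>{..r}. \<theta> ` U q) \<rparr>"

type_synonym 's rigid_obj = "((nat \<times> 's) \<times> nat) set"
type_synonym 's rigid_mor = "(nat \<times> 's, nat, nat \<Rightarrow> nat set) letter list set"

definition rigidification :: "'s sset \<Rightarrow> ('s rigid_obj, 's rigid_mor) scat" where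
  "rigidification S = colim (rigid_diagram S)"

definition rigid_vertex :: "'s sset \<Rightarrow> 's \<Rightarrow> 's rigid_obj" where
  "rigid_vertex S x = colim_obj (rigid_diagram S) (0, x) 0"

definition rigid_map ::
  "'t sset \<Rightarrow> (nat \<Rightarrow> 's \<Rightarrow> 't) \<Rightarrow> 't rigid_obj \<Rightarrow> 't rigid_obj \<Rightarrow> nat
     \<Rightarrow> 's rigid_mor \<Rightarrow> 't rigid_mor" where
  "rigid_map T f X Y r c =
     colim_rel (rigid_diagram T) r X Y ``
       (map (\<lambda>((n, \<sigma>), i, j, U). ((n, f n \<sigma>), i, j, U)) ` c)"


section \<open>Chains on mapping spaces\<close>

text \<open>Eilenberg-Zilber shuffle map followed by composition. The \<open>(p, q)\<close>-shuffle with
  \<open>\<mu>\<^sub>1 < \<dots> < \<mu>\<^sub>p\<close> and \<open>\<nu>\<^sub>1 < \<dots> < \<nu>\<^sub>q\<close> partitioning \<open>{0..<p+q}\<close> is represented by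
  \<open>\<mu>\<close>, contributes \<open>s\<^bsub>\<nu>q\<^esub> \<dots> s\<^bsub>\<nu>1\<^esub> \<sigma>\<close> and \<open>s\<^bsub>\<mu>p\<^esub> \<dots> s\<^bsub>\<mu>1\<^esub> \<tau>\<close>, and has the sign of
  the permutation \<open>(\<mu>, \<nu>)\<close>, counted by inversions. Iterated degeneracies omitting the indices in
  \<open>\<mu>\<close> are given by the operator counting the elements of \<open>\<mu>\<close> below its argument.\<close>

definition count_op :: "nat \<Rightarrow> nat set \<Rightarrow> nat \<Rightarrow> nat" where
  "count_op n \<mu> = (\<lambda>t\<in>{..n}. card {u \<in> \<mu>. u < t})"

definition shuffle_sign :: "nat set \<Rightarrow> nat set \<Rightarrow> nat" where
  "shuffle_sign \<mu> \<nu> = card {(u, v). u \<in> \<mu> \<and> v \<in> \<nu> \<and> v < u}"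

definition shuffle_comp ::
  "('o, 'm) scat \<Rightarrow> 'o \<Rightarrow> 'o \<Rightarrow> 'o \<Rightarrow> nat \<times> 'm \<Rightarrow> nat \<times> 'm
     \<Rightarrow> (nat \<times> 'm \<Rightarrow>\<^sub>0 'k::{comm_ring,comm_monoid_mult})" where
  "shuffle_comp C x y z = (\<lambda>(p, \<sigma>) (q, \<tau>).
     \<Sum>\<mu> | \<mu> \<subseteq> {..<p + q} \<and> card \<mu> = p.
       let \<nu> = {..<p + q} - \<mu> in
       sgn_pow (shuffle_sign \<mu> \<nu>)
         (nchain (Map C x z)
           (p + q, scomp C (p + q) x y z
                     (sact (Map C x y) (p + q) p (count_op (p + q) \<mu>) \<sigma>)
                     (sact (Map C y z) (p + q) q (count_op (p + q) \<nu>) \<tau>))))"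

text \<open>The endomorphism dga of \<open>x\<close> in the dg category of normalized chains on the mapping spaces of
  \<open>C\<close>.\<close>

definition endo_dga ::
  "('o, 'm) scat \<Rightarrow> 'o \<Rightarrow> ('k::{comm_ring,comm_monoid_mult}, nat \<times> 'm \<Rightarrow>\<^sub>0 'k) dg_alg" where
  "endo_dga C x =
     \<lparr> Gr = (\<lambda>i. {p. Poly_Mapping.keys p \<subseteq> {(n, \<sigma>) \<in> nondegenerate (Map C x x). int n = i}}),
       Zero = 0, Add = (+), Scale = scale, One = nchain (Map C x x) (0, sid C x),
       Mul = bilin (shuffle_comp C x x x),
       Dif = lin (chain_boundary (Map C x x)) \<rparr>"

definition Gamma ::
  "'s sset \<Rightarrow> 's \<Rightarrow> ('k::{comm_ring,comm_monoid_mult}, nat \<times> 's rigid_mor \<Rightarrow>\<^sub>0 'k) dg_alg" where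
  "Gamma S x = endo_dga (rigidification S) (rigid_vertex S x)"

definition Gamma_map ::
  "'t sset \<Rightarrow> 't \<Rightarrow> (nat \<Rightarrow> 's \<Rightarrow> 't)
     \<Rightarrow> (nat \<times> 's rigid_mor \<Rightarrow>\<^sub>0 'k::{comm_ring,comm_monoid_mult})
     \<Rightarrow> (nat \<times> 't rigid_mor \<Rightarrow>\<^sub>0 'k)" where
  "Gamma_map T y f =
     (let Y = rigid_vertex T y in
      lin (\<lambda>(r, c). nchain (Map (rigidification T) Y Y) (r, rigid_map T f Y Y r c)))"

text \<open>\<open>S \<mapsto> \<Gamma>(S)(x, x)\<close>, where \<open>x\<close> is the unique vertex of \<open>S\<close>.\<close>

definition Gamma_functor ::
  "('s, 'k::{comm_ring,comm_monoid_mult}, nat \<times> 's rigid_mor \<Rightarrow>\<^sub>0 'k) dga_functor" where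
  "Gamma_functor =
     \<lparr> Fob = (\<lambda>S. Gamma S (the_elem (spx S 0))),
       Fmap = (\<lambda>S T. Gamma_map T (the_elem (spx T 0))) \<rparr>"

end

theory Submission
 imports Defs
begin

text \<open>Let \<open>M\<close> be the simplicial monoid of endomorphisms of the single object of the rigidification of
 \<open>S\<close>. The weak equivalence is realized by one natural map of dgas from the cobar construction to the
 chains on \<open>M\<close>. An \<open>n\<close>-simplex \<open>\<sigma>\<close> contributes to \<open>M\<close> the \<open>(n - 1)\<close>-cube of
 paths from its first to its last vertex, and the letter \<open>[\<sigma>]\<close> goes, up to sign, to the fundamental
 chain of this cube, minus the constant loop if \<open>n = 1\<close>; words go to products. Of the two faces of the
 cube in the direction of an inner vertex \<open>i\<close> one is the cube of the face of \<open>\<sigma>\<close> opposite to \<open>i\<close>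
 and the other the product of the cubes of the front and the last face (\<open>boundary_fund\<close>). This is the
 cobar differential except for the two outer faces of \<open>\<sigma>\<close>, which the constant loops account for
 (\<open>compare_boundary_letter\<close>). The map vanishes on degenerate simplices: the cube of a degenerate edge
 is the constant loop, and in higher dimensions it factors through a smaller cube
 (\<open>fund_degenerate\<close>).

 That the map is a quasi-isomorphism is proved by discrete Morse theory. A simplex of \<open>M\<close> is a class of
 paths of letters, and every class has a unique normal form (\<open>cls_eq_iff_nf\<close>), a product of nondegenerate
 simplices of \<open>S\<close> whose inner vertices all join the subset after the start. The nondegenerate
 \<open>r\<close>-simplices of \<open>M\<close> are therefore given by a word of nondegenerate simplices together with an
 ordered partition of its inner vertices into \<open>r\<close> blocks, the vertices that join at the same time
 (\<open>nondegenerate_cell_iff\<close>). Inner faces merge two blocks, and outer faces lose vertices. For each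
 word, a matching pairs all ordered partitions (\<open>packed_cases\<close>) except the one whose blocks are single
 points in reverse order. The lower of two matched cells is a face of the upper one with coefficient \<open>\<plusminus>1\<close>, and the other
 incidences are triangular (\<open>cell_matching\<close>). One critical cell per word is left, and the image of the
 word contains it with coefficient \<open>\<plusminus>1\<close> and otherwise critical cells of shorter words only
 (\<open>word_matching\<close>). Inverting triangular matrices (\<open>matching_injective\<close>, \<open>matching_surjective\<close>)
 gives \<open>homology_iso_compare\<close>.

 The map is injective, multiplicative and compatible with the differentials, so the identities of a dga
 hold in the cobar construction because they hold in the chains on \<open>M\<close> (\<open>dga_cobar\<close>); functoriality
 follows in the same way. The chains on \<open>M\<close> form a dga by the Leibniz rule (\<open>shuffle_boundary\<close>) and
 the associativity of the shuffle product.\<close>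

abbreviation keys where "keys \<equiv> Poly_Mapping.keys"

abbreviation lookup where "lookup \<equiv> Poly_Mapping.lookup"

section \<open>Linear maps between free modules\<close>

lemma lookup_scale: "lookup (scale r p) x = r * lookup p x"
 unfolding scale_def by transfer (auto simp: when_def)

lemma lookup_gen: "lookup (gen x) y = (if x = y then 1 else 0)"
 by (simp add: gen_def lookup_single when_def)

lemma scale_add: "scale r (p + q) = scale r p + scale r q"
 by (rule poly_mapping_eqI) (simp add: lookup_scale lookup_add distrib_left)

lemma add_scale: "scale (r + s) p = scale r p + scale s p"
 by (rule poly_mapping_eqI) (simp add: lookup_scale lookup_add distrib_right)

lemma scale_scale: "scale (r * s) p = scale r (scale s p)"
 by (rule poly_mapping_eqI) (simp add: lookup_scale mult.assoc)

lemma scale_one [simp]: "scale (1 :: 'k::{comm_ring,comm_monoid_mult}) p = p"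
 by (rule poly_mapping_eqI) (simp add: lookup_scale)

lemma scale_0 [simp]: "scale r 0 = 0" "scale 0 p = 0"
 by (rule poly_mapping_eqI, simp add: lookup_scale)+

lemma scale_minus [simp]: "scale r (- p) = - scale r p" "scale (- r) p = - scale r p"
 by (rule poly_mapping_eqI, simp add: lookup_scale)+

lemma scale_sum: "scale r (sum f A) = (\<Sum>x\<in>A. scale r (f x))"
 by (rule poly_mapping_eqI) (simp add: lookup_scale lookup_sum sum_distrib_left)

lemma keys_scale: "keys (scale r p) \<subseteq> keys p"
 by (auto simp: in_keys_iff lookup_scale)

lemma keys_gen: "keys (gen x) \<subseteq> {x}"
 by (auto simp: in_keys_iff lookup_gen split: if_splits)

lemma keys_sum_subset: "(\<And>x. x \<in> A ==> keys (f x) \<subseteq> B)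
  ==> keys (sum f A) \<subseteq> B"
 by (induction A rule: infinite_finite_induct) (use keys_add in fastforce)+

lemma keys_add_subset: "[|keys p \<subseteq> B; keys q \<subseteq> B|]
  ==> keys (p + q) \<subseteq> B"
 using keys_add[of p q] by auto

lemma keys_minus: "keys (- p) = keys (p :: 'a \<Rightarrow>\<^sub>0 'b::ab_group_add)"
 by (auto simp: in_keys_iff)

lemma lin_superset:
 assumes "finite A" "keys p \<subseteq> A"
 shows "lin f p = (\<Sum>x\<in>A. scale (lookup p x) (f x))"
 unfolding lin_def by (rule sum.mono_neutral_left) (use assms in \<open>auto simp: in_keys_iff\<close>)

lemma lookup_lin:
 "lookup (lin f p) y
  = (\<Sum>x\<in>keys p. lookup p x * lookup (f x) y)"
 by (simp add: lin_def lookup_sum lookup_scale)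

lemma lin_add: "lin f (p + q) = lin f p + lin f q"
proof -
 let ?A = "keys p \<union> keys q"
 have "lin f (p + q) = (\<Sum>x\<in>?A. scale (lookup (p + q) x) (f x))"
  by (rule lin_superset) (use keys_add[of p q] in auto)
 also have "\<dots> = lin f p + lin f q"
  by (simp add: lin_superset[of ?A p] lin_superset[of ?A q] lookup_add add_scale sum.distrib)
 finally show ?thesis .
qed

lemma lin_scale: "lin f (scale r p) = scale r (lin f p)"
 by (subst lin_superset[OF finite_keys keys_scale])
  (simp add: lin_def scale_sum lookup_scale scale_scale)

lemma lin_0 [simp]: "lin f 0 = 0" by (simp add: lin_def)

lemma lin_minus: "lin f (- p) = - lin f p"
 using lin_add[of f p "- p"] by (simp add: eq_neg_iff_add_eq_0 add.commute)

lemma lin_diff: "lin f (p - q) = lin f p - lin f q"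
 using lin_add[of f p "- q"] by (simp add: lin_minus)

lemma lin_sum: "lin f (sum g A) = (\<Sum>x\<in>A. lin f (g x))"
 by (induction A rule: infinite_finite_induct) (simp_all add: lin_add)

lemma lin_gen [simp]: "lin f (gen x :: _ \<Rightarrow>\<^sub>0 'k::{comm_ring,comm_monoid_mult}) = f x"
 by (simp add: lin_superset[OF _ keys_gen] lookup_gen)

lemma lin_cong: "(\<And>x. x \<in> keys p ==> f x = g x) ==> lin f p = lin g p"
 by (simp add: lin_def)

lemma lin_zero_fun [simp]: "lin (\<lambda>x. 0) p = 0" by (simp add: lin_def)

lemma lin_add_fun: "lin (\<lambda>x. f x + g x) p = lin f p + lin g p"
 by (simp add: lin_def scale_add sum.distrib)

lemma lin_minus_fun: "lin (\<lambda>x. - f x) p = - lin f p"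
 by (simp add: lin_def sum_negf)

lemma lin_scale_fun: "lin (\<lambda>x. scale r (f x)) p = scale r (lin f p)"
 by (simp add: lin_def scale_sum flip: scale_scale) (simp add: mult.commute)

lemma lin_sum_fun: "lin (\<lambda>x. \<Sum>a\<in>A. f x a) p = (\<Sum>a\<in>A. lin (\<lambda>x. f x a) p)"
 by (simp add: lin_def scale_sum sum.swap[of _ A])

lemma lin_gen_eq: "lin gen p = (p :: _ \<Rightarrow>\<^sub>0 'k::{comm_ring,comm_monoid_mult})"
 by (rule poly_mapping_eqI)
  (auto simp: lookup_lin lookup_gen if_distrib[of "\<lambda>z. _ * z"] sum.delta' in_keys_iff cong: if_cong)

lemma lin_lin: "lin f (lin g p) = lin (\<lambda>x. lin f (g x)) p"
 by (simp add: lin_def[of g] lin_def[of "\<lambda>x. lin f (g x)"] lin_sum lin_scale)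

lemma lin_swap: "lin (\<lambda>x. lin (\<lambda>y. f x y) q) p = lin (\<lambda>y. lin (\<lambda>x. f x y) p) q"
 by (simp add: lin_def scale_sum sum.swap[of _ "keys q"] flip: scale_scale)
  (simp add: mult.commute)

lemma keys_lin: "(\<And>x. x \<in> keys p ==> keys (f x) \<subseteq> B)
  ==> keys (lin f p) \<subseteq> B"
 unfolding lin_def by (rule keys_sum_subset) (use keys_scale in fast)

lemma sgn_pow_0 [simp]: "sgn_pow n 0 = 0" by (simp add: sgn_pow_def)

lemma sgn_pow_zero [simp]: "sgn_pow 0 a = a" by (simp add: sgn_pow_def)

lemma sgn_pow_Suc: "sgn_pow (Suc n) a = - sgn_pow n a" by (simp add: sgn_pow_def)

lemma sgn_pow_sgn_pow: "sgn_pow m (sgn_pow n a) = sgn_pow (m + n) a"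
 by (simp add: sgn_pow_def)

lemma sgn_pow_diff: "sgn_pow n (a - b) = sgn_pow n a - sgn_pow n b"
 by (simp add: sgn_pow_def)

lemma sgn_pow_sum: "sgn_pow n (sum f A) = (\<Sum>x\<in>A. sgn_pow n (f x))"
 by (simp add: sgn_pow_def sum_negf)

lemma sgn_pow_cong: "even (m + n) ==> sgn_pow m a = sgn_pow n a"
 by (auto simp: sgn_pow_def)

lemma lin_sgn_pow: "lin f (sgn_pow n p) = sgn_pow n (lin f p)"
 by (simp add: sgn_pow_def lin_minus)

lemma lin_sgn_pow_fun: "lin (\<lambda>x. sgn_pow n (f x)) p = sgn_pow n (lin f p)"
 by (simp add: sgn_pow_def lin_minus_fun)

lemma keys_sgn_pow: "keys (sgn_pow n p) = keys (p :: _ \<Rightarrow>\<^sub>0 'k::ab_group_add)"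
 by (simp add: sgn_pow_def keys_minus)

lemma lookup_sgn_pow: "lookup (sgn_pow n p) x = sgn_pow n (lookup p x)"
 by (simp add: sgn_pow_def)

lemma bilin_gen [simp]:
 "bilin f (gen x) (gen y :: _ \<Rightarrow>\<^sub>0 'k::{comm_ring,comm_monoid_mult}) = f x y"
 by (simp add: bilin_def)

lemma bilin_add: "bilin f (p + q) s = bilin f p s + bilin f q s"
  "bilin f t (u + v) = bilin f t u + bilin f t v"
 by (simp_all add: bilin_def lin_add lin_add_fun)

lemma bilin_scale: "bilin f (scale r p) q = scale r (bilin f p q)"
  "bilin f p (scale r q) = scale r (bilin f p q)"
 by (simp_all add: bilin_def lin_scale lin_scale_fun)

lemma bilin_0 [simp]: "bilin f 0 q = 0" "bilin f p 0 = 0"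
 by (simp_all add: bilin_def)

lemma bilin_minus: "bilin f (- p) q = - bilin f p q" "bilin f p (- q) = - bilin f p q"
 by (simp_all add: bilin_def lin_minus lin_minus_fun)

lemma bilin_diff: "bilin f (p - q) s = bilin f p s - bilin f q s"
  "bilin f t (u - v) = bilin f t u - bilin f t v"
 by (simp_all add: diff_conv_add_uminus bilin_add bilin_minus del: add_uminus_conv_diff)

lemma bilin_sgn_pow: "bilin f (sgn_pow n p) q = sgn_pow n (bilin f p q)"
  "bilin f p (sgn_pow n q) = sgn_pow n (bilin f p q)"
 by (simp_all add: sgn_pow_def bilin_minus)

lemma bilin_sum: "bilin f (sum g A) q = (\<Sum>a\<in>A. bilin f (g a) q)"
  "bilin f p (sum h B) = (\<Sum>b\<in>B. bilin f p (h b))"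
 by (simp_all add: bilin_def lin_sum lin_sum_fun)

lemma bilin_lin: "bilin f (lin g p) q = lin (\<lambda>x. bilin f (g x) q) p"
  "bilin f u (lin h v) = lin (\<lambda>y. bilin f u (h y)) v"
  apply (simp add: bilin_def lin_lin)
 apply (simp add: bilin_def lin_lin)
 apply (rule lin_swap)
 done

lemma bilin_lin_lin: "bilin f (lin g p) (lin h q) = bilin (\<lambda>x y. bilin f (g x) (h y)) p q"
proof -
 have "bilin f (lin g p) (lin h q) = lin (\<lambda>x. lin (\<lambda>y. bilin f (g x) (h y)) q) p"
  unfolding bilin_lin(2) bilin_lin(1) by (rule lin_swap)
 then show ?thesis by (simp add: bilin_def[of "\<lambda>x y. bilin f (g x) (h y)"])
qed

lemma lin_bilin: "lin h (bilin f p q) = bilin (\<lambda>x y. lin h (f x y)) p q"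
 by (simp add: bilin_def lin_lin)

lemma bilin_cong: "(\<And>x y. [|x \<in> keys p; y \<in> keys q|] ==> f x y = g x y)
  ==> bilin f p q = bilin g p q"
 unfolding bilin_def by (intro lin_cong) auto

lemma bilin_gen_left [simp]:
 "bilin f (gen x :: _ \<Rightarrow>\<^sub>0 'k::{comm_ring,comm_monoid_mult}) q = lin (f x) q"
 by (simp add: bilin_def)

lemma bilin_gen_right [simp]:
 "bilin f p (gen y :: _ \<Rightarrow>\<^sub>0 'k::{comm_ring,comm_monoid_mult}) = lin (\<lambda>x. f x y) p"
 by (simp add: bilin_def)

lemma keys_bilin: "(\<And>x y. [|x \<in> keys p; y \<in> keys q|]
   ==> keys (f x y) \<subseteq> B) ==> keys (bilin f p q) \<subseteq> B"
 unfolding bilin_def by (intro keys_lin) auto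

section \<open>Normalized chains of simplicial sets\<close>

lemma act_closed: "[|simplicial_set S; \<theta> \<in> mono_maps m n; \<sigma> \<in> spx S n|] ==> sact S m n \<theta> \<sigma> \<in> spx S m"
 by (auto simp: simplicial_set_def)

lemma act_id: "[|simplicial_set S; \<sigma> \<in> spx S n|] ==> sact S n n (restrict id {..n}) \<sigma> = \<sigma>"
 by (auto simp: simplicial_set_def)

lemma act_act: "[|simplicial_set S; \<phi> \<in> mono_maps l m; \<theta> \<in> mono_maps m n; \<sigma> \<in> spx S n|]
  ==> sact S l m \<phi> (sact S m n \<theta> \<sigma>) = sact S l n (compose {..l} \<theta> \<phi>) \<sigma>"
 by (auto simp: simplicial_set_def)

lemma mono_mapsD:
 assumes "\<theta> \<in> mono_maps m n"
 shows "t \<le> m ==> \<theta> t \<le> n" "[|s \<le> t; t \<le> m|] ==> \<theta> s \<le> \<theta> t" "m < t ==> \<theta> t = undefined"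
 using assms by (auto simp: mono_maps_def mono_on_def PiE_iff extensional_def)

lemma mono_mapsI:
 assumes "\<And>t. t \<le> m ==> \<theta> t \<le> n" "\<And>s t. [|s \<le> t; t \<le> m|] ==> \<theta> s \<le> \<theta> t"
  "\<And>t. m < t ==> \<theta> t = undefined"
 shows "\<theta> \<in> mono_maps m n"
 using assms by (auto simp: mono_maps_def mono_on_def PiE_iff extensional_def)

lemma mono_maps_restrict:
 assumes "\<And>t. t \<le> m ==> f t \<le> n" "\<And>s t. [|s \<le> t; t \<le> m|] ==> f s \<le> f t"
 shows "restrict f {..m} \<in> mono_maps m n"
 using assms by (auto intro!: mono_mapsI)

lemma mono_maps_eqI:
 assumes "\<theta> \<in> mono_maps m n" "\<phi> \<in> mono_maps m n'" "\<And>t. t \<le> m ==> \<theta> t = \<phi> t"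
 shows "\<theta> = \<phi>"
 using assms mono_mapsD(3) by (metis ext not_le_imp_less)

lemma compose_mono_maps: "[|\<phi> \<in> mono_maps l m; \<theta> \<in> mono_maps m n|]
  ==> compose {..l} \<theta> \<phi> \<in> mono_maps l n"
 by (rule mono_mapsI) (auto simp: compose_def dest: mono_mapsD)

lemma id_mono_maps: "restrict id {..n} \<in> mono_maps n n"
 by (rule mono_maps_restrict) auto

lemma coface_mono: "coface n i \<in> mono_maps n (Suc n)"
 unfolding coface_def by (rule mono_maps_restrict) auto

lemma codegeneracy_mono: "i \<le> m ==> codegeneracy m i \<in> mono_maps (Suc m) m"
 unfolding codegeneracy_def by (rule mono_maps_restrict) auto

lemma sface_closed: "[|simplicial_set S; \<sigma> \<in> spx S (Suc n)|] ==> sface S n i \<sigma> \<in> spx S n"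
 unfolding sface_def by (rule act_closed[OF _ coface_mono])

text \<open>An operator that identifies two neighbouring vertices factors through a codegeneracy.\<close>

lemma degenerate_act:
 assumes S: "simplicial_set S" and \<theta>: "\<theta> \<in> mono_maps m n" and \<sigma>: "\<sigma> \<in> spx S n"
  and i: "i < m" "\<theta> i = \<theta> (Suc i)"
 shows "degenerate S m (sact S m n \<theta> \<sigma>)"
proof -
 obtain m' where m': "m = Suc m'" using i(1) by (cases m) auto
 define \<theta>' where "\<theta>' = compose {..m'} \<theta> (coface m' i)"
 have \<theta>'m: "\<theta>' \<in> mono_maps m' n"
  unfolding \<theta>'_def using coface_mono \<theta> m' by (auto intro: compose_mono_maps)
 have sm: "codegeneracy m' i \<in> mono_maps m m'"
  using codegeneracy_mono[of i m'] i m' by simp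
 have "compose {..m} \<theta>' (codegeneracy m' i) = \<theta>"
 proof (rule mono_maps_eqI[OF compose_mono_maps[OF sm \<theta>'m] \<theta>])
  fix t assume "t \<le> m"
  moreover have "\<not> t - Suc 0 < i" if "i < t" using that by arith
  moreover have "t = Suc i" if "i < t" "t - Suc 0 < Suc i" using that by arith
  ultimately show "compose {..m} \<theta>' (codegeneracy m' i) t = \<theta> t"
   using i m' by (auto simp: compose_def \<theta>'_def coface_def codegeneracy_def le_less)
 qed
 then have "sact S m n \<theta> \<sigma> = sact S m m' (codegeneracy m' i) (sact S m' n \<theta>' \<sigma>)"
  using act_act[OF S sm \<theta>'m \<sigma>] by simp
 moreover have "sact S m' n \<theta>' \<sigma> \<in> spx S m'" by (rule act_closed[OF S \<theta>'m \<sigma>])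
 ultimately show ?thesis unfolding degenerate_def
  by (intro exI[of _ m'] exI[of _ i] exI[of _ "sact S m' n \<theta>' \<sigma>"]) (use i m' in simp)
qed

lemma degenerate_spx: "[|simplicial_set S; degenerate S n \<sigma>|] ==> \<sigma> \<in> spx S n"
 unfolding degenerate_def by (auto intro: act_closed codegeneracy_mono)

lemma nchain_degenerate: "degenerate S n \<sigma> ==> nchain S (n, \<sigma>) = 0"
 by (simp add: nchain_def nondegenerate_def)

lemma nchain_nondegenerate: "s \<in> nondegenerate S ==> nchain S s = gen s"
 by (simp add: nchain_def)

lemma keys_nchain: "keys (nchain S s) \<subseteq> {s} \<inter> nondegenerate S"
 using keys_gen[of s] by (auto simp: nchain_def)

lemma lin_nchain:
 "[|\<sigma> \<in> spx S n; degenerate S n \<sigma> ==> f (n, \<sigma>) = 0|] ==> lin f (nchain S (n, \<sigma>)) = f (n, \<sigma>)"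
 by (auto simp: nchain_def nondegenerate_def)

lemma chain_boundary_degenerate:
 assumes S: "simplicial_set S" and d: "degenerate S n \<sigma>"
 shows "chain_boundary S (n, \<sigma>) = 0"
proof -
 from d obtain m i \<tau> where n: "n = Suc m" and i: "i \<le> m" and \<tau>: "\<tau> \<in> spx S m"
  and \<sigma>: "\<sigma> = sact S n m (codegeneracy m i) \<tau>" unfolding degenerate_def by blast
 let ?g = "\<lambda>j. compose {..m} (codegeneracy m i) (coface m j)"
 have g: "?g j \<in> mono_maps m m" for j
  by (rule compose_mono_maps[OF coface_mono codegeneracy_mono[OF i]])
 have face: "sface S m j \<sigma> = sact S m m (?g j) \<tau>" for j
  unfolding sface_def \<sigma> n by (rule act_act[OF S coface_mono codegeneracy_mono[OF i] \<tau>])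
 have zero: "nchain S (m, sface S m j \<sigma>) = 0" if "j \<le> Suc m" "j \<noteq> i" "j \<noteq> Suc i" for j
 proof (rule nchain_degenerate)
  define k where "k = (if j < i then i - 1 else i)"
  have "k < m" "?g j k = ?g j (Suc k)"
   using that i by (auto simp: k_def compose_def coface_def codegeneracy_def)
  then show "degenerate S m (sface S m j \<sigma>)"
   unfolding face by (intro degenerate_act[OF S g \<tau>])
 qed
 have same: "sface S m j \<sigma> = \<tau>" if "j = i \<or> j = Suc i" for j
 proof -
  have "?g j = restrict id {..m}"
   by (rule mono_maps_eqI[OF g id_mono_maps])
     (use that in \<open>auto simp: compose_def coface_def codegeneracy_def\<close>)
  then show ?thesis unfolding face using act_id[OF S \<tau>] by simp
 qed
 have "chain_boundary S (n, \<sigma>) = (\<Sum>j\<le>Suc m. sgn_pow j (nchain S (m, sface S m j \<sigma>)))"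
  by (simp add: n)
 also have "\<dots> = (\<Sum>j\<in>{i, Suc i}. sgn_pow j (nchain S (m, sface S m j \<sigma>)))"
  by (rule sum.mono_neutral_right) (use i in \<open>auto intro: zero simp: zero\<close>)
 also have "\<dots> = 0" by (simp add: same sgn_pow_Suc)
 finally show ?thesis .
qed

lemma keys_chain_boundary:
 "keys (chain_boundary S (n, \<sigma>)) \<subseteq> {(m, \<tau>) \<in> nondegenerate S. n = Suc m}"
proof (cases n)
 case (Suc m)
 then show ?thesis
  by (auto intro!: keys_sum_subset simp: keys_sgn_pow simp del: sum.atMost_Suc)
   (use keys_nchain in fastforce)+
qed simp

lemma lin_boundary_nchain:
 "[|simplicial_set S; \<sigma> \<in> spx S n|]
  ==> lin (chain_boundary S) (nchain S (n, \<sigma>)) = chain_boundary S (n, \<sigma>)"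
 by (rule lin_nchain) (auto simp: chain_boundary_degenerate)

lemma chain_boundary_boundary:
 assumes S: "simplicial_set S" and \<sigma>: "\<sigma> \<in> spx S n"
 shows "lin (chain_boundary S) (chain_boundary S (n, \<sigma>))
  = (0 :: _ \<Rightarrow>\<^sub>0 'k::{comm_ring,comm_monoid_mult})" (is "?dd = 0")
proof (cases n)
 case (Suc k)
 show ?thesis
 proof (cases k)
  case 0
  then show ?thesis
   by (auto simp: Suc lin_add lin_sgn_pow lin_sum nchain_def intro!: sum.neutral)
 next
  case (Suc m)
  have n: "n = Suc (Suc m)" using \<open>n = Suc k\<close> Suc by simp
  define h :: "nat => nat => _ \<Rightarrow>\<^sub>0 'k"
   where "h i j = nchain S (m, sface S m j (sface S (Suc m) i \<sigma>))" for i j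
  have swap: "h i j = h j (i - 1)" if "j < i" "i \<le> Suc (Suc m)" for i j
  proof -
   have "compose {..m} (coface (Suc m) i) (coface m j)
     = compose {..m} (coface (Suc m) j) (coface m (i - 1))"
    by (rule mono_maps_eqI[OF compose_mono_maps[OF coface_mono coface_mono]
       compose_mono_maps[OF coface_mono coface_mono]])
     (use that in \<open>auto simp: compose_def coface_def\<close>)
   then show ?thesis
    unfolding h_def sface_def using act_act[OF S coface_mono coface_mono] \<sigma> n by metis
  qed
  let ?P = "{(i, j). i \<le> Suc (Suc m) \<and> j \<le> Suc m}"
  let ?L = "{(i, j). i \<le> Suc (Suc m) \<and> j \<le> Suc m \<and> j < i}"
  let ?R = "{(i, j). i \<le> Suc (Suc m) \<and> j \<le> Suc m \<and> i \<le> j}"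
  have fin: "finite ?P" by (rule finite_subset[of _ "{..Suc (Suc m)} \<times> {..Suc m}"]) auto
  have "?dd = (\<Sum>i\<le>Suc (Suc m). sgn_pow i (\<Sum>j\<le>Suc m. sgn_pow j (h i j)))"
  proof -
   have "lin (chain_boundary S) (sgn_pow i (nchain S (Suc m, sface S (Suc m) i \<sigma>)))
     = sgn_pow i (\<Sum>j\<le>Suc m. sgn_pow j (h i j))" for i
    using sface_closed[OF S, of \<sigma> "Suc m" i] \<sigma> n
    by (simp add: lin_sgn_pow lin_boundary_nchain[OF S] h_def)
   then show ?thesis unfolding n chain_boundary.simps(2)[of S "Suc m"] lin_sum by simp
  qed
  also have "\<dots> = (\<Sum>(i, j)\<in>?P. sgn_pow (i + j) (h i j))"
   unfolding sgn_pow_sum sgn_pow_sgn_pow sum.cartesian_product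
   by (rule sum.cong) auto
  also have "\<dots> = (\<Sum>(i, j)\<in>?L. sgn_pow (i + j) (h i j)) + (\<Sum>(i, j)\<in>?R. sgn_pow (i + j) (h i j))"
   by (subst sum.union_disjoint[symmetric])
    (auto intro!: sum.cong finite_subset[OF _ fin])
  also have "(\<Sum>(i, j)\<in>?L. sgn_pow (i + j) (h i j)) = (\<Sum>(i, j)\<in>?R. - sgn_pow (i + j) (h i j))"
  proof (rule sum.reindex_bij_witness[of _ "\<lambda>(i, j). (Suc j, i)" "\<lambda>(i, j). (j, i - 1)"])
   fix a assume a: "a \<in> ?L"
   obtain i j where ij: "a = (i, j)" by (cases a)
   obtain i' where i': "i = Suc i'" using a ij by (cases i) auto
   show "(case case a of (i, j) => (j, i - 1) of (i, j) => - sgn_pow (i + j) (h i j)) =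
      (case a of (i, j) => sgn_pow (i + j) (h i j))"
    using a swap[of j i] by (simp add: ij i' sgn_pow_Suc add.commute)
  qed auto
  finally show ?thesis by (simp add: sum_negf case_prod_unfold)
 qed
qed simp

definition push :: "'t sset => (nat => 's => 't) => (nat \<times> 's \<Rightarrow>\<^sub>0 'k)
  => (nat \<times> 't \<Rightarrow>\<^sub>0 'k::{comm_ring,comm_monoid_mult})" where
 "push T f = lin (\<lambda>(n, \<sigma>). nchain T (n, f n \<sigma>))"

lemma simplicial_mapsD:
 assumes "f \<in> simplicial_maps S T"
 shows "\<sigma> \<in> spx S n ==> f n \<sigma> \<in> spx T n"
  "[|\<theta> \<in> mono_maps m n; \<sigma> \<in> spx S n|] ==> f m (sact S m n \<theta> \<sigma>) = sact T m n \<theta> (f n \<sigma>)"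
 using assms by (auto simp: simplicial_maps_def)

text \<open>Unlike \<^const>\<open>simplicial_maps\<close>, this allows components given by a formula on the whole
 type.\<close>

definition simplicial_on :: "'s sset => 't sset => (nat => 's => 't) => bool" where
 "simplicial_on S T f \<longleftrightarrow> (\<forall>n. \<forall>\<sigma>\<in>spx S n. f n \<sigma> \<in> spx T n) \<and>
   (\<forall>m n. \<forall>\<theta>\<in>mono_maps m n. \<forall>\<sigma>\<in>spx S n. f m (sact S m n \<theta> \<sigma>) = sact T m n \<theta> (f n \<sigma>))"

lemma simplicial_onD:
 assumes "simplicial_on S T f"
 shows "\<sigma> \<in> spx S n ==> f n \<sigma> \<in> spx T n"
  "[|\<theta> \<in> mono_maps m n; \<sigma> \<in> spx S n|] ==> f m (sact S m n \<theta> \<sigma>) = sact T m n \<theta> (f n \<sigma>)"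
 using assms by (auto simp: simplicial_on_def)

lemma simplicial_maps_on: "f \<in> simplicial_maps S T ==> simplicial_on S T f"
 by (auto simp: simplicial_on_def dest: simplicial_mapsD)

lemma degenerate_map:
 assumes f: "simplicial_on S T f" and "degenerate S n \<sigma>"
 shows "degenerate T n (f n \<sigma>)"
proof -
 from assms(2) obtain m i \<tau> where *: "n = Suc m" "i \<le> m" "\<tau> \<in> spx S m"
  "\<sigma> = sact S n m (codegeneracy m i) \<tau>" unfolding degenerate_def by blast
 then have "f n \<sigma> = sact T n m (codegeneracy m i) (f m \<tau>)"
  using simplicial_onD(2)[OF f codegeneracy_mono] by simp
 then show ?thesis unfolding degenerate_def using * simplicial_onD(1)[OF f] by blast
qed

lemma push_nchain:
 assumes "simplicial_on S T f" "\<sigma> \<in> spx S n"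
 shows "push T f (nchain S (n, \<sigma>)) = nchain T (n, f n \<sigma>)"
 unfolding push_def
 by (subst lin_nchain) (use assms degenerate_map nchain_degenerate in \<open>fastforce+\<close>)

lemma push_boundary:
 assumes S: "simplicial_set S" and T: "simplicial_set T" and f: "simplicial_on S T f"
  and \<sigma>: "\<sigma> \<in> spx S n"
 shows "push T f (chain_boundary S (n, \<sigma>) :: _ \<Rightarrow>\<^sub>0 'k::{comm_ring,comm_monoid_mult})
  = chain_boundary T (n, f n \<sigma>)"
proof (cases n)
 case (Suc m)
 have step: "push T f (sgn_pow i (nchain S (m, sface S m i \<sigma>)) :: _ \<Rightarrow>\<^sub>0 'k) = sgn_pow i (nchain T (m, sface T m i (f n \<sigma>)))"
  for i
 proof -
  have "push T f (sgn_pow i (nchain S (m, sface S m i \<sigma>)) :: _ \<Rightarrow>\<^sub>0 'k)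
    = sgn_pow i (push T f (nchain S (m, sface S m i \<sigma>)))"
   by (simp add: push_def lin_sgn_pow)
  also have "\<dots> = sgn_pow i (nchain T (m, f m (sface S m i \<sigma>)))"
   using sface_closed[OF S, of \<sigma> m i] \<sigma> Suc by (simp add: push_nchain[OF f])
  also have "f m (sface S m i \<sigma>) = sface T m i (f n \<sigma>)"
   unfolding sface_def using simplicial_onD(2)[OF f coface_mono] \<sigma> Suc by simp
  finally show ?thesis .
 qed
 show ?thesis
  using step unfolding Suc push_def chain_boundary.simps lin_sum by (auto intro: sum.cong simp del: sum.atMost_Suc)
qed (simp add: push_def)

definition nchains :: "'s sset => (nat \<times> 's \<Rightarrow>\<^sub>0 'k::zero) set" where
 "nchains S = {c. keys c \<subseteq> nondegenerate S}"

lemma nchains_keysD: "[|c \<in> nchains S; (n, \<sigma>) \<in> keys c|] ==> \<sigma> \<in> spx S n"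
 by (auto simp: nchains_def nondegenerate_def)

lemma push_boundary_chain:
 assumes "simplicial_set S" "simplicial_set T" "simplicial_on S T f" "c \<in> nchains S"
 shows "push T f (lin (chain_boundary S) c) = lin (chain_boundary T) (push T f c)"
proof -
 have "lin (\<lambda>s. push T f (chain_boundary S s)) c
   = lin (\<lambda>s. lin (chain_boundary T) ((\<lambda>(n, \<sigma>). nchain T (n, f n \<sigma>)) s)) c"
 proof (rule lin_cong)
  fix s assume s: "s \<in> keys c"
  obtain n \<sigma> where [simp]: "s = (n, \<sigma>)" by (cases s)
  have \<sigma>: "\<sigma> \<in> spx S n" using s assms(4) nchains_keysD by auto
  show "push T f (chain_boundary S s) = lin (chain_boundary T) (case s of (n, \<sigma>) => nchain T (n, f n \<sigma>))"
   by (simp add: push_boundary[OF assms(1-3) \<sigma>]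
    lin_boundary_nchain[OF assms(2) simplicial_onD(1)[OF assms(3) \<sigma>]])
 qed
 then show ?thesis by (simp add: push_def lin_lin)
qed

lemma push_push:
 assumes "simplicial_on T U g" "simplicial_on S T f" "c \<in> nchains S"
 shows "push U g (push T f c) = push U (\<lambda>n. g n \<circ> f n) c"
 unfolding push_def lin_lin
proof (rule lin_cong, clarify)
 fix n \<sigma> assume s: "(n, \<sigma>) \<in> keys c"
 have \<sigma>: "f n \<sigma> \<in> spx T n" using s assms nchains_keysD simplicial_onD(1) by metis
 show "lin (\<lambda>(n, \<sigma>). nchain U (n, g n \<sigma>)) (nchain T (n, f n \<sigma>)) = nchain U (n, (g n \<circ> f n) \<sigma>)"
  using push_nchain[OF assms(1) \<sigma>] by (simp add: push_def)
qed

lemma push_cong: "(\<And>n \<sigma>. (n, \<sigma>) \<in> keys c ==> f n \<sigma> = g n \<sigma>) ==> push T f c = push T g c"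
 unfolding push_def by (rule lin_cong) auto

section \<open>The shuffle product\<close>

definition cnt :: "nat set => nat => nat" where
 "cnt \<mu> t = card {u \<in> \<mu>. u < t}"

lemma count_op_cnt: "count_op n \<mu> = (\<lambda>t\<in>{..n}. cnt \<mu> t)"
 by (simp add: count_op_def cnt_def)

lemma finite_below [simp]: "finite {u \<in> \<mu>. u < (t::nat)}"
 by (rule finite_subset[of _ "{..<t}"]) auto

lemma cnt_0 [simp]: "cnt \<mu> 0 = 0" by (simp add: cnt_def)

lemma cnt_empty [simp]: "cnt {} t = 0" by (simp add: cnt_def)

lemma cnt_Suc: "cnt \<mu> (Suc t) = cnt \<mu> t + (if t \<in> \<mu> then 1 else 0)"
proof -
 have "{u \<in> \<mu>. u < Suc t} = {u \<in> \<mu>. u < t} \<union> (if t \<in> \<mu> then {t} else {})"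
  by (auto simp: less_Suc_eq)
 then show ?thesis by (simp add: cnt_def card_insert_if)
qed

lemma cnt_mono: "s \<le> t ==> cnt \<mu> s \<le> cnt \<mu> t"
 unfolding cnt_def by (rule card_mono) auto

lemma cnt_le: "cnt \<mu> t \<le> t"
 by (induction t) (auto simp: cnt_Suc)

lemma cnt_less_iff: "u \<in> \<mu> ==> cnt \<mu> u < cnt \<mu> t \<longleftrightarrow> u < t"
 using cnt_mono[of t u \<mu>] cnt_mono[of "Suc u" t \<mu>] by (cases "u < t") (auto simp: cnt_Suc)

lemma cnt_eq_iff: "[|u \<in> \<mu>; v \<in> \<mu>|] ==> cnt \<mu> u = cnt \<mu> v \<longleftrightarrow> u = v"
 by (metis cnt_less_iff linorder_neqE_nat less_irrefl)

lemma cnt_total: "\<mu> \<subseteq> {..<n} ==> cnt \<mu> n = card \<mu>"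
 unfolding cnt_def by (rule arg_cong[of _ _ card]) auto

lemma cnt_complement: "t \<le> n ==> cnt ({..<n} - \<mu>) t = t - cnt \<mu> t"
proof (induction t)
 case (Suc t)
 then show ?case using cnt_le[of \<mu> t] by (auto simp: cnt_Suc)
qed simp

lemma cnt_cong: "(\<And>u. u < t ==> u \<in> \<mu> \<longleftrightarrow> u \<in> \<mu>') ==> cnt \<mu> t = cnt \<mu>' t"
 unfolding cnt_def by (rule arg_cong[of _ _ card]) auto

lemma bij_betw_cnt:
 assumes "finite \<mu>" shows "bij_betw (cnt \<mu>) \<mu> {..<card \<mu>}"
proof -
 have inj: "inj_on (cnt \<mu>) \<mu>" by (rule inj_onI) (simp add: cnt_eq_iff)
 obtain n where n: "\<mu> \<subseteq> {..<n}" using assms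
  by (metis Max_ge lessThan_iff less_Suc_eq_le subsetI)
 have "cnt \<mu> u < card \<mu>" if "u \<in> \<mu>" for u
  using cnt_less_iff[OF that, of n] cnt_total[OF n] n that by auto
 then have "cnt \<mu> ` \<mu> \<subseteq> {..<card \<mu>}" by auto
 then have "cnt \<mu> ` \<mu> = {..<card \<mu>}"
  by (intro card_subset_eq) (simp_all add: card_image inj)
 with inj show ?thesis by (simp add: bij_betw_def)
qed

lemma count_op_mono: "[|\<mu> \<subseteq> {..<n}; card \<mu> = p|] ==> count_op n \<mu> \<in> mono_maps n p"
 unfolding count_op_cnt using cnt_mono cnt_total by (auto intro!: mono_maps_restrict) metis

text \<open>The elements of the complement below \<open>u\<close> are the inversions of \<open>u\<close>.\<close>

lemma shuffle_sign_sum: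
 assumes "\<mu> \<subseteq> {..<n}"
 shows "shuffle_sign \<mu> ({..<n} - \<mu>) = (\<Sum>u\<in>\<mu>. u - cnt \<mu> u)"
proof -
 have fin: "finite \<mu>" using assms finite_subset by blast
 have "{(u, v). u \<in> \<mu> \<and> v \<in> {..<n} - \<mu> \<and> v < u} = (SIGMA u:\<mu>. {v \<in> {..<n} - \<mu>. v < u})"
  by auto
 then have "shuffle_sign \<mu> ({..<n} - \<mu>) = (\<Sum>u\<in>\<mu>. cnt ({..<n} - \<mu>) u)"
  unfolding shuffle_sign_def cnt_def by (simp add: card_SigmaI fin)
 also have "\<dots> = (\<Sum>u\<in>\<mu>. u - cnt \<mu> u)"
  by (rule sum.cong) (use assms cnt_complement in auto)
 finally show ?thesis .
qed

lemma shuffle_sign_finite: "[|finite A; finite B|] ==> finite {(u, v). u \<in> A \<and> v \<in> B \<and> v < (u::nat)}"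
 by (rule finite_subset[of _ "A \<times> B"]) auto

lemma shuffle_sign_swap:
 assumes "finite A" "finite B" "A \<inter> B = {}"
 shows "shuffle_sign A B + shuffle_sign B A = card A * card B"
proof -
 have "card {(u, v). u \<in> B \<and> v \<in> A \<and> v < u} = card {(v, u). u \<in> B \<and> v \<in> A \<and> v < u}"
  by (rule bij_betw_same_card[of prod.swap]) (auto simp: bij_betw_def inj_on_def image_iff)
 moreover have "card {(u, v). u \<in> A \<and> v \<in> B \<and> v < u} + card {(u, v). v \<in> B \<and> u \<in> A \<and> u < v}
  = card (A \<times> B)"
 proof (subst card_Un_disjoint[symmetric])
  show "finite {(u, v). v \<in> B \<and> u \<in> A \<and> u < v}"
   by (rule finite_subset[of _ "A \<times> B"]) (use assms in auto)
  show "card ({(u, v). u \<in> A \<and> v \<in> B \<and> v < u} \<union> {(u, v). v \<in> B \<and> u \<in> A \<and> u < v}) = card (A \<times> B)"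
   by (rule arg_cong[of _ _ card]) (use assms(3) in \<open>auto simp: neq_iff\<close>)
 qed (use assms shuffle_sign_finite in auto)
 ultimately show ?thesis by (simp add: shuffle_sign_def card_cartesian_product)
qed

lemma shuffle_sign_Un_left:
 assumes "finite A" "finite B" "finite C" "A \<inter> B = {}"
 shows "shuffle_sign (A \<union> B) C = shuffle_sign A C + shuffle_sign B C"
 unfolding shuffle_sign_def
 by (subst card_Un_disjoint[symmetric])
  (use assms in \<open>auto intro!: shuffle_sign_finite arg_cong[of _ _ card]\<close>)

lemma shuffle_sign_Un_right:
 assumes "finite A" "finite B" "finite C" "B \<inter> C = {}"
 shows "shuffle_sign A (B \<union> C) = shuffle_sign A B + shuffle_sign A C"
 unfolding shuffle_sign_def
 by (subst card_Un_disjoint[symmetric])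
  (use assms in \<open>auto intro!: shuffle_sign_finite arg_cong[of _ _ card]\<close>)

definition pairing :: "'x sset => 'y sset => 'z sset => (nat => 'x => 'y => 'z) => bool" where
 "pairing X Y Z m \<longleftrightarrow> simplicial_set X \<and> simplicial_set Y \<and> simplicial_set Z \<and>
   (\<forall>n. \<forall>x\<in>spx X n. \<forall>y\<in>spx Y n. m n x y \<in> spx Z n) \<and>
   (\<forall>k n. \<forall>\<theta>\<in>mono_maps k n. \<forall>x\<in>spx X n. \<forall>y\<in>spx Y n.
    sact Z k n \<theta> (m n x y) = m k (sact X k n \<theta> x) (sact Y k n \<theta> y))"

lemma pairingD:
 assumes "pairing X Y Z m"
 shows "simplicial_set X" "simplicial_set Y" "simplicial_set Z"
  "[|x \<in> spx X n; y \<in> spx Y n|] ==> m n x y \<in> spx Z n"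
  "[|\<theta> \<in> mono_maps k n; x \<in> spx X n; y \<in> spx Y n|]
    ==> sact Z k n \<theta> (m n x y) = m k (sact X k n \<theta> x) (sact Y k n \<theta> y)"
 using assms by (auto simp: pairing_def)

lemma pairing_flip: "pairing X Y Z m ==> pairing Y X Z (\<lambda>n y x. m n x y)"
 by (auto simp: pairing_def)

definition shuffle_sets :: "nat => nat => nat set set" where
 "shuffle_sets p q = {\<mu>. \<mu> \<subseteq> {..<p + q} \<and> card \<mu> = p}"

lemma finite_shuffle_sets [simp]: "finite (shuffle_sets p q)"
 by (rule finite_subset[of _ "Pow {..<p + q}"]) (auto simp: shuffle_sets_def)

lemma shuffle_setsD:
 assumes "\<mu> \<in> shuffle_sets p q"
 shows "\<mu> \<subseteq> {..<p + q}" "card \<mu> = p" "finite \<mu>" "card ({..<p + q} - \<mu>) = q"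
  "count_op (p + q) \<mu> \<in> mono_maps (p + q) p"
  "count_op (p + q) ({..<p + q} - \<mu>) \<in> mono_maps (p + q) q"
 using assms count_op_mono[of \<mu> "p + q" p] count_op_mono[of "{..<p + q} - \<mu>" "p + q" q]
  finite_subset[of \<mu> "{..<p + q}"]
 by (auto simp: shuffle_sets_def card_Diff_subset)

text \<open>The simplex of \<open>Z\<close> indexed by a pair of operators \<open>[n] \<rightarrow> [p]\<close>, \<open>[n] \<rightarrow> [q]\<close>.\<close>

definition pair_simplex :: "'x sset => 'y sset => (nat => 'x => 'y => 'z) => nat
  => nat => (nat => nat) => 'x => nat => (nat => nat) => 'y => 'z" where
 "pair_simplex X Y m n p \<theta> \<sigma> q \<phi> \<tau> = m n (sact X n p \<theta> \<sigma>) (sact Y n q \<phi> \<tau>)"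

definition shuffle :: "'x sset => 'y sset => 'z sset => (nat => 'x => 'y => 'z)
  => nat \<times> 'x => nat \<times> 'y => (nat \<times> 'z \<Rightarrow>\<^sub>0 'k::{comm_ring,comm_monoid_mult})" where
 "shuffle X Y Z m = (\<lambda>(p, \<sigma>) (q, \<tau>). \<Sum>\<mu>\<in>shuffle_sets p q.
   sgn_pow (shuffle_sign \<mu> ({..<p + q} - \<mu>))
    (nchain Z (p + q, pair_simplex X Y m (p + q) p (count_op (p + q) \<mu>) \<sigma>
              q (count_op (p + q) ({..<p + q} - \<mu>)) \<tau>)))"

lemma shuffle_comp_eq_shuffle:
 "shuffle_comp C x y z = shuffle (Map C x y) (Map C y z) (Map C x z) (\<lambda>n. scomp C n x y z)"
 by (simp add: shuffle_comp_def shuffle_def shuffle_sets_def pair_simplex_def Let_def)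

lemma pair_simplex_closed:
 "[|pairing X Y Z m; \<theta> \<in> mono_maps n p; \<phi> \<in> mono_maps n q; \<sigma> \<in> spx X p; \<tau> \<in> spx Y q|]
  ==> pair_simplex X Y m n p \<theta> \<sigma> q \<phi> \<tau> \<in> spx Z n"
 unfolding pair_simplex_def by (meson pairingD act_closed)

lemma act_pair_simplex:
 "[|pairing X Y Z m; \<psi> \<in> mono_maps k n; \<theta> \<in> mono_maps n p; \<phi> \<in> mono_maps n q; \<sigma> \<in> spx X p; \<tau> \<in> spx Y q|]
  ==> sact Z k n \<psi> (pair_simplex X Y m n p \<theta> \<sigma> q \<phi> \<tau>)
   = pair_simplex X Y m k p (compose {..k} \<theta> \<psi>) \<sigma> q (compose {..k} \<phi> \<psi>) \<tau>"
 unfolding pair_simplex_def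
 by (subst pairingD(5)) (auto simp: act_act act_closed pairingD)

lemma pair_simplex_degenerate:
 assumes P: "pairing X Y Z m" and \<theta>: "\<theta> \<in> mono_maps n p" and \<phi>: "\<phi> \<in> mono_maps n q"
  and \<sigma>: "\<sigma> \<in> spx X p" and \<tau>: "\<tau> \<in> spx Y q"
  and u: "u < n" "\<theta> u = \<theta> (Suc u)" "\<phi> u = \<phi> (Suc u)"
 shows "degenerate Z n (pair_simplex X Y m n p \<theta> \<sigma> q \<phi> \<tau>)"
proof -
 define e where "e = restrict (\<lambda>t. if t = u then Suc u else t) {..n}"
 have e: "e \<in> mono_maps n n" unfolding e_def
  by (rule mono_maps_restrict) (use u in \<open>auto simp: le_eq_less_or_eq Suc_le_eq\<close>)
 have ce: "compose {..n} \<psi> e = \<psi>" if "\<psi> \<in> mono_maps n k" "\<psi> u = \<psi> (Suc u)" for \<psi> k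
  by (rule mono_maps_eqI[OF compose_mono_maps[OF e that(1)] that(1)])
   (use that u in \<open>auto simp: compose_def e_def\<close>)
 have "sact Z n n e (pair_simplex X Y m n p \<theta> \<sigma> q \<phi> \<tau>) = pair_simplex X Y m n p \<theta> \<sigma> q \<phi> \<tau>"
  using act_pair_simplex[OF P e \<theta> \<phi> \<sigma> \<tau>] ce[OF \<theta> u(2)] ce[OF \<phi> u(3)] by simp
 moreover have "degenerate Z n (sact Z n n e (pair_simplex X Y m n p \<theta> \<sigma> q \<phi> \<tau>))"
  by (rule degenerate_act[OF pairingD(3)[OF P] e _ u(1)])
   (use u pair_simplex_closed[OF P \<theta> \<phi> \<sigma> \<tau>] in \<open>auto simp: e_def\<close>)
 ultimately show ?thesis by simp
qed

text \<open>The degeneracy of \<open>\<sigma>\<close> collapses a horizontal step of the path, which does not move in the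
 second factor.\<close>

lemma shuffle_degenerate_left:
 assumes P: "pairing X Y Z m" and d: "degenerate X p \<sigma>" and \<tau>: "\<tau> \<in> spx Y q"
 shows "shuffle X Y Z m (p, \<sigma>) (q, \<tau>) = 0"
proof -
 from d obtain p' i \<sigma>' where p: "p = Suc p'" and i: "i \<le> p'" and \<sigma>': "\<sigma>' \<in> spx X p'"
  and \<sigma>: "\<sigma> = sact X p p' (codegeneracy p' i) \<sigma>'" unfolding degenerate_def by blast
 have cd: "codegeneracy p' i \<in> mono_maps p p'" using codegeneracy_mono[OF i] p by simp
 have zero: "nchain Z (p + q, pair_simplex X Y m (p + q) p (count_op (p + q) \<mu>) \<sigma>
              q (count_op (p + q) ({..<p + q} - \<mu>)) \<tau>) = 0" if \<mu>: "\<mu> \<in> shuffle_sets p q" for \<mu>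
 proof (rule nchain_degenerate)
  let ?n = "p + q"
  note \<mu>D = shuffle_setsD[OF \<mu>]
  have "i \<in> cnt \<mu> ` \<mu>"
   using bij_betw_cnt[OF \<mu>D(3)] i \<mu>D(2) p by (simp add: bij_betw_def)
  then obtain u where u: "u \<in> \<mu>" "cnt \<mu> u = i" by blast
  have un: "u < ?n" using u \<mu>D by auto
  have "pair_simplex X Y m ?n p (count_op ?n \<mu>) \<sigma> q (count_op ?n ({..<?n} - \<mu>)) \<tau>
    = pair_simplex X Y m ?n p' (compose {..?n} (codegeneracy p' i) (count_op ?n \<mu>)) \<sigma>'
      q (count_op ?n ({..<?n} - \<mu>)) \<tau>"
   unfolding pair_simplex_def \<sigma> using act_act[OF pairingD(1)[OF P] \<mu>D(5) cd \<sigma>'] by simp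
  moreover have "degenerate Z ?n \<dots>"
  proof (rule pair_simplex_degenerate[OF P compose_mono_maps[OF \<mu>D(5) cd] \<mu>D(6) \<sigma>' \<tau> un])
   show "compose {..?n} (codegeneracy p' i) (count_op ?n \<mu>) u
     = compose {..?n} (codegeneracy p' i) (count_op ?n \<mu>) (Suc u)"
    using un u i p by (simp add: compose_def count_op_cnt codegeneracy_def cnt_Suc)
   show "count_op ?n ({..<?n} - \<mu>) u = count_op ?n ({..<?n} - \<mu>) (Suc u)"
    using un u by (simp add: count_op_cnt cnt_Suc)
  qed
  ultimately show "degenerate Z ?n (pair_simplex X Y m ?n p (count_op ?n \<mu>) \<sigma> q (count_op ?n ({..<?n} - \<mu>)) \<tau>)"
   by simp
 qed
 show ?thesis by (simp add: shuffle_def zero)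
qed

lemma pair_simplex_flip:
 "pair_simplex Y X (\<lambda>n y x. m n x y) n q \<phi> \<tau> p \<theta> \<sigma> = pair_simplex X Y m n p \<theta> \<sigma> q \<phi> \<tau>"
 by (simp add: pair_simplex_def)

lemma complement_shuffle_sets: "\<mu> \<in> shuffle_sets p q ==> {..<p + q} - \<mu> \<in> shuffle_sets q p"
 using shuffle_setsD(4)[of \<mu> p q] by (auto simp: shuffle_sets_def add.commute)

lemma shuffle_sign_complement:
 assumes "\<mu> \<in> shuffle_sets p q"
 shows "shuffle_sign ({..<p + q} - \<mu>) \<mu> + shuffle_sign \<mu> ({..<p + q} - \<mu>) = p * q"
proof -
 have "shuffle_sign \<mu> ({..<p + q} - \<mu>) + shuffle_sign ({..<p + q} - \<mu>) \<mu>
   = card \<mu> * card ({..<p + q} - \<mu>)"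
  by (rule shuffle_sign_swap) (use shuffle_setsD(3)[OF assms] in auto)
 then show ?thesis unfolding shuffle_setsD(2,4)[OF assms] by linarith
qed

text \<open>Graded commutativity of the shuffle product. It is used below to obtain the statements about
 the second factor from those about the first.\<close>

lemma shuffle_flip:
 "shuffle Y X Z (\<lambda>n y x. m n x y) (q, \<tau>) (p, \<sigma>) = sgn_pow (p * q) (shuffle X Y Z m (p, \<sigma>) (q, \<tau>))"
 unfolding shuffle_def case_prod_conv sgn_pow_sum sgn_pow_sgn_pow
  pair_simplex_flip[of Y X m]
proof (rule sum.reindex_bij_witness[of _ "\<lambda>\<mu>. {..<p + q} - \<mu>" "\<lambda>\<mu>. {..<p + q} - \<mu>"])
 fix \<mu> assume \<mu>: "\<mu> \<in> shuffle_sets q p"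
 let ?\<nu> = "{..<p + q} - \<mu>"
 have sub: "\<mu> \<subseteq> {..<p + q}" using shuffle_setsD(1)[OF \<mu>] by (simp add: add.commute)
 then show dd: "{..<p + q} - ?\<nu> = \<mu>" by auto
 show "?\<nu> \<in> shuffle_sets p q" using complement_shuffle_sets[OF \<mu>] by (simp add: add.commute)
 have eq: "shuffle_sign ?\<nu> \<mu> + shuffle_sign \<mu> ?\<nu> = p * q"
  using shuffle_sign_complement[OF \<mu>] unfolding add.commute[of q p] mult.commute[of q p] .
 have "even (p * q + shuffle_sign ?\<nu> \<mu> + shuffle_sign \<mu> ?\<nu>)"
  unfolding add.assoc eq by simp
 then show "sgn_pow (p * q + shuffle_sign ?\<nu> ({..<p + q} - ?\<nu>))
    (nchain Z (p + q, pair_simplex X Y m (p + q) p (count_op (p + q) ?\<nu>) \<sigma> q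
           (count_op (p + q) ({..<p + q} - ?\<nu>)) \<tau>)) =
    sgn_pow (shuffle_sign \<mu> ({..<q + p} - \<mu>))
    (nchain Z (q + p, pair_simplex X Y m (q + p) p (count_op (q + p) ({..<q + p} - \<mu>)) \<sigma> q
           (count_op (q + p) \<mu>) \<tau>))"
  unfolding dd add.commute[of q p] by (rule sgn_pow_cong)
next
 fix \<mu> assume \<mu>: "\<mu> \<in> shuffle_sets p q"
 then show "{..<p + q} - ({..<p + q} - \<mu>) = \<mu>" using shuffle_setsD(1) by auto
 show "{..<p + q} - \<mu> \<in> shuffle_sets q p" by (rule complement_shuffle_sets[OF \<mu>])
qed

lemma shuffle_degenerate_right:
 assumes P: "pairing X Y Z m" and \<sigma>: "\<sigma> \<in> spx X p" and d: "degenerate Y q \<tau>"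
 shows "shuffle X Y Z m (p, \<sigma>) (q, \<tau>) = 0"
 using shuffle_flip[of X Y Z "\<lambda>n y x. m n x y" p \<sigma> q \<tau>]
  by (simp add: shuffle_degenerate_left[OF pairing_flip[OF P] d \<sigma>])

lemma bilin_shuffle_nchain:
 assumes P: "pairing X Y Z m" and "\<sigma> \<in> spx X p" "\<tau> \<in> spx Y q"
 shows "bilin (shuffle X Y Z m) (nchain X (p, \<sigma>)) (nchain Y (q, \<tau>))
  = (shuffle X Y Z m (p, \<sigma>) (q, \<tau>) :: _ \<Rightarrow>\<^sub>0 'k::{comm_ring,comm_monoid_mult})"
proof -
 have "lin (shuffle X Y Z m s) (nchain Y (q, \<tau>)) = (shuffle X Y Z m s (q, \<tau>) :: _ \<Rightarrow>\<^sub>0 'k)"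
  if "s = (p, \<sigma>)" for s
  unfolding that by (rule lin_nchain[OF assms(3)]) (rule shuffle_degenerate_right[OF P assms(2)])
 moreover have "lin (\<lambda>x. lin (shuffle X Y Z m x) (nchain Y (q, \<tau>))) (nchain X (p, \<sigma>))
   = (lin (shuffle X Y Z m (p, \<sigma>)) (nchain Y (q, \<tau>)) :: _ \<Rightarrow>\<^sub>0 'k)"
 proof (rule lin_nchain[OF assms(2)])
  assume "degenerate X p \<sigma>"
  then show "lin (shuffle X Y Z m (p, \<sigma>)) (nchain Y (q, \<tau>)) = (0 :: _ \<Rightarrow>\<^sub>0 'k)"
   using assms(3) by (simp add: lin_nchain[OF assms(3)] shuffle_degenerate_left[OF P])
 qed
 ultimately show ?thesis unfolding bilin_def by simp
qed

lemma keys_shuffle: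
 "keys (shuffle X Y Z m (p, \<sigma>) (q, \<tau>)) \<subseteq> {(n, \<rho>) \<in> nondegenerate Z. n = p + q}"
 unfolding shuffle_def by (auto intro!: keys_sum_subset simp: keys_sgn_pow) (use keys_nchain in fastforce)+

lemma shuffle_vertex_left:
 assumes "\<tau> \<in> spx Y q" "simplicial_set Y"
 shows "shuffle X Y Z m (0, \<sigma>) (q, \<tau>) = nchain Z (q, m q (sact X q 0 (\<lambda>t\<in>{..q}. 0) \<sigma>) \<tau>)"
proof -
 have "shuffle_sets 0 q = {{}}" by (auto simp: shuffle_sets_def dest: finite_subset)
 moreover have "{u. u < q \<and> u < t} = {..<t}" if "t \<le> q" for t using that by auto
 then have "count_op q {..<q} = restrict id {..q}"
  by (auto simp: count_op_def fun_eq_iff)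
 moreover have "restrict (cnt {}) {..q} = (\<lambda>t\<in>{..q}. 0)" by (auto simp: fun_eq_iff)
 ultimately show ?thesis
  using act_id[OF assms(2,1)] by (simp add: shuffle_def pair_simplex_def shuffle_sign_def count_op_cnt)
qed

lemma pair_simplex_natural:
 assumes "pairing X Y Z m" "simplicial_on X X' a" "simplicial_on Y Y' b"
  "\<And>n x y. [|x \<in> spx X n; y \<in> spx Y n|] ==> c n (m n x y) = m' n (a n x) (b n y)"
  "\<theta> \<in> mono_maps n p" "\<phi> \<in> mono_maps n q" "\<sigma> \<in> spx X p" "\<tau> \<in> spx Y q"
 shows "c n (pair_simplex X Y m n p \<theta> \<sigma> q \<phi> \<tau>) = pair_simplex X' Y' m' n p \<theta> (a p \<sigma>) q \<phi> (b q \<tau>)"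
 unfolding pair_simplex_def
 using assms act_closed[OF pairingD(1)[OF assms(1)]] act_closed[OF pairingD(2)[OF assms(1)]]
 by (simp add: simplicial_onD)

lemma shuffle_natural:
 assumes P: "pairing X Y Z m" and a: "simplicial_on X X' a" and b: "simplicial_on Y Y' b"
  and c: "simplicial_on Z Z' c"
  and abc: "\<And>n x y. [|x \<in> spx X n; y \<in> spx Y n|] ==> c n (m n x y) = m' n (a n x) (b n y)"
  and \<sigma>: "\<sigma> \<in> spx X p" and \<tau>: "\<tau> \<in> spx Y q"
 shows "push Z' c (shuffle X Y Z m (p, \<sigma>) (q, \<tau>))
  = (shuffle X' Y' Z' m' (p, a p \<sigma>) (q, b q \<tau>) :: _ \<Rightarrow>\<^sub>0 'k::{comm_ring,comm_monoid_mult})"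
proof -
 have "push Z' c (sgn_pow s (nchain Z (p + q, pair_simplex X Y m (p + q) p (count_op (p + q) \<mu>) \<sigma>
              q (count_op (p + q) ({..<p + q} - \<mu>)) \<tau>)))
   = (sgn_pow s (nchain Z' (p + q, pair_simplex X' Y' m' (p + q) p (count_op (p + q) \<mu>) (a p \<sigma>)
              q (count_op (p + q) ({..<p + q} - \<mu>)) (b q \<tau>))) :: _ \<Rightarrow>\<^sub>0 'k)"
  if \<mu>: "\<mu> \<in> shuffle_sets p q" for \<mu> s
 proof -
  note D = shuffle_setsD(5,6)[OF \<mu>]
  show ?thesis
   using push_nchain[OF c pair_simplex_closed[OF P D \<sigma> \<tau>], where 'c = 'k]
    pair_simplex_natural[where c = c and m' = m', OF P a b abc D \<sigma> \<tau>]
   by (simp add: push_def lin_sgn_pow)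
 qed
 then show ?thesis by (simp add: shuffle_def push_def lin_sum)
qed

lemma shuffle_natural_chain:
 assumes P: "pairing X Y Z m" "pairing X' Y' Z' m'"
  and maps: "simplicial_on X X' a" "simplicial_on Y Y' b" "simplicial_on Z Z' c"
   "\<And>n x y. [|x \<in> spx X n; y \<in> spx Y n|] ==> c n (m n x y) = m' n (a n x) (b n y)"
  and ch: "A \<in> nchains X" "B \<in> nchains Y"
 shows "push Z' c (bilin (shuffle X Y Z m) A B :: _ \<Rightarrow>\<^sub>0 'k::{comm_ring,comm_monoid_mult})
  = bilin (shuffle X' Y' Z' m') (push X' a A) (push Y' b B)"
 unfolding push_def lin_bilin bilin_lin_lin
proof (rule bilin_cong)
 fix s t assume s: "s \<in> keys A" and t: "t \<in> keys B"
 obtain p \<sigma> q \<tau> where [simp]: "s = (p, \<sigma>)" "t = (q, \<tau>)" by (cases s, cases t)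
 have \<sigma>: "\<sigma> \<in> spx X p" and \<tau>: "\<tau> \<in> spx Y q" using s t ch nchains_keysD by auto
 show "lin (\<lambda>(n, \<sigma>). nchain Z' (n, c n \<sigma>)) (shuffle X Y Z m s t :: _ \<Rightarrow>\<^sub>0 'k) =
    bilin (shuffle X' Y' Z' m') (case s of (n, \<sigma>) => nchain X' (n, a n \<sigma>))
        (case t of (n, \<sigma>) => nchain Y' (n, b n \<sigma>))"
  using bilin_shuffle_nchain[OF P(2) simplicial_onD(1)[OF maps(1) \<sigma>] simplicial_onD(1)[OF maps(2) \<tau>], where 'k = 'k]
   shuffle_natural[OF P(1) maps \<sigma> \<tau>, where 'k = 'k]
  by (simp add: push_def)
qed

text \<open>The subset of \<open>\<mu>\<close> that corresponds to \<open>\<mu>'\<close> under the increasing enumeration of \<open>\<mu>\<close>.\<close>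

definition pull :: "nat set => nat set => nat set" where
 "pull \<mu> \<mu>' = {u \<in> \<mu>. cnt \<mu> u \<in> \<mu>'}"

lemma pull_subset: "pull \<mu> \<mu>' \<subseteq> \<mu>" by (auto simp: pull_def)

lemma cnt_image_pull:
 assumes "finite \<mu>" "\<mu>' \<subseteq> {..<card \<mu>}"
 shows "cnt \<mu> ` pull \<mu> \<mu>' = \<mu>'"
 using bij_betw_cnt[OF assms(1)] assms(2) unfolding bij_betw_def pull_def by auto

lemma pull_cnt_image: "A \<subseteq> \<mu> ==> pull \<mu> (cnt \<mu> ` A) = A"
 by (auto simp: pull_def) (metis cnt_eq_iff subsetD)

lemma inj_on_cnt: "A \<subseteq> \<mu> ==> inj_on (cnt \<mu>) A"
 by (rule inj_onI) (metis cnt_eq_iff subsetD)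

lemma card_pull:
 assumes "finite \<mu>" "\<mu>' \<subseteq> {..<card \<mu>}"
 shows "card (pull \<mu> \<mu>') = card \<mu>'"
 using card_image[OF inj_on_cnt[OF pull_subset]] cnt_image_pull[OF assms] by metis

lemma Diff_pull:
 assumes "finite \<mu>"
 shows "\<mu> - pull \<mu> \<mu>' = pull \<mu> ({..<card \<mu>} - \<mu>')"
 using bij_betw_cnt[OF assms] by (auto simp: pull_def bij_betw_def)

lemma cnt_pull:
 assumes "finite \<mu>" "\<mu>' \<subseteq> {..<card \<mu>}"
 shows "cnt (pull \<mu> \<mu>') t = cnt \<mu>' (cnt \<mu> t)"
proof -
 have eq: "cnt \<mu> ` {u \<in> pull \<mu> \<mu>'. u < t} = {w \<in> \<mu>'. w < cnt \<mu> t}"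
 proof (rule set_eqI)
  fix w
  have "w \<in> cnt \<mu> ` {u \<in> pull \<mu> \<mu>'. u < t} \<longleftrightarrow> (\<exists>u\<in>pull \<mu> \<mu>'. w = cnt \<mu> u \<and> cnt \<mu> u < cnt \<mu> t)"
   using cnt_less_iff[of _ \<mu> t] by (auto simp: pull_def)
  also have "\<dots> \<longleftrightarrow> w \<in> cnt \<mu> ` pull \<mu> \<mu>' \<and> w < cnt \<mu> t" by auto
  finally show "w \<in> cnt \<mu> ` {u \<in> pull \<mu> \<mu>'. u < t} \<longleftrightarrow> w \<in> {w \<in> \<mu>'. w < cnt \<mu> t}"
   by (simp add: cnt_image_pull[OF assms])
 qed
 have "card (cnt \<mu> ` {u \<in> pull \<mu> \<mu>'. u < t}) = card {u \<in> pull \<mu> \<mu>'. u < t}"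
  by (rule card_image[OF inj_on_cnt]) (auto simp: pull_def)
 then show ?thesis unfolding cnt_def[of "pull \<mu> \<mu>'"] cnt_def[of \<mu>'] using eq by simp
qed

lemma count_op_pull:
 assumes "\<mu> \<subseteq> {..<n}" "\<mu>' \<subseteq> {..<card \<mu>}"
 shows "compose {..n} (count_op (card \<mu>) \<mu>') (count_op n \<mu>) = count_op n (pull \<mu> \<mu>')"
proof -
 have "finite \<mu>" using assms(1) finite_subset by blast
 moreover have "cnt \<mu> t \<le> card \<mu>" if "t \<le> n" for t
  using cnt_mono[OF that, of \<mu>] cnt_total[OF assms(1)] by simp
 ultimately show ?thesis
  by (auto simp: fun_eq_iff compose_def count_op_cnt cnt_pull assms(2))
qed

lemma shuffle_sign_pull:
 assumes "finite \<mu>" "\<mu>1 \<subseteq> {..<card \<mu>}" "\<mu>2 \<subseteq> {..<card \<mu>}"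
 shows "shuffle_sign (pull \<mu> \<mu>1) (pull \<mu> \<mu>2) = shuffle_sign \<mu>1 \<mu>2"
proof -
 let ?f = "map_prod (cnt \<mu>) (cnt \<mu>)"
 let ?X = "{(u, v). u \<in> pull \<mu> \<mu>1 \<and> v \<in> pull \<mu> \<mu>2 \<and> v < u}"
 have "?f ` ?X = {(u, v). u \<in> \<mu>1 \<and> v \<in> \<mu>2 \<and> v < u}"
 proof (intro equalityI subsetI)
  fix x assume "x \<in> ?f ` ?X"
  then show "x \<in> {(u, v). u \<in> \<mu>1 \<and> v \<in> \<mu>2 \<and> v < u}"
   by (auto simp: pull_def cnt_less_iff)
 next
  fix x assume "x \<in> {(u, v). u \<in> \<mu>1 \<and> v \<in> \<mu>2 \<and> v < u}"
  then obtain u v where x: "x = (u, v)" "u \<in> \<mu>1" "v \<in> \<mu>2" "v < u" by auto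
  then obtain u' v' where "u' \<in> pull \<mu> \<mu>1" "v' \<in> pull \<mu> \<mu>2" "cnt \<mu> u' = u" "cnt \<mu> v' = v"
   using cnt_image_pull[OF assms(1,2)] cnt_image_pull[OF assms(1,3)] by (metis imageE)
  moreover have "v' < u'" using calculation x cnt_less_iff[of v' \<mu> u'] by (auto simp: pull_def)
  ultimately show "x \<in> ?f ` ?X" using x by force
 qed
 moreover have inj: "inj_on ?f ?X"
  by (rule inj_on_subset[OF map_prod_inj_on[OF inj_on_cnt[OF subset_refl] inj_on_cnt[OF subset_refl]]])
   (auto simp: pull_def)
 ultimately show ?thesis unfolding shuffle_sign_def using card_image[OF inj] by simp
qed

text \<open>The first two blocks of an ordered partition of \<open>{..<p + q + r}\<close> with blocks of sizes
 \<open>p\<close>, \<open>q\<close>, \<open>r\<close>. Both bracketings of a triple shuffle product are sums over these.\<close>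

definition blocks3 :: "nat => nat => nat => (nat set \<times> nat set) set" where
 "blocks3 p q r = {(A, B). A \<subseteq> {..<p + q + r} \<and> B \<subseteq> {..<p + q + r} \<and> A \<inter> B = {} \<and>
   card A = p \<and> card B = q}"

text \<open>Inversions are counted between two blocks at a time, so the sign of an ordered partition into three
 blocks is the product of the signs of the two shuffles in either bracketing.\<close>

definition shuffle3 :: "'x sset => (nat => 'x => 'x => 'x) => nat => 'x => nat => 'x => nat => 'x
  => (nat \<times> 'x \<Rightarrow>\<^sub>0 'k::{comm_ring,comm_monoid_mult})" where
 "shuffle3 M m p \<sigma> q \<tau> r \<rho> = (\<Sum>(A, B)\<in>blocks3 p q r.
   let n = p + q + r; C = {..<n} - A - B in
   sgn_pow (shuffle_sign A B + shuffle_sign A C + shuffle_sign B C)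
    (nchain M (n, m n (m n (sact M n p (count_op n A) \<sigma>) (sact M n q (count_op n B) \<tau>))
            (sact M n r (count_op n C) \<rho>))))"

lemma shuffle_left_assoc:
 fixes M :: "'x sset" and m
 assumes P: "pairing M M M m" and \<sigma>: "\<sigma> \<in> spx M p" and \<tau>: "\<tau> \<in> spx M q" and \<rho>: "\<rho> \<in> spx M r"
 shows "lin (\<lambda>s. shuffle M M M m s (r, \<rho>)) (shuffle M M M m (p, \<sigma>) (q, \<tau>))
  = (shuffle3 M m p \<sigma> q \<tau> r \<rho> :: _ \<Rightarrow>\<^sub>0 'k::{comm_ring,comm_monoid_mult})"
proof -
 let ?n = "p + q + r"
 have S: "simplicial_set M" using P by (simp add: pairing_def)
 define z where "z \<mu>' = pair_simplex M M m (p + q) p (count_op (p + q) \<mu>') \<sigma>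
              q (count_op (p + q) ({..<p + q} - \<mu>')) \<tau>" for \<mu>'
 define t where "t \<mu>' \<mu> = sgn_pow (shuffle_sign \<mu>' ({..<p + q} - \<mu>') + shuffle_sign \<mu> ({..<?n} - \<mu>))
    (nchain M (?n, pair_simplex M M m ?n (p + q) (count_op ?n \<mu>) (z \<mu>') r (count_op ?n ({..<?n} - \<mu>)) \<rho>)
     :: _ \<Rightarrow>\<^sub>0 'k)" for \<mu>' \<mu>
 have z: "z \<mu>' \<in> spx M (p + q)" if "\<mu>' \<in> shuffle_sets p q" for \<mu>'
  unfolding z_def by (rule pair_simplex_closed[OF P shuffle_setsD(5,6)[OF that] \<sigma> \<tau>])
 have "lin (\<lambda>s. shuffle M M M m s (r, \<rho>)) (shuffle M M M m (p, \<sigma>) (q, \<tau>))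
   = (\<Sum>\<mu>'\<in>shuffle_sets p q. lin (\<lambda>s. shuffle M M M m s (r, \<rho>))
     (sgn_pow (shuffle_sign \<mu>' ({..<p + q} - \<mu>')) (nchain M (p + q, z \<mu>')) :: _ \<Rightarrow>\<^sub>0 'k))"
  by (simp add: shuffle_def[of M M M m] z_def lin_sum)
 also have "\<dots> = (\<Sum>\<mu>'\<in>shuffle_sets p q. \<Sum>\<mu>\<in>shuffle_sets (p + q) r. t \<mu>' \<mu>)"
 proof (rule sum.cong[OF HOL.refl])
  fix \<mu>' assume \<mu>': "\<mu>' \<in> shuffle_sets p q"
  have "lin (\<lambda>s. shuffle M M M m s (r, \<rho>)) (nchain M (p + q, z \<mu>') :: _ \<Rightarrow>\<^sub>0 'k)
    = shuffle M M M m (p + q, z \<mu>') (r, \<rho>)"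
   by (rule lin_nchain[OF z[OF \<mu>']]) (rule shuffle_degenerate_left[OF P _ \<rho>])
  then show "lin (\<lambda>s. shuffle M M M m s (r, \<rho>))
     (sgn_pow (shuffle_sign \<mu>' ({..<p + q} - \<mu>')) (nchain M (p + q, z \<mu>')) :: _ \<Rightarrow>\<^sub>0 'k)
    = (\<Sum>\<mu>\<in>shuffle_sets (p + q) r. t \<mu>' \<mu>)"
   by (simp add: lin_sgn_pow shuffle_def sgn_pow_sum sgn_pow_sgn_pow t_def)
 qed
 also have "\<dots> = (\<Sum>(\<mu>', \<mu>)\<in>shuffle_sets p q \<times> shuffle_sets (p + q) r. t \<mu>' \<mu>)"
  by (rule sum.cartesian_product)
 also have "\<dots> = shuffle3 M m p \<sigma> q \<tau> r \<rho>"
  unfolding shuffle3_def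
 proof (rule sum.reindex_bij_witness[of _ "\<lambda>(A, B). (cnt (A \<union> B) ` A, A \<union> B)"
    "\<lambda>(\<mu>', \<mu>). (pull \<mu> \<mu>', \<mu> - pull \<mu> \<mu>')"])
  fix a assume "a \<in> shuffle_sets p q \<times> shuffle_sets (p + q) r"
  then obtain \<mu>' \<mu> where a: "a = (\<mu>', \<mu>)" and \<mu>': "\<mu>' \<in> shuffle_sets p q"
   and \<mu>: "\<mu> \<in> shuffle_sets (p + q) r" by auto
  note D' = shuffle_setsD[OF \<mu>'] and D = shuffle_setsD[OF \<mu>]
  have sub': "\<mu>' \<subseteq> {..<card \<mu>}" and sub'': "{..<p + q} - \<mu>' \<subseteq> {..<card \<mu>}" using D' D by auto
  define A B where "A = pull \<mu> \<mu>'" and "B = \<mu> - A"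
  have B: "B = pull \<mu> ({..<p + q} - \<mu>')" unfolding B_def A_def Diff_pull[OF D(3)] D(2) ..
  have AB: "A \<union> B = \<mu>" "A \<inter> B = {}" using pull_subset[of \<mu> \<mu>'] by (auto simp: A_def B_def)
  have cA: "card A = p" unfolding A_def card_pull[OF D(3) sub'] by (rule D'(2))
  have cB: "card B = q" unfolding B card_pull[OF D(3) sub''] by (rule D'(4))
  show "(case case a of (\<mu>', \<mu>) => (pull \<mu> \<mu>', \<mu> - pull \<mu> \<mu>') of (A, B) => (cnt (A \<union> B) ` A, A \<union> B)) = a"
   using AB cnt_image_pull[OF D(3) sub'] by (simp add: a A_def B_def)
  show "(case a of (\<mu>', \<mu>) => (pull \<mu> \<mu>', \<mu> - pull \<mu> \<mu>')) \<in> blocks3 p q r"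
   using AB cA cB D(1) by (auto simp: a blocks3_def simp flip: A_def B_def)
  have fin: "finite A" "finite B" using D(3) AB(1) by auto
  have C: "{..<?n} - A - B = {..<?n} - \<mu>" using AB by auto
  have s1: "shuffle_sign \<mu>' ({..<p + q} - \<mu>') = shuffle_sign A B"
   unfolding A_def B by (rule shuffle_sign_pull[OF D(3) sub' sub'', symmetric])
  have s2: "shuffle_sign \<mu> ({..<?n} - \<mu>) = shuffle_sign A ({..<?n} - \<mu>) + shuffle_sign B ({..<?n} - \<mu>)"
   using shuffle_sign_Un_left[OF fin _ AB(2), of "{..<?n} - \<mu>"] AB(1) by simp
  have "sact M ?n (p + q) (count_op ?n \<mu>) (z \<mu>') =
    pair_simplex M M m ?n p (count_op ?n A) \<sigma> q (count_op ?n B) \<tau>"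
   unfolding z_def using act_pair_simplex[OF P D(5) D'(5,6) \<sigma> \<tau>]
    count_op_pull[OF D(1) sub'] count_op_pull[OF D(1) sub''] D(2) by (simp add: A_def B)
  then have "pair_simplex M M m ?n (p + q) (count_op ?n \<mu>) (z \<mu>') r (count_op ?n ({..<?n} - \<mu>)) \<rho>
    = m ?n (m ?n (sact M ?n p (count_op ?n A) \<sigma>) (sact M ?n q (count_op ?n B) \<tau>))
       (sact M ?n r (count_op ?n ({..<?n} - \<mu>)) \<rho>)"
   by (simp add: pair_simplex_def)
  then show "(case case a of (\<mu>', \<mu>) => (pull \<mu> \<mu>', \<mu> - pull \<mu> \<mu>') of
    (A, B) => let n = ?n; C = {..<n} - A - B in
     sgn_pow (shuffle_sign A B + shuffle_sign A C + shuffle_sign B C)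
      (nchain M (n, m n (m n (sact M n p (count_op n A) \<sigma>) (sact M n q (count_op n B) \<tau>))
            (sact M n r (count_op n C) \<rho>)))) = (case a of (\<mu>', \<mu>) => t \<mu>' \<mu>)"
   unfolding a t_def case_prod_conv Let_def A_def[symmetric] B_def[symmetric] C s1 s2
   by (simp only: add.assoc[of "shuffle_sign A B"])
 next
  fix b assume "b \<in> blocks3 p q r"
  then obtain A B where b: "b = (A, B)" and AB: "A \<subseteq> {..<?n}" "B \<subseteq> {..<?n}" "A \<inter> B = {}"
   "card A = p" "card B = q" by (auto simp: blocks3_def)
  have fin: "finite A" "finite B" using AB finite_subset by blast+
  have c: "card (A \<union> B) = p + q" using card_Un_disjoint[OF fin AB(3)] AB by simp
  have "cnt (A \<union> B) ` A \<subseteq> {..<p + q}"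
   using bij_betw_cnt[of "A \<union> B"] fin c unfolding bij_betw_def by auto
  moreover have "card (cnt (A \<union> B) ` A) = p"
   using card_image[OF inj_on_cnt[of A "A \<union> B"]] AB by auto
  ultimately show "(case b of (A, B) => (cnt (A \<union> B) ` A, A \<union> B)) \<in> shuffle_sets p q \<times> shuffle_sets (p + q) r"
   using AB c by (auto simp: b shuffle_sets_def)
  show "(case case b of (A, B) => (cnt (A \<union> B) ` A, A \<union> B) of (\<mu>', \<mu>) => (pull \<mu> \<mu>', \<mu> - pull \<mu> \<mu>')) = b"
   using pull_cnt_image[of A "A \<union> B"] AB by (auto simp: b)
 qed
 finally show ?thesis .
qed

lemma shuffle_right_assoc:
 fixes M :: "'x sset" and m
 assumes P: "pairing M M M m" and \<sigma>: "\<sigma> \<in> spx M p" and \<tau>: "\<tau> \<in> spx M q" and \<rho>: "\<rho> \<in> spx M r"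
  and assoc: "\<And>n x y z. [|x \<in> spx M n; y \<in> spx M n; z \<in> spx M n|] ==> m n (m n x y) z = m n x (m n y z)"
 shows "lin (shuffle M M M m (p, \<sigma>)) (shuffle M M M m (q, \<tau>) (r, \<rho>))
  = (shuffle3 M m p \<sigma> q \<tau> r \<rho> :: _ \<Rightarrow>\<^sub>0 'k::{comm_ring,comm_monoid_mult})"
proof -
 let ?n = "p + (q + r)"
 have n: "p + q + r = ?n" by simp
 have S: "simplicial_set M" using P by (simp add: pairing_def)
 define z where "z \<mu>' = pair_simplex M M m (q + r) q (count_op (q + r) \<mu>') \<tau>
              r (count_op (q + r) ({..<q + r} - \<mu>')) \<rho>" for \<mu>'
 define t where "t \<mu>' \<mu> = sgn_pow (shuffle_sign \<mu>' ({..<q + r} - \<mu>') + shuffle_sign \<mu> ({..<?n} - \<mu>))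
    (nchain M (?n, pair_simplex M M m ?n p (count_op ?n \<mu>) \<sigma> (q + r) (count_op ?n ({..<?n} - \<mu>)) (z \<mu>'))
     :: _ \<Rightarrow>\<^sub>0 'k)" for \<mu>' \<mu>
 have z: "z \<mu>' \<in> spx M (q + r)" if "\<mu>' \<in> shuffle_sets q r" for \<mu>'
  unfolding z_def by (rule pair_simplex_closed[OF P shuffle_setsD(5,6)[OF that] \<tau> \<rho>])
 have "lin (shuffle M M M m (p, \<sigma>)) (shuffle M M M m (q, \<tau>) (r, \<rho>))
   = (\<Sum>\<mu>'\<in>shuffle_sets q r. lin (shuffle M M M m (p, \<sigma>))
     (sgn_pow (shuffle_sign \<mu>' ({..<q + r} - \<mu>')) (nchain M (q + r, z \<mu>')) :: _ \<Rightarrow>\<^sub>0 'k))"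
  by (simp add: shuffle_def[of M M M m] z_def lin_sum)
 also have "\<dots> = (\<Sum>\<mu>'\<in>shuffle_sets q r. \<Sum>\<mu>\<in>shuffle_sets p (q + r). t \<mu>' \<mu>)"
 proof (rule sum.cong[OF HOL.refl])
  fix \<mu>' assume \<mu>': "\<mu>' \<in> shuffle_sets q r"
  have "lin (shuffle M M M m (p, \<sigma>)) (nchain M (q + r, z \<mu>') :: _ \<Rightarrow>\<^sub>0 'k)
    = shuffle M M M m (p, \<sigma>) (q + r, z \<mu>')"
   by (rule lin_nchain[OF z[OF \<mu>']]) (rule shuffle_degenerate_right[OF P \<sigma>])
  then show "lin (shuffle M M M m (p, \<sigma>))
     (sgn_pow (shuffle_sign \<mu>' ({..<q + r} - \<mu>')) (nchain M (q + r, z \<mu>')) :: _ \<Rightarrow>\<^sub>0 'k)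
    = (\<Sum>\<mu>\<in>shuffle_sets p (q + r). t \<mu>' \<mu>)"
   by (simp add: lin_sgn_pow shuffle_def sgn_pow_sum sgn_pow_sgn_pow t_def)
 qed
 also have "\<dots> = (\<Sum>(\<mu>', \<mu>)\<in>shuffle_sets q r \<times> shuffle_sets p (q + r). t \<mu>' \<mu>)"
  by (rule sum.cartesian_product)
 also have "\<dots> = shuffle3 M m p \<sigma> q \<tau> r \<rho>"
  unfolding shuffle3_def n
 proof (rule sum.reindex_bij_witness[of _ "\<lambda>(A, B). (cnt ({..<?n} - A) ` B, A)"
    "\<lambda>(\<mu>', \<mu>). (\<mu>, pull ({..<?n} - \<mu>) \<mu>')"])
  fix a assume "a \<in> shuffle_sets q r \<times> shuffle_sets p (q + r)"
  then obtain \<mu>' \<mu> where a: "a = (\<mu>', \<mu>)" and \<mu>': "\<mu>' \<in> shuffle_sets q r"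
   and \<mu>: "\<mu> \<in> shuffle_sets p (q + r)" by auto
  note D' = shuffle_setsD[OF \<mu>'] and D = shuffle_setsD[OF \<mu>]
  define \<nu> where "\<nu> = {..<?n} - \<mu>"
  have \<nu>: "\<nu> \<subseteq> {..<?n}" "finite \<nu>" "card \<nu> = q + r" using D by (auto simp: \<nu>_def)
  have sub': "\<mu>' \<subseteq> {..<card \<nu>}" and sub'': "{..<q + r} - \<mu>' \<subseteq> {..<card \<nu>}" using D' \<nu> by auto
  define B C where "B = pull \<nu> \<mu>'" and "C = \<nu> - pull \<nu> \<mu>'"
  have C: "C = pull \<nu> ({..<q + r} - \<mu>')" unfolding C_def Diff_pull[OF \<nu>(2)] \<nu>(3) ..
  have BC: "B \<union> C = \<nu>" "B \<inter> C = {}" using pull_subset[of \<nu> \<mu>'] by (auto simp: B_def C_def)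
  have cB: "card B = q" unfolding B_def card_pull[OF \<nu>(2) sub'] by (rule D'(2))
  show "(case case a of (\<mu>', \<mu>) => (\<mu>, pull ({..<?n} - \<mu>) \<mu>') of (A, B) => (cnt ({..<?n} - A) ` B, A)) = a"
   using cnt_image_pull[OF \<nu>(2) sub'] by (simp add: a flip: \<nu>_def)
  show "(case a of (\<mu>', \<mu>) => (\<mu>, pull ({..<?n} - \<mu>) \<mu>')) \<in> blocks3 p q r"
   using BC cB D(1,2) \<nu>(1) unfolding n a blocks3_def case_prod_conv B_def[symmetric, unfolded \<nu>_def]
   by (auto simp: \<nu>_def)
  have fin: "finite B" "finite C" "finite \<mu>" using \<nu>(2) BC(1) D(3) by auto
  have C': "{..<?n} - \<mu> - B = C" unfolding C_def B_def \<nu>_def ..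
  have s1: "shuffle_sign \<mu>' ({..<q + r} - \<mu>') = shuffle_sign B C"
   unfolding B_def C by (rule shuffle_sign_pull[OF \<nu>(2) sub' sub'', symmetric])
  have s2: "shuffle_sign \<mu> \<nu> = shuffle_sign \<mu> B + shuffle_sign \<mu> C"
   using shuffle_sign_Un_right[OF fin(3,1,2) BC(2)] BC(1) by simp
  have "sact M ?n (q + r) (count_op ?n \<nu>) (z \<mu>') =
    pair_simplex M M m ?n q (count_op ?n B) \<tau> r (count_op ?n C) \<rho>"
   unfolding z_def using act_pair_simplex[OF P D(6) D'(5,6) \<tau> \<rho>]
    count_op_pull[OF \<nu>(1) sub'] count_op_pull[OF \<nu>(1) sub''] \<nu>(3) by (simp add: B_def C \<nu>_def)
  moreover have "sact M ?n p (count_op ?n \<mu>) \<sigma> \<in> spx M ?n" by (rule act_closed[OF S D(5) \<sigma>])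
  moreover have "sact M ?n q (count_op ?n B) \<tau> \<in> spx M ?n"
   by (rule act_closed[OF S count_op_mono \<tau>]) (use BC \<nu>(1) cB in auto)
  moreover have "sact M ?n r (count_op ?n C) \<rho> \<in> spx M ?n"
  proof (rule act_closed[OF S count_op_mono \<rho>])
   show "card C = r" unfolding C card_pull[OF \<nu>(2) sub''] by (rule D'(4))
  qed (use BC \<nu>(1) in auto)
  ultimately have "pair_simplex M M m ?n p (count_op ?n \<mu>) \<sigma> (q + r) (count_op ?n \<nu>) (z \<mu>')
    = m ?n (m ?n (sact M ?n p (count_op ?n \<mu>) \<sigma>) (sact M ?n q (count_op ?n B) \<tau>))
       (sact M ?n r (count_op ?n C) \<rho>)"
   by (simp add: pair_simplex_def assoc)
  then show "(case case a of (\<mu>', \<mu>) => (\<mu>, pull ({..<?n} - \<mu>) \<mu>') of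
    (A, B) => let n = ?n; C = {..<n} - A - B in
     sgn_pow (shuffle_sign A B + shuffle_sign A C + shuffle_sign B C)
      (nchain M (n, m n (m n (sact M n p (count_op n A) \<sigma>) (sact M n q (count_op n B) \<tau>))
            (sact M n r (count_op n C) \<rho>)))) = (case a of (\<mu>', \<mu>) => t \<mu>' \<mu>)"
   unfolding a t_def case_prod_conv Let_def B_def[symmetric, unfolded \<nu>_def] C' s1
    s2[unfolded \<nu>_def] \<nu>_def by (simp only: add.commute[of "shuffle_sign B C"])
 next
  fix b assume "b \<in> blocks3 p q r"
  then obtain A B where b: "b = (A, B)" and AB: "A \<subseteq> {..<?n}" "B \<subseteq> {..<?n}" "A \<inter> B = {}"
   "card A = p" "card B = q" unfolding blocks3_def n by auto
  have fin: "finite A" "finite B" using AB finite_subset by blast+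
  have c: "card ({..<?n} - A) = q + r" using AB fin by (simp add: card_Diff_subset)
  have BA: "B \<subseteq> {..<?n} - A" using AB by auto
  have "cnt ({..<?n} - A) ` B \<subseteq> {..<q + r}"
   using bij_betw_cnt[of "{..<?n} - A"] fin c BA unfolding bij_betw_def by auto
  moreover have "card (cnt ({..<?n} - A) ` B) = q"
   using card_image[OF inj_on_cnt[OF BA]] AB by auto
  ultimately show "(case b of (A, B) => (cnt ({..<?n} - A) ` B, A)) \<in> shuffle_sets q r \<times> shuffle_sets p (q + r)"
   using AB c by (auto simp: b shuffle_sets_def)
  show "(case case b of (A, B) => (cnt ({..<?n} - A) ` B, A) of (\<mu>', \<mu>) => (\<mu>, pull ({..<?n} - \<mu>) \<mu>')) = b"
   using pull_cnt_image[OF BA] by (auto simp: b)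
 qed
 finally show ?thesis .
qed

text \<open>A shuffle is read as a lattice path whose horizontal steps are the elements of \<open>\<mu>\<close>. A step
 is deleted, and a horizontal one inserted, at \<open>j\<close>.\<close>

definition collapse_step :: "nat => nat set => nat set" where
 "collapse_step j \<mu> = {u. (u < j \<and> u \<in> \<mu>) \<or> (j \<le> u \<and> Suc u \<in> \<mu>)}"

definition insert_step :: "nat => nat set => nat set" where
 "insert_step j \<mu> = {u. (u < j \<and> u \<in> \<mu>) \<or> u = j \<or> (j < u \<and> u - 1 \<in> \<mu>)}"

lemma collapse_insert_step: "collapse_step j (insert_step j \<mu>) = \<mu>"
 by (auto simp: collapse_step_def insert_step_def)

lemma insert_collapse_step:
 assumes "j \<in> \<mu>" shows "insert_step j (collapse_step j \<mu>) = \<mu>"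
proof (rule set_eqI)
 fix u show "u \<in> insert_step j (collapse_step j \<mu>) \<longleftrightarrow> u \<in> \<mu>"
 proof (cases "j < u")
  case True
  then obtain v where "u = Suc v" "j \<le> v" by (cases u) auto
  then show ?thesis by (auto simp: collapse_step_def insert_step_def)
 qed (use assms in \<open>auto simp: collapse_step_def insert_step_def\<close>)
qed

lemma cnt_collapse_step:
 assumes "j \<in> \<mu>"
 shows "cnt (collapse_step j \<mu>) u + (if j < u then 1 else 0) = cnt \<mu> (if j < u then Suc u else u)"
proof (induction u)
 case (Suc u)
 consider "Suc u < j" | "Suc u = j" | "u = j" | "j < u" by linarith
 then show ?case
  using Suc assms by cases (auto simp: cnt_Suc collapse_step_def)
qed simp

lemma collapse_step_image:
 assumes "j \<in> \<mu>"
 shows "\<mu> = insert j ((\<lambda>u. if u < j then u else Suc u) ` collapse_step j \<mu>)"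
proof (rule set_eqI)
 fix u show "u \<in> \<mu> \<longleftrightarrow> u \<in> insert j ((\<lambda>u. if u < j then u else Suc u) ` collapse_step j \<mu>)"
 proof (cases "j < u")
  case True
  then obtain v where "u = Suc v" "j \<le> v" by (cases u) auto
  then show ?thesis by (auto simp: collapse_step_def image_iff)
 qed (use assms in \<open>auto simp: collapse_step_def image_iff\<close>)
qed

lemma inj_skip: "inj_on (\<lambda>u. if u < j then u else Suc u) A"
 by (auto simp: inj_on_def split: if_splits)

lemma collapse_step_sum:
 assumes j: "j \<in> \<mu>" and fin: "finite \<mu>"
 shows "(\<Sum>u\<in>\<mu>. u - cnt \<mu> u)
  = (\<Sum>u\<in>collapse_step j \<mu>. u - cnt (collapse_step j \<mu>) u) + (j - cnt \<mu> j)"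
  and "card \<mu> = Suc (card (collapse_step j \<mu>))"
proof -
 let ?d = "\<lambda>u. if u < j then u else Suc u" and ?c = "collapse_step j \<mu>"
 have fin': "finite ?c"
 proof (rule finite_imageD[OF _ inj_skip])
  show "finite (?d ` ?c)" by (rule finite_subset[OF _ fin]) (use collapse_step_image[OF j] in blast)
 qed
 have nj: "j \<notin> ?d ` ?c" by auto
 have "(\<Sum>u\<in>\<mu>. u - cnt \<mu> u) = (\<Sum>u\<in>insert j (?d ` ?c). u - cnt \<mu> u)"
  using collapse_step_image[OF j] by simp
 also have "\<dots> = (j - cnt \<mu> j) + (\<Sum>u\<in>?c. ?d u - cnt \<mu> (?d u))"
  unfolding sum.insert[OF finite_imageI[OF fin'] nj] sum.reindex[OF inj_skip] o_def ..
 also have "(\<Sum>u\<in>?c. ?d u - cnt \<mu> (?d u)) = (\<Sum>u\<in>?c. u - cnt ?c u)"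
 proof (rule sum.cong[OF HOL.refl])
  fix u
  consider "u < j" | "u = j" | "j < u" by linarith
  then show "?d u - cnt \<mu> (?d u) = u - cnt ?c u"
   using cnt_collapse_step[OF j, of u] j by cases (auto simp: cnt_Suc)
 qed
 finally show "(\<Sum>u\<in>\<mu>. u - cnt \<mu> u) = (\<Sum>u\<in>?c. u - cnt ?c u) + (j - cnt \<mu> j)" by simp
 have "card \<mu> = card (insert j (?d ` ?c))" using collapse_step_image[OF j] by simp
 also have "\<dots> = Suc (card ?c)"
  unfolding card_insert_disjoint[OF finite_imageI[OF fin'] nj] card_image[OF inj_skip] ..
 finally show "card \<mu> = Suc (card ?c)" .
qed

text \<open>The lattice path of \<open>\<mu>\<close> does not turn at its vertex \<open>t\<close> and is horizontal there.\<close>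

definition straight :: "nat set => nat => nat => bool" where
 "straight \<mu> n t \<longleftrightarrow> (0 < t \<longrightarrow> t - 1 \<in> \<mu>) \<and> (t < n \<longrightarrow> t \<in> \<mu>)"

context
 fixes n' t \<mu>
 assumes t: "t \<le> Suc n'" and st: "straight \<mu> (Suc n') t"
begin

lemma straight_step: "min t n' \<in> \<mu>"
 using t st by (cases "t \<le> n'") (auto simp: straight_def min_def le_Suc_eq)

lemma cnt_straight:
 assumes "u \<le> n'"
 shows "cnt (collapse_step (min t n') \<mu>) u + (if t \<le> u then 1 else 0) = cnt \<mu> (if t \<le> u then Suc u else u)"
proof (cases "u = t")
 case True
 then have "t \<in> \<mu>" using st assms by (auto simp: straight_def)
 then show ?thesis using cnt_collapse_step[OF straight_step, of u] assms True by (simp add: min_def cnt_Suc)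
next
 case False
 then show ?thesis using cnt_collapse_step[OF straight_step, of u] assms t
  by (cases "t \<le> n'") (auto simp: min_def)
qed

lemma cnt_straight_less:
 assumes u: "u \<le> n'"
 shows "cnt (collapse_step (min t n') \<mu>) u < cnt \<mu> t \<longleftrightarrow> u < t"
proof (cases "u < t")
 case True
 then have "cnt \<mu> u \<le> cnt \<mu> (t - 1)" by (intro cnt_mono) auto
 moreover have "cnt \<mu> t = Suc (cnt \<mu> (t - 1))"
  using True st cnt_Suc[of \<mu> "t - 1"] by (auto simp: straight_def)
 ultimately show ?thesis using cnt_straight[OF u] True by auto
next
 case False
 then have "t \<in> \<mu>" using u st by (auto simp: straight_def)
 then have "Suc (cnt \<mu> t) \<le> cnt \<mu> (Suc u)" using cnt_mono[of "Suc t" "Suc u" \<mu>] False by (simp add: cnt_Suc)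
 then show ?thesis using cnt_straight[OF u] False by auto
qed

lemma straight_sign:
 assumes "finite \<mu>"
 shows "even (t + (\<Sum>u\<in>\<mu>. u - cnt \<mu> u)
  + (cnt \<mu> t + (\<Sum>u\<in>collapse_step (min t n') \<mu>. u - cnt (collapse_step (min t n') \<mu>) u)))"
proof -
 have "min t n' - cnt \<mu> (min t n') = t - cnt \<mu> t"
 proof (cases "t \<le> n'")
  case False
  then have "t = Suc n'" using t by simp
  moreover from this have "n' \<in> \<mu>" using st by (auto simp: straight_def)
  ultimately show ?thesis by (simp add: cnt_Suc)
 qed (simp add: min_def)
 then have "(\<Sum>u\<in>\<mu>. u - cnt \<mu> u)
   = (\<Sum>u\<in>collapse_step (min t n') \<mu>. u - cnt (collapse_step (min t n') \<mu>) u) + (t - cnt \<mu> t)"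
  using collapse_step_sum(1)[OF straight_step assms] by simp
 then show ?thesis using cnt_le[of \<mu> t] by presburger
qed

lemma compose_straight:
 assumes \<mu>: "\<mu> \<subseteq> {..<Suc n'}" "card \<mu> = Suc p'"
 defines "\<mu>' \<equiv> collapse_step (min t n') \<mu>"
 shows "compose {..n'} (count_op (Suc n') \<mu>) (coface n' t)
   = compose {..n'} (coface p' (cnt \<mu> t)) (count_op n' \<mu>')"
  and "compose {..n'} (count_op (Suc n') ({..<Suc n'} - \<mu>)) (coface n' t) = count_op n' ({..<n'} - \<mu>')"
  and "\<mu>' \<subseteq> {..<n'}" "card \<mu>' = p'"
proof -
 show c: "card \<mu>' = p'" using collapse_step_sum(2)[OF straight_step] \<mu> finite_subset[OF \<mu>(1)]
  unfolding \<mu>'_def by simp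
 show s: "\<mu>' \<subseteq> {..<n'}" using \<mu>(1) t straight_step by (auto simp: \<mu>'_def collapse_step_def min_def split: if_splits)
 have le: "cnt \<mu>' u \<le> p'" if "u \<le> n'" for u
  using cnt_mono[OF that, of \<mu>'] cnt_total[OF s] c by simp
 show "compose {..n'} (count_op (Suc n') \<mu>) (coface n' t)
   = compose {..n'} (coface p' (cnt \<mu> t)) (count_op n' \<mu>')"
 proof
  fix u
  show "compose {..n'} (count_op (Suc n') \<mu>) (coface n' t) u
   = compose {..n'} (coface p' (cnt \<mu> t)) (count_op n' \<mu>') u"
  proof (cases "u \<le> n'")
   case True
   then show ?thesis
    using cnt_straight[OF True] cnt_straight_less[OF True] le[OF True]
    by (auto simp: compose_def coface_def count_op_cnt simp flip: \<mu>'_def)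
  qed (simp add: compose_def)
 qed
 show "compose {..n'} (count_op (Suc n') ({..<Suc n'} - \<mu>)) (coface n' t) = count_op n' ({..<n'} - \<mu>')"
 proof
  fix u
  show "compose {..n'} (count_op (Suc n') ({..<Suc n'} - \<mu>)) (coface n' t) u = count_op n' ({..<n'} - \<mu>') u"
  proof (cases "u \<le> n'")
   case True
   then show ?thesis
    using cnt_straight[OF True] cnt_complement[of "if t \<le> u then Suc u else u" "Suc n'" \<mu>]
     cnt_complement[OF True, of \<mu>']
    by (auto simp: compose_def coface_def count_op_cnt simp flip: \<mu>'_def)
  qed (simp add: compose_def count_op_cnt)
 qed
qed

end

lemma insert_step_straight:
 assumes i: "i \<le> Suc p'" and \<mu>': "\<mu>' \<subseteq> {..<n'}" "card \<mu>' = p'"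
 defines "t \<equiv> LEAST t. t = Suc n' \<or> i \<le> cnt \<mu>' t"
 defines "\<mu> \<equiv> insert_step (min t n') \<mu>'"
 shows "t \<le> Suc n'" "straight \<mu> (Suc n') t" "\<mu> \<subseteq> {..<Suc n'}" "card \<mu> = Suc p'" "cnt \<mu> t = i"
  "collapse_step (min t n') \<mu> = \<mu>'"
proof -
 have least: "t = Suc n' \<or> i \<le> cnt \<mu>' t" unfolding t_def by (rule LeastI[of _ "Suc n'"]) simp
 have below: "cnt \<mu>' u < i" if "u < t" for u
  using not_less_Least[OF that[unfolded t_def]] by auto
 show tn: "t \<le> Suc n'" unfolding t_def by (rule Least_le) simp
 show sub: "\<mu> \<subseteq> {..<Suc n'}" using \<mu>'(1) by (auto simp: \<mu>_def insert_step_def min_def split: if_splits)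
 have j: "min t n' \<in> \<mu>" by (simp add: \<mu>_def insert_step_def)
 show coll: "collapse_step (min t n') \<mu> = \<mu>'" unfolding \<mu>_def by (rule collapse_insert_step)
 show card: "card \<mu> = Suc p'" using collapse_step_sum(2)[OF j] finite_subset[OF sub] coll \<mu>'(2) by simp
 have prev: "t - 1 \<in> \<mu>'" if "0 < t" "t \<le> n'"
 proof -
  have "cnt \<mu>' (t - 1) < cnt \<mu>' (Suc (t - 1))" using below[of "t - 1"] least that by auto
  then show ?thesis by (simp add: cnt_Suc split: if_splits)
 qed
 show "straight \<mu> (Suc n') t"
  unfolding straight_def
 proof (intro conjI impI)
  assume "0 < t" then show "t - 1 \<in> \<mu>"
   using prev tn by (cases "t \<le> n'") (auto simp: \<mu>_def insert_step_def min_def)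
 next
  assume "t < Suc n'" then show "t \<in> \<mu>" using j by (simp add: min_def)
 qed
 show "cnt \<mu> t = i"
 proof (cases "t \<le> n'")
  case True
  have "cnt \<mu> t = cnt \<mu>' t" using cnt_collapse_step[OF j, of t, unfolded coll] True by (simp add: min_def)
  also have "cnt \<mu>' t = i"
  proof (cases t)
   case 0 then show ?thesis using least True by auto
  next
   case (Suc s) then show ?thesis using least True below[of s] by (auto simp: cnt_Suc split: if_splits)
  qed
  finally show ?thesis .
 next
  case False
  then have "t = Suc n'" using tn by simp
  then have "cnt \<mu> t = Suc p'" using cnt_total[OF sub] card by simp
  moreover have "p' < i" using below[of n'] \<open>t = Suc n'\<close> cnt_total[OF \<mu>'(1)] \<mu>'(2) by simp
  ultimately show ?thesis using i by simp
 qed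
qed

text \<open>The contribution to the boundary of a shuffle product of the face opposite to the vertex \<open>t\<close>
 of the path \<open>\<mu>\<close>.\<close>

definition face_term :: "'x sset => 'y sset => 'z sset => (nat => 'x => 'y => 'z) => nat => 'x => nat => 'y
  => nat set => nat => (nat \<times> 'z \<Rightarrow>\<^sub>0 'k::{comm_ring,comm_monoid_mult})" where
 "face_term X Y Z m p \<sigma> q \<tau> \<mu> t = (let n = p + q; n' = n - 1 in
   sgn_pow (t + shuffle_sign \<mu> ({..<n} - \<mu>))
    (nchain Z (n', pair_simplex X Y m n' p (compose {..n'} (count_op n \<mu>) (coface n' t)) \<sigma>
            q (compose {..n'} (count_op n ({..<n} - \<mu>)) (coface n' t)) \<tau>)))"

definition straight_pairs :: "nat => nat => (nat set \<times> nat) set" where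
 "straight_pairs p q = {(\<mu>, t). \<mu> \<in> shuffle_sets p q \<and> t \<le> p + q \<and> straight \<mu> (p + q) t}"

lemma even_swap: "even (a + b) ==> even (b + a :: nat)"
 by (simp add: add.commute)

text \<open>Deleting the horizontal step at a straight vertex leaves the path of a shuffle of the second factor
 with a face of the first.\<close>

lemma sum_straight:
 assumes P: "pairing X Y Z m" and \<sigma>: "\<sigma> \<in> spx X p" and \<tau>: "\<tau> \<in> spx Y q" and pq: "0 < p + q"
 shows "(\<Sum>(\<mu>, t)\<in>straight_pairs p q. face_term X Y Z m p \<sigma> q \<tau> \<mu> t)
  = (lin (\<lambda>s. shuffle X Y Z m s (q, \<tau>)) (chain_boundary X (p, \<sigma>)) :: _ \<Rightarrow>\<^sub>0 'k::{comm_ring,comm_monoid_mult})"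
proof (cases p)
 case 0
 have "\<not> straight \<mu> (p + q) t" if "\<mu> \<in> shuffle_sets p q" for \<mu> t
 proof -
  have "\<mu> = {}" using shuffle_setsD(2,3)[OF that] 0 by simp
  then show ?thesis using pq by (auto simp: straight_def)
 qed
 then have "straight_pairs p q = {}" by (auto simp: straight_pairs_def)
 then show ?thesis by (simp add: 0)
next
 case (Suc p')
 define n' where "n' = p' + q"
 have n: "p + q = Suc n'" by (simp add: n'_def Suc)
 define g where "g i \<mu>' = (sgn_pow (i + shuffle_sign \<mu>' ({..<n'} - \<mu>'))
    (nchain Z (n', pair_simplex X Y m n' p' (count_op n' \<mu>') (sface X p' i \<sigma>)
            q (count_op n' ({..<n'} - \<mu>')) \<tau>)) :: _ \<Rightarrow>\<^sub>0 'k)" for i \<mu>'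
 have S: "simplicial_set X" using P by (simp add: pairing_def)
 have "lin (\<lambda>s. shuffle X Y Z m s (q, \<tau>)) (chain_boundary X (p, \<sigma>))
   = (\<Sum>i\<le>p. sgn_pow i (shuffle X Y Z m (p', sface X p' i \<sigma>) (q, \<tau>)) :: _ \<Rightarrow>\<^sub>0 'k)"
 proof -
  have "lin (\<lambda>s. shuffle X Y Z m s (q, \<tau>)) (nchain X (p', sface X p' i \<sigma>))
    = (shuffle X Y Z m (p', sface X p' i \<sigma>) (q, \<tau>) :: _ \<Rightarrow>\<^sub>0 'k)" for i
   by (rule lin_nchain[OF sface_closed[OF S]])
    (use \<sigma> Suc in \<open>auto intro: shuffle_degenerate_left[OF P _ \<tau>]\<close>)
  then show ?thesis unfolding Suc chain_boundary.simps lin_sum lin_sgn_pow by simp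
 qed
 also have "\<dots> = (\<Sum>i\<le>p. \<Sum>\<mu>'\<in>shuffle_sets p' q. g i \<mu>')"
  by (simp add: shuffle_def sgn_pow_sum sgn_pow_sgn_pow g_def n'_def)
 also have "\<dots> = (\<Sum>(i, \<mu>')\<in>{..p} \<times> shuffle_sets p' q. g i \<mu>')"
  by (rule sum.cartesian_product)
 also have "\<dots> = (\<Sum>(\<mu>, t)\<in>straight_pairs p q. face_term X Y Z m p \<sigma> q \<tau> \<mu> t)"
 proof (rule sum.reindex_bij_witness[symmetric, of _
    "\<lambda>(i, \<mu>'). let t = (LEAST t. t = Suc n' \<or> i \<le> cnt \<mu>' t) in (insert_step (min t n') \<mu>', t)"
    "\<lambda>(\<mu>, t). (cnt \<mu> t, collapse_step (min t n') \<mu>)"])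
  fix a assume "a \<in> straight_pairs p q"
  then obtain \<mu> t where a: "a = (\<mu>, t)" and \<mu>s: "\<mu> \<in> shuffle_sets p q" and t: "t \<le> Suc n'"
   and st: "straight \<mu> (Suc n') t" by (auto simp: straight_pairs_def n)
  note D = shuffle_setsD[OF \<mu>s, unfolded n]
  let ?\<mu>' = "collapse_step (min t n') \<mu>"
  note cs = compose_straight[OF t st D(1) D(2)[unfolded Suc]]
  have j: "min t n' \<in> \<mu>" by (rule straight_step[OF t st])
  have least: "(LEAST s. s = Suc n' \<or> cnt \<mu> t \<le> cnt ?\<mu>' s) = t"
  proof (rule Least_equality)
   show "t = Suc n' \<or> cnt \<mu> t \<le> cnt ?\<mu>' t"
    using cnt_straight_less[OF t st, of t] t by (cases "t \<le> n'") auto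
   show "t \<le> s" if "s = Suc n' \<or> cnt \<mu> t \<le> cnt ?\<mu>' s" for s
    using that cnt_straight_less[OF t st, of s] t by (cases "s \<le> n'") (auto simp: not_less[symmetric])
  qed
  show "(case case a of (\<mu>, t) => (cnt \<mu> t, collapse_step (min t n') \<mu>) of
    (i, \<mu>') => let t = (LEAST t. t = Suc n' \<or> i \<le> cnt \<mu>' t) in (insert_step (min t n') \<mu>', t)) = a"
   by (simp add: a least Let_def insert_collapse_step[OF j])
  have cp: "cnt \<mu> t \<le> p" using cnt_mono[OF t, of \<mu>] cnt_total[OF D(1)] D(2) by simp
  show "(case a of (\<mu>, t) => (cnt \<mu> t, collapse_step (min t n') \<mu>)) \<in> {..p} \<times> shuffle_sets p' q"
   using cp cs(3,4) by (simp add: a shuffle_sets_def n'_def)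
  have co: "count_op n' ?\<mu>' \<in> mono_maps n' p'" using cs(3,4) by (rule count_op_mono)
  have "pair_simplex X Y m n' p' (count_op n' ?\<mu>') (sface X p' (cnt \<mu> t) \<sigma>) q (count_op n' ({..<n'} - ?\<mu>')) \<tau>
   = pair_simplex X Y m n' p (compose {..n'} (count_op (Suc n') \<mu>) (coface n' t)) \<sigma>
     q (compose {..n'} (count_op (Suc n') ({..<Suc n'} - \<mu>)) (coface n' t)) \<tau>"
   unfolding cs(1,2) pair_simplex_def sface_def
   using act_act[OF S co coface_mono] \<sigma> Suc by simp
  moreover have "even (cnt \<mu> t + shuffle_sign ?\<mu>' ({..<n'} - ?\<mu>') + (t + shuffle_sign \<mu> ({..<Suc n'} - \<mu>)))"
   unfolding shuffle_sign_sum[OF D(1)] shuffle_sign_sum[OF cs(3)]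
   by (rule even_swap[OF straight_sign[OF t st D(3)]])
  ultimately show "(case case a of (\<mu>, t) => (cnt \<mu> t, collapse_step (min t n') \<mu>) of (i, \<mu>') => g i \<mu>')
    = (case a of (\<mu>, t) => face_term X Y Z m p \<sigma> q \<tau> \<mu> t)"
   unfolding a case_prod_conv g_def face_term_def n Let_def diff_Suc_1 by (metis sgn_pow_cong)
 next
  fix b assume "b \<in> {..p} \<times> shuffle_sets p' q"
  then obtain i \<mu>' where b: "b = (i, \<mu>')" and i: "i \<le> Suc p'" and \<mu>': "\<mu>' \<subseteq> {..<n'}" "card \<mu>' = p'"
   by (auto simp: shuffle_sets_def n'_def Suc)
  note E = insert_step_straight[OF i \<mu>']
  show "(case b of (i, \<mu>') => let t = (LEAST t. t = Suc n' \<or> i \<le> cnt \<mu>' t) in (insert_step (min t n') \<mu>', t))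
    \<in> straight_pairs p q"
   using E by (simp add: b Let_def straight_pairs_def n shuffle_sets_def Suc n'_def[symmetric])
  show "(case case b of (i, \<mu>') => let t = (LEAST t. t = Suc n' \<or> i \<le> cnt \<mu>' t) in (insert_step (min t n') \<mu>', t)
    of (\<mu>, t) => (cnt \<mu> t, collapse_step (min t n') \<mu>)) = b"
   using E by (simp add: b Let_def)
 qed
 finally show ?thesis ..
qed

lemma finite_straight_pairs: "finite (straight_pairs p q)"
 by (rule finite_subset[of _ "shuffle_sets p q \<times> {..p + q}"]) (auto simp: straight_pairs_def)

text \<open>The corners of the path, separated by the direction of the step that leads to them.\<close>

definition turn_pairs :: "bool => nat => nat => (nat set \<times> nat) set" where
 "turn_pairs h p q = {(\<mu>, t). \<mu> \<in> shuffle_sets p q \<and> 0 < t \<and> t < p + q \<and>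
   (if h then t - 1 \<in> \<mu> \<and> t \<notin> \<mu> else t - 1 \<notin> \<mu> \<and> t \<in> \<mu>)}"

lemma finite_turn_pairs: "finite (turn_pairs h p q)"
 by (rule finite_subset[of _ "shuffle_sets p q \<times> {..p + q}"]) (auto simp: turn_pairs_def)

text \<open>Replacing a corner of the path by the opposite corner keeps the face and changes the sign.\<close>

lemma sum_turns:
 "(\<Sum>(\<mu>, t)\<in>turn_pairs True p q. face_term X Y Z m p \<sigma> q \<tau> \<mu> t)
  = - (\<Sum>(\<mu>, t)\<in>turn_pairs False p q. face_term X Y Z m p \<sigma> q \<tau> \<mu> t :: _ \<Rightarrow>\<^sub>0 'k::{comm_ring,comm_monoid_mult})"
 unfolding sum_negf[symmetric]
proof (rule sum.reindex_bij_witness[of _ "\<lambda>(\<mu>, t). (insert (t - 1) (\<mu> - {t}), t)"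
   "\<lambda>(\<mu>, t). (insert t (\<mu> - {t - 1}), t)"])
 fix a assume "a \<in> turn_pairs True p q"
 then obtain \<mu> s where a: "a = (\<mu>, Suc s)" and \<mu>: "\<mu> \<in> shuffle_sets p q" and s: "Suc s < p + q" "s \<in> \<mu>" "Suc s \<notin> \<mu>"
  by (cases a; cases "snd a") (auto simp: turn_pairs_def)
 note D = shuffle_setsD[OF \<mu>]
 define \<mu>2 where "\<mu>2 = insert (Suc s) (\<mu> - {s})"
 have b: "(case a of (\<mu>, t) => (insert t (\<mu> - {t - 1}), t)) = (\<mu>2, Suc s)" by (simp add: a \<mu>2_def)
 have "card \<mu>2 = Suc (card (\<mu> - {s}))" unfolding \<mu>2_def using D(3) s by (simp add: card_insert_if)
 then have card2: "card \<mu>2 = card \<mu>" using card_Suc_Diff1[OF D(3) s(2)] by simp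
 show "(case case a of (\<mu>, t) => (insert t (\<mu> - {t - 1}), t) of (\<mu>, t) => (insert (t - 1) (\<mu> - {t}), t)) = a"
  using s by (auto simp: a)
 have sub2: "\<mu>2 \<subseteq> {..<p + q}" using D(1) s by (auto simp: \<mu>2_def)
 show "(case a of (\<mu>, t) => (insert t (\<mu> - {t - 1}), t)) \<in> turn_pairs False p q"
  unfolding b using s sub2 D(2) card2 by (auto simp: turn_pairs_def shuffle_sets_def \<mu>2_def)
 have c: "cnt \<mu>2 u = cnt \<mu> u" if "u \<noteq> Suc s" for u
 proof (cases "u \<le> s")
  case True
  show ?thesis by (rule cnt_cong) (use True in \<open>auto simp: \<mu>2_def\<close>)
 next
  case False
  then have "Suc (Suc s) \<le> u" using that by linarith
  then obtain v where v: "u = Suc (Suc s) + v" using le_Suc_ex by blast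
  have base: "cnt \<mu>2 s = cnt \<mu> s" by (rule cnt_cong) (auto simp: \<mu>2_def)
  show ?thesis unfolding v
   by (induction v) (use s base in \<open>auto simp: cnt_Suc \<mu>2_def\<close>)
 qed
 have cs: "cnt \<mu>2 (Suc s) = cnt \<mu> s" using c[of s] by (simp add: cnt_Suc \<mu>2_def)
 have co: "compose {..p + q - 1} (count_op (p + q) \<mu>2) (coface (p + q - 1) (Suc s))
   = compose {..p + q - 1} (count_op (p + q) \<mu>) (coface (p + q - 1) (Suc s))"
  by (auto simp: fun_eq_iff compose_def count_op_cnt coface_def c)
 have co': "compose {..p + q - 1} (count_op (p + q) ({..<p + q} - \<mu>2)) (coface (p + q - 1) (Suc s))
   = compose {..p + q - 1} (count_op (p + q) ({..<p + q} - \<mu>)) (coface (p + q - 1) (Suc s))"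
  by (auto simp: fun_eq_iff compose_def count_op_cnt coface_def c cnt_complement)
 have "(\<Sum>u\<in>\<mu>2. u - cnt \<mu>2 u) = (Suc s - cnt \<mu> s) + (\<Sum>u\<in>\<mu> - {s}. u - cnt \<mu>2 u)"
  unfolding \<mu>2_def using D(3) s by (simp add: cs[unfolded \<mu>2_def])
 also have "(\<Sum>u\<in>\<mu> - {s}. u - cnt \<mu>2 u) = (\<Sum>u\<in>\<mu> - {s}. u - cnt \<mu> u)"
 proof (rule sum.cong[OF HOL.refl])
  fix u assume "u \<in> \<mu> - {s}"
  then have "u \<noteq> Suc s" using s by auto
  then show "u - cnt \<mu>2 u = u - cnt \<mu> u" by (simp add: c)
 qed
 also have "(Suc s - cnt \<mu> s) = Suc (s - cnt \<mu> s)" using cnt_le[of \<mu> s] by simp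
 also have "Suc (s - cnt \<mu> s) + (\<Sum>u\<in>\<mu> - {s}. u - cnt \<mu> u) = Suc (\<Sum>u\<in>\<mu>. u - cnt \<mu> u)"
  using sum.remove[OF D(3) s(2), of "\<lambda>u. u - cnt \<mu> u"] by simp
 finally have "shuffle_sign \<mu>2 ({..<p + q} - \<mu>2) = Suc (shuffle_sign \<mu> ({..<p + q} - \<mu>))"
  unfolding shuffle_sign_sum[OF sub2] shuffle_sign_sum[OF D(1)] .
 then show "- (case case a of (\<mu>, t) => (insert t (\<mu> - {t - 1}), t) of (\<mu>, t) => face_term X Y Z m p \<sigma> q \<tau> \<mu> t)
   = ((case a of (\<mu>, t) => face_term X Y Z m p \<sigma> q \<tau> \<mu> t) :: _ \<Rightarrow>\<^sub>0 'k)"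
  unfolding b unfolding a case_prod_conv face_term_def Let_def co co' by (simp add: sgn_pow_Suc)
next
 fix b assume "b \<in> turn_pairs False p q"
 then obtain \<mu> s where b: "b = (\<mu>, Suc s)" and \<mu>: "\<mu> \<in> shuffle_sets p q" and s: "Suc s < p + q" "s \<notin> \<mu>" "Suc s \<in> \<mu>"
  by (cases b; cases "snd b") (auto simp: turn_pairs_def)
 note D = shuffle_setsD[OF \<mu>]
 have "card (insert s (\<mu> - {Suc s})) = card \<mu>"
  using D(3) s card_Suc_Diff1[OF D(3) s(3)] by (simp add: card_insert_if)
 then show "(case b of (\<mu>, t) => (insert (t - 1) (\<mu> - {t}), t)) \<in> turn_pairs True p q"
  using s D(1,2) by (auto simp: b turn_pairs_def shuffle_sets_def)
 show "(case case b of (\<mu>, t) => (insert (t - 1) (\<mu> - {t}), t) of (\<mu>, t) => (insert t (\<mu> - {t - 1}), t)) = b"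
  using s by (auto simp: b)
qed

lemma face_term_flip:
 assumes "\<mu> \<in> shuffle_sets p q"
 shows "face_term X Y Z m p \<sigma> q \<tau> \<mu> t = (sgn_pow (p * q)
   (face_term Y X Z (\<lambda>n y x. m n x y) q \<tau> p \<sigma> ({..<p + q} - \<mu>) t) :: _ \<Rightarrow>\<^sub>0 'k::{comm_ring,comm_monoid_mult})"
proof -
 have dd: "{..<p + q} - ({..<p + q} - \<mu>) = \<mu>" using shuffle_setsD(1)[OF assms] by auto
 have "even (t + shuffle_sign \<mu> ({..<p + q} - \<mu>) + (p * q + (t + shuffle_sign ({..<p + q} - \<mu>) \<mu>)))"
  unfolding shuffle_sign_complement[OF assms, symmetric] by presburger
 then show ?thesis
  unfolding face_term_def Let_def add.commute[of q p] dd sgn_pow_sgn_pow pair_simplex_flip[of Y X m]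
  by (rule sgn_pow_cong)
qed

lemma sum_straight_complement:
 assumes P: "pairing X Y Z m" and \<sigma>: "\<sigma> \<in> spx X p" and \<tau>: "\<tau> \<in> spx Y q" and pq: "0 < p + q"
 shows "(\<Sum>(\<mu>, t)\<in>{(\<mu>, t). ({..<p + q} - \<mu>, t) \<in> straight_pairs q p \<and> \<mu> \<subseteq> {..<p + q}}. face_term X Y Z m p \<sigma> q \<tau> \<mu> t)
  = (sgn_pow p (lin (shuffle X Y Z m (p, \<sigma>)) (chain_boundary Y (q, \<tau>))) :: _ \<Rightarrow>\<^sub>0 'k::{comm_ring,comm_monoid_mult})"
proof -
 let ?m = "\<lambda>n y x. m n x y"
 have "(\<Sum>(\<mu>, t)\<in>{(\<mu>, t). ({..<p + q} - \<mu>, t) \<in> straight_pairs q p \<and> \<mu> \<subseteq> {..<p + q}}. face_term X Y Z m p \<sigma> q \<tau> \<mu> t)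
  = (\<Sum>(\<mu>, t)\<in>straight_pairs q p. sgn_pow (p * q) (face_term Y X Z ?m q \<tau> p \<sigma> \<mu> t) :: _ \<Rightarrow>\<^sub>0 'k)"
 proof (rule sum.reindex_bij_witness[of _ "\<lambda>(\<mu>, t). ({..<p + q} - \<mu>, t)" "\<lambda>(\<mu>, t). ({..<p + q} - \<mu>, t)"])
  fix a assume "a \<in> {(\<mu>, t). ({..<p + q} - \<mu>, t) \<in> straight_pairs q p \<and> \<mu> \<subseteq> {..<p + q}}"
  then obtain \<mu> t where a: "a = (\<mu>, t)" and 1: "({..<p + q} - \<mu>, t) \<in> straight_pairs q p" and 2: "\<mu> \<subseteq> {..<p + q}"
   by auto
  then show "(case case a of (\<mu>, t) => ({..<p + q} - \<mu>, t) of (\<mu>, t) => ({..<p + q} - \<mu>, t)) = a"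
   "(case a of (\<mu>, t) => ({..<p + q} - \<mu>, t)) \<in> straight_pairs q p" by (auto simp: a)
  have "{..<p + q} - ({..<p + q} - \<mu>) \<in> shuffle_sets p q"
   using complement_shuffle_sets[of "{..<p + q} - \<mu>" q p] 1 by (auto simp: straight_pairs_def add.commute)
  moreover have "{..<p + q} - ({..<p + q} - \<mu>) = \<mu>" using 2 by auto
  ultimately have "\<mu> \<in> shuffle_sets p q" by simp
  then show "(case case a of (\<mu>, t) => ({..<p + q} - \<mu>, t) of
     (\<mu>, t) => sgn_pow (p * q) (face_term Y X Z ?m q \<tau> p \<sigma> \<mu> t)) =
    ((case a of (\<mu>, t) => face_term X Y Z m p \<sigma> q \<tau> \<mu> t) :: _ \<Rightarrow>\<^sub>0 'k)"
   using face_term_flip[of \<mu> p q X Y Z m \<sigma> \<tau> t, where 'k = 'k] by (simp add: a)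
 next
  fix b assume "b \<in> straight_pairs q p"
  then obtain \<mu> t where b: "b = (\<mu>, t)" and 1: "(\<mu>, t) \<in> straight_pairs q p" by (cases b) auto
  have "\<mu> \<subseteq> {..<p + q}" using 1 shuffle_setsD(1)[of \<mu> q p] by (auto simp: straight_pairs_def add.commute)
  then have dd: "{..<p + q} - ({..<p + q} - \<mu>) = \<mu>" by auto
  show "(case case b of (\<mu>, t) => ({..<p + q} - \<mu>, t) of (\<mu>, t) => ({..<p + q} - \<mu>, t)) = b"
   by (simp add: b dd)
  show "(case b of (\<mu>, t) => ({..<p + q} - \<mu>, t))
    \<in> {(\<mu>, t). ({..<p + q} - \<mu>, t) \<in> straight_pairs q p \<and> \<mu> \<subseteq> {..<p + q}}"
   using 1 by (auto simp: b dd)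
 qed
 also have "\<dots> = sgn_pow (p * q) (\<Sum>(\<mu>, t)\<in>straight_pairs q p. face_term Y X Z ?m q \<tau> p \<sigma> \<mu> t)"
  by (simp add: sgn_pow_sum case_prod_unfold)
 also have "\<dots> = sgn_pow (p * q) (lin (\<lambda>s. shuffle Y X Z ?m s (p, \<sigma>)) (chain_boundary Y (q, \<tau>)))"
  using sum_straight[OF pairing_flip[OF P] \<tau> \<sigma>, where 'k = 'k] pq by (simp add: add.commute)
 also have "\<dots> = sgn_pow (p * q) (lin (\<lambda>s. sgn_pow (p * (q - 1)) (shuffle X Y Z m (p, \<sigma>) s)) (chain_boundary Y (q, \<tau>)))"
 proof (rule arg_cong[of _ _ "sgn_pow (p * q)"], rule lin_cong)
  fix s assume "s \<in> keys (chain_boundary Y (q, \<tau>) :: _ \<Rightarrow>\<^sub>0 'k)"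
  then obtain \<rho> where s: "s = (q - 1, \<rho>)" using keys_chain_boundary[of Y q \<tau>] by fastforce
  show "shuffle Y X Z ?m s (p, \<sigma>) = (sgn_pow (p * (q - 1)) (shuffle X Y Z m (p, \<sigma>) s) :: _ \<Rightarrow>\<^sub>0 'k)"
   unfolding s by (rule shuffle_flip)
 qed
 also have "\<dots> = sgn_pow p (lin (shuffle X Y Z m (p, \<sigma>)) (chain_boundary Y (q, \<tau>)))"
 proof (cases q)
  case (Suc q')
  have "even (p * q + p * (q - 1) + p)"
   by (cases "even p"; cases "even q'") (simp_all add: Suc)
  then show ?thesis unfolding lin_sgn_pow_fun sgn_pow_sgn_pow by (rule sgn_pow_cong)
 qed simp
 finally show ?thesis .
qed

text \<open>The vertices of a path at which it is straight give the two terms of the Leibniz rule, and its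
 corners cancel.\<close>

lemma shuffle_boundary:
 assumes P: "pairing X Y Z m" and \<sigma>: "\<sigma> \<in> spx X p" and \<tau>: "\<tau> \<in> spx Y q"
 shows "lin (chain_boundary Z) (shuffle X Y Z m (p, \<sigma>) (q, \<tau>))
  = lin (\<lambda>s. shuffle X Y Z m s (q, \<tau>)) (chain_boundary X (p, \<sigma>))
   + (sgn_pow p (lin (shuffle X Y Z m (p, \<sigma>)) (chain_boundary Y (q, \<tau>))) :: _ \<Rightarrow>\<^sub>0 'k::{comm_ring,comm_monoid_mult})"
proof (cases "p + q")
 case 0
 have "lin (chain_boundary Z) (nchain Z (0, z)) = (0 :: _ \<Rightarrow>\<^sub>0 'k)" for z by (simp add: nchain_def)
 then show ?thesis using 0 by (simp add: shuffle_def lin_sum lin_sgn_pow)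
next
 case (Suc n')
 have S: "simplicial_set Z" using P by (simp add: pairing_def)
 have bd: "lin (chain_boundary Z) (sgn_pow s (nchain Z (p + q, z)))
   = (\<Sum>t\<le>p + q. sgn_pow (t + s) (nchain Z (n', sface Z n' t z)) :: _ \<Rightarrow>\<^sub>0 'k)" if "z \<in> spx Z (p + q)" for s z
  unfolding lin_sgn_pow lin_boundary_nchain[OF S that] unfolding Suc
  by (simp add: sgn_pow_sum sgn_pow_sgn_pow add.commute del: sum.atMost_Suc)
 have "lin (chain_boundary Z) (shuffle X Y Z m (p, \<sigma>) (q, \<tau>))
   = (\<Sum>\<mu>\<in>shuffle_sets p q. \<Sum>t\<le>p + q. face_term X Y Z m p \<sigma> q \<tau> \<mu> t :: _ \<Rightarrow>\<^sub>0 'k)"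
  unfolding shuffle_def case_prod_conv lin_sum
 proof (rule sum.cong[OF HOL.refl])
  fix \<mu> assume \<mu>: "\<mu> \<in> shuffle_sets p q"
  note D = shuffle_setsD[OF \<mu>]
  let ?z = "pair_simplex X Y m (p + q) p (count_op (p + q) \<mu>) \<sigma> q (count_op (p + q) ({..<p + q} - \<mu>)) \<tau>"
  have cf: "coface n' t \<in> mono_maps n' (p + q)" for t using coface_mono[of n' t] Suc by simp
  have "sface Z n' t ?z = pair_simplex X Y m n' p (compose {..n'} (count_op (p + q) \<mu>) (coface n' t)) \<sigma>
    q (compose {..n'} (count_op (p + q) ({..<p + q} - \<mu>)) (coface n' t)) \<tau>" for t
   unfolding sface_def using act_pair_simplex[OF P cf D(5,6) \<sigma> \<tau>] Suc by simp
  then show "lin (chain_boundary Z) (sgn_pow (shuffle_sign \<mu> ({..<p + q} - \<mu>)) (nchain Z (p + q, ?z)))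
    = (\<Sum>t\<le>p + q. face_term X Y Z m p \<sigma> q \<tau> \<mu> t :: _ \<Rightarrow>\<^sub>0 'k)"
   by (subst bd[OF pair_simplex_closed[OF P D(5,6) \<sigma> \<tau>]], intro sum.cong HOL.refl)
    (simp only: face_term_def Let_def Suc diff_Suc_1)
 qed
 also have "\<dots> = (\<Sum>(\<mu>, t)\<in>shuffle_sets p q \<times> {..p + q}. face_term X Y Z m p \<sigma> q \<tau> \<mu> t)"
  by (rule sum.cartesian_product)
 also have "shuffle_sets p q \<times> {..p + q} = straight_pairs p q
    \<union> {(\<mu>, t). ({..<p + q} - \<mu>, t) \<in> straight_pairs q p \<and> \<mu> \<subseteq> {..<p + q}}
    \<union> (turn_pairs True p q \<union> turn_pairs False p q)" (is "_ = ?A \<union> ?B \<union> (?C \<union> ?D)")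
 proof (intro equalityI subsetI)
  fix a assume "a \<in> shuffle_sets p q \<times> {..p + q}"
  then obtain \<mu> t where a: "a = (\<mu>, t)" "\<mu> \<in> shuffle_sets p q" "t \<le> p + q" by auto
  then show "a \<in> ?A \<union> ?B \<union> (?C \<union> ?D)"
   using complement_shuffle_sets[OF a(2)] shuffle_setsD(1)[OF a(2)]
   by (cases "t = 0 \<or> t = p + q") (auto simp: straight_pairs_def straight_def turn_pairs_def add.commute)
 next
  fix a assume a: "a \<in> ?A \<union> ?B \<union> (?C \<union> ?D)"
  have "\<mu> \<in> shuffle_sets p q" if "{..<p + q} - \<mu> \<in> shuffle_sets q p" "\<mu> \<subseteq> {..<p + q}" for \<mu>
   using complement_shuffle_sets[OF that(1)] that(2) by (simp add: add.commute double_diff)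
  then show "a \<in> shuffle_sets p q \<times> {..p + q}"
   using a by (auto simp: straight_pairs_def turn_pairs_def add.commute)
 qed
 also have "(\<Sum>(\<mu>, t)\<in>?A \<union> ?B \<union> (?C \<union> ?D). face_term X Y Z m p \<sigma> q \<tau> \<mu> t)
   = (\<Sum>(\<mu>, t)\<in>?A. face_term X Y Z m p \<sigma> q \<tau> \<mu> t) + (\<Sum>(\<mu>, t)\<in>?B. face_term X Y Z m p \<sigma> q \<tau> \<mu> t)
    + ((\<Sum>(\<mu>, t)\<in>?C. face_term X Y Z m p \<sigma> q \<tau> \<mu> t) + (\<Sum>(\<mu>, t)\<in>?D. face_term X Y Z m p \<sigma> q \<tau> \<mu> t) :: _ \<Rightarrow>\<^sub>0 'k)"
 proof -
  have fB: "finite ?B"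
   by (rule finite_subset[of _ "Pow {..<p + q} \<times> {..p + q}"]) (auto simp: straight_pairs_def)
  have 1: "?A \<inter> ?B = {}" using Suc by (auto simp: straight_pairs_def straight_def)
  have 2: "(?A \<union> ?B) \<inter> (?C \<union> ?D) = {}"
   by (auto simp: straight_pairs_def straight_def turn_pairs_def split: if_splits)
  have 3: "?C \<inter> ?D = {}" by (auto simp: turn_pairs_def)
  show ?thesis
   by (subst sum.union_disjoint[OF _ _ 2], simp_all add: fB finite_straight_pairs finite_turn_pairs)
    (simp add: sum.union_disjoint[OF _ _ 1] sum.union_disjoint[OF _ _ 3] fB finite_straight_pairs finite_turn_pairs)
 qed
 also have "(\<Sum>(\<mu>, t)\<in>?C. face_term X Y Z m p \<sigma> q \<tau> \<mu> t) + (\<Sum>(\<mu>, t)\<in>?D. face_term X Y Z m p \<sigma> q \<tau> \<mu> t) = (0 :: _ \<Rightarrow>\<^sub>0 'k)"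
  unfolding sum_turns by simp
 finally show ?thesis using sum_straight[OF P \<sigma> \<tau>, where 'k = 'k] sum_straight_complement[OF P \<sigma> \<tau>, where 'k = 'k] Suc
  by simp
qed

section \<open>The algebra of chains of a simplicial monoid\<close>

definition const_op :: "nat => nat => nat" where
 "const_op n = (\<lambda>t\<in>{..n}. 0)"

lemma const_op_mono: "const_op n \<in> mono_maps n 0"
 unfolding const_op_def by (rule mono_maps_restrict) auto

locale simplicial_monoid =
 fixes M :: "'x sset" and m :: "nat => 'x => 'x => 'x" and e :: 'x
 assumes mult: "pairing M M M m"
  and assoc: "[|x \<in> spx M n; y \<in> spx M n; z \<in> spx M n|] ==> m n (m n x y) z = m n x (m n y z)"
  and unit: "e \<in> spx M 0"
  and unit_left: "x \<in> spx M n ==> m n (sact M n 0 (const_op n) e) x = x"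
  and unit_right: "x \<in> spx M n ==> m n x (sact M n 0 (const_op n) e) = x"

definition gr_chains :: "'x sset => int => (nat \<times> 'x \<Rightarrow>\<^sub>0 'k::zero) set" where
 "gr_chains M i = {p. keys p \<subseteq> {(n, \<sigma>) \<in> nondegenerate M. int n = i}}"

definition chain_dga :: "'x sset => (nat => 'x => 'x => 'x) => 'x
  => ('k::{comm_ring,comm_monoid_mult}, nat \<times> 'x \<Rightarrow>\<^sub>0 'k) dg_alg" where
 "chain_dga M m e = \<lparr> Gr = gr_chains M, Zero = 0, Add = (+), Scale = scale, One = nchain M (0, e),
   Mul = bilin (shuffle M M M m), Dif = lin (chain_boundary M) \<rparr>"

lemma endo_dga_eq: "endo_dga C x = chain_dga (Map C x x) (\<lambda>n. scomp C n x x x) (sid C x)"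
 by (simp add: endo_dga_def chain_dga_def gr_chains_def[abs_def] shuffle_comp_eq_shuffle)

lemma nondegenerate_spx: "(n, \<sigma>) \<in> nondegenerate S ==> \<sigma> \<in> spx S n"
 by (simp add: nondegenerate_def)

lemma gr_chainsD:
 assumes "a \<in> gr_chains M i" "(p, \<sigma>) \<in> keys a"
 shows "int p = i" "\<sigma> \<in> spx M p" "(p, \<sigma>) \<in> nondegenerate M"
 using assms by (auto simp: gr_chains_def nondegenerate_def)

lemma gr_nchains: "a \<in> gr_chains M i ==> a \<in> nchains M"
 by (auto simp: gr_chains_def nchains_def)

lemma bilin_eq_lin_right: "bilin f p q = lin (\<lambda>y. lin (\<lambda>x. f x y) p) q"
 unfolding bilin_def by (rule lin_swap)

context simplicial_monoid
begin

lemma simplicial: "simplicial_set M" using mult by (simp add: pairing_def)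

abbreviation sh :: "nat \<times> 'x => nat \<times> 'x => (nat \<times> 'x \<Rightarrow>\<^sub>0 'k::{comm_ring,comm_monoid_mult})" where
 "sh \<equiv> shuffle M M M m"

lemma shuffle_assoc_chains:
 assumes "a \<in> nchains M" "b \<in> nchains M" "c \<in> nchains M"
 shows "bilin sh (bilin sh a b) c = bilin sh a (bilin sh b c :: _ \<Rightarrow>\<^sub>0 'k::{comm_ring,comm_monoid_mult})"
proof -
 have "bilin sh (bilin sh a b) c = lin (\<lambda>x. lin (\<lambda>y. bilin sh (sh x y) c) b) a"
  by (simp only: bilin_def[of _ a b] bilin_lin)
 also have "\<dots> = lin (\<lambda>x. lin (\<lambda>y. lin (\<lambda>z. lin (\<lambda>s. sh s z) (sh x y)) c) b) a"
  by (simp only: bilin_eq_lin_right)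
 also have "\<dots> = lin (\<lambda>x. lin (\<lambda>y. lin (\<lambda>z. lin (sh x) (sh y z)) c) b) a"
 proof (intro lin_cong)
  fix x y z assume "x \<in> keys a" "y \<in> keys b" "z \<in> keys c"
  then show "lin (\<lambda>s. sh s z) (sh x y) = (lin (sh x) (sh y z) :: _ \<Rightarrow>\<^sub>0 'k)"
   using assms shuffle_left_assoc[OF mult, where 'k = 'k] shuffle_right_assoc[OF mult _ _ _ assoc, where 'k = 'k]
   by (cases x; cases y; cases z) (simp add: nchains_keysD)
 qed
 also have "\<dots> = bilin sh a (bilin sh b c)"
  by (simp only: bilin_def lin_lin)
 finally show ?thesis .
qed

lemma shuffle_boundary_chains:
 assumes a: "a \<in> gr_chains M (int p)" and b: "b \<in> nchains M"
 shows "lin (chain_boundary M) (bilin sh a b) = bilin sh (lin (chain_boundary M) a) b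
  + sgn_pow p (bilin sh a (lin (chain_boundary M) b) :: _ \<Rightarrow>\<^sub>0 'k::{comm_ring,comm_monoid_mult})"
proof -
 have "lin (chain_boundary M) (bilin sh a b) = lin (\<lambda>x. lin (\<lambda>y. lin (chain_boundary M) (sh x y)) b) a"
  by (simp only: bilin_def lin_lin)
 also have "\<dots> = lin (\<lambda>x. lin (\<lambda>y. lin (\<lambda>s. sh s y) (chain_boundary M x)
    + sgn_pow p (lin (sh x) (chain_boundary M y))) b) a"
 proof (intro lin_cong)
  fix x y assume x: "x \<in> keys a" and y: "y \<in> keys b"
  obtain p' \<sigma> q \<tau> where [simp]: "x = (p', \<sigma>)" "y = (q, \<tau>)" by (cases x, cases y)
  have "p' = p" "\<sigma> \<in> spx M p" using gr_chainsD[OF a, of p' \<sigma>] x by auto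
  moreover have "\<tau> \<in> spx M q" using nchains_keysD[OF b] y by auto
  ultimately show "lin (chain_boundary M) (sh x y) = (lin (\<lambda>s. sh s y) (chain_boundary M x)
    + sgn_pow p (lin (sh x) (chain_boundary M y)) :: _ \<Rightarrow>\<^sub>0 'k)"
   using shuffle_boundary[OF mult, where 'k = 'k] by simp
 qed
 also have "\<dots> = lin (\<lambda>x. lin (\<lambda>y. lin (\<lambda>s. sh s y) (chain_boundary M x)) b) a
    + sgn_pow p (lin (\<lambda>x. lin (\<lambda>y. lin (sh x) (chain_boundary M y)) b) a)"
  by (simp only: lin_add_fun lin_sgn_pow_fun)
 also have "lin (\<lambda>x. lin (\<lambda>y. lin (\<lambda>s. sh s y) (chain_boundary M x)) b) a
   = (bilin sh (lin (chain_boundary M) a) b :: _ \<Rightarrow>\<^sub>0 'k)"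
  unfolding bilin_lin(1) unfolding bilin_eq_lin_right ..
 also have "lin (\<lambda>x. lin (\<lambda>y. lin (sh x) (chain_boundary M y)) b) a
   = (bilin sh a (lin (chain_boundary M) b) :: _ \<Rightarrow>\<^sub>0 'k)"
  by (simp only: bilin_def lin_lin)
 finally show ?thesis .
qed

lemma nchain_unit: "nchain M (0, e) = gen (0, e)"
 using unit by (simp add: nchain_def nondegenerate_def degenerate_def)

lemma unit_shuffle:
 assumes \<sigma>: "\<sigma> \<in> spx M p"
 shows "sh (0, e) (p, \<sigma>) = nchain M (p, \<sigma>)" "sh (p, \<sigma>) (0, e) = nchain M (p, \<sigma>)"
proof -
 show "sh (0, e) (p, \<sigma>) = nchain M (p, \<sigma>)"
  using unit_left[OF \<sigma>] by (simp add: shuffle_vertex_left[OF \<sigma> simplicial] const_op_def)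
 have "nchain M (p, \<sigma>) = shuffle M M M (\<lambda>n y x. m n x y) (0, e) (p, \<sigma>)"
  using unit_right[OF \<sigma>] by (simp add: shuffle_vertex_left[OF \<sigma> simplicial] const_op_def)
 also have "\<dots> = sh (p, \<sigma>) (0, e)"
  by (simp add: shuffle_flip[of M M M m 0 e p \<sigma>])
 finally show "sh (p, \<sigma>) (0, e) = nchain M (p, \<sigma>)" ..
qed

lemma keys_nchains_eq: "a \<in> nchains M ==> lin (nchain M) a = (a :: _ \<Rightarrow>\<^sub>0 'k::{comm_ring,comm_monoid_mult})"
 using lin_cong[of a "nchain M" gen] by (auto simp: nchains_def nchain_nondegenerate lin_gen_eq subset_eq)

lemma unit_mul:
 assumes c: "c \<in> nchains M"
 shows "bilin sh (gen (0, e)) c = (c :: _ \<Rightarrow>\<^sub>0 'k::{comm_ring,comm_monoid_mult})" "bilin sh c (gen (0, e)) = c"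
proof -
 have "lin (sh (0, e)) c = lin (nchain M) c" "lin (\<lambda>s. sh s (0, e)) c = lin (nchain M) c"
  using nchains_keysD[OF c] by (auto intro!: lin_cong simp: unit_shuffle)
 then show "bilin sh (gen (0, e)) c = c" "bilin sh c (gen (0, e)) = c"
  using keys_nchains_eq[OF c] by simp_all
qed

lemma gr_chains_bilin:
 assumes a: "a \<in> gr_chains M i" and b: "b \<in> gr_chains M j"
 shows "bilin sh a b \<in> gr_chains M (i + j)"
 unfolding gr_chains_def mem_Collect_eq
proof (rule keys_bilin)
 fix x y assume x: "x \<in> keys a" and y: "y \<in> keys b"
 obtain p \<sigma> q \<tau> where [simp]: "x = (p, \<sigma>)" "y = (q, \<tau>)" by (cases x, cases y)
 have "int p = i" "int q = j" using gr_chainsD(1)[OF a] gr_chainsD(1)[OF b] x y by auto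
 then show "keys (sh x y) \<subseteq> {(n, \<sigma>) \<in> nondegenerate M. int n = i + j}"
  using keys_shuffle[of M M M m p \<sigma> q \<tau>] by auto
qed

lemma gr_chains_boundary:
 assumes a: "a \<in> gr_chains M i"
 shows "lin (chain_boundary M) a \<in> gr_chains M (i - 1)"
 unfolding gr_chains_def mem_Collect_eq
proof (rule keys_lin)
 fix x assume x: "x \<in> keys a"
 obtain p \<sigma> where [simp]: "x = (p, \<sigma>)" by (cases x)
 have "int p = i" using gr_chainsD(1)[OF a] x by auto
 then show "keys (chain_boundary M x) \<subseteq> {(n, \<sigma>) \<in> nondegenerate M. int n = i - 1}"
  using keys_chain_boundary[of M p \<sigma>] by auto
qed

lemma boundary_boundary_chains:
 "a \<in> nchains M ==> lin (chain_boundary M) (lin (chain_boundary M) a) = (0 :: _ \<Rightarrow>\<^sub>0 'k::{comm_ring,comm_monoid_mult})"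
proof -
 assume a: "a \<in> nchains M"
 have "lin (\<lambda>x. lin (chain_boundary M) (chain_boundary M x)) a = lin (\<lambda>x. 0 :: _ \<Rightarrow>\<^sub>0 'k) a"
  by (rule lin_cong) (use a chain_boundary_boundary[OF simplicial] nchains_keysD in fastforce)
 then show ?thesis by (simp add: lin_lin)
qed

theorem dga_chain_dga: "dga (chain_dga M m e :: ('k::{comm_ring,comm_monoid_mult}, _) dg_alg)"
proof
 fix i j l :: int and a b c :: "_ \<Rightarrow>\<^sub>0 'k" and r s :: 'k
 let ?A = "chain_dga M m e :: ('k, _) dg_alg"
 note simps = chain_dga_def Neg_def
 show "Zero ?A \<in> Gr ?A i" by (simp add: simps gr_chains_def)
 show "a \<in> Gr ?A i ==> b \<in> Gr ?A i ==> Add ?A a b \<in> Gr ?A i"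
  using keys_add[of a b] by (auto simp: simps gr_chains_def)
 show "a \<in> Gr ?A i ==> Scale ?A r a \<in> Gr ?A i"
  using keys_scale[of r a] by (auto simp: simps gr_chains_def)
 show "Add ?A (Add ?A a b) c = Add ?A a (Add ?A b c)" by (simp add: simps add.assoc)
 show "Add ?A a b = Add ?A b a" by (simp add: simps add.commute)
 show "Add ?A (Zero ?A) a = a" by (simp add: simps)
 show "Add ?A a (Neg ?A a) = Zero ?A" by (simp add: simps)
 show "Scale ?A r (Add ?A a b) = Add ?A (Scale ?A r a) (Scale ?A r b)" by (simp add: simps scale_add)
 show "Scale ?A (r + s) a = Add ?A (Scale ?A r a) (Scale ?A s a)" by (simp add: simps add_scale)
 show "Scale ?A (r * s) a = Scale ?A r (Scale ?A s a)" by (simp add: simps scale_scale)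
 show "Scale ?A 1 a = a" by (simp add: simps)
 show "a \<in> Gr ?A i ==> b \<in> Gr ?A j ==> Mul ?A a b \<in> Gr ?A (i + j)"
  by (simp add: simps gr_chains_bilin)
 show "Mul ?A (Add ?A a b) c = Add ?A (Mul ?A a c) (Mul ?A b c)" by (simp add: simps bilin_add)
 show "Mul ?A a (Add ?A b c) = Add ?A (Mul ?A a b) (Mul ?A a c)" by (simp add: simps bilin_add)
 show "Mul ?A (Scale ?A r a) b = Scale ?A r (Mul ?A a b)" by (simp add: simps bilin_scale)
 show "Mul ?A a (Scale ?A r b) = Scale ?A r (Mul ?A a b)" by (simp add: simps bilin_scale)
 show "a \<in> Gr ?A i ==> b \<in> Gr ?A j ==> c \<in> Gr ?A l ==> Mul ?A (Mul ?A a b) c = Mul ?A a (Mul ?A b c)"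
  by (simp add: simps shuffle_assoc_chains gr_nchains)
 show "One ?A \<in> Gr ?A 0"
  using keys_nchain[of M "(0, e)"] by (auto simp: simps gr_chains_def)
 show "a \<in> Gr ?A i ==> Mul ?A (One ?A) a = a" "a \<in> Gr ?A i ==> Mul ?A a (One ?A) = a"
  by (simp_all add: simps nchain_unit unit_mul gr_nchains del: bilin_gen_left bilin_gen_right)
 show "a \<in> Gr ?A i ==> Dif ?A a \<in> Gr ?A (i - 1)" by (simp add: simps gr_chains_boundary)
 show "Dif ?A (Add ?A a b) = Add ?A (Dif ?A a) (Dif ?A b)" by (simp add: simps lin_add)
 show "Dif ?A (Scale ?A r a) = Scale ?A r (Dif ?A a)" by (simp add: simps lin_scale)
 show "a \<in> Gr ?A i ==> Dif ?A (Dif ?A a) = Zero ?A"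
  by (simp add: simps boundary_boundary_chains gr_nchains)
 show "Dif ?A (Mul ?A a b) = Add ?A (Mul ?A (Dif ?A a) b)
     (if even i then Mul ?A a (Dif ?A b) else Neg ?A (Mul ?A a (Dif ?A b)))"
  if a: "a \<in> Gr ?A i" and b: "b \<in> Gr ?A j"
 proof (cases "i < 0")
  case True
  then have "keys a = {}" using a by (auto simp: simps gr_chains_def)
  then have "a = 0" by simp
  then show ?thesis by (simp add: simps)
 next
  case False
  then obtain p where p: "i = int p" by (metis nonneg_int_cases not_less)
  show ?thesis
   using shuffle_boundary_chains[of a p b] a b by (auto simp: simps gr_nchains p sgn_pow_def)
 qed
qed

end

lemma dga_hom_push:
 assumes M: "simplicial_monoid M m e" and M': "simplicial_monoid M' m' e'"
  and f: "simplicial_on M M' f"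
  and fm: "\<And>n x y. [|x \<in> spx M n; y \<in> spx M n|] ==> f n (m n x y) = m' n (f n x) (f n y)"
  and fe: "f 0 e = e'"
 shows "dga_hom (chain_dga M m e) (chain_dga M' m' e' :: ('k::{comm_ring,comm_monoid_mult}, _) dg_alg) (push M' f)"
proof -
 interpret M: simplicial_monoid M m e by fact
 interpret M': simplicial_monoid M' m' e' by fact
 have "push M' f a \<in> gr_chains M' i" if a: "a \<in> gr_chains M i" for i and a :: "_ \<Rightarrow>\<^sub>0 'k"
  unfolding gr_chains_def mem_Collect_eq push_def
 proof (rule keys_lin, clarify)
  fix n \<sigma> k \<tau> assume "(n, \<sigma>) \<in> keys a" "(k, \<tau>) \<in> keys (nchain M' (n, f n \<sigma>) :: _ \<Rightarrow>\<^sub>0 'k)"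
  then show "(k, \<tau>) \<in> nondegenerate M' \<and> int k = i"
   using gr_chainsD(1)[OF a] keys_nchain[of M' "(n, f n \<sigma>)"] by auto
 qed
 moreover have "push M' f (nchain M (0, e)) = (nchain M' (0, e') :: _ \<Rightarrow>\<^sub>0 'k)"
  using push_nchain[OF f M.unit] fe by simp
 moreover have "push M' f (bilin (shuffle M M M m) a b)
   = (bilin (shuffle M' M' M' m') (push M' f a) (push M' f b) :: _ \<Rightarrow>\<^sub>0 'k)"
  if "a \<in> nchains M" "b \<in> nchains M" for a b
  by (rule shuffle_natural_chain[OF M.mult M'.mult f f f fm that])
 moreover have "push M' f (lin (chain_boundary M) a) = (lin (chain_boundary M') (push M' f a) :: _ \<Rightarrow>\<^sub>0 'k)"
  if "a \<in> nchains M" for a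
  by (rule push_boundary_chain[OF M.simplicial M'.simplicial f that])
 ultimately show ?thesis
  by (auto simp: dga_hom_def chain_dga_def gr_nchains push_def lin_add lin_scale)
qed

section \<open>Quasi-isomorphisms and copies of functors\<close>

context dga
begin

lemma add_zero_right: "a \<in> Gr A i ==> Add A a (Zero A) = a"
 using add_zero add_commute zero_closed by metis

lemma neg_closed: "a \<in> Gr A i ==> Neg A a \<in> Gr A i"
 by (simp add: Neg_def scale_closed)

lemma add_neg_cancel: "[|a \<in> Gr A i; b \<in> Gr A i|] ==> Add A (Add A a b) (Neg A b) = a"
 by (simp add: add_assoc neg_closed add_neg add_zero_right)

lemma neg_add_cancel: "[|a \<in> Gr A i; b \<in> Gr A i|] ==> Add A (Add A a (Neg A b)) b = a"
 using add_assoc[of a i "Neg A b" b] add_commute[of "Neg A b" i b]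
 by (simp add: neg_closed add_neg add_zero_right)

lemma dif_zero: "Dif A (Zero A) = Zero A"
proof -
 have z: "Zero A \<in> Gr A 0" "Dif A (Zero A) \<in> Gr A (0 - 1)"
  by (rule zero_closed, rule dif_closed, rule zero_closed)
 have "Add A (Dif A (Zero A)) (Dif A (Zero A)) = Dif A (Zero A)"
  using dif_add[OF z(1) z(1)] add_zero[OF z(1)] by simp
 then show ?thesis using add_neg_cancel[OF z(2) z(2)] add_neg[OF z(2)] by simp
qed

lemma dif_neg: "a \<in> Gr A i ==> Dif A (Neg A a) = Neg A (Dif A a)"
 by (simp add: Neg_def dif_scale)

lemma cyclesD: "z \<in> cycles A i ==> z \<in> Gr A i" "z \<in> cycles A i ==> Dif A z = Zero A"
 by (auto simp: cycles_def)

lemma dif_closed': "b \<in> Gr A (i + 1) ==> Dif A b \<in> Gr A i"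
 using dif_closed[of b "i + 1"] by simp

lemma cycles_add: "[|z \<in> cycles A i; w \<in> cycles A i|] ==> Add A z w \<in> cycles A i"
 using add_zero[OF zero_closed] by (auto simp: cycles_def add_closed dif_add)

lemma cycles_neg: "z \<in> cycles A i ==> Neg A z \<in> cycles A i"
proof -
 have "Neg A (Zero A) = Zero A" using add_neg[OF zero_closed] add_zero[OF neg_closed[OF zero_closed]] by simp
 then show "z \<in> cycles A i ==> Neg A z \<in> cycles A i" by (auto simp: cycles_def neg_closed dif_neg)
qed

lemma equiv_homologous: "equiv (cycles A i) (homologous A i)"
proof (rule equivI)
 show "homologous A i \<subseteq> cycles A i \<times> cycles A i" by (auto simp: homologous_def)
 show "refl_on (cycles A i) (homologous A i)"
 proof (rule refl_onI)
  fix z assume z: "z \<in> cycles A i"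
  then have "z = Add A z (Dif A (Zero A))" using add_zero_right cyclesD dif_zero by metis
  then show "(z, z) \<in> homologous A i" using z zero_closed by (auto simp: homologous_def)
 qed
 show "sym (homologous A i)"
 proof (rule symI)
  fix z w assume "(z, w) \<in> homologous A i"
  then obtain b where *: "z \<in> cycles A i" "w \<in> cycles A i" "b \<in> Gr A (i + 1)" "w = Add A z (Dif A b)"
   by (auto simp: homologous_def)
  then have "z = Add A w (Dif A (Neg A b))"
   using add_neg_cancel[OF cyclesD(1) dif_closed'] by (simp add: dif_neg)
  then show "(w, z) \<in> homologous A i" using * neg_closed by (auto simp: homologous_def)
 qed
 show "trans (homologous A i)"
 proof (rule transI)
  fix z w v assume "(z, w) \<in> homologous A i" "(w, v) \<in> homologous A i"
  then obtain b b' where *: "z \<in> cycles A i" "v \<in> cycles A i" "b \<in> Gr A (i + 1)" "b' \<in> Gr A (i + 1)"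
    "v = Add A (Add A z (Dif A b)) (Dif A b')"
   by (auto simp: homologous_def)
  then have "v = Add A z (Dif A (Add A b b'))"
   using add_assoc[OF cyclesD(1) dif_closed' dif_closed'] by (simp add: dif_add)
  then show "(z, v) \<in> homologous A i" using * add_closed by (auto simp: homologous_def)
 qed
qed

end

text \<open>The element-wise form of \<^const>\<open>quasi_iso\<close>.\<close>

definition homology_iso :: "('k, 'a) dg_alg => ('k, 'b) dg_alg => ('a => 'b) => bool" where
 "homology_iso A B \<phi> \<longleftrightarrow>
   (\<forall>i. \<forall>z\<in>cycles A i. (\<exists>b\<in>Gr B (i + 1). \<phi> z = Dif B b) \<longrightarrow> (\<exists>a\<in>Gr A (i + 1). z = Dif A a)) \<and>
   (\<forall>i. \<forall>w\<in>cycles B i. \<exists>z\<in>cycles A i. \<exists>b\<in>Gr B (i + 1). w = Add B (\<phi> z) (Dif B b))"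

lemma quasi_isoI:
 fixes A :: "('k::{comm_ring,comm_monoid_mult}, 'a) dg_alg" and B :: "('k, 'b) dg_alg"
 assumes A: "dga A" and B: "dga B" and hom: "dga_hom A B \<phi>" and iso: "homology_iso A B \<phi>"
 shows "quasi_iso A B \<phi>"
 unfolding quasi_iso_def
proof (intro conjI allI)
 interpret A: dga A by fact
 interpret B: dga B by fact
 note hD = hom[unfolded dga_hom_def]
 fix i
 let ?RA = "homologous A i" and ?RB = "homologous B i"
 note EA = A.equiv_homologous[of i] and EB = B.equiv_homologous[of i]
 have pz: "\<phi> (Zero A) = Zero B"
 proof -
  have z: "\<phi> (Zero A) \<in> Gr B 0" "Zero A \<in> Gr A 0" using hD A.zero_closed by auto
  have "\<phi> (Zero A) = Add B (\<phi> (Zero A)) (\<phi> (Zero A))" using hD z A.add_zero[OF z(2)] by metis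
  then show ?thesis using B.add_neg_cancel[OF z(1) z(1)] B.add_neg[OF z(1)] by simp
 qed
 have cyc: "\<phi> z \<in> cycles B i" if "z \<in> cycles A i" for z
  using that hD pz by (auto simp: cycles_def) metis
 have rel: "(\<phi> z, \<phi> w) \<in> ?RB" if zw: "(z, w) \<in> ?RA" for z w
 proof -
  obtain b where *: "z \<in> cycles A i" "w \<in> cycles A i" "b \<in> Gr A (i + 1)" "w = Add A z (Dif A b)"
   using zw by (auto simp: homologous_def)
  have eq: "\<phi> w = Add B (\<phi> z) (Dif B (\<phi> b))"
   using * hD A.cyclesD(1)[OF *(1)] A.dif_closed'[OF *(3)] by simp
  show ?thesis unfolding homologous_def mem_Collect_eq case_prod_conv
   using cyc[OF *(1)] cyc[OF *(2)] eq hD *(3) by blast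
 qed
 have img: "?RB `` (\<phi> ` (?RA `` {z})) = ?RB `` {\<phi> z}" if z: "z \<in> cycles A i" for z
 proof (intro equalityI subsetI)
  fix w assume "w \<in> ?RB `` (\<phi> ` (?RA `` {z}))"
  then obtain v where "(z, v) \<in> ?RA" "(\<phi> v, w) \<in> ?RB" by auto
  then show "w \<in> ?RB `` {\<phi> z}" using rel EB by (meson Image_singleton_iff equivE transD)
 next
  fix w assume "w \<in> ?RB `` {\<phi> z}"
  moreover have "(z, z) \<in> ?RA" using z EA by (meson equivE refl_onD)
  ultimately show "w \<in> ?RB `` (\<phi> ` (?RA `` {z}))" by blast
 qed
 have inj: "(z, w) \<in> ?RA" if z: "z \<in> cycles A i" and w: "w \<in> cycles A i" and zw: "(\<phi> z, \<phi> w) \<in> ?RB" for z w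
 proof -
  obtain b where b: "b \<in> Gr B (i + 1)" "\<phi> w = Add B (\<phi> z) (Dif B b)" using zw by (auto simp: homologous_def)
  define d where "d = Add A w (Neg A z)"
  have d: "d \<in> cycles A i" unfolding d_def by (intro A.cycles_add A.cycles_neg z w)
  have n: "\<phi> (Neg A z) = Neg B (\<phi> z)" using hD A.cyclesD(1)[OF z] by (simp add: Neg_def)
  have gz: "\<phi> z \<in> Gr B i" "Dif B b \<in> Gr B i" using cyc[OF z] B.cyclesD(1) B.dif_closed'[OF b(1)] by auto
  have "\<phi> d = Add B (\<phi> w) (Neg B (\<phi> z))"
   unfolding d_def using hD A.cyclesD(1)[OF z] A.cyclesD(1)[OF w] A.neg_closed n by metis
  also have "\<dots> = Dif B b" unfolding b(2) B.add_commute[OF gz] by (rule B.add_neg_cancel[OF gz(2,1)])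
  finally obtain a where a: "a \<in> Gr A (i + 1)" "d = Dif A a"
   using iso d b(1) unfolding homology_iso_def by metis
  have "w = Add A d z" unfolding d_def using A.neg_add_cancel A.cyclesD(1) z w by metis
  also have "\<dots> = Add A z (Dif A a)" using A.add_commute A.cyclesD(1)[OF d] A.cyclesD(1)[OF z] a(2) by metis
  finally show ?thesis using z w a(1) by (auto simp: homologous_def)
 qed
 show "bij_betw (\<lambda>c. ?RB `` (\<phi> ` c)) (homology A i) (homology B i)"
  unfolding bij_betw_def homology_def
 proof (intro conjI inj_onI)
  fix c d assume "c \<in> cycles A i // ?RA" "d \<in> cycles A i // ?RA"
   and eq: "?RB `` (\<phi> ` c) = ?RB `` (\<phi> ` d)"
  then obtain z w where *: "z \<in> cycles A i" "w \<in> cycles A i" "c = ?RA `` {z}" "d = ?RA `` {w}"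
   by (auto elim!: quotientE)
  then have "(\<phi> z, \<phi> w) \<in> ?RB" using eq img cyc EB by (metis eq_equiv_class)
  then show "c = d" using inj * EA by (metis equiv_class_eq)
 next
  show "(\<lambda>c. ?RB `` (\<phi> ` c)) ` (cycles A i // ?RA) = cycles B i // ?RB"
  proof (intro equalityI subsetI)
  fix c assume "c \<in> (\<lambda>c. ?RB `` (\<phi> ` c)) ` (cycles A i // ?RA)"
  then obtain z where "z \<in> cycles A i" "c = ?RB `` {\<phi> z}" using img by (auto elim!: quotientE)
  then show "c \<in> cycles B i // ?RB" using quotientI[OF cyc, of z ?RB] by simp
 next
  fix c assume "c \<in> cycles B i // ?RB"
  then obtain w where w: "w \<in> cycles B i" "c = ?RB `` {w}" by (auto elim!: quotientE)
  then obtain z b where z: "z \<in> cycles A i" "b \<in> Gr B (i + 1)" "w = Add B (\<phi> z) (Dif B b)"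
   using iso unfolding homology_iso_def by blast
  have "(\<phi> z, w) \<in> ?RB" using z w cyc by (auto simp: homologous_def)
  then have "c = ?RB `` (\<phi> ` (?RA `` {z}))" using img[OF z(1)] w(2) EB by (metis equiv_class_eq)
  then show "c \<in> (\<lambda>c. ?RB `` (\<phi> ` c)) ` (cycles A i // ?RA)" using z(1) by (auto intro: quotientI)
  qed
 qed
qed (rule hom)

text \<open>The functors of a zig-zag take values in a prescribed type, into which the given ones are carried
 by injections.\<close>

definition copy_dga :: "('b => 'c) => ('k, 'b) dg_alg => ('k, 'c) dg_alg" where
 "copy_dga \<iota> A = \<lparr> Gr = (\<lambda>i. \<iota> ` Gr A i), Zero = \<iota> (Zero A),
   Add = (\<lambda>x y. \<iota> (Add A (inv \<iota> x) (inv \<iota> y))), Scale = (\<lambda>r x. \<iota> (Scale A r (inv \<iota> x))),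
   One = \<iota> (One A), Mul = (\<lambda>x y. \<iota> (Mul A (inv \<iota> x) (inv \<iota> y))), Dif = (\<lambda>x. \<iota> (Dif A (inv \<iota> x))) \<rparr>"

definition copy_functor ::
 "('b => 'c) => ('s, 'k, 'b) dga_functor => ('s, 'k, 'c) dga_functor" where
 "copy_functor \<iota> F = \<lparr> Fob = (\<lambda>S. copy_dga \<iota> (Fob F S)), Fmap = (\<lambda>S T f x. \<iota> (Fmap F S T f (inv \<iota> x))) \<rparr>"

lemma dga_copy:
 fixes A :: "('k::{comm_ring,comm_monoid_mult}, 'b) dg_alg"
 assumes \<iota>: "inj \<iota>" and A: "dga A"
 shows "dga (copy_dga \<iota> A)"
proof -
 interpret dga A by fact
 show ?thesis
  by unfold_locales
   (auto simp: Neg_def copy_dga_def inv_f_f[OF \<iota>] inj_eq[OF \<iota>] zero_closed add_closed scale_closed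
    add_assoc add_zero add_neg[unfolded Neg_def] scale_add add_scale scale_scale scale_one mul_closed
    mul_add_left mul_add_right mul_scale_left mul_scale_right mul_assoc one_closed one_mul mul_one
    dif_closed dif_add dif_scale dif_dif dif_mul[unfolded Neg_def] intro: add_commute)
qed

lemma dga_hom_copy:
 "[|inj \<iota>; dga_hom A B \<phi>|] ==> dga_hom A (copy_dga \<iota> B) (\<lambda>x. \<iota> (\<phi> x))"
 "[|inj \<kappa>; dga_hom C D \<psi>|] ==> dga_hom (copy_dga \<kappa> C) (copy_dga \<kappa> D) (\<lambda>x. \<kappa> (\<psi> (inv \<kappa> x)))"
 by (auto simp: dga_hom_def copy_dga_def)

lemma homology_iso_copy:
 "[|inj \<iota>; homology_iso A B \<phi>|] ==> homology_iso A (copy_dga \<iota> B) (\<lambda>x. \<iota> (\<phi> x))"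
 unfolding homology_iso_def
 by (simp add: cycles_def copy_dga_def inj_eq) fastforce

lemma is_dga_functor_copy:
 fixes F :: "('s, 'k::{comm_ring,comm_monoid_mult}, 'b) dga_functor" and \<iota> :: "'b => 'c"
 assumes \<iota>: "inj \<iota>" and F: "is_dga_functor F"
 shows "is_dga_functor (copy_functor \<iota> F)"
proof -
 have "Gr (copy_dga \<iota> A) i = \<iota> ` Gr A i" for A :: "('k, 'b) dg_alg" and i by (simp add: copy_dga_def)
 then show ?thesis
  using F \<iota> unfolding is_dga_functor_def copy_functor_def
  by (auto simp: dga_copy dga_hom_copy)
qed

lemma homology_iso_id: "dga B ==> homology_iso B B (\<lambda>x. x)"
 unfolding homology_iso_def using dga.add_zero_right dga.dif_zero dga.zero_closed dga.cyclesD(1) by metis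

lemma dga_hom_id: "dga_hom B B (\<lambda>x. x)"
 by (simp add: dga_hom_def)

text \<open>A natural map inducing bijections on homology is a zig-zag of length one; only a copy of its
 target in the required type is to be inserted.\<close>

theorem naturally_weakly_equivalentI:
 fixes F :: "('s, 'k::{comm_ring,comm_monoid_mult}, 'a) dga_functor"
  and G :: "('s, 'k, 'b) dga_functor"
 assumes F: "is_dga_functor F" and G: "is_dga_functor G"
  and hom: "\<And>S. S \<in> reduced_ssets ==> dga_hom (Fob F S) (Fob G S) (\<eta> S)"
  and iso: "\<And>S. S \<in> reduced_ssets ==> homology_iso (Fob F S) (Fob G S) (\<eta> S)"
  and nat: "\<And>S T f i a. [|S \<in> reduced_ssets; T \<in> reduced_ssets; f \<in> simplicial_maps S T; a \<in> Gr (Fob F S) i|]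
    ==> \<eta> T (Fmap F S T f a) = Fmap G S T f (\<eta> S a)"
  shows "naturally_weakly_equivalent F G"
proof -
 define \<iota> :: "'b => ('a + 'b) set" where "\<iota> b = {Inr b}" for b
 have \<iota>: "inj \<iota>" by (auto simp: \<iota>_def inj_def)
 define Z where "Z = copy_functor \<iota> G"
 have Z: "is_dga_functor Z" unfolding Z_def by (rule is_dga_functor_copy[OF \<iota> G])
 have dF: "dga (Fob F S)" and dG: "dga (Fob G S)" if "S \<in> reduced_ssets" for S
  using F G that by (auto simp: is_dga_functor_def)
 have ob: "Fob Z S = copy_dga \<iota> (Fob G S)" for S by (simp add: Z_def copy_functor_def)
 have "natural_quasi_iso F Z"
  unfolding natural_quasi_iso_def
 proof (intro conjI exI[of _ "\<lambda>S x. \<iota> (\<eta> S x)"] ballI allI)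
  show "quasi_iso (Fob F S) (Fob Z S) (\<lambda>x. \<iota> (\<eta> S x))" if S: "S \<in> reduced_ssets" for S
   unfolding ob
   by (rule quasi_isoI[OF dF[OF S] dga_copy[OF \<iota> dG[OF S]] dga_hom_copy(1)[OF \<iota> hom[OF S]]
      homology_iso_copy[OF \<iota> iso[OF S]]])
 qed (use F Z nat in \<open>auto simp: Z_def copy_functor_def inv_f_f[OF \<iota>]\<close>)
 moreover have "natural_quasi_iso G Z"
  unfolding natural_quasi_iso_def
 proof (intro conjI exI[of _ "\<lambda>S x. \<iota> x"] ballI allI)
  show "quasi_iso (Fob G S) (Fob Z S) (\<lambda>x. \<iota> x)" if S: "S \<in> reduced_ssets" for S
   unfolding ob
   by (rule quasi_isoI[OF dG[OF S] dga_copy[OF \<iota> dG[OF S]] dga_hom_copy(1)[OF \<iota> dga_hom_id]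
      homology_iso_copy[OF \<iota> homology_iso_id[OF dG[OF S]]]])
 qed (use G Z in \<open>auto simp: Z_def copy_functor_def inv_f_f[OF \<iota>]\<close>)
 ultimately show ?thesis
  unfolding naturally_weakly_equivalent_def by (intro exI[of _ "\<lambda>_. Z"] exI[of _ 0]) simp
qed

section \<open>The simplicial monoid of a reduced simplicial set\<close>

type_synonym 's rletter = "(nat \<times> 's, nat, nat => nat set) letter"

definition chains_in :: "nat set set => nat => (nat => nat set) set" where
 "chains_in P r = {U. (\<forall>t\<le>r. U t \<in> P) \<and> (\<forall>s t. s \<le> t \<longrightarrow> t \<le> r \<longrightarrow> U s \<subseteq> U t) \<and> (\<forall>t>r. U t = undefined)}"

lemma spx_nerve: "spx (nerve P) r = chains_in P r"
proof (intro equalityI subsetI)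
 fix U assume "U \<in> spx (nerve P) r"
 then have "U \<in> {..r} \<rightarrow>\<^sub>E P" "mono_on {..r} U" by (auto simp: nerve_def)
 moreover from this(2) have "U s \<subseteq> U t" if "s \<le> t" "t \<le> r" for s t
  by (rule mono_onD) (use that in auto)
 ultimately show "U \<in> chains_in P r"
  unfolding chains_in_def PiE_iff extensional_def by simp
qed (auto simp: nerve_def chains_in_def PiE_iff extensional_def mono_on_def)

lemma sact_nerve: "sact (nerve P) k r \<theta> U = compose {..k} U \<theta>"
 by (simp add: nerve_def)

lemma chains_inD:
 assumes "U \<in> chains_in P r"
 shows "t \<le> r ==> U t \<in> P" "[|s \<le> t; t \<le> r|] ==> U s \<subseteq> U t" "r < t ==> U t = undefined"
 using assms by (auto simp: chains_in_def)

lemma chains_in_restrict: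
 "[|\<And>t. t \<le> r ==> V t \<in> P; \<And>s t. [|s \<le> t; t \<le> r|] ==> V s \<subseteq> V t|] ==> restrict V {..r} \<in> chains_in P r"
 by (auto simp: chains_in_def)

lemma compose_chains_in: "[|U \<in> chains_in P r; \<theta> \<in> mono_maps k r|] ==> compose {..k} U \<theta> \<in> chains_in P k"
 unfolding compose_def by (rule chains_in_restrict) (auto dest: mono_mapsD chains_inD)

lemma chains_in_eqI:
 "[|U \<in> chains_in P r; V \<in> chains_in Q r; \<And>t. t \<le> r ==> U t = V t|] ==> U = V"
 by (metis chains_inD(3) ext not_le_imp_less)

lemma simplicial_set_nerve: "simplicial_set (nerve (P :: nat set set))"
 unfolding simplicial_set_def spx_nerve sact_nerve
proof (intro conjI ballI allI)
 fix n U assume U: "U \<in> chains_in P n"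
 show "compose {..n} U (restrict id {..n}) = U"
  by (rule chains_in_eqI[OF compose_chains_in[OF U id_mono_maps] U]) (simp add: compose_def)
next
 fix l k n \<phi> \<theta> U assume "\<phi> \<in> mono_maps l k"
 then show "compose {..l} (compose {..k} U \<theta>) \<phi> = compose {..l} U (compose {..l} \<theta> \<phi>)"
  by (auto simp: compose_def fun_eq_iff dest: mono_mapsD)
qed (auto intro: compose_chains_in)

lemma cube_posetD:
 assumes "A \<in> cube_poset i j"
 shows "A \<subseteq> {i..j}" "i \<in> A" "j \<in> A" "i \<le> j" "finite A"
 using assms finite_subset[of A "{i..j}"] by (auto simp: cube_poset_def)

lemma rigid_simplex_simps:
 "Ob (rigid_simplex n) = {..n}"
 "Map (rigid_simplex n) a b = nerve (cube_poset a b)"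
 "scomp (rigid_simplex n) r a b c U V = (\<lambda>t\<in>{..r}. U t \<union> V t)"
 "sidn (rigid_simplex n) r a = (\<lambda>t\<in>{..r}. {a})"
 by (simp_all add: rigid_simplex_def sidn_def sact_nerve compose_def cong: restrict_cong)

context
 fixes D and S :: "'s sset"
 defines "D \<equiv> rigid_diagram S"
begin

lemma rigid_diagram_simps:
 "(n, \<sigma>) \<in> Dob D \<longleftrightarrow> \<sigma> \<in> spx S n"
 "Dcat D (n, \<sigma>) = rigid_simplex n"
 "Dobmap D (s, \<theta>, t) = \<theta>"
 "Dmap D (s, \<theta>, t) r a b U = (\<lambda>q\<in>{..r}. \<theta> ` U q)"
 "letter_act D k r \<psi> ((n, \<sigma>), a, b, U) = ((n, \<sigma>), a, b, compose {..k} U \<psi>)"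
 by (simp_all add: D_def rigid_diagram_def rigid_simplex_def sact_nerve letter_act_def)

lemma rigid_diagram_arr:
 "(i, \<theta>, j) \<in> Darr D \<longleftrightarrow> (\<exists>m n \<sigma>. i = (m, sact S m n \<theta> \<sigma>) \<and> j = (n, \<sigma>) \<and> \<theta> \<in> mono_maps m n \<and> \<sigma> \<in> spx S n)"
 by (auto simp: D_def rigid_diagram_def)

end

locale reduced =
 fixes S :: "'s sset" and x :: 's
 assumes S: "simplicial_set S" and S0: "spx S 0 = {x}"
begin

abbreviation "D \<equiv> rigid_diagram S"
abbreviation "X \<equiv> rigid_vertex S x"

text \<open>Each vertex of a simplex is an operator of the unique vertex of \<open>S\<close>, so all objects are identified.\<close>

lemma colim_obj_X:
 assumes \<sigma>: "\<sigma> \<in> spx S n" and i: "i \<le> n"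
 shows "colim_obj D (n, \<sigma>) i = X"
proof -
 define \<theta> where "\<theta> = restrict (\<lambda>t. i) {..0::nat}"
 have \<theta>: "\<theta> \<in> mono_maps 0 n" unfolding \<theta>_def by (rule mono_maps_restrict) (use i in auto)
 have "sact S 0 n \<theta> \<sigma> = x" using act_closed[OF S \<theta> \<sigma>] S0 by simp
 then have "((0, x), \<theta>, (n, \<sigma>)) \<in> Darr D" using \<theta> \<sigma> by (auto simp: rigid_diagram_arr)
 from colim_ob_eq.arrow[OF this, of 0]
 have "colim_ob_eq D ((0, x), 0) ((n, \<sigma>), i)"
  by (simp add: rigid_diagram_simps rigid_simplex_simps \<theta>_def)
 then show ?thesis
  unfolding colim_obj_def rigid_vertex_def
  by (blast intro: colim_ob_eq.sym colim_ob_eq.trans)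
qed

lemma X_in_colim_Ob: "X \<in> colim_Ob D"
proof -
 have "(0, x) \<in> Dob D" "0 \<in> Ob (Dcat D (0, x))" using S0 by (auto simp: rigid_diagram_simps rigid_simplex_simps)
 then show ?thesis unfolding colim_Ob_def rigid_vertex_def by blast
qed

text \<open>Since the colimit has a single object, consecutive letters of a path need not match, and a path is
 a word of valid letters.\<close>

fun valid :: "nat => 's rletter => bool" where
 "valid r ((n, \<sigma>), a, b, U) \<longleftrightarrow> \<sigma> \<in> spx S n \<and> a \<le> n \<and> b \<le> n \<and> U \<in> chains_in (cube_poset a b) r"

declare valid.simps [simp del]

lemma colim_path_iff: "colim_path D r X w X \<longleftrightarrow> (\<forall>l\<in>set w. valid r l)"
proof (induction w)
 case (Cons l w)
 obtain n \<sigma> a b U where l: "l = ((n, \<sigma>), a, b, U)" by (cases l) auto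
 have "colim_path D r X (l # w) X \<longleftrightarrow> valid r l \<and> X = colim_obj D (n, \<sigma>) a \<and> colim_path D r (colim_obj D (n, \<sigma>) b) w X"
  unfolding l colim_path.simps valid.simps rigid_diagram_simps rigid_simplex_simps spx_nerve by simp
 also have "\<dots> \<longleftrightarrow> valid r l \<and> colim_path D r X w X"
 proof (cases "valid r l")
  case True
  then have "colim_obj D (n, \<sigma>) a = X" "colim_obj D (n, \<sigma>) b = X"
   unfolding l valid.simps using colim_obj_X by simp_all
  then show ?thesis by simp
 qed simp
 finally show ?case using Cons by simp
qed (simp add: X_in_colim_Ob)

definition eqv :: "nat => 's rletter list => 's rletter list => bool" where
 "eqv r w w' \<longleftrightarrow> colim_eq D r X X w w'"

lemma eqv_valid: "eqv r w w' ==> (\<forall>l\<in>set w. valid r l) \<and> (\<forall>l\<in>set w'. valid r l)"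
 unfolding eqv_def by (induction rule: colim_eq.induct) (auto simp: colim_path_iff)

lemma eqv_refl: "(\<And>l. l \<in> set w ==> valid r l) ==> eqv r w w"
 unfolding eqv_def by (rule colim_eq.refl) (simp add: colim_path_iff)

lemma eqv_sym: "eqv r w w' ==> eqv r w' w"
 unfolding eqv_def by (rule colim_eq.sym)

lemma eqv_trans [trans]: "[|eqv r u v; eqv r v w|] ==> eqv r u w"
 unfolding eqv_def by (rule colim_eq.trans)

lemma eqv_rule:
 "[|colim_rule D r s t; \<And>l. l \<in> set s ==> valid r l; \<And>l. l \<in> set t ==> valid r l|] ==> eqv r s t"
 unfolding eqv_def using colim_eq.rule[of D r s t X "[]" "[]" X] by (simp add: colim_path_iff)

lemma eqv_context:
 "[|eqv r w w'; \<And>l. l \<in> set u ==> valid r l; \<And>l. l \<in> set v ==> valid r l|] ==> eqv r (u @ w @ v) (u @ w' @ v)"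
 unfolding eqv_def
proof (induction rule: colim_eq.induct)
 case (rule s t u' v')
 then show ?case
  using colim_eq.rule[OF rule(1), of X "u @ u'" "v' @ v" X] by (simp add: colim_path_iff ball_Un)
next
 case (refl w)
 then show ?case by (intro colim_eq.refl) (auto simp: colim_path_iff)
next
 case (sym v w)
 then show ?case by (blast intro: colim_eq.sym)
next
 case (trans u v w)
 then show ?case by (blast intro: colim_eq.trans)
qed

lemma eqv_append: "[|eqv r u u'; eqv r v v'|] ==> eqv r (u @ v) (u' @ v')"
 using eqv_context[of r u u' "[]" v] eqv_context[of r v v' u' "[]"] eqv_valid[of r u u'] eqv_valid[of r v v']
  eqv_trans[of r "u @ v" "u' @ v" "u' @ v'"] by auto

fun lact :: "nat => (nat => nat) => 's rletter => 's rletter" where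
 "lact k \<psi> (s, a, b, U) = (s, a, b, compose {..k} U \<psi>)"

lemma letter_act_lact: "letter_act D k r \<psi> = lact k \<psi>"
 by (auto simp: fun_eq_iff rigid_diagram_simps)

lemma valid_lact: "[|valid r l; \<psi> \<in> mono_maps k r|] ==> valid k (lact k \<psi> l)"
 by (cases l) (auto simp: valid.simps intro: compose_chains_in)

lemma arrow_rule:
 assumes "\<sigma> \<in> spx S n" "\<theta> \<in> mono_maps m n" "valid r ((m, sact S m n \<theta> \<sigma>), a, b, U)"
 shows "colim_rule D r [((m, sact S m n \<theta> \<sigma>), a, b, U)] [((n, \<sigma>), \<theta> a, \<theta> b, \<lambda>q\<in>{..r}. \<theta> ` U q)]"
proof -
 have "((m, sact S m n \<theta> \<sigma>), \<theta>, (n, \<sigma>)) \<in> Darr D" using assms(1,2) by (auto simp: rigid_diagram_arr)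
 from colim_rule.arrow[OF this, of a b U r] show ?thesis
  using assms(3) by (simp add: valid.simps rigid_diagram_simps rigid_simplex_simps spx_nerve)
qed

lemma valid_arrow:
 assumes "\<sigma> \<in> spx S n" "\<theta> \<in> mono_maps m n" "valid r ((m, \<rho>), a, b, U)"
 shows "valid r ((n, \<sigma>), \<theta> a, \<theta> b, \<lambda>q\<in>{..r}. \<theta> ` U q)"
proof -
 have "\<theta> ` A \<in> cube_poset (\<theta> a) (\<theta> b)" if "A \<in> cube_poset a b" for A
  using that assms(2,3) by (fastforce simp: valid.simps cube_poset_def dest: mono_mapsD)
 then have "(\<lambda>q\<in>{..r}. \<theta> ` U q) \<in> chains_in (cube_poset (\<theta> a) (\<theta> b)) r"
  using assms(3) by (intro chains_in_restrict) (auto simp: valid.simps dest: chains_inD)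
 then show ?thesis using assms by (auto simp: valid.simps dest: mono_mapsD)
qed

lemma eqv_arrow:
 "[|\<sigma> \<in> spx S n; \<theta> \<in> mono_maps m n; valid r ((m, sact S m n \<theta> \<sigma>), a, b, U)|]
  ==> eqv r [((m, sact S m n \<theta> \<sigma>), a, b, U)] [((n, \<sigma>), \<theta> a, \<theta> b, \<lambda>q\<in>{..r}. \<theta> ` U q)]"
 by (rule eqv_rule[OF arrow_rule]) (auto intro: valid_arrow)

lemma valid_comp:
 assumes "valid r (s, a, b, U)" "valid r (s, b, c, V)"
 shows "valid r (s, a, c, \<lambda>t\<in>{..r}. U t \<union> V t)"
proof -
 have "A \<union> B \<in> cube_poset a c" if "A \<in> cube_poset a b" "B \<in> cube_poset b c" for A B
  using that by (fastforce simp: cube_poset_def)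
 then show ?thesis using assms
  by (cases s) (auto simp: valid.simps intro!: chains_in_restrict dest: chains_inD)
qed

lemma comp_rule:
 assumes "valid r (s, a, b, U)" "valid r (s, b, c, V)"
 shows "colim_rule D r [(s, a, b, U), (s, b, c, V)] [(s, a, c, \<lambda>t\<in>{..r}. U t \<union> V t)]"
 using colim_rule.comp[of s D a b c U r V] assms
 by (cases s) (simp add: valid.simps rigid_diagram_simps rigid_simplex_simps spx_nerve)

lemma eqv_comp:
 assumes "valid r (s, a, b, U)" "valid r (s, b, c, V)"
 shows "eqv r [(s, a, b, U), (s, b, c, V)] [(s, a, c, \<lambda>t\<in>{..r}. U t \<union> V t)]"
 by (rule eqv_rule[OF comp_rule[OF assms]]) (use assms valid_comp[OF assms] in \<open>auto\<close>)

lemma valid_ident: "[|\<sigma> \<in> spx S n; a \<le> n|] ==> valid r ((n, \<sigma>), a, a, \<lambda>t\<in>{..r}. {a})"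
 by (auto simp: valid.simps cube_poset_def intro!: chains_in_restrict)

lemma eqv_ident: "[|\<sigma> \<in> spx S n; a \<le> n|] ==> eqv r [((n, \<sigma>), a, a, \<lambda>t\<in>{..r}. {a})] []"
 using colim_rule.ident[of "(n, \<sigma>)" D a r] valid_ident[of \<sigma> n a r]
 by (intro eqv_rule) (auto simp: rigid_diagram_simps rigid_simplex_simps)

text \<open>Induction over the generating relation, with its three rules in explicit form.\<close>

lemma eqv_cases:
 assumes "colim_rule D r s t" "\<forall>l\<in>set s. valid r l"
 obtains (arr) m n \<theta> \<sigma> a b U where "\<sigma> \<in> spx S n" "\<theta> \<in> mono_maps m n"
   "s = [((m, sact S m n \<theta> \<sigma>), a, b, U)]" "t = [((n, \<sigma>), \<theta> a, \<theta> b, \<lambda>q\<in>{..r}. \<theta> ` U q)]"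
  | (cmp) j a b c U V where "s = [(j, a, b, U), (j, b, c, V)]" "t = [(j, a, c, \<lambda>t\<in>{..r}. U t \<union> V t)]"
  | (idt) n \<sigma> a where "\<sigma> \<in> spx S n" "a \<le> n" "s = [((n, \<sigma>), a, a, \<lambda>t\<in>{..r}. {a})]" "t = []"
 using assms(1)
proof cases
 case (arrow i e j a b f)
 then show ?thesis using arr by (auto simp: rigid_diagram_arr rigid_diagram_simps rigid_simplex_simps)
next
 case (comp j a b c f g)
 then show ?thesis using cmp by (cases j) (auto simp: rigid_diagram_simps rigid_simplex_simps)
next
 case (ident j a)
 then show ?thesis using idt by (cases j) (auto simp: rigid_diagram_simps rigid_simplex_simps)
qed

lemma eqv_lact:
 assumes "eqv r w w'" and \<psi>: "\<psi> \<in> mono_maps k r"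
 shows "eqv k (map (lact k \<psi>) w) (map (lact k \<psi>) w')"
 using assms(1) unfolding eqv_def
proof (induction rule: colim_eq.induct)
 case (rule s t u v)
 have val: "\<forall>l\<in>set (u @ s @ v). valid r l" "\<forall>l\<in>set (u @ t @ v). valid r l"
  using rule(2,3) by (simp_all only: colim_path_iff)
 have vs: "\<forall>l\<in>set s. valid r l" using val by auto
 have "eqv k (map (lact k \<psi>) s) (map (lact k \<psi>) t)"
  using rule(1) vs
 proof (cases rule: eqv_cases)
  case (arr m n \<theta> \<sigma> a b U)
  have "compose {..k} (\<lambda>q\<in>{..r}. \<theta> ` U q) \<psi> = (\<lambda>q\<in>{..k}. \<theta> ` compose {..k} U \<psi> q)"
   using \<psi> by (auto simp: compose_def fun_eq_iff dest: mono_mapsD)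
  moreover have "valid k ((m, sact S m n \<theta> \<sigma>), a, b, compose {..k} U \<psi>)"
   using vs valid_lact[OF _ \<psi>, of "((m, sact S m n \<theta> \<sigma>), a, b, U)"] arr by simp
  ultimately show ?thesis
   using eqv_arrow[OF arr(1,2), of k a b "compose {..k} U \<psi>"] by (simp add: arr)
 next
  case (cmp j a b c U V)
  have "compose {..k} (\<lambda>t\<in>{..r}. U t \<union> V t) \<psi> = (\<lambda>t\<in>{..k}. compose {..k} U \<psi> t \<union> compose {..k} V \<psi> t)"
   using \<psi> by (auto simp: compose_def fun_eq_iff dest: mono_mapsD)
  moreover have "valid k (lact k \<psi> (j, a, b, U))" "valid k (lact k \<psi> (j, b, c, V))"
   using vs valid_lact[OF _ \<psi>] cmp by (auto simp del: lact.simps)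
  ultimately show ?thesis
   using eqv_comp[of k j a b "compose {..k} U \<psi>" c "compose {..k} V \<psi>"] by (simp add: cmp)
 next
  case (idt n \<sigma> a)
  have "compose {..k} (\<lambda>t\<in>{..r}. {a}) \<psi> = (\<lambda>t\<in>{..k}. {a})"
   using \<psi> by (auto simp: compose_def fun_eq_iff dest: mono_mapsD)
  then show ?thesis using eqv_ident[OF idt(1,2), of k] by (simp add: idt)
 qed
 then have "eqv k (map (lact k \<psi>) u @ map (lact k \<psi>) s @ map (lact k \<psi>) v)
    (map (lact k \<psi>) u @ map (lact k \<psi>) t @ map (lact k \<psi>) v)"
  by (rule eqv_context) (use val valid_lact[OF _ \<psi>] in auto)
 then show ?case by (simp add: eqv_def)
next
 case (refl w)
 then have "\<forall>l\<in>set w. valid r l" by (simp only: colim_path_iff)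
 then show ?case using valid_lact[OF _ \<psi>] by (intro colim_eq.refl) (auto simp: colim_path_iff)
next
 case (sym v w)
 then show ?case by (blast intro: colim_eq.sym)
next
 case (trans u v w)
 then show ?case by (blast intro: colim_eq.trans)
qed

definition cls :: "nat => 's rletter list => 's rigid_mor" where
 "cls r w = {w'. eqv r w w'}"

lemma cls_eq_iff:
 assumes "\<forall>l\<in>set w. valid r l"
 shows "cls r w = cls r w' \<longleftrightarrow> eqv r w w'"
proof
 assume "cls r w = cls r w'"
 moreover have "w \<in> cls r w" using assms eqv_refl by (simp add: cls_def)
 ultimately have "eqv r w' w" by (simp add: cls_def)
 then show "eqv r w w'" by (rule eqv_sym)
next
 assume "eqv r w w'"
 then show "cls r w = cls r w'" unfolding cls_def by (blast intro: eqv_sym eqv_trans)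
qed

abbreviation "M \<equiv> Map (rigidification S) X X"
abbreviation "mul n \<equiv> scomp (rigidification S) n X X X"
abbreviation "one \<equiv> sid (rigidification S) X"

lemma Image_colim_rel: "colim_rel D r X X `` A = (\<Union>w\<in>A. cls r w)"
 by (auto simp: colim_rel_def cls_def eqv_def)

lemma spx_M: "spx M r = {cls r w | w. \<forall>l\<in>set w. valid r l}"
 unfolding rigidification_def colim_def
 by (auto simp: quotient_def colim_path_iff Image_colim_rel)

lemma UN_cls:
 assumes "A \<noteq> {}" "\<And>w. w \<in> A ==> eqv r w0 w"
 shows "(\<Union>w\<in>A. cls r w) = cls r w0"
proof -
 have "cls r w = cls r w0" if "w \<in> A" for w
  using assms(2)[OF that] eqv_sym eqv_trans unfolding cls_def by blast
 then show ?thesis using assms(1) by auto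
qed

lemma sact_M:
 assumes \<psi>: "\<psi> \<in> mono_maps k r" and w: "\<forall>l\<in>set w. valid r l"
 shows "sact M k r \<psi> (cls r w) = cls k (map (lact k \<psi>) w)"
proof -
 have "sact M k r \<psi> (cls r w) = (\<Union>w\<in>map (lact k \<psi>) ` cls r w. cls k w)"
  unfolding rigidification_def colim_def by (simp add: letter_act_lact Image_colim_rel)
 also have "\<dots> = cls k (map (lact k \<psi>) w)"
  by (rule UN_cls) (use eqv_refl w eqv_lact[OF _ \<psi>] in \<open>auto simp: cls_def\<close>)
 finally show ?thesis .
qed

lemma mul_cls:
 assumes "\<forall>l\<in>set u. valid r l" "\<forall>l\<in>set v. valid r l"
 shows "mul r (cls r u) (cls r v) = cls r (u @ v)"
proof -
 have "mul r (cls r u) (cls r v) = (\<Union>w\<in>{a @ b | a b. a \<in> cls r u \<and> b \<in> cls r v}. cls r w)"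
  unfolding rigidification_def colim_def by (simp add: Image_colim_rel)
 also have "\<dots> = cls r (u @ v)"
 proof (rule UN_cls)
  have "eqv r u u" "eqv r v v" using assms eqv_refl by auto
  then show "{a @ b | a b. a \<in> cls r u \<and> b \<in> cls r v} \<noteq> {}" by (auto simp: cls_def)
 qed (use eqv_append in \<open>auto simp: cls_def\<close>)
 finally show ?thesis .
qed

lemma one_cls: "one = cls 0 []"
 unfolding rigidification_def colim_def by (simp add: Image_colim_rel)

lemma valid_map_lact: "[|\<forall>l\<in>set w. valid r l; \<psi> \<in> mono_maps k r|] ==> \<forall>l\<in>set (map (lact k \<psi>) w). valid k l"
 using valid_lact by auto

lemma simplicial_set_M: "simplicial_set M"
 unfolding simplicial_set_def
proof (intro conjI allI ballI)
 fix k n \<theta> c assume \<theta>: "\<theta> \<in> mono_maps k n" and "c \<in> spx M n"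
 then obtain w where c: "c = cls n w" and w: "\<forall>l\<in>set w. valid n l" by (auto simp: spx_M)
 show "sact M k n \<theta> c \<in> spx M k"
  unfolding c sact_M[OF \<theta> w] using valid_map_lact[OF w \<theta>] by (auto simp: spx_M simp del: set_map)
next
 fix n c assume "c \<in> spx M n"
 then obtain w where c: "c = cls n w" and w: "\<forall>l\<in>set w. valid n l" by (auto simp: spx_M)
 have "lact n (restrict id {..n}) l = l" if "valid n l" for l
  using that act_id[OF simplicial_set_nerve] by (cases l) (auto simp: valid.simps spx_nerve sact_nerve)
 then have "map (lact n (restrict id {..n})) w = w" using w by (simp add: map_idI)
 then show "sact M n n (restrict id {..n}) c = c" unfolding c sact_M[OF id_mono_maps w] by simp
next
 fix l k n \<phi> \<theta> c assume \<phi>: "\<phi> \<in> mono_maps l k" and \<theta>: "\<theta> \<in> mono_maps k n" and "c \<in> spx M n"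
 then obtain w where c: "c = cls n w" and w: "\<forall>l\<in>set w. valid n l" by (auto simp: spx_M)
 have "lact l \<phi> (lact k \<theta> y) = lact l (compose {..l} \<theta> \<phi>) y" for y
  using \<phi> by (cases y) (auto simp: compose_def fun_eq_iff dest: mono_mapsD)
 then show "sact M l k \<phi> (sact M k n \<theta> c) = sact M l n (compose {..l} \<theta> \<phi>) c"
  unfolding c sact_M[OF \<theta> w] sact_M[OF \<phi> valid_map_lact[OF w \<theta>]] sact_M[OF compose_mono_maps[OF \<phi> \<theta>] w]
  by (simp add: o_def)
qed

lemma simplicial_monoid_M: "simplicial_monoid M mul one"
proof
 show "pairing M M M mul"
  unfolding pairing_def
 proof (intro conjI simplicial_set_M allI ballI)
  fix n c d assume "c \<in> spx M n" "d \<in> spx M n"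
  then obtain u v where "c = cls n u" "\<forall>l\<in>set u. valid n l" "d = cls n v" "\<forall>l\<in>set v. valid n l"
   by (auto simp: spx_M)
  note * = this
  show "mul n c d \<in> spx M n"
   unfolding *(1,3) mul_cls[OF *(2,4)] using *(2,4) unfolding spx_M by (auto intro!: exI[of _ "u @ v"])
  fix k \<theta> assume \<theta>: "\<theta> \<in> mono_maps k n"
  have "\<forall>l\<in>set (u @ v). valid n l" using *(2,4) by auto
  from sact_M[OF \<theta> this] show "sact M k n \<theta> (mul n c d) = mul k (sact M k n \<theta> c) (sact M k n \<theta> d)"
   unfolding *(1,3) mul_cls[OF *(2,4)] sact_M[OF \<theta> *(2)] sact_M[OF \<theta> *(4)]
    mul_cls[OF valid_map_lact[OF *(2) \<theta>] valid_map_lact[OF *(4) \<theta>]] by simp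
 qed
next
 fix n c d e assume "c \<in> spx M n" "d \<in> spx M n" "e \<in> spx M n"
 then obtain u v w where "c = cls n u" "\<forall>l\<in>set u. valid n l" "d = cls n v" "\<forall>l\<in>set v. valid n l"
   "e = cls n w" "\<forall>l\<in>set w. valid n l"
  by (auto simp: spx_M)
 note * = this
 have uv: "\<forall>l\<in>set (u @ v). valid n l" and vw: "\<forall>l\<in>set (v @ w). valid n l" using * by auto
 show "mul n (mul n c d) e = mul n c (mul n d e)"
  unfolding *(1,3,5) mul_cls[OF *(2,4)] mul_cls[OF *(4,6)] mul_cls[OF uv *(6)] mul_cls[OF *(2) vw] by simp
next
 show "one \<in> spx M 0" unfolding one_cls spx_M by (auto intro!: exI[of _ "[]"])
next
 fix n c assume "c \<in> spx M n"
 then obtain w where c: "c = cls n w" and w: "\<forall>l\<in>set w. valid n l" by (auto simp: spx_M)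
 have "sact M n 0 (const_op n) one = cls n []"
  unfolding one_cls using sact_M[OF const_op_mono, of "[]" n] by simp
 then show "mul n (sact M n 0 (const_op n) one) c = c" "mul n c (sact M n 0 (const_op n) one) = c"
  using mul_cls[OF w, of "[]"] mul_cls[OF _ w, of "[]"] by (simp_all add: c)
qed

lemma Gamma_eq: "Gamma S x = chain_dga M mul one"
 by (simp add: Gamma_def endo_dga_eq)

end

section \<open>Normal forms\<close>

text \<open>The decomposition of the face of \<open>\<sigma>\<close> on the vertex set \<open>W\<close> as a degeneracy \<open>s\<close> of a
 nondegenerate simplex \<open>\<tau>\<close>. It is phrased through all operators with values in \<open>W\<close>, which avoids
 choosing an enumeration of \<open>W\<close>.\<close>

definition ez :: "'s sset => nat => 's => nat set => nat => 's => (nat => nat) => bool" where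
 "ez S n \<sigma> W k \<tau> s \<longleftrightarrow> \<tau> \<in> spx S k \<and> s ` W = {..k} \<and> (\<forall>u\<in>W. \<forall>v\<in>W. u \<le> v \<longrightarrow> s u \<le> s v) \<and>
   (\<forall>j \<theta>. \<theta> \<in> mono_maps j n \<longrightarrow> \<theta> ` {..j} \<subseteq> W \<longrightarrow>
    sact S j n \<theta> \<sigma> = sact S j k (compose {..j} s \<theta>) \<tau>)"

lemma ezD:
 assumes "ez S n \<sigma> W k \<tau> s"
 shows "\<tau> \<in> spx S k" "s ` W = {..k}" "[|u \<in> W; v \<in> W; u \<le> v|] ==> s u \<le> s v" "u \<in> W ==> s u \<le> k"
  "[|\<theta> \<in> mono_maps j n; \<theta> ` {..j} \<subseteq> W|] ==> sact S j n \<theta> \<sigma> = sact S j k (compose {..j} s \<theta>) \<tau>"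
 using assms unfolding ez_def by blast+

lemma ez_compose_mono:
 assumes "ez S n \<sigma> W k \<tau> s" "\<theta> \<in> mono_maps j n" "\<theta> ` {..j} \<subseteq> W"
 shows "compose {..j} s \<theta> \<in> mono_maps j k"
 unfolding compose_def
 by (rule mono_maps_restrict) (use assms ezD(3,4)[OF assms(1)] mono_mapsD[OF assms(2)] in \<open>auto simp: image_subset_iff\<close>)

lemma ez_section:
 assumes E: "ez S n \<sigma> W k \<tau> s" and W: "W \<subseteq> {..n}" and u: "u \<in> W"
 obtains \<theta> where "\<theta> \<in> mono_maps k n" "\<theta> ` {..k} \<subseteq> W" "\<And>t. t \<le> k ==> s (\<theta> t) = t" "\<theta> (s u) = u"
proof -
 define \<theta> where "\<theta> = (\<lambda>t\<in>{..k}. if t = s u then u else (SOME v. v \<in> W \<and> s v = t))"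
 have \<theta>: "\<theta> t \<in> W \<and> s (\<theta> t) = t" if "t \<le> k" for t
 proof -
  have "\<exists>v. v \<in> W \<and> s v = t" using that ezD(2)[OF E] by (metis atMost_iff imageE)
  from someI_ex[OF this] show ?thesis using that u by (auto simp: \<theta>_def)
 qed
 have "\<theta> \<in> mono_maps k n"
 proof (rule mono_mapsI)
  show "\<theta> t \<le> n" if "t \<le> k" for t using \<theta>[OF that] W by auto
  show "\<theta> a \<le> \<theta> b" if "a \<le> b" "b \<le> k" for a b
  proof (rule ccontr)
   assume "\<not> \<theta> a \<le> \<theta> b"
   then have "s (\<theta> b) \<le> s (\<theta> a)" using \<theta>[of a] \<theta>[of b] that ezD(3)[OF E, of "\<theta> b" "\<theta> a"] by simp
   then have "a = b" using \<theta>[of a] \<theta>[of b] that by simp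
   then show False using \<open>\<not> \<theta> a \<le> \<theta> b\<close> by simp
  qed
 qed (simp add: \<theta>_def)
 moreover have "\<theta> (s u) = u" using ezD(4)[OF E u] by (simp add: \<theta>_def)
 ultimately show ?thesis using that \<theta> by blast
qed

lemma nondegenerate_injective:
 assumes S: "simplicial_set S" and nd: "\<not> degenerate S k \<tau>" and \<phi>: "\<phi> \<in> mono_maps k k'"
  and \<tau>': "\<tau>' \<in> spx S k'" "\<tau> = sact S k k' \<phi> \<tau>'"
 shows "t \<le> k ==> t \<le> \<phi> t" "k \<le> k'"
proof -
 have step: "\<phi> i < \<phi> (Suc i)" if "i < k" for i
  using degenerate_act[OF S \<phi> \<tau>'(1) that] mono_mapsD(2)[OF \<phi>, of i "Suc i"] nd \<tau>'(2) that
  by (metis Suc_leI le_SucI le_neq_implies_less le_refl)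
 show *: "t \<le> k ==> t \<le> \<phi> t" for t
 proof (induction t)
  case (Suc t)
  then show ?case using step[of t] by simp
 qed simp
 show "k \<le> k'" using *[of k] mono_mapsD(1)[OF \<phi>, of k] by simp
qed

text \<open>The Eilenberg-Zilber lemma: each decomposition factors through the other by an operator that is
 injective because its source is nondegenerate.\<close>

lemma ez_unique:
 assumes S: "simplicial_set S" and W: "W \<subseteq> {..n}" and E: "ez S n \<sigma> W k \<tau> s" "ez S n \<sigma> W k' \<tau>' s'"
  and nd: "\<not> degenerate S k \<tau>" "\<not> degenerate S k' \<tau>'"
 shows "k = k' \<and> \<tau> = \<tau>' \<and> (\<forall>u\<in>W. s u = s' u)"
proof -
 have main: "k \<le> k' \<and> (k' \<le> k \<longrightarrow> \<tau> = \<tau>' \<and> s u = s' u)"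
  if E: "ez S n \<sigma> W k \<tau> s" "ez S n \<sigma> W k' \<tau>' s'" and nd: "\<not> degenerate S k \<tau>" and u: "u \<in> W"
  for k k' \<tau> \<tau>' s s' u
 proof -
  obtain \<theta> where \<theta>: "\<theta> \<in> mono_maps k n" "\<theta> ` {..k} \<subseteq> W" "\<And>t. t \<le> k ==> s (\<theta> t) = t" "\<theta> (s u) = u"
   using ez_section[OF E(1) W u] by blast
  let ?\<phi> = "compose {..k} s' \<theta>"
  have \<phi>: "?\<phi> \<in> mono_maps k k'" by (rule ez_compose_mono[OF E(2) \<theta>(1,2)])
  have "compose {..k} s \<theta> = restrict id {..k}" using \<theta>(3) by (auto simp: compose_def fun_eq_iff)
  then have "sact S k n \<theta> \<sigma> = \<tau>"
   using ezD(5)[OF E(1) \<theta>(1,2)] act_id[OF S ezD(1)[OF E(1)]] by simp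
  then have \<tau>: "\<tau> = sact S k k' ?\<phi> \<tau>'" using ezD(5)[OF E(2) \<theta>(1,2)] by simp
  note inj = nondegenerate_injective[OF S nd \<phi> ezD(1)[OF E(2)] \<tau>]
  have "\<tau> = \<tau>' \<and> s u = s' u" if "k' \<le> k"
  proof -
   have kk: "k' = k" using that inj(2) by simp
   have id: "?\<phi> t = t" if "t \<le> k" for t
   proof -
    have "k - t \<le> k - ?\<phi> t"
     if "t \<le> k" for t
    using that
    proof (induction "k - t" arbitrary: t)
     case (Suc d)
     have "\<phi> i < \<phi> (Suc i)" if "\<phi> = ?\<phi>" "i < k" for i \<phi>
      using degenerate_act[OF S \<phi> ezD(1)[OF E(2)] that(2)] mono_mapsD(2)[OF \<phi>, of i "Suc i"] nd \<tau> that
      by (metis Suc_leI le_SucI le_neq_implies_less le_refl)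
     then have "?\<phi> t < ?\<phi> (Suc t)" using Suc by simp
     moreover have "k - Suc t \<le> k - ?\<phi> (Suc t)" using Suc.hyps(1)[of "Suc t"] Suc.hyps(2) Suc.prems by simp
     moreover have "?\<phi> (Suc t) \<le> k" using mono_mapsD(1)[OF \<phi>, of "Suc t"] Suc kk by simp
     ultimately show ?case using Suc by linarith
    qed simp
    from this[OF that] show ?thesis using inj(1)[OF that] mono_mapsD(1)[OF \<phi> that] that kk by linarith
   qed
   have "?\<phi> = restrict id {..k}" by (rule mono_maps_eqI[OF \<phi> id_mono_maps]) (use id in auto)
   then have "\<tau> = \<tau>'" using \<tau> kk act_id[OF S ezD(1)[OF E(2)]] by simp
   moreover have "s' u = s u" using id[OF ezD(4)[OF E(1) u]] \<theta>(4) ezD(4)[OF E(1) u] by (simp add: compose_def)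
   ultimately show ?thesis by simp
  qed
  then show ?thesis using inj(2) by blast
 qed
 obtain u where u: "u \<in> W" using ezD(2)[OF E(1)] by (metis atMost_iff imageE le_refl)
 have "k = k'" using main[OF E nd(1) u] main[OF E(2,1) nd(2) u] by simp
 then show ?thesis using main[OF E nd(1)] u by auto
qed

lemma enumerate_subset:
 assumes W: "W \<subseteq> {..n}" "W \<noteq> {}"
 obtains c \<epsilon> where "\<epsilon> \<in> mono_maps c n" "cnt W ` W = {..c}"
  "\<And>t. t \<le> c ==> \<epsilon> t \<in> W \<and> cnt W (\<epsilon> t) = t" "\<And>u. u \<in> W ==> \<epsilon> (cnt W u) = u"
proof -
 have fin: "finite W" using W(1) finite_subset by blast
 define c where "c = card W - 1"
 have c: "card W = Suc c" using W(2) fin by (simp add: c_def card_gt_0_iff)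
 have im: "cnt W ` W = {..c}"
  using bij_betw_cnt[OF fin] c by (simp add: bij_betw_def lessThan_Suc_atMost)
 define \<epsilon> where "\<epsilon> = restrict (inv_into W (cnt W)) {..c}"
 have \<epsilon>: "\<epsilon> t \<in> W" "cnt W (\<epsilon> t) = t" if "t \<le> c" for t
  using that im by (auto simp: \<epsilon>_def intro: inv_into_into f_inv_into_f)
 have \<epsilon>_cnt: "\<epsilon> (cnt W u) = u" if "u \<in> W" for u
  using that im \<epsilon> cnt_eq_iff[of _ W u] by blast
 have \<epsilon>m: "\<epsilon> \<in> mono_maps c n"
 proof (rule mono_mapsI)
  show "\<epsilon> t \<le> n" if "t \<le> c" for t using \<epsilon>[OF that] W by auto
  show "\<epsilon> a \<le> \<epsilon> b" if "a \<le> b" "b \<le> c" for a b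
   using cnt_less_iff[of "\<epsilon> b" W "\<epsilon> a"] \<epsilon>[of a] \<epsilon>[of b] that by (auto simp: not_less[symmetric])
 qed (simp add: \<epsilon>_def)
 show ?thesis using that \<epsilon>m im \<epsilon> \<epsilon>_cnt by blast
qed

lemma ez_ends:
 assumes E: "ez S n \<sigma> W k \<tau> s" and W: "W \<subseteq> {i..j}" "i \<in> W" "j \<in> W"
 shows "s i = 0" "s j = k"
proof -
 obtain v where "v \<in> W" "s v = 0" using ezD(2)[OF E] by (metis atMost_iff imageE le0)
 moreover from this have "i \<le> v" using W(1) by auto
 ultimately show "s i = 0" using ezD(3)[OF E W(2)] by (metis le_zero_eq le_refl)
 obtain v where "v \<in> W" "s v = k" using ezD(2)[OF E] by (metis atMost_iff imageE le_refl)
 moreover from this have "v \<le> j" using W(1) by auto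
 ultimately show "s j = k" using ezD(3)[OF E _ W(3)] ezD(4)[OF E W(3)] by (metis le_antisym le_refl)
qed

text \<open>A decomposition of least dimension has a nondegenerate simplex.\<close>

lemma ez_exists:
 assumes S: "simplicial_set S" and W: "W \<subseteq> {..n}" "W \<noteq> {}" and \<sigma>: "\<sigma> \<in> spx S n"
 shows "\<exists>k \<tau> s. ez S n \<sigma> W k \<tau> s \<and> \<not> degenerate S k \<tau>"
proof -
 obtain c \<epsilon> where \<epsilon>m: "\<epsilon> \<in> mono_maps c n" and im: "cnt W ` W = {..c}"
  and \<epsilon>: "\<And>t. t \<le> c ==> \<epsilon> t \<in> W \<and> cnt W (\<epsilon> t) = t" and \<epsilon>_cnt: "\<And>u. u \<in> W ==> \<epsilon> (cnt W u) = u"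
  by (rule enumerate_subset[OF W]) (rule that)
 have "ez S n \<sigma> W c (sact S c n \<epsilon> \<sigma>) (cnt W)"
  unfolding ez_def
 proof (intro conjI allI impI ballI)
  show "sact S c n \<epsilon> \<sigma> \<in> spx S c" by (rule act_closed[OF S \<epsilon>m \<sigma>])
  fix j \<theta> assume \<theta>: "\<theta> \<in> mono_maps j n" "\<theta> ` {..j} \<subseteq> W"
  have "compose {..j} (cnt W) \<theta> \<in> mono_maps j c"
   unfolding compose_def
   by (rule mono_maps_restrict) (use \<theta> im in \<open>auto intro: cnt_mono dest: mono_mapsD\<close>)
  moreover have "compose {..j} \<epsilon> (compose {..j} (cnt W) \<theta>) = \<theta>"
   using \<theta> mono_mapsD(3)[OF \<theta>(1)] by (auto simp: compose_def fun_eq_iff \<epsilon>_cnt image_subset_iff not_le)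
  ultimately show "sact S j n \<theta> \<sigma> = sact S j c (compose {..j} (cnt W) \<theta>) (sact S c n \<epsilon> \<sigma>)"
   using act_act[OF S _ \<epsilon>m \<sigma>] by simp
 qed (use im in \<open>auto intro: cnt_mono\<close>)
 then have ex: "\<exists>k \<tau> s. ez S n \<sigma> W k \<tau> s" by blast
 define k where "k = (LEAST k. \<exists>\<tau> s. ez S n \<sigma> W k \<tau> s)"
 obtain \<tau> s where E: "ez S n \<sigma> W k \<tau> s" using LeastI_ex[OF ex] unfolding k_def by blast
 have "\<not> degenerate S k \<tau>"
 proof
  assume "degenerate S k \<tau>"
  then obtain m i \<tau>' where d: "k = Suc m" "i \<le> m" "\<tau>' \<in> spx S m" "\<tau> = sact S k m (codegeneracy m i) \<tau>'"
   unfolding degenerate_def by blast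
  let ?c = "codegeneracy m i"
  have cm: "?c \<in> mono_maps k m" using codegeneracy_mono[OF d(2)] d(1) by simp
  have "?c ` {..k} = {..m}"
  proof (intro equalityI subsetI)
   fix t assume "t \<in> {..m}"
   then have "?c (if t \<le> i then t else Suc t) = t" "(if t \<le> i then t else Suc t) \<le> k"
    using d by (auto simp: codegeneracy_def)
   then show "t \<in> ?c ` {..k}" by (metis atMost_iff imageI)
  qed (use mono_mapsD(1)[OF cm] in auto)
  then have im2: "(?c \<circ> s) ` W = {..m}" using ezD(2)[OF E] unfolding image_comp[symmetric] by simp
  have "ez S n \<sigma> W m \<tau>' (?c \<circ> s)"
   unfolding ez_def
  proof (intro conjI allI impI ballI)
   show "(?c \<circ> s) u \<le> (?c \<circ> s) v" if "u \<in> W" "v \<in> W" "u \<le> v" for u v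
    using mono_mapsD(2)[OF cm] ezD(3,4)[OF E] that by simp
   fix j \<theta> assume \<theta>: "\<theta> \<in> mono_maps j n" "\<theta> ` {..j} \<subseteq> W"
   show "sact S j n \<theta> \<sigma> = sact S j m (compose {..j} (?c \<circ> s) \<theta>) \<tau>'"
    using ezD(5)[OF E \<theta>] act_act[OF S ez_compose_mono[OF E \<theta>] cm d(3)] d(4)
    by (simp add: compose_def cong: restrict_cong)
  qed (use d(3) im2 in auto)
  then have "k \<le> m" unfolding k_def by (intro Least_le) blast
  then show False using d(1) by simp
 qed
 then show ?thesis using E by blast
qed

definition ez_pick :: "'s sset => nat => 's => nat set => nat \<times> 's \<times> (nat => nat)" where
 "ez_pick S n \<sigma> W = (SOME (k, \<tau>, s). ez S n \<sigma> W k \<tau> s \<and> \<not> degenerate S k \<tau>)"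

context reduced
begin

text \<open>The part of a letter between two consecutive vertices of its initial subset. It is an identity if
 the face on its vertices is degenerate to a point.\<close>

definition piece :: "nat => nat => 's => (nat => nat set) => nat => nat => 's rletter list" where
 "piece r n \<sigma> U v v' = (case ez_pick S n \<sigma> (U r \<inter> {v..v'}) of (k, \<tau>, s) =>
   if k = 0 then [] else [((k, \<tau>), 0, k, \<lambda>t\<in>{..r}. s ` (U t \<inter> {v..v'}))])"

fun nf_letter :: "nat => 's rletter => 's rletter list" where
 "nf_letter r ((n, \<sigma>), a, b, U) =
   concat (map (\<lambda>v. if v \<in> U 0 then piece r n \<sigma> U v (LEAST u. u \<in> U 0 \<and> v < u) else []) [a..<b])"

declare nf_letter.simps [simp del]

definition nf :: "nat => 's rletter list => 's rletter list" where
 "nf r w = concat (map (nf_letter r) w)"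

lemma nf_append: "nf r (u @ v) = nf r u @ nf r v" by (simp add: nf_def)

lemma nf_single: "nf r [l] = nf_letter r l" by (simp add: nf_def)

lemma piece_eq:
 assumes E: "ez S n \<sigma> (U r \<inter> {v..v'}) k \<tau> s" and nd: "\<not> degenerate S k \<tau>" and U: "U r \<subseteq> {..n}"
  and mono: "\<And>t. t \<le> r ==> U t \<subseteq> U r"
 shows "piece r n \<sigma> U v v' = (if k = 0 then [] else [((k, \<tau>), 0, k, \<lambda>t\<in>{..r}. s ` (U t \<inter> {v..v'}))])"
proof -
 obtain k' \<tau>' s' where p: "ez_pick S n \<sigma> (U r \<inter> {v..v'}) = (k', \<tau>', s')" by (metis prod_cases3)
 have "case ez_pick S n \<sigma> (U r \<inter> {v..v'}) of (k, \<tau>, s) => ez S n \<sigma> (U r \<inter> {v..v'}) k \<tau> s \<and> \<not> degenerate S k \<tau>"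
  unfolding ez_pick_def by (rule someI[of _ "(k, \<tau>, s)"]) (use E nd in simp)
 then have E': "ez S n \<sigma> (U r \<inter> {v..v'}) k' \<tau>' s'" "\<not> degenerate S k' \<tau>'" using p by auto
 have "k' = k \<and> \<tau>' = \<tau> \<and> (\<forall>u\<in>U r \<inter> {v..v'}. s' u = s u)"
  by (rule ez_unique[OF S _ E'(1) E E'(2) nd]) (use U in auto)
 moreover from this have "s' ` (U t \<inter> {v..v'}) = s ` (U t \<inter> {v..v'})" if "t \<le> r" for t
  using mono[OF that] by (intro image_cong) auto
 ultimately show ?thesis unfolding piece_def p by (simp add: fun_eq_iff)
qed

lemma validD:
 assumes "valid r ((n, \<sigma>), a, b, U)"
 shows "\<sigma> \<in> spx S n" "a \<le> n" "b \<le> n" "U \<in> chains_in (cube_poset a b) r" "a \<le> b"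
  "t \<le> r ==> U t \<subseteq> {a..b}" "t \<le> r ==> a \<in> U t" "t \<le> r ==> b \<in> U t" "t \<le> r ==> U t \<subseteq> {..n}"
  "t \<le> r ==> U t \<subseteq> U r" "t \<le> r ==> U 0 \<subseteq> U t" "t \<le> r ==> finite (U t)"
proof -
 note v = assms[unfolded valid.simps]
 show 1: "\<sigma> \<in> spx S n" "a \<le> n" "b \<le> n" "U \<in> chains_in (cube_poset a b) r" using v by auto
 have P: "U t \<in> cube_poset a b" if "t \<le> r" for t using chains_inD(1)[OF 1(4) that] .
 show "a \<le> b" using cube_posetD(4)[OF P[of 0]] by simp
 show "t \<le> r ==> U t \<subseteq> {a..b}" "t \<le> r ==> a \<in> U t" "t \<le> r ==> b \<in> U t" "t \<le> r ==> finite (U t)"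
  using cube_posetD[OF P] by auto
 show "t \<le> r ==> U t \<subseteq> {..n}" using cube_posetD(1)[OF P] 1(3) by fastforce
 show "t \<le> r ==> U t \<subseteq> U r" "t \<le> r ==> U 0 \<subseteq> U t" using chains_inD(2)[OF 1(4)] by auto
qed

lemma nf_comp:
 assumes U: "valid r ((n, \<sigma>), a, b, U)" and V: "valid r ((n, \<sigma>), b, c, V)"
 shows "nf_letter r ((n, \<sigma>), a, c, \<lambda>t\<in>{..r}. U t \<union> V t) = nf_letter r ((n, \<sigma>), a, b, U) @ nf_letter r ((n, \<sigma>), b, c, V)"
proof -
 note u = validD[OF U] and v = validD[OF V]
 let ?W = "\<lambda>t\<in>{..r}. U t \<union> V t"
 have split: "[a..<c] = [a..<b] @ [b..<c]"
  using upt_add_eq_append[of a b "c - b"] u(5) v(5) by simp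
 have piece_cong: "piece r n \<sigma> P p q = piece r n \<sigma> Q p q"
  if "\<And>t. t \<le> r ==> P t \<inter> {p..q} = Q t \<inter> {p..q}" for P Q p q
 proof -
  have eq: "(\<lambda>t\<in>{..r}. s ` (P t \<inter> {p..q})) = (\<lambda>t\<in>{..r}. s ` (Q t \<inter> {p..q}))" for s :: "nat => nat"
   using that by (auto simp: fun_eq_iff restrict_def)
  show ?thesis unfolding piece_def eq using that[of r] by simp
 qed
 have left: "(if p \<in> ?W 0 then piece r n \<sigma> ?W p (LEAST u. u \<in> ?W 0 \<and> p < u) else [])
   = (if p \<in> U 0 then piece r n \<sigma> U p (LEAST u. u \<in> U 0 \<and> p < u) else [])" if p: "p \<in> set [a..<b]" for p
 proof -
  have V0: "V 0 \<subseteq> {b..c}" using v(6)[of 0] by simp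
  have in0: "p \<in> ?W 0 \<longleftrightarrow> p \<in> U 0" using p V0 by auto
  define q where "q = (LEAST u. u \<in> U 0 \<and> p < u)"
  have q: "q \<in> U 0 \<and> p < q" unfolding q_def by (rule LeastI[of _ b]) (use p u(8)[of 0] in auto)
  have qb: "q \<le> b" using q u(6)[of 0] by auto
  have "(LEAST u. u \<in> ?W 0 \<and> p < u) = q"
  proof (rule Least_equality)
   show "q \<le> y" if "y \<in> ?W 0 \<and> p < y" for y
   proof (cases "y \<in> U 0")
    case True then show ?thesis unfolding q_def using that by (intro Least_le) auto
   next
    case False then show ?thesis using that V0 qb by auto
   qed
  qed (use q in auto)
  moreover have "piece r n \<sigma> ?W p q = piece r n \<sigma> U p q"
  proof (rule piece_cong)
   fix t assume t: "t \<le> r"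
   have "y = b" if "y \<in> V t" "y \<le> q" for y
    using subsetD[OF v(6)[OF t] that(1)] that(2) qb by simp
   then show "?W t \<inter> {p..q} = U t \<inter> {p..q}" using t u(8)[OF t] by auto
  qed
  ultimately show ?thesis unfolding in0 q_def by simp
 qed
 have right: "(if p \<in> ?W 0 then piece r n \<sigma> ?W p (LEAST u. u \<in> ?W 0 \<and> p < u) else [])
   = (if p \<in> V 0 then piece r n \<sigma> V p (LEAST u. u \<in> V 0 \<and> p < u) else [])" if p: "p \<in> set [b..<c]" for p
 proof -
  have U0: "U 0 \<subseteq> {a..b}" using u(6)[of 0] by simp
  have in0: "p \<in> ?W 0 \<longleftrightarrow> p \<in> V 0" using p U0 v(7)[of 0] by (cases "p = b") auto
  have "(u \<in> ?W 0 \<and> p < u) = (u \<in> V 0 \<and> p < u)" for u using p U0 by auto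
  moreover have "piece r n \<sigma> ?W p q = piece r n \<sigma> V p q" for q
  proof (rule piece_cong)
   fix t assume t: "t \<le> r"
   have "y = b" if "y \<in> U t" "p \<le> y" for y
    using subsetD[OF u(6)[OF t] that(1)] that(2) p by simp
   then show "?W t \<inter> {p..q} = V t \<inter> {p..q}" using t v(7)[OF t] by auto
  qed
  ultimately show ?thesis unfolding in0 by simp
 qed
 show ?thesis
  unfolding nf_letter.simps split map_append concat_append
  using left right by (intro arg_cong2[of _ _ _ _ "(@)"] arg_cong[of _ _ concat] map_cong HOL.refl) auto
qed

lemma nf_indecomposable:
 assumes U: "valid r ((n, \<sigma>), i, j, U)" and U0: "U 0 = {i, j}"
  and E: "ez S n \<sigma> (U r) k \<tau> s" "\<not> degenerate S k \<tau>"
 shows "nf_letter r ((n, \<sigma>), i, j, U) = (if k = 0 then [] else [((k, \<tau>), 0, k, \<lambda>t\<in>{..r}. s ` U t)])"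
proof -
 note u = validD[OF U]
 have Ut: "U t \<inter> {i..j} = U t" if "t \<le> r" for t using u(6)[OF that] by auto
 have p: "piece r n \<sigma> U i j = (if k = 0 then [] else [((k, \<tau>), 0, k, \<lambda>t\<in>{..r}. s ` U t)])"
  using piece_eq[of n \<sigma> U r i j k \<tau> s] E u(9)[of r] u(10) Ut by (simp cong: restrict_cong)
 show ?thesis
 proof (cases "i = j")
  case True
  then have "U r = {i}" using u(6)[of r] u(7)[of r] by auto
  then have "k = 0" using ezD(2)[OF E(1)]
   by (metis atMost_iff image_insert image_empty le0 le_refl singletonD)
  then show ?thesis using True by (simp add: nf_letter.simps)
 next
  case False
  then have ij: "i < j" using u(5) by simp
  have "(LEAST u. u \<in> U 0 \<and> i < u) = j" by (rule Least_equality) (use U0 ij in auto)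
  moreover have "v \<notin> U 0" if "v \<in> set [Suc i..<j]" for v using that U0 by auto
  then have "concat (map (\<lambda>v. if v \<in> U 0 then piece r n \<sigma> U v (LEAST u. u \<in> U 0 \<and> v < u) else []) [Suc i..<j]) = []"
   by (simp add: concat_eq_Nil_conv)
  moreover have "i \<in> U 0" using U0 by simp
  ultimately have "nf_letter r ((n, \<sigma>), i, j, U) = piece r n \<sigma> U i j"
   using upt_conv_Cons[OF ij] by (simp only: nf_letter.simps list.map concat.simps if_True append_Nil2)
  then show ?thesis using p by simp
 qed
qed

text \<open>Reduction to letters without inner vertex in \<open>U 0\<close>, which are not decomposable.\<close>

lemma letter_induct [consumes 1, case_names indec split]:
 assumes val: "valid r ((n, \<sigma>), a, b, U)"
  and indec: "\<And>a b U. [|valid r ((n, \<sigma>), a, b, U); U 0 = {a, b}|] ==> P a b U"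
  and split: "\<And>a b c U V. [|valid r ((n, \<sigma>), a, b, U); valid r ((n, \<sigma>), b, c, V); P a b U; P b c V|]
    ==> P a c (\<lambda>t\<in>{..r}. U t \<union> V t)"
 shows "P a b U"
 using val
proof (induction "b - a" arbitrary: a b U rule: less_induct)
 case less
 note u = validD[OF less.prems]
 show ?case
 proof (cases "U 0 = {a, b}")
  case True
  then show ?thesis by (rule indec[OF less.prems])
 next
  case False
  then obtain v where v: "v \<in> U 0" "v \<noteq> a" "v \<noteq> b" using u(7,8)[of 0] by auto
  then have av: "a < v" "v < b" using u(6)[of 0] by fastforce+
  have vt: "v \<in> U t" if "t \<le> r" for t using u(11)[OF that] v(1) by auto
  define U1 U2 where "U1 = (\<lambda>t\<in>{..r}. U t \<inter> {a..v})" and "U2 = (\<lambda>t\<in>{..r}. U t \<inter> {v..b})"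
  have mono: "U p \<subseteq> U q" if "p \<le> q" "q \<le> r" for p q using chains_inD(2)[OF u(4) that] .
  have "U1 \<in> chains_in (cube_poset a v) r" unfolding U1_def
   by (rule chains_in_restrict) (use vt u(7) av in \<open>auto simp: cube_poset_def dest: subsetD[OF mono]\<close>)
  then have V1: "valid r ((n, \<sigma>), a, v, U1)" using u av by (auto simp: valid.simps)
  have "U2 \<in> chains_in (cube_poset v b) r" unfolding U2_def
   by (rule chains_in_restrict) (use vt u(8) av in \<open>auto simp: cube_poset_def dest: subsetD[OF mono]\<close>)
  then have V2: "valid r ((n, \<sigma>), v, b, U2)" using u av by (auto simp: valid.simps)
  have "U = (\<lambda>t\<in>{..r}. U1 t \<union> U2 t)"
  proof
   fix t show "U t = (\<lambda>t\<in>{..r}. U1 t \<union> U2 t) t"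
    using u(6)[of t] chains_inD(3)[OF u(4), of t] av by (cases "t \<le> r") (auto simp: U1_def U2_def)
  qed
  moreover have "P a v U1" by (rule less.hyps[OF _ V1]) (use av in auto)
  moreover have "P v b U2" by (rule less.hyps[OF _ V2]) (use av in auto)
  ultimately show ?thesis using split[OF V1 V2] by simp
 qed
qed

text \<open>Both sides split in the same way, and for letters that do not split the decomposition of a face of
 \<open>sact S m n \<theta> \<sigma>\<close> is that of its image in \<open>\<sigma>\<close>.\<close>

lemma nf_arrow:
 assumes \<sigma>: "\<sigma> \<in> spx S n" and \<theta>: "\<theta> \<in> mono_maps m n" and U: "valid r ((m, sact S m n \<theta> \<sigma>), a, b, U)"
 shows "nf_letter r ((m, sact S m n \<theta> \<sigma>), a, b, U) = nf_letter r ((n, \<sigma>), \<theta> a, \<theta> b, \<lambda>q\<in>{..r}. \<theta> ` U q)"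
 using U
proof (induction rule: letter_induct)
 case (indec i j U)
 note u = validD[OF indec(1)]
 let ?V = "\<lambda>q\<in>{..r}. \<theta> ` U q"
 have V: "valid r ((n, \<sigma>), \<theta> i, \<theta> j, ?V)" by (rule valid_arrow[OF \<sigma> \<theta> indec(1)])
 note v = validD[OF V]
 have W: "?V r \<subseteq> {..n}" "?V r \<noteq> {}" using v(9)[of r] v(7)[of r] by auto
 obtain k \<tau> s where E: "ez S n \<sigma> (?V r) k \<tau> s" "\<not> degenerate S k \<tau>"
  using ez_exists[OF S W \<sigma>] by blast
 have E': "ez S m (sact S m n \<theta> \<sigma>) (U r) k \<tau> (s \<circ> \<theta>)"
  unfolding ez_def
 proof (intro conjI allI impI ballI)
  show "\<tau> \<in> spx S k" by (rule ezD(1)[OF E(1)])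
  show "(s \<circ> \<theta>) ` U r = {..k}" using ezD(2)[OF E(1)] by (simp add: image_comp)
  show "(s \<circ> \<theta>) p \<le> (s \<circ> \<theta>) q" if "p \<in> U r" "q \<in> U r" "p \<le> q" for p q
   using ezD(3)[OF E(1)] mono_mapsD(2)[OF \<theta>, of p q] u(9)[of r] that by auto
  fix l \<psi> assume \<psi>: "\<psi> \<in> mono_maps l m" "\<psi> ` {..l} \<subseteq> U r"
  have "compose {..l} \<theta> \<psi> ` {..l} \<subseteq> ?V r" using \<psi>(2) by (auto simp: compose_def)
  from ezD(5)[OF E(1) compose_mono_maps[OF \<psi>(1) \<theta>] this] act_act[OF S \<psi>(1) \<theta> \<sigma>]
  show "sact S l m \<psi> (sact S m n \<theta> \<sigma>) = sact S l k (compose {..l} (s \<circ> \<theta>) \<psi>) \<tau>"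
   by (simp add: compose_def cong: restrict_cong)
 qed
 have V0: "?V 0 = {\<theta> i, \<theta> j}" using indec(2) by simp
 show ?case
  unfolding nf_indecomposable[OF indec(1,2) E' E(2)] nf_indecomposable[OF V V0 E]
  by (simp add: image_comp cong: restrict_cong)
next
 case (split a b c U V)
 have eq: "(\<lambda>q\<in>{..r}. \<theta> ` (\<lambda>t\<in>{..r}. U t \<union> V t) q) = (\<lambda>t\<in>{..r}. (\<lambda>q\<in>{..r}. \<theta> ` U q) t \<union> (\<lambda>q\<in>{..r}. \<theta> ` V q) t)"
  by (auto simp: fun_eq_iff)
 show ?case
  unfolding nf_comp[OF split(1,2)] split(3,4) eq
   nf_comp[OF valid_arrow[OF \<sigma> \<theta> split(1)] valid_arrow[OF \<sigma> \<theta> split(2)]] ..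
qed

lemma nf_ident: "nf_letter r ((n, \<sigma>), a, a, U) = []" by (simp add: nf_letter.simps)

lemma nf_eqv: "eqv r w w' ==> nf r w = nf r w'"
 unfolding eqv_def
proof (induction rule: colim_eq.induct)
 case (rule s t u v)
 have val: "\<forall>l\<in>set s. valid r l" using rule(2) by (simp add: colim_path_iff ball_Un)
 have "nf r s = nf r t" using rule(1) val
 proof (cases rule: eqv_cases)
  case (arr m n \<theta> \<sigma> a b U)
  then show ?thesis using nf_arrow[OF arr(1,2), of r a b U] val by (simp add: nf_single)
 next
  case (cmp j a b c U V)
  obtain n \<sigma> where j: "j = (n, \<sigma>)" by (cases j)
  have "nf r [(j, a, b, U), (j, b, c, V)] = nf_letter r (j, a, b, U) @ nf_letter r (j, b, c, V)"
   by (simp add: nf_def)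
  then show ?thesis using nf_comp[of r n \<sigma> a b U c V] val cmp by (simp add: nf_single j)
 next
  case (idt n \<sigma> a)
  then show ?thesis by (simp add: nf_def nf_ident)
 qed
 then show ?case by (simp add: nf_append)
qed auto

lemma eqv_nf_letter: "valid r ((n, \<sigma>), a, b, U) ==> eqv r [((n, \<sigma>), a, b, U)] (nf_letter r ((n, \<sigma>), a, b, U))"
proof (induction rule: letter_induct)
 case (indec i j U)
 note u = validD[OF indec(1)]
 have W: "U r \<subseteq> {..n}" "U r \<noteq> {}" using u(7,9)[of r] by auto
 obtain k \<tau> s where E: "ez S n \<sigma> (U r) k \<tau> s" "\<not> degenerate S k \<tau>"
  using ez_exists[OF S W u(1)] by blast
 let ?W = "U r"
 obtain c \<epsilon> where \<epsilon>m: "\<epsilon> \<in> mono_maps c n" and im: "cnt ?W ` ?W = {..c}"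
  and \<epsilon>: "\<And>t. t \<le> c ==> \<epsilon> t \<in> ?W \<and> cnt ?W (\<epsilon> t) = t" and \<epsilon>_cnt: "\<And>u. u \<in> ?W ==> \<epsilon> (cnt ?W u) = u"
  by (rule enumerate_subset[OF W]) (rule that)
 have \<epsilon>W: "\<epsilon> ` {..c} \<subseteq> ?W" using \<epsilon> by auto
 define V where "V = (\<lambda>t\<in>{..r}. cnt ?W ` U t)"
 have sub: "U t \<subseteq> ?W" if "t \<le> r" for t using u(10)[OF that] .
 have cle: "cnt ?W v \<le> c" if "v \<in> ?W" for v using im that by auto
 have i0: "cnt ?W i = 0"
 proof -
  have "{v \<in> ?W. v < i} = {}" using u(6)[of r] by auto
  then show ?thesis by (simp add: cnt_def)
 qed
 have jc: "cnt ?W j = c"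
 proof -
  have "c \<in> cnt ?W ` ?W" using im by simp
  then obtain v where "v \<in> ?W" "cnt ?W v = c" by auto
  moreover from this have "v \<le> j" using u(6)[of r] by auto
  ultimately show ?thesis using cnt_mono[of v j ?W] cle[OF u(8)[of r]] by simp
 qed
 have "V \<in> chains_in (cube_poset 0 c) r"
  unfolding V_def
 proof (rule chains_in_restrict)
  fix t assume t: "t \<le> r"
  show "cnt ?W ` U t \<in> cube_poset 0 c"
   using cle sub[OF t] u(7,8)[OF t] i0 jc by (auto simp: cube_poset_def intro: rev_image_eqI)
 qed (use chains_inD(2)[OF u(4)] in \<open>auto intro: image_mono\<close>)
 then have V: "valid r ((c, sact S c n \<epsilon> \<sigma>), 0, c, V)"
  using act_closed[OF S \<epsilon>m u(1)] by (simp add: valid.simps)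
 have ends: "\<epsilon> 0 = i" "\<epsilon> c = j" using \<epsilon>_cnt[OF u(7)[of r]] \<epsilon>_cnt[OF u(8)[of r]] i0 jc by auto
 have "(\<lambda>q\<in>{..r}. \<epsilon> ` V q) = U"
 proof
  fix q
  have "\<epsilon> ` V q = U q" if "q \<le> r"
   unfolding V_def using that sub[OF that] \<epsilon>_cnt by (auto simp: image_image subset_eq)
  then show "(\<lambda>q\<in>{..r}. \<epsilon> ` V q) q = U q" using chains_inD(3)[OF u(4), of q] by (cases "q \<le> r") auto
 qed
 then have 1: "eqv r [((c, sact S c n \<epsilon> \<sigma>), 0, c, V)] [((n, \<sigma>), i, j, U)]"
  using eqv_arrow[OF u(1) \<epsilon>m V] ends by simp
 let ?\<phi> = "compose {..c} s \<epsilon>"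
 have \<phi>: "?\<phi> \<in> mono_maps c k" by (rule ez_compose_mono[OF E(1) \<epsilon>m \<epsilon>W])
 have eq: "sact S c n \<epsilon> \<sigma> = sact S c k ?\<phi> \<tau>" by (rule ezD(5)[OF E(1) \<epsilon>m \<epsilon>W])
 have V': "valid r ((c, sact S c k ?\<phi> \<tau>), 0, c, V)" using V eq by simp
 note si = ez_ends(1)[OF E(1) u(6)[of r, OF order_refl] u(7)[of r, OF order_refl] u(8)[of r, OF order_refl]]
  and sj = ez_ends(2)[OF E(1) u(6)[of r, OF order_refl] u(7)[of r, OF order_refl] u(8)[of r, OF order_refl]]
 have \<phi>ends: "?\<phi> 0 = 0" "?\<phi> c = k" using ends si sj by (auto simp: compose_def)
 have img: "(\<lambda>q\<in>{..r}. ?\<phi> ` V q) = (\<lambda>t\<in>{..r}. s ` U t)"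
 proof -
  have "?\<phi> ` V q = s ` U q" if "q \<le> r" for q
  proof -
   have "?\<phi> (cnt ?W v) = s v" if "v \<in> U q" for v
    using that sub[OF \<open>q \<le> r\<close>] cle[of v] \<epsilon>_cnt[of v] by (auto simp: compose_def)
   then show ?thesis unfolding V_def using that by (simp add: image_image)
  qed
  then show ?thesis by (auto simp: fun_eq_iff)
 qed
 have 2: "eqv r [((c, sact S c n \<epsilon> \<sigma>), 0, c, V)] [((k, \<tau>), 0, k, \<lambda>t\<in>{..r}. s ` U t)]"
  using eqv_arrow[OF ezD(1)[OF E(1)] \<phi> V'] unfolding \<phi>ends img eq .
 have 3: "eqv r [((n, \<sigma>), i, j, U)] [((k, \<tau>), 0, k, \<lambda>t\<in>{..r}. s ` U t)]"
  using eqv_trans[OF eqv_sym[OF 1] 2] .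
 show ?case
 proof (cases "k = 0")
  case True
  have "s ` U t = {0}" if "t \<le> r" for t
   using ezD(4)[OF E(1)] sub[OF that] u(7)[OF that] True by fastforce
  then have "(\<lambda>t\<in>{..r}. s ` U t) = (\<lambda>t\<in>{..r}. {0})" by (auto simp: fun_eq_iff)
  then show ?thesis
   using eqv_trans[OF 3] eqv_ident[OF ezD(1)[OF E(1)], of 0 r] True nf_indecomposable[OF indec E] by simp
 next
  case False
  then show ?thesis using 3 nf_indecomposable[OF indec E] by simp
 qed
next
 case (split a b c U V)
 have "eqv r [((n, \<sigma>), a, c, \<lambda>t\<in>{..r}. U t \<union> V t)] ([((n, \<sigma>), a, b, U)] @ [((n, \<sigma>), b, c, V)])"
  using eqv_sym[OF eqv_comp[OF split(1,2)]] by simp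
 also have "eqv r \<dots> (nf_letter r ((n, \<sigma>), a, b, U) @ nf_letter r ((n, \<sigma>), b, c, V))"
  by (rule eqv_append[OF split(3,4)])
 finally show ?case unfolding nf_comp[OF split(1,2)] .
qed

lemma eqv_nf: "\<forall>l\<in>set w. valid r l ==> eqv r w (nf r w)"
proof (induction w)
 case (Cons l w)
 have "eqv r [l] (nf_letter r l)" using eqv_nf_letter[of r] Cons.prems by (cases l) (auto)
 from eqv_append[OF this, of w "nf r w"] Cons show ?case by (simp add: nf_def)
qed (auto intro: eqv_refl simp: nf_def)

text \<open>The generating relations preserve the normal form, and a path is equivalent to its normal form.\<close>

theorem cls_eq_iff_nf:
 assumes "\<forall>l\<in>set w. valid r l" "\<forall>l\<in>set w'. valid r l"
 shows "cls r w = cls r w' \<longleftrightarrow> nf r w = nf r w'"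
 unfolding cls_eq_iff[OF assms(1)]
 using nf_eqv eqv_nf[OF assms(1)] eqv_sym[OF eqv_nf[OF assms(2)]] eqv_trans by metis

fun normal :: "nat => 's rletter => bool" where
 "normal r ((n, \<sigma>), a, b, U) \<longleftrightarrow> valid r ((n, \<sigma>), a, b, U) \<and> a = 0 \<and> b = n \<and> 0 < n \<and>
   \<not> degenerate S n \<sigma> \<and> U 0 = {0, n} \<and> U r = {0..n}"

lemma normal_valid: "normal r l ==> valid r l" by (cases l) auto

lemma nf_normal_letter: "normal r l ==> nf_letter r l = [l]"
proof -
 assume l: "normal r l"
 obtain n \<sigma> a b U where [simp]: "l = ((n, \<sigma>), a, b, U)" by (cases l) auto
 have U: "valid r ((n, \<sigma>), 0, n, U)" "U 0 = {0, n}" "0 < n" "\<not> degenerate S n \<sigma>" "U r = {0..n}" "a = 0" "b = n"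
  using l by auto
 note u = validD[OF U(1)]
 have "ez S n \<sigma> (U r) n \<sigma> id"
  unfolding ez_def
 proof (intro conjI allI impI ballI)
  fix j \<theta> assume \<theta>: "\<theta> \<in> mono_maps j n"
  have "compose {..j} id \<theta> = \<theta>" using mono_mapsD(3)[OF \<theta>] by (auto simp: compose_def fun_eq_iff not_le)
  then show "sact S j n \<theta> \<sigma> = sact S j n (compose {..j} id \<theta>) \<sigma>" by simp
 qed (use u(1) U(5) in auto)
 from nf_indecomposable[OF U(1,2) this U(4)] show "nf_letter r l = [l]"
  using chains_inD(3)[OF u(4)] U(3,6,7) by (auto simp: fun_eq_iff not_le)
qed

lemma nf_normal: "\<forall>l\<in>set w. normal r l ==> nf r w = w"
 by (induction w) (auto simp: nf_def nf_normal_letter)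

text \<open>This number does not increase under normalization, which bounds the volume of the normal form of a
 face.\<close>

definition vertices_added :: "nat => 's rletter => nat" where
 "vertices_added r = (\<lambda>(j, a, b, U). card (U r - U 0))"

lemma nf_letter_normal:
 "valid r ((n, \<sigma>), a, b, U) ==> (\<forall>l\<in>set (nf_letter r ((n, \<sigma>), a, b, U)). normal r l) \<and>
   (\<Sum>l\<leftarrow>nf_letter r ((n, \<sigma>), a, b, U). vertices_added r l) \<le> card (U r - U 0)"
proof (induction rule: letter_induct)
 case (indec i j U)
 note u = validD[OF indec(1)]
 have W: "U r \<subseteq> {..n}" "U r \<noteq> {}" using u(7,9)[of r] by auto
 obtain k \<tau> s where E: "ez S n \<sigma> (U r) k \<tau> s" "\<not> degenerate S k \<tau>"
  using ez_exists[OF S W u(1)] by blast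
 show ?case
 proof (cases "k = 0")
  case False
  have sub: "U t \<subseteq> U r" if "t \<le> r" for t using u(10)[OF that] .
  note si = ez_ends(1)[OF E(1) u(6)[of r, OF order_refl] u(7)[of r, OF order_refl] u(8)[of r, OF order_refl]]
   and sj = ez_ends(2)[OF E(1) u(6)[of r, OF order_refl] u(7)[of r, OF order_refl] u(8)[of r, OF order_refl]]
  have "(\<lambda>t\<in>{..r}. s ` U t) \<in> chains_in (cube_poset 0 k) r"
  proof (rule chains_in_restrict)
   fix t assume t: "t \<le> r"
   show "s ` U t \<in> cube_poset 0 k"
    using ezD(4)[OF E(1)] sub[OF t] u(7,8)[OF t] si sj by (auto simp: cube_poset_def intro: rev_image_eqI)
  qed (use chains_inD(2)[OF u(4)] in \<open>auto intro: image_mono\<close>)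
  moreover have "s ` U 0 = {0, k}" using indec(2) si sj by simp
  ultimately have "normal r ((k, \<tau>), 0, k, \<lambda>t\<in>{..r}. s ` U t)"
   using E ezD(1,2)[OF E(1)] False by (auto simp: valid.simps)
  moreover have "card (s ` U r - s ` U 0) \<le> card (U r - U 0)"
   using u(12)[of r] by (intro order_trans[OF card_mono card_image_le]) auto
  ultimately show ?thesis
   unfolding nf_indecomposable[OF indec E] using False by (simp add: vertices_added_def)
 qed (use nf_indecomposable[OF indec E] in simp)
next
 case (split a b c U V)
 note u = validD[OF split(1)] and v = validD[OF split(2)]
 have "(U r \<union> V r) - (U 0 \<union> V 0) = (U r - U 0) \<union> (V r - V 0)"
 proof -
  have "x = b" if "x \<in> U p" "x \<in> V q" "p \<le> r" "q \<le> r" for x p q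
   using that u(6)[of p] v(6)[of q] by (meson atLeastAtMost_iff le_antisym subsetD)
  then have "U r \<inter> V 0 \<subseteq> U 0" "V r \<inter> U 0 \<subseteq> V 0" using u(8)[of 0] v(7)[of 0] by auto
  then show ?thesis by auto
 qed
 moreover have "(U r - U 0) \<inter> (V r - V 0) = {}"
 proof -
  have "x = b" if "x \<in> U r" "x \<in> V r" for x
   using that u(6)[of r] v(6)[of r] by (meson atLeastAtMost_iff le_antisym le_refl subsetD)
  then show ?thesis using u(8)[of 0] by auto
 qed
 ultimately have "card ((U r \<union> V r) - (U 0 \<union> V 0)) = card (U r - U 0) + card (V r - V 0)"
  using u(12)[of r] v(12)[of r] by (simp add: card_Un_disjoint)
 then show ?case unfolding nf_comp[OF split(1,2)] using split(3,4) by auto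
qed

lemma nf_set_normal: "[|\<forall>l\<in>set w. valid r l; l \<in> set (nf r w)|] ==> normal r l"
 using nf_letter_normal by (fastforce simp: nf_def)

lemma nf_vertices_added:
 "\<forall>l\<in>set w. valid r l ==> (\<Sum>l\<leftarrow>nf r w. vertices_added r l) \<le> (\<Sum>l\<leftarrow>w. vertices_added r l)"
proof (induction w)
 case (Cons l w)
 obtain n \<sigma> a b U where [simp]: "l = ((n, \<sigma>), a, b, U)" by (cases l) auto
 have "(\<Sum>l\<leftarrow>nf_letter r l. vertices_added r l) \<le> vertices_added r l"
  using nf_letter_normal[of r n \<sigma> a b U] Cons.prems by (simp add: vertices_added_def)
 then show ?case using Cons by (simp add: nf_def)
qed (simp add: nf_def)

end

section \<open>Acyclic matchings\<close>

text \<open>A family of pairs of basis elements in consecutive degrees with unit incidence numbers that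
 are triangular with respect to a rank.\<close>

locale matching =
 fixes d :: "'c => ('b \<Rightarrow>\<^sub>0 'k::{comm_ring,comm_monoid_mult})" and I :: "'i set"
  and lo :: "'i => 'b" and hi :: "'i => 'c" and rank :: "'i => nat"
 assumes inj_lo: "inj_on lo I" and inj_hi: "inj_on hi I"
  and incidence: "c \<in> I ==> \<exists>\<epsilon>. \<epsilon> * \<epsilon> = 1 \<and> lookup (d (hi c)) (lo c) = \<epsilon>"
  and triangular: "[|c \<in> I; c' \<in> I; c' \<noteq> c; lookup (d (hi c)) (lo c') \<noteq> 0|]
    ==> rank c' < rank c"
begin

text \<open>A pair of largest rank in \<open>x\<close> has a lower element that occurs in no other boundary.\<close>

lemma matching_injective:
 assumes keys: "keys x \<subseteq> hi ` I" and zero: "\<And>c. c \<in> I ==> lookup (lin d x) (lo c) = 0"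
 shows "x = 0"
proof (rule ccontr)
 assume "x \<noteq> 0"
 define J where "J = {c \<in> I. hi c \<in> keys x}"
 have "finite (hi ` J)" by (rule finite_subset[of _ "keys x"]) (auto simp: J_def)
 then have fin: "finite J" by (rule finite_imageD) (rule inj_on_subset[OF inj_hi], auto simp: J_def)
 obtain u where "u \<in> keys x" using \<open>x \<noteq> 0\<close> by (metis keys_eq_empty ex_in_conv)
 then have "J \<noteq> {}" using keys by (auto simp: J_def)
 then have "Max (rank ` J) \<in> rank ` J" using fin by (intro Max_in) auto
 then obtain c where c: "c \<in> J" "rank c = Max (rank ` J)" by auto
 have max: "rank c' \<le> rank c" if "c' \<in> J" for c' unfolding c(2) using fin that by (intro Max_ge) auto
 have cI: "c \<in> I" "hi c \<in> keys x" using c(1) by (auto simp: J_def)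
 obtain \<epsilon> where \<epsilon>: "\<epsilon> * \<epsilon> = 1" "lookup (d (hi c)) (lo c) = \<epsilon>" using incidence[OF cI(1)] by blast
 have "0 = (\<Sum>u\<in>keys x. lookup x u * lookup (d u) (lo c))"
  using zero[OF cI(1)] by (simp add: lookup_lin)
 also have "\<dots> = (\<Sum>u\<in>{hi c}. lookup x u * lookup (d u) (lo c))"
 proof (rule sum.mono_neutral_right)
  show "\<forall>u\<in>keys x - {hi c}. lookup x u * lookup (d u) (lo c) = 0"
  proof
   fix u assume u: "u \<in> keys x - {hi c}"
   then obtain c' where c': "c' \<in> I" "u = hi c'" using keys by auto
   then have "c' \<in> J" "c \<noteq> c'" using u by (auto simp: J_def)
   then have "lookup (d (hi c')) (lo c) = 0"
    using triangular[OF c'(1) cI(1)] max[of c'] by (meson not_le)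
   then show "lookup x u * lookup (d u) (lo c) = 0" by (simp add: c'(2))
  qed
 qed (use cI in auto)
 finally have "lookup x (hi c) * \<epsilon> = 0" using \<epsilon> by simp
 then have "lookup x (hi c) * (\<epsilon> * \<epsilon>) = 0" by (simp flip: mult.assoc)
 then show False using cI(2) \<epsilon>(1) by (simp add: in_keys_iff)
qed

text \<open>Coefficients at lower elements are removed in the order of decreasing rank.\<close>

lemma matching_surjective:
 "\<exists>x. keys x \<subseteq> hi ` I \<and> (\<forall>c\<in>I. lookup (y - lin d x) (lo c) = 0)"
proof -
 have "\<exists>x. keys x \<subseteq> hi ` I \<and> (\<forall>c\<in>I. lookup (y - lin d x) (lo c) = 0)"
  if "\<And>c. [|c \<in> I; lo c \<in> keys y|] ==> rank c < N" for N y
  using that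
 proof (induction N arbitrary: y)
  case 0
  then have "\<forall>c\<in>I. lookup y (lo c) = 0" by (auto simp: in_keys_iff)
  then show ?case by (intro exI[of _ 0]) simp
 next
  case (Suc N)
  define J where "J = {c \<in> I. lo c \<in> keys y \<and> rank c = N}"
  have "finite (lo ` J)" by (rule finite_subset[of _ "keys y"]) (auto simp: J_def)
  then have fin: "finite J" by (rule finite_imageD) (rule inj_on_subset[OF inj_lo], auto simp: J_def)
  define \<epsilon> where "\<epsilon> c = lookup (d (hi c)) (lo c)" for c
  have \<epsilon>: "\<epsilon> c * \<epsilon> c = 1" if "c \<in> I" for c using incidence[OF that] by (auto simp: \<epsilon>_def)
  define x0 where "x0 = (\<Sum>c\<in>J. scale (lookup y (lo c) * \<epsilon> c) (gen (hi c)))"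
  have k0: "keys x0 \<subseteq> hi ` I"
   unfolding x0_def by (rule keys_sum_subset) (use keys_scale keys_gen in \<open>fastforce simp: J_def\<close>)
  have d0: "lin d x0 = (\<Sum>c\<in>J. scale (lookup y (lo c) * \<epsilon> c) (d (hi c)))"
   by (simp add: x0_def lin_sum lin_scale)
  have low: "rank c < N" if cI: "c \<in> I" and ck: "lo c \<in> keys (y - lin d x0)" for c
  proof (rule ccontr)
   assume ge: "\<not> rank c < N"
   have L: "lookup (lin d x0) (lo c)
     = (\<Sum>c'\<in>J. lookup y (lo c') * \<epsilon> c' * lookup (d (hi c')) (lo c))"
    by (simp add: d0 lookup_sum lookup_scale)
   have other: "lookup (d (hi c')) (lo c) = 0" if "c' \<in> J" "c' \<noteq> c" for c'
    using triangular[of c' c] that cI ge by (auto simp: J_def)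
   have "lookup (lin d x0) (lo c) = lookup y (lo c)"
   proof (cases "c \<in> J")
    case True
    have "lookup (lin d x0) (lo c)
     = (\<Sum>c'\<in>{c}. lookup y (lo c') * \<epsilon> c' * lookup (d (hi c')) (lo c))"
     unfolding L by (rule sum.mono_neutral_right) (use fin True other in auto)
    then show ?thesis using \<epsilon>[OF cI] by (simp add: \<epsilon>_def[symmetric] mult.assoc)
   next
    case False
    then have "lookup (lin d x0) (lo c) = 0" unfolding L
     by (intro sum.neutral ballI) (metis other False mult_zero_right)
    moreover have "lo c \<notin> keys y" using False Suc.prems[OF cI] cI ge by (auto simp: J_def)
    ultimately show ?thesis by (simp add: in_keys_iff)
   qed
   then show False using ck by (simp add: in_keys_iff lookup_minus)
  qed
  then obtain x1 where x1: "keys x1 \<subseteq> hi ` I"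
   "\<forall>c\<in>I. lookup (y - lin d x0 - lin d x1) (lo c) = 0"
   using Suc.IH[of "y - lin d x0"] by blast
  show ?case
  proof (intro exI[of _ "x0 + x1"] conjI)
   show "keys (x0 + x1) \<subseteq> hi ` I" by (rule keys_add_subset[OF k0 x1(1)])
   show "\<forall>c\<in>I. lookup (y - lin d (x0 + x1)) (lo c) = 0"
    using x1(2) by (simp add: lin_add diff_diff_add)
  qed
 qed
 moreover obtain N where "\<And>c. [|c \<in> I; lo c \<in> keys y|] ==> rank c < N"
 proof -
  have "finite (lo ` {c \<in> I. lo c \<in> keys y})"
   by (rule finite_subset[of _ "keys y"]) auto
  then have "finite {c \<in> I. lo c \<in> keys y}"
   by (rule finite_imageD) (rule inj_on_subset[OF inj_lo], auto)
  then have "finite (rank ` {c \<in> I. lo c \<in> keys y})" by simp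
  then have "\<And>c. [|c \<in> I; lo c \<in> keys y|] ==> rank c \<le> Max (rank ` {c \<in> I. lo c \<in> keys y})"
   by (intro Max_ge) auto
  then show ?thesis using that[of "Suc (Max (rank ` {c \<in> I. lo c \<in> keys y}))"] by (simp add: less_Suc_eq_le)
 qed
 ultimately show ?thesis by blast
qed

end

section \<open>The matching on ordered set partitions\<close>

text \<open>An ordered partition of \<open>p\<close> points into \<open>r\<close> blocks is the list of the \<open>p\<close> block numbers.\<close>

definition packed :: "nat => nat list => bool" where
 "packed r b \<longleftrightarrow> set b = {1..r}"

text \<open>The effect of an inner face operator: the blocks \<open>j\<close> and \<open>j + 1\<close> are joined.\<close>

definition merge :: "nat => nat list => nat list" where
 "merge j b = map (\<lambda>y. if y \<le> j then y else y - 1) b"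

text \<open>Points are removed as long as they form the last block by themselves. The first point that does not
 decides: a partition is lower if this point shares its block, and otherwise upper.\<close>

fun lower :: "nat => nat list => bool" where
 "lower r [] = False"
| "lower r (x # ys) = (x \<in> set ys \<or> (x = r \<and> lower (r - 1) ys))"

fun critical :: "nat => nat list => bool" where
 "critical r [] = True"
| "critical r (x # ys) = (x = r \<and> x \<notin> set ys \<and> critical (r - 1) ys)"

text \<open>The deciding point becomes a block of its own, followed by the block of its former companions.\<close>

fun split_block :: "nat => nat list => nat list" where
 "split_block r [] = []"
| "split_block r (x # ys) = (if x \<in> set ys then x # map (\<lambda>y. if x \<le> y then Suc y else y) ys
   else Suc r # split_block (r - 1) ys)"

fun part_rank :: "nat => nat list => nat" where
 "part_rank r [] = 0"
| "part_rank r (x # ys) = (if x \<in> set ys then length (filter (\<lambda>y. y < x) ys)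
   else part_rank (r - 1) ys + Suc (length ys))"

lemma length_merge [simp]: "length (merge j b) = length b" by (simp add: merge_def)

lemma length_split_block [simp]: "length (split_block r b) = length b"
 by (induction r b rule: split_block.induct) auto

lemma packed_Cons_top:
 assumes "packed r (r # ys)" "r \<notin> set ys"
 shows "packed (r - 1) ys" "r = Suc (r - 1)"
proof -
 have ins: "insert r (set ys) = {1..r}" using assms(1) by (simp add: packed_def)
 then have "set ys = {1..r} - {r}" using assms(2) by (metis Diff_insert_absorb)
 moreover have "{1..r} - {r} = {1..r - 1}" by auto
 ultimately show "packed (r - 1) ys" by (simp add: packed_def)
 have "r \<in> {1..r}" unfolding ins[symmetric] by simp
 then show "r = Suc (r - 1)" by auto
qed

lemma packed_split_block: "[|packed r c; lower r c|] ==> packed (Suc r) (split_block r c)"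
proof (induction r c rule: lower.induct)
 case (2 r x ys)
 show ?case
 proof (cases "x \<in> set ys")
  case True
  then have ys: "set ys = {1..r}" using 2(2) by (auto simp: packed_def)
  have "insert x ((\<lambda>y. if x \<le> y then Suc y else y) ` {1..r}) = {1..Suc r}"
  proof (intro equalityI subsetI)
   fix y assume y: "y \<in> {1..Suc r}"
   show "y \<in> insert x ((\<lambda>y. if x \<le> y then Suc y else y) ` {1..r})"
   proof (cases "y < x \<or> y = x")
    case True
    then show ?thesis using y \<open>x \<in> set ys\<close> ys by force
   next
    case False
    then have "y - 1 \<in> {1..r}" "y = Suc (y - 1)" "x \<le> y - 1" using y \<open>x \<in> set ys\<close> ys by auto
    then have "y \<in> (\<lambda>y. if x \<le> y then Suc y else y) ` {1..r}"
     by (intro image_eqI[of _ _ "y - 1"]) auto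
    then show ?thesis by simp
   qed
  qed (use True ys in auto)
  then show ?thesis using True ys by (simp add: packed_def)
 next
  case False
  then have x: "x = r" "lower (r - 1) ys" using 2(3) by auto
  note top = packed_Cons_top[OF 2(2)[unfolded x(1)] False[unfolded x(1)]]
  have "set (split_block (r - 1) ys) = {1..Suc (r - 1)}" using 2(1)[OF top(1) x(2)] by (simp add: packed_def)
  then have "set (split_block (r - 1) ys) = {1..r}" using top(2) by simp
  moreover have "insert (Suc r) {1..r} = {1..Suc r}" by auto
  ultimately show ?thesis using False by (simp add: packed_def)
 qed
qed simp

lemma merge_split_block: "[|packed r c; lower r c|] ==> \<exists>j. 1 \<le> j \<and> j \<le> r \<and> merge j (split_block r c) = c"
proof (induction r c rule: lower.induct)
 case (2 r x ys)
 show ?case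
 proof (cases "x \<in> set ys")
  case True
  then have "x \<in> {1..r}" using 2(2) by (auto simp: packed_def)
  moreover have "map ((\<lambda>y. if y \<le> x then y else y - 1) \<circ> (\<lambda>y. if x \<le> y then Suc y else y)) ys = ys"
   by (rule map_idI) auto
  ultimately show ?thesis using True by (intro exI[of _ x]) (auto simp: merge_def)
 next
  case False
  then have x: "x = r" "lower (r - 1) ys" using 2(3) by auto
  note top = packed_Cons_top[OF 2(2)[unfolded x(1)] False[unfolded x(1)]]
  obtain j where "1 \<le> j" "j \<le> r - 1" "merge j (split_block (r - 1) ys) = ys" using 2(1)[OF top(1) x(2)] by blast
  then show ?thesis using False x top(2) by (intro exI[of _ j]) (auto simp: merge_def)
 qed
qed simp

lemma merge_index_unique:
 assumes u: "packed (Suc r) u" and i: "1 \<le> i" "i \<le> r" and j: "1 \<le> j" "j \<le> r" and eq: "merge i u = merge j u"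
 shows "i = j"
proof -
 have "(if y \<le> i then y else y - 1) = (if y \<le> j then y else y - 1)" if "y \<in> {1..Suc r}" for y
  using eq that u by (auto simp: merge_def packed_def map_eq_conv)
 from this[of "Suc i"] this[of "Suc j"] i j show ?thesis by (auto split: if_splits)
qed

lemma split_block_inj:
 "[|packed r c; lower r c; packed r c'; lower r c'; split_block r c = split_block r c'|] ==> c = c'"
proof (induction r c arbitrary: c' rule: lower.induct)
 case (2 r x ys)
 obtain x' ys' where c': "c' = x' # ys'" using 2(5) by (cases c') auto
 have le: "x \<le> r" "x' \<le> r" using 2(2,4) c' by (auto simp: packed_def)
 show ?case
 proof (cases "x \<in> set ys")
  case True
  then have T': "x' \<in> set ys'" "x' = x" using 2(6) le c' by (auto split: if_splits)
  then have "map (\<lambda>y. if x \<le> y then Suc y else y) ys = map (\<lambda>y. if x \<le> y then Suc y else y) ys'"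
   using 2(6) True c' by simp
  moreover have "inj (\<lambda>y. if x \<le> y then Suc y else y)" by (auto simp: inj_def split: if_splits)
  ultimately show ?thesis using T' c' by (simp add: inj_map_eq_map)
 next
  case False
  then have F': "x' \<notin> set ys'" using 2(6) le c' by (auto split: if_splits)
  then have x: "x = r" "lower (r - 1) ys" "x' = r" "lower (r - 1) ys'" using 2(3,5) False c' by auto
  have "packed (r - 1) ys" "packed (r - 1) ys'"
   using packed_Cons_top(1) 2(2,4) x False F' c' by metis+
  then show ?thesis using 2(1)[of ys'] 2(6) x False F' c' by auto
 qed
qed simp

text \<open>In an upper partition the deciding point is a block that is not the last one; it is split off from
 the block that follows.\<close>

lemma packed_cases: "packed R u ==> lower R u \<or> critical R u \<or> (\<exists>r c. R = Suc r \<and> packed r c \<and> lower r c \<and> u = split_block r c)"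
proof (induction R u rule: lower.induct)
 case (2 R x ys)
 show ?case
 proof (cases "x \<in> set ys")
  case False
  have xR: "x \<in> {1..R}" using 2(2) by (auto simp: packed_def)
  show ?thesis
  proof (cases "x = R")
   case True
   note top = packed_Cons_top[OF 2(2)[unfolded True] False[unfolded True]]
   from 2(1)[OF top(1)] consider "lower (R - 1) ys" | "critical (R - 1) ys"
    | r c where "R - 1 = Suc r" "packed r c" "lower r c" "ys = split_block r c" by blast
   then show ?thesis
   proof cases
    case 3
    have RS: "R = Suc (Suc r)" using 3(1) by simp
    have n: "Suc r \<notin> set c" using 3(2) by (auto simp: packed_def)
    have "packed (Suc r) (Suc r # c)" using 3(2) by (auto simp: packed_def)
    moreover have "lower (Suc r) (Suc r # c)" using 3(3) by simp
    moreover have "x # ys = split_block (Suc r) (Suc r # c)" using n 3(4) RS True by simp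
    ultimately show ?thesis using RS by blast
   qed (use True False in auto)
  next
   case neq: False
   then have R: "0 < R" "x < R" "0 < x" using xR by auto
   have "insert x (set ys) = {1..R}" using 2(2) by (simp add: packed_def)
   then have ys: "set ys = {1..R} - {x}" using False by (metis Diff_insert_absorb)
   define zs where "zs = map (\<lambda>y. if x < y then y - 1 else y) ys"
   have "Suc x \<in> set ys" using R by (simp add: ys)
   then have xz: "x \<in> set zs" unfolding zs_def by (force simp: image_iff)
   have "y \<in> {1..R - 1}" if y: "y \<in> set zs" for y
   proof -
    obtain v where "v \<in> set ys" "y = (if x < v then v - 1 else v)"
     using y unfolding zs_def set_map by blast
    then show ?thesis using R by (auto simp: ys)
   qed
   then have "set zs \<subseteq> {1..R - 1}" by (rule subsetI)
   moreover have "{1..R - 1} \<subseteq> insert x (set zs)"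
   proof
    fix y assume y: "y \<in> {1..R - 1}"
    show "y \<in> insert x (set zs)"
    proof (cases "y < x")
     case True
     have "y \<in> set ys" unfolding ys using y True R by simp
     then have "(if x < y then y - 1 else y) \<in> set zs" unfolding zs_def set_map by (intro imageI)
     then show ?thesis using True by simp
    next
     case False
     show ?thesis
     proof (cases "y = x")
      case False
      have "Suc y \<in> set ys" "x < Suc y" unfolding ys using y False \<open>\<not> y < x\<close> R by auto
      then have "(if x < Suc y then Suc y - 1 else Suc y) \<in> set zs"
       unfolding zs_def set_map by (intro imageI)
      then show ?thesis using \<open>x < Suc y\<close> by simp
     qed simp
    qed
   qed
   ultimately have "packed (R - 1) (x # zs)" using xz by (auto simp: packed_def)
   moreover have "map (\<lambda>y. if x \<le> y then Suc y else y) zs = ys"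
    unfolding zs_def map_map
   proof (rule map_idI)
    fix y assume "y \<in> set ys"
    then have "y \<noteq> x" using False by blast
    then show "((\<lambda>y. if x \<le> y then Suc y else y) \<circ> (\<lambda>y. if x < y then y - 1 else y)) y = y"
     by (cases "x < y") auto
   qed
   then have "split_block (R - 1) (x # zs) = x # ys" using xz by simp
   moreover have "lower (R - 1) (x # zs)" using xz by simp
   moreover have "R = Suc (R - 1)" using R by simp
   ultimately show ?thesis by metis
  qed
 qed simp
qed simp

lemma part_rank_bound: "part_rank r b \<le> length b * length b"
proof (induction r b rule: part_rank.induct)
 case (2 r x ys)
 have "length (filter (\<lambda>y. y < x) ys) \<le> length ys" by (rule length_filter_le)
 also have "\<dots> \<le> Suc (length ys) * Suc (length ys)" by simp
 finally have "length (filter (\<lambda>y. y < x) ys) \<le> Suc (length ys) * Suc (length ys)" .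
 then show ?case using 2 by auto
qed simp

lemma part_rank_decreases:
 "[|packed r c; lower r c; 1 \<le> i; i \<le> r; lower r (merge i (split_block r c)); merge i (split_block r c) \<noteq> c|]
  ==> part_rank r (merge i (split_block r c)) < part_rank r c"
proof (induction r c rule: lower.induct)
 case (2 r x ys)
 let ?m = "\<lambda>y. if y \<le> i then y else y - 1"
 show ?case
 proof (cases "x \<in> set ys")
  case True
  then have x: "1 \<le> x" "x \<le> r" and ys: "set ys = {1..r}" using 2(2) by (auto simp: packed_def)
  let ?s = "\<lambda>y. if x \<le> y then Suc y else y"
  define zs where "zs = map ?m (map ?s ys)"
  have m: "merge i (split_block r (x # ys)) = ?m x # zs"
   using True by (simp add: merge_def zs_def)
  have "i \<noteq> x"
  proof
   assume "i = x"
   then have "zs = ys" unfolding zs_def map_map by (intro map_idI) auto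
   then show False using 2(7) m \<open>i = x\<close> by simp
  qed
  have zs_mem: "y \<in> set zs \<longleftrightarrow> (\<exists>v\<in>{1..r}. y = ?m (?s v))" for y
   unfolding zs_def set_map ys image_image by (rule image_iff)
  have low: "lower r (?m x # zs)" using 2(6) m by simp
  show ?thesis
  proof (cases "Suc i = x")
   case True
   have mx: "?m x = i" using True by simp
   have "i \<in> set zs" unfolding zs_mem using True 2(4) x \<open>1 \<le> i\<close> by (intro bexI[of _ i]) auto
   then have "part_rank r (?m x # zs) = length (filter (\<lambda>y. y < i) zs)" using mx by simp
   also have "\<dots> = length (filter (\<lambda>y. y < i) ys)"
    unfolding zs_def using True by (auto simp: filter_map o_def intro!: arg_cong[of _ _ length] filter_cong)
   also have "\<dots> < length (filter (\<lambda>y. y < x) ys)"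
   proof -
    have "i \<in> set ys" using ys True 2(4) x \<open>1 \<le> i\<close> by auto
    then have "length (filter (\<lambda>y. y < i) ys) < length (filter (\<lambda>y. y < x) ys)"
     using True
    proof (induction ys)
     case (Cons a as)
     have "length (filter (\<lambda>y. y < i) as) \<le> length (filter (\<lambda>y. y < x) as)"
      by (induction as) (use Cons(3) in auto)
     then show ?case using Cons by (auto simp: less_Suc_eq_le)
    qed simp
    then show ?thesis .
   qed
   finally show ?thesis using m \<open>x \<in> set ys\<close> by simp
  next
   case False
   have nin: "?m x \<notin> set zs"
   proof
    assume "?m x \<in> set zs"
    then obtain v where "v \<in> {1..r}" "?m x = ?m (?s v)" using zs_mem by auto
    then show False using False \<open>i \<noteq> x\<close> by (auto split: if_splits)
   qed
   moreover have "?m x \<noteq> r"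
   proof
    assume mr: "?m x = r"
    then have "x = r" using x by (auto split: if_splits)
    then show False using mr \<open>i \<noteq> x\<close> 2(5) x by (auto split: if_splits)
   qed
   ultimately show ?thesis using low by simp
  qed
 next
  case False
  then have x: "x = r" "lower (r - 1) ys" using 2(3) by auto
  note top = packed_Cons_top[OF 2(2)[unfolded x(1)] False[unfolded x(1)]]
  have sb: "split_block r (x # ys) = Suc r # split_block (r - 1) ys" using False by simp
  have m: "merge i (split_block r (x # ys)) = r # merge i (split_block (r - 1) ys)"
   unfolding sb using 2(5) by (simp add: merge_def)
  have sset: "set (split_block (r - 1) ys) = {1..r}" using packed_split_block[OF top(1) x(2)] top(2) by (simp add: packed_def)
  show ?thesis
  proof (cases "i = r")
   case True
   have "r \<in> set (merge i (split_block (r - 1) ys))"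
    using sset True 2(4) by (auto simp: merge_def image_iff intro!: bexI[of _ r])
   then have "part_rank r (r # merge i (split_block (r - 1) ys))
     = length (filter (\<lambda>y. y < r) (merge i (split_block (r - 1) ys)))" by simp
   also have "\<dots> \<le> length ys" using length_filter_le[of "\<lambda>y. y < r" "merge i (split_block (r - 1) ys)"] by simp
   finally show ?thesis unfolding m using False by simp
  next
   case neq: False
   then have ir: "i \<le> r - 1" using 2(5) by simp
   have nin: "r \<notin> set (merge i (split_block (r - 1) ys))"
    using sset neq 2(5) by (auto simp: merge_def split: if_splits)
   then have "lower (r - 1) (merge i (split_block (r - 1) ys))" using 2(6) m by simp
   moreover have "merge i (split_block (r - 1) ys) \<noteq> ys" using 2(7) m x(1) by auto
   ultimately have "part_rank (r - 1) (merge i (split_block (r - 1) ys)) < part_rank (r - 1) ys"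
    using 2(1)[OF top(1) x(2) 2(4) ir] by simp
   then show ?thesis unfolding m using nin False by simp
  qed
 qed
qed simp

lemma critical_iff: "packed r b ==> critical r b \<longleftrightarrow> b = rev [1..<Suc r]"
proof (induction r b rule: critical.induct)
 case (1 r)
 then show ?case by (auto simp: packed_def)
next
 case (2 r x ys)
 show ?case
 proof
  assume c: "critical r (x # ys)"
  then have x: "x = r" "r \<notin> set ys" by auto
  note top = packed_Cons_top[OF 2(2)[unfolded x(1)] x(2)]
  then have "ys = rev [1..<Suc (r - 1)]" using 2(1)[OF top(1)] c by simp
  then have "x # ys = rev ([1..<r] @ [r])" using x top(2) by simp
  also have "[1..<r] @ [r] = [1..<Suc r]" using top(2) by (metis One_nat_def le_add1 plus_1_eq_Suc upt_Suc)
  finally show "x # ys = rev [1..<Suc r]" .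
 next
  assume eq: "x # ys = rev [1..<Suc r]"
  then have "r \<noteq> 0" by (cases "r = 0") simp_all
  then have "[1..<Suc r] = [1..<r] @ [r]" by simp
  then have x: "x = r" "ys = rev [1..<r]" using eq by auto
  then have "r \<notin> set ys" by auto
  note top = packed_Cons_top[OF 2(2)[unfolded x(1)] this]
  then show "critical r (x # ys)" using 2(1)[OF top(1)] x top(2) \<open>r \<notin> set ys\<close> by simp
 qed
qed

lemma distinct_not_lower: "distinct b ==> \<not> lower r b"
 by (induction r b rule: lower.induct) auto

section \<open>The cells of the simplicial monoid\<close>

text \<open>The list \<open>bs\<close> contains the times at which the inner vertices \<open>1, \<dots>, n - 1\<close> join.\<close>

fun word_letter :: "nat => nat \<times> 's => nat list => 's rletter" where
 "word_letter r (n, \<tau>) bs = ((n, \<tau>), 0, n, \<lambda>t\<in>{..r}. {0, n} \<union> {v \<in> {1..<n}. bs ! (v - 1) \<le> t})"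

fun build :: "nat => (nat \<times> 's) list => nat list => 's rletter list" where
 "build r [] bs = []"
| "build r (s # sh) bs = word_letter r s (take (fst s - 1) bs) # build r sh (drop (fst s - 1) bs)"

text \<open>The number of inner vertices of the letters, which is the dimension of the product of their cubes.\<close>

definition vol :: "(nat \<times> 's) list => nat" where
 "vol sh = (\<Sum>s\<leftarrow>sh. fst s - 1)"

lemma vol_simps [simp]: "vol [] = 0" "vol (s # sh) = (fst s - 1) + vol sh" "vol (sh @ sh') = vol sh + vol sh'"
 by (simp_all add: vol_def)

text \<open>The time at which a vertex that joins at \<open>b\<close> joins after an operator has been applied.\<close>

definition birth_op :: "(nat => nat) => nat => nat" where
 "birth_op \<psi> b = (LEAST t. b \<le> \<psi> t)"

lemma birth_op:
 assumes \<psi>: "\<psi> \<in> mono_maps k r" "\<psi> k = r" and b: "b \<le> r"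
 shows "t \<le> k ==> birth_op \<psi> b \<le> t \<longleftrightarrow> b \<le> \<psi> t" "birth_op \<psi> b \<le> k"
proof -
 show le: "birth_op \<psi> b \<le> k" unfolding birth_op_def by (rule Least_le) (use \<psi> b in simp)
 have least: "b \<le> \<psi> (birth_op \<psi> b)" unfolding birth_op_def by (rule LeastI[of _ k]) (use \<psi> b in simp)
 assume t: "t \<le> k"
 show "birth_op \<psi> b \<le> t \<longleftrightarrow> b \<le> \<psi> t"
 proof
  assume "birth_op \<psi> b \<le> t"
  then show "b \<le> \<psi> t" using mono_mapsD(2)[OF \<psi>(1), of "birth_op \<psi> b" t] t least by simp
 next
  assume "b \<le> \<psi> t" then show "birth_op \<psi> b \<le> t" unfolding birth_op_def by (rule Least_le)
 qed
qed

lemma birth_op_coface: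
 assumes i: "1 \<le> i" "i \<le> r" and b: "b \<in> {1..Suc r}"
 shows "birth_op (coface r i) b = (if b \<le> i then b else b - 1)"
 unfolding birth_op_def
proof (rule Least_equality)
 show "b \<le> coface r i (if b \<le> i then b else b - 1)" using i b by (auto simp: coface_def)
 show "(if b \<le> i then b else b - 1) \<le> t" if "b \<le> coface r i t" for t
 proof (cases "t \<le> r")
  case True then show ?thesis using that by (auto simp: coface_def split: if_splits)
 next
  case False then show ?thesis using b i by auto
 qed
qed

lemma birth_op_codegeneracy:
 assumes i: "i \<le> m" and b: "b \<in> {1..m}"
 shows "birth_op (codegeneracy m i) b = (if b \<le> i then b else Suc b)"
 unfolding birth_op_def
proof (rule Least_equality)
 show "b \<le> codegeneracy m i (if b \<le> i then b else Suc b)" using i b by (auto simp: codegeneracy_def)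
 show "(if b \<le> i then b else Suc b) \<le> t" if "b \<le> codegeneracy m i t" for t
 proof (cases "t \<le> Suc m")
  case True then show ?thesis using that b i by (auto simp: codegeneracy_def split: if_splits)
 next
  case False then show ?thesis using b i by auto
 qed
qed

context reduced
begin

definition is_shape :: "(nat \<times> 's) list => bool" where
 "is_shape sh \<longleftrightarrow> (\<forall>s\<in>set sh. s \<in> nondegenerate S \<and> 0 < fst s)"

text \<open>A cell is given by its shape, a word of nondegenerate simplices of positive dimension, and by the
 times at which the inner vertices of the letters join.\<close>

definition cell_ok :: "nat => (nat \<times> 's) list => nat list => bool" where
 "cell_ok r sh bs \<longleftrightarrow> is_shape sh \<and> length bs = vol sh \<and> set bs \<subseteq> {1..r}"

definition cell :: "nat => (nat \<times> 's) list => nat list => 's rigid_mor" where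
 "cell r sh bs = cls r (build r sh bs)"

lemma cell_ok_Cons:
 assumes "cell_ok r (s # sh) bs"
 shows "s \<in> nondegenerate S" "0 < fst s" "length (take (fst s - 1) bs) = fst s - 1"
  "set (take (fst s - 1) bs) \<subseteq> {1..r}" "cell_ok r sh (drop (fst s - 1) bs)"
 using assms set_take_subset[of "fst s - 1" bs] set_drop_subset[of "fst s - 1" bs]
 by (auto simp: cell_ok_def is_shape_def)

lemma normal_word_letter:
 assumes s: "(n, \<tau>) \<in> nondegenerate S" "0 < n" and bs: "length bs = n - 1" "set bs \<subseteq> {1..r}"
 shows "normal r (word_letter r (n, \<tau>) bs)"
proof -
 let ?U = "\<lambda>t\<in>{..r}. {0, n} \<union> {v \<in> {1..<n}. bs ! (v - 1) \<le> t}"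
 have b: "1 \<le> bs ! (v - 1) \<and> bs ! (v - 1) \<le> r" if "v \<in> {1..<n}" for v
 proof -
  have "bs ! (v - 1) \<in> set bs" using that bs(1) by (intro nth_mem) auto
  then show ?thesis using bs(2) by auto
 qed
 have "?U \<in> chains_in (cube_poset 0 n) r"
  by (rule chains_in_restrict) (auto simp: cube_poset_def)
 moreover have emp: "{v \<in> {1..<n}. bs ! (v - 1) \<le> 0} = {}" using b by (metis (no_types, lifting) Collect_empty_eq not_one_le_zero le_zero_eq)
 have "?U 0 = {0, n} \<union> {v \<in> {1..<n}. bs ! (v - 1) \<le> 0}" by simp
 then have "?U 0 = {0, n}" unfolding emp by simp
 moreover have "?U r = {0..n}"
 proof (intro equalityI subsetI)
  fix v assume "v \<in> {0..n}"
  then consider "v = 0" | "v = n" | "v \<in> {1..<n}" by fastforce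
  then show "v \<in> ?U r" using b by cases auto
 qed auto
 ultimately show ?thesis using s by (simp add: nondegenerate_def valid.simps)
qed

lemma normal_is_word_letter:
 assumes "normal r l"
 obtains n \<tau> bs where "(n, \<tau>) \<in> nondegenerate S" "0 < n" "length bs = n - 1" "set bs \<subseteq> {1..r}"
  "l = word_letter r (n, \<tau>) bs"
proof -
 obtain n \<tau> a b U where l: "l = ((n, \<tau>), a, b, U)" by (cases l) auto
 have U: "valid r ((n, \<tau>), 0, n, U)" "U 0 = {0, n}" "0 < n" "\<not> degenerate S n \<tau>" "U r = {0..n}" "a = 0" "b = n"
  using assms l by auto
 note u = validD[OF U(1)]
 define B where "B v = (LEAST t. v \<in> U t)" for v
 define bs where "bs = map B [1..<n]"
 have B: "v \<in> U t \<longleftrightarrow> B v \<le> t" "1 \<le> B v" "B v \<le> r" if v: "v \<in> {1..<n}" and t: "t \<le> r" for v t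
 proof -
  have vr: "v \<in> U r" using U(5) v by auto
  have least: "v \<in> U (B v)" unfolding B_def by (rule LeastI[of _ r]) (rule vr)
  show le: "B v \<le> r" unfolding B_def by (rule Least_le) (rule vr)
  have "v \<notin> U 0" using v U(2) by auto
  then show "1 \<le> B v" using least by (cases "B v") auto
  show "v \<in> U t \<longleftrightarrow> B v \<le> t"
  proof
   assume "v \<in> U t" then show "B v \<le> t" unfolding B_def by (rule Least_le)
  next
   assume "B v \<le> t" then show "v \<in> U t" using chains_inD(2)[OF u(4) _ t] least by blast
  qed
 qed
 have nth: "bs ! (v - 1) = B v" if "v \<in> {1..<n}" for v using that by (auto simp: bs_def nth_map)
 have "U = (\<lambda>t\<in>{..r}. {0, n} \<union> {v \<in> {1..<n}. bs ! (v - 1) \<le> t})"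
 proof
  fix t show "U t = (\<lambda>t\<in>{..r}. {0, n} \<union> {v \<in> {1..<n}. bs ! (v - 1) \<le> t}) t"
  proof (cases "t \<le> r")
   case True
   have "v \<in> U t \<longleftrightarrow> v \<in> {0, n} \<union> {v \<in> {1..<n}. bs ! (v - 1) \<le> t}" for v
   proof (cases "v \<in> {1..<n}")
    case True
    then show ?thesis using B(1)[OF True \<open>t \<le> r\<close>] nth[OF True] by auto
   next
    case False
    have "v \<in> U t ==> v \<le> n" using u(6)[OF \<open>t \<le> r\<close>] by auto
    then show ?thesis using False u(7,8)[OF \<open>t \<le> r\<close>] by fastforce
   qed
   then show ?thesis using True by auto
  qed (use chains_inD(3)[OF u(4)] in auto)
 qed
 moreover have "(n, \<tau>) \<in> nondegenerate S" using U(4) u(1) by (simp add: nondegenerate_def)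
 moreover have "set bs \<subseteq> {1..r}" using B(2,3)[of _ r] by (auto simp: bs_def)
 moreover have "length bs = n - 1" by (simp add: bs_def)
 ultimately show ?thesis using that[of n \<tau> bs] U(3,6,7) l by simp
qed

lemma word_letter_inj:
 assumes bs: "length bs = n - 1" "set bs \<subseteq> {1..r}" "length bs' = n' - 1" "set bs' \<subseteq> {1..r}"
  and eq: "word_letter r (n, \<tau>) bs = word_letter r (n', \<tau>') bs'"
 shows "n = n' \<and> \<tau> = \<tau>' \<and> bs = bs'"
proof -
 have n: "n = n'" "\<tau> = \<tau>'" using eq by auto
 have U: "(\<lambda>t\<in>{..r}. {0, n} \<union> {v \<in> {1..<n}. bs ! (v - 1) \<le> t}) = (\<lambda>t\<in>{..r}. {0, n} \<union> {v \<in> {1..<n}. bs' ! (v - 1) \<le> t})"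
  using eq n by simp
 have "bs = bs'"
 proof (rule nth_equalityI)
  show "length bs = length bs'" using bs n by simp
  fix k assume k: "k < length bs"
  have iff: "bs ! k \<le> t \<longleftrightarrow> bs' ! k \<le> t" if "t \<le> r" for t
  proof -
   have "Suc k \<in> {0, n} \<union> {v \<in> {1..<n}. bs ! (v - 1) \<le> t} \<longleftrightarrow> Suc k \<in> {0, n} \<union> {v \<in> {1..<n}. bs' ! (v - 1) \<le> t}"
    using fun_cong[OF U, of t] that by simp
   then show ?thesis using k bs(1) by auto
  qed
  have "bs ! k \<in> {1..r}" by (rule subsetD[OF bs(2) nth_mem[OF k]])
  moreover have "bs' ! k \<in> {1..r}" by (rule subsetD[OF bs(4) nth_mem]) (use k bs n in simp)
  ultimately have "bs ! k \<le> r" "bs' ! k \<le> r" by simp_all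
  then show "bs ! k = bs' ! k" using iff by (meson le_antisym le_refl)
 qed
 then show ?thesis using n by simp
qed

lemma build_normal: "cell_ok r sh bs ==> \<forall>l\<in>set (build r sh bs). normal r l"
proof (induction sh arbitrary: bs)
 case (Cons s sh)
 note c = cell_ok_Cons[OF Cons.prems]
 obtain n \<tau> where s: "s = (n, \<tau>)" by (cases s)
 show ?case using normal_word_letter[of n \<tau> "take (fst s - 1) bs" r] c Cons.IH[OF c(5)]
  by (auto simp: s simp del: word_letter.simps)
qed simp

lemma build_valid: "cell_ok r sh bs ==> \<forall>l\<in>set (build r sh bs). valid r l"
 using build_normal normal_valid by blast

lemma normal_is_build: "\<forall>l\<in>set w. normal r l ==> \<exists>sh bs. cell_ok r sh bs \<and> w = build r sh bs"
proof (induction w)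
 case Nil
 then show ?case by (intro exI[of _ "[]"]) (simp add: cell_ok_def is_shape_def)
next
 case (Cons l w)
 then obtain sh bs where w: "cell_ok r sh bs" "w = build r sh bs" by auto
 obtain n \<tau> bs' where l: "(n, \<tau>) \<in> nondegenerate S" "0 < n" "length bs' = n - 1" "set bs' \<subseteq> {1..r}"
  "l = word_letter r (n, \<tau>) bs'" using normal_is_word_letter[of r l] Cons.prems by auto
 show ?case
  by (intro exI[of _ "(n, \<tau>) # sh"] exI[of _ "bs' @ bs"]) (use w l in \<open>auto simp: cell_ok_def is_shape_def\<close>)
qed

lemma build_inj: "[|cell_ok r sh bs; cell_ok r sh' bs'; build r sh bs = build r sh' bs'|] ==> sh = sh' \<and> bs = bs'"
proof (induction sh arbitrary: bs sh' bs')
 case Nil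
 then show ?case by (cases sh') (auto simp: cell_ok_def)
next
 case (Cons s sh)
 then obtain s' sh2 where sh': "sh' = s' # sh2" by (cases sh') auto
 note c = cell_ok_Cons[OF Cons.prems(1)] and c' = cell_ok_Cons[OF Cons.prems(2)[unfolded sh']]
 obtain n \<tau> n' \<tau>' where s: "s = (n, \<tau>)" "s' = (n', \<tau>')" by (cases s, cases s')
 have 1: "n = n' \<and> \<tau> = \<tau>' \<and> take (fst s - 1) bs = take (fst s' - 1) bs'"
  by (rule word_letter_inj[of _ _ r]) (use c c' s Cons.prems(3) sh' in \<open>auto simp del: word_letter.simps\<close>)
 have 2: "sh = sh2 \<and> drop (fst s - 1) bs = drop (fst s' - 1) bs'"
  by (rule Cons.IH[OF c(5) c'(5)]) (use Cons.prems(3) sh' in auto)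
 have "bs = bs'" using 1 2 append_take_drop_id[of "fst s - 1" bs] append_take_drop_id[of "fst s' - 1" bs'] s by metis
 then show ?case using 1 2 s sh' by simp
qed

lemma build_append: "length bs = vol sh ==> build r (sh @ sh') (bs @ bs') = build r sh bs @ build r sh' bs'"
 by (induction sh arbitrary: bs) auto

lemma cell_spx: "cell_ok r sh bs ==> cell r sh bs \<in> spx M r"
 unfolding cell_def spx_M using build_valid by blast

lemma cls_is_cell:
 assumes w: "\<forall>l\<in>set w. valid r l"
 shows "\<exists>sh bs. cell_ok r sh bs \<and> cls r w = cell r sh bs \<and> vol sh \<le> (\<Sum>l\<leftarrow>w. vertices_added r l)"
proof -
 have n: "\<forall>l\<in>set (nf r w). normal r l" using nf_set_normal[OF w] by blast
 then obtain sh bs where b: "cell_ok r sh bs" "nf r w = build r sh bs" using normal_is_build by blast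
 have "cls r w = cell r sh bs"
  unfolding cell_def cls_eq_iff[OF w] b(2)[symmetric] by (rule eqv_nf[OF w])
 moreover have "(\<Sum>l\<leftarrow>nf r w. vertices_added r l) = vol sh"
 proof -
  have "vertices_added r (word_letter r s bs') = fst s - 1"
   if "normal r (word_letter r s bs')" for s bs'
  proof -
   obtain n \<tau> where s: "s = (n, \<tau>)" by (cases s)
   have "vertices_added r (word_letter r s bs') = card ({0..n} - {0, n})"
    using that by (auto simp: s vertices_added_def)
   also have "{0..n} - {0, n} = {1..<n}" by auto
   finally show ?thesis by (simp add: s)
  qed
  then have "(\<Sum>l\<leftarrow>build r sh bs. vertices_added r l) = vol sh"
   using build_normal[OF b(1)] by (induction sh arbitrary: bs) (auto simp del: word_letter.simps)
  then show ?thesis by (simp add: b(2))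
 qed
 ultimately show ?thesis using nf_vertices_added[OF w] b(1) by auto
qed

lemma spx_is_cell: "c \<in> spx M r ==> \<exists>sh bs. cell_ok r sh bs \<and> c = cell r sh bs"
 using cls_is_cell unfolding spx_M by blast

lemma cell_inj: "[|cell_ok r sh bs; cell_ok r sh' bs'; cell r sh bs = cell r sh' bs'|] ==> sh = sh' \<and> bs = bs'"
 unfolding cell_def using build_inj cls_eq_iff_nf[OF build_valid build_valid] nf_normal[OF build_normal] by metis

lemma mul_cell:
 assumes "cell_ok r sh bs" "cell_ok r sh' bs'"
 shows "mul r (cell r sh bs) (cell r sh' bs') = cell r (sh @ sh') (bs @ bs')" "cell_ok r (sh @ sh') (bs @ bs')"
 unfolding cell_def mul_cls[OF build_valid[OF assms(1)] build_valid[OF assms(2)]]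
 using assms by (auto simp: build_append cell_ok_def is_shape_def)

lemma lact_word_letter:
 assumes \<psi>: "\<psi> \<in> mono_maps k r" "\<psi> k = r" and bs: "length bs = n - 1" "set bs \<subseteq> {1..r}"
 shows "lact k \<psi> (word_letter r (n, \<tau>) bs) = word_letter k (n, \<tau>) (map (birth_op \<psi>) bs)"
proof -
 have "(bs ! (v - 1) \<le> \<psi> t) = (map (birth_op \<psi>) bs ! (v - 1) \<le> t)" if "v \<in> {1..<n}" "t \<le> k" for v t
 proof -
  have v: "v - 1 < length bs" using that bs(1) by auto
  have "bs ! (v - 1) \<in> set bs" by (rule nth_mem[OF v])
  then have "bs ! (v - 1) \<le> r" using bs(2) by auto
  then show ?thesis using birth_op(1)[OF \<psi>] that v by simp
 qed
 then have "{v \<in> {1..<n}. bs ! (v - 1) \<le> \<psi> t} = {v \<in> {1..<n}. map (birth_op \<psi>) bs ! (v - 1) \<le> t}" if "t \<le> k" for t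
  using that by blast
 then show ?thesis using mono_mapsD(1)[OF \<psi>(1)] by (auto simp: compose_def fun_eq_iff)
qed

lemma act_cell:
 assumes \<psi>: "\<psi> \<in> mono_maps k r" "\<psi> 0 = 0" "\<psi> k = r" and c: "cell_ok r sh bs"
 shows "sact M k r \<psi> (cell r sh bs) = cell k sh (map (birth_op \<psi>) bs)" "cell_ok k sh (map (birth_op \<psi>) bs)"
proof -
 have "map (lact k \<psi>) (build r sh bs) = build k sh (map (birth_op \<psi>) bs)"
  using c
 proof (induction sh arbitrary: bs)
  case (Cons s sh)
  note c = cell_ok_Cons[OF Cons.prems]
  obtain n \<tau> where s: "s = (n, \<tau>)" by (cases s)
  show ?case
   using lact_word_letter[OF \<psi>(1,3), of "take (fst s - 1) bs" n \<tau>] c Cons.IH[OF c(5)]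
   by (simp add: s take_map drop_map del: word_letter.simps)
 qed simp
 then show "sact M k r \<psi> (cell r sh bs) = cell k sh (map (birth_op \<psi>) bs)"
  unfolding cell_def sact_M[OF \<psi>(1) build_valid[OF c]] by simp
 have "birth_op \<psi> b \<in> {1..k}" if "b \<in> set bs" for b
 proof -
  have b: "b \<in> {1..r}" using that c by (auto simp: cell_ok_def)
  then show ?thesis using birth_op(2)[OF \<psi>(1,3), of b] birth_op(1)[OF \<psi>(1,3), of b 0] \<psi>(2) by auto
 qed
 then show "cell_ok k sh (map (birth_op \<psi>) bs)" using c by (auto simp: cell_ok_def)
qed

lemma inner_face_cell:
 assumes c: "cell_ok (Suc r) sh bs" and i: "1 \<le> i" "i \<le> r"
 shows "sface M r i (cell (Suc r) sh bs) = cell r sh (merge i bs)" "cell_ok r sh (merge i bs)"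
proof -
 have "map (birth_op (coface r i)) bs = merge i bs"
  unfolding merge_def using c birth_op_coface[OF i] by (auto simp: cell_ok_def)
 moreover have "coface r i 0 = 0" "coface r i r = Suc r" using i by (auto simp: coface_def)
 ultimately show "sface M r i (cell (Suc r) sh bs) = cell r sh (merge i bs)" "cell_ok r sh (merge i bs)"
  using act_cell[OF coface_mono _ _ c, of i] by (auto simp: sface_def)
qed

text \<open>A simplex is degenerate if at some time nothing is added.\<close>

lemma degenerate_cell_iff:
 assumes c: "cell_ok r sh bs"
 shows "degenerate M r (cell r sh bs) \<longleftrightarrow> \<not> packed r bs"
proof
 assume "degenerate M r (cell r sh bs)"
 then obtain m i \<tau> where *: "r = Suc m" "i \<le> m" "\<tau> \<in> spx M m" "cell r sh bs = sact M r m (codegeneracy m i) \<tau>"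
  unfolding degenerate_def by blast
 obtain sh' bs' where t: "cell_ok m sh' bs'" "\<tau> = cell m sh' bs'" using spx_is_cell[OF *(3)] by blast
 have e: "codegeneracy m i 0 = 0" "codegeneracy m i (Suc m) = m" using *(2) by (auto simp: codegeneracy_def)
 note a = act_cell[OF codegeneracy_mono[OF *(2)] e t(1)]
 have "bs = map (birth_op (codegeneracy m i)) bs'"
  using cell_inj[OF c[unfolded *(1)] a(2)] *(1,4) a(1) t(2) by simp
 moreover have "Suc i \<notin> set (map (birth_op (codegeneracy m i)) bs')"
  using t(1) birth_op_codegeneracy[OF *(2)] by (fastforce simp: cell_ok_def split: if_splits)
 ultimately show "\<not> packed r bs" using *(1,2) by (auto simp: packed_def)
next
 assume "\<not> packed r bs"
 then have "\<exists>b\<in>{1..r}. b \<notin> set bs" using c unfolding packed_def cell_ok_def by blast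
 then obtain b where b: "b \<in> {1..r}" "b \<notin> set bs" by blast
 then obtain i m where i: "b = Suc i" "r = Suc m" "i \<le> m" by (cases b; cases r) auto
 have bs: "set bs \<subseteq> {1..Suc m}" "Suc i \<notin> set bs" using c b i by (auto simp: cell_ok_def)
 have ge: "Suc (Suc i) \<le> y" if "y \<in> set bs" "\<not> y \<le> i" for y
  using that bs(2) by (metis not_less_eq_eq le_antisym)
 have c': "cell_ok m sh (merge i bs)"
  using c bs(1) ge i(3) by (force simp: cell_ok_def merge_def)
 have e: "codegeneracy m i 0 = 0" "codegeneracy m i (Suc m) = m" using i(3) by (auto simp: codegeneracy_def)
 have "map (birth_op (codegeneracy m i)) (merge i bs) = bs"
  unfolding merge_def map_map
 proof (rule map_idI)
  fix y assume y: "y \<in> set bs"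
  then have "(if y \<le> i then y else y - 1) \<in> set (merge i bs)" by (auto simp: merge_def)
  then have "(if y \<le> i then y else y - 1) \<in> {1..m}" using c' by (auto simp: cell_ok_def)
  from birth_op_codegeneracy[OF i(3) this] ge[OF y]
  show "(birth_op (codegeneracy m i) \<circ> (\<lambda>y. if y \<le> i then y else y - 1)) y = y" by auto
 qed
 then have "cell r sh bs = sact M r m (codegeneracy m i) (cell m sh (merge i bs))"
  using act_cell(1)[OF codegeneracy_mono[OF i(3)] e c'] i(2) by simp
 then show "degenerate M r (cell r sh bs)"
  unfolding degenerate_def using i(2,3) cell_spx[OF c'] by blast
qed

lemma nondegenerate_cell_iff: "(r, c) \<in> nondegenerate M \<longleftrightarrow> (\<exists>sh bs. cell_ok r sh bs \<and> packed r bs \<and> c = cell r sh bs)"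
 using degenerate_cell_iff spx_is_cell cell_spx unfolding nondegenerate_def by blast

lemma vertices_added_lact:
 assumes \<psi>: "\<psi> \<in> mono_maps k r" and bs: "length bs = n - 1"
 shows "vertices_added k (lact k \<psi> (word_letter r (n, \<tau>) bs)) = length (filter (\<lambda>b. \<psi> 0 < b \<and> b \<le> \<psi> k) bs)"
proof -
 have "vertices_added k (lact k \<psi> (word_letter r (n, \<tau>) bs))
   = card (({0, n} \<union> {v \<in> {1..<n}. bs ! (v - 1) \<le> \<psi> k}) - ({0, n} \<union> {v \<in> {1..<n}. bs ! (v - 1) \<le> \<psi> 0}))"
  using mono_mapsD(1)[OF \<psi>, of 0] mono_mapsD(1)[OF \<psi>, of k] by (simp add: vertices_added_def compose_def)
 also have "({0, n} \<union> {v \<in> {1..<n}. bs ! (v - 1) \<le> \<psi> k}) - ({0, n} \<union> {v \<in> {1..<n}. bs ! (v - 1) \<le> \<psi> 0})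
   = {v \<in> {1..<n}. \<psi> 0 < bs ! (v - 1) \<and> bs ! (v - 1) \<le> \<psi> k}" by auto
 also have "\<dots> = Suc ` {i. i < length bs \<and> \<psi> 0 < bs ! i \<and> bs ! i \<le> \<psi> k}"
 proof (intro equalityI subsetI)
  fix v assume v: "v \<in> {v \<in> {1..<n}. \<psi> 0 < bs ! (v - 1) \<and> bs ! (v - 1) \<le> \<psi> k}"
  then have "v = Suc (v - 1)" "v - 1 < length bs" using bs by auto
  then show "v \<in> Suc ` {i. i < length bs \<and> \<psi> 0 < bs ! i \<and> bs ! i \<le> \<psi> k}" using v by blast
 qed (use bs in auto)
 also have "card \<dots> = length (filter (\<lambda>b. \<psi> 0 < b \<and> b \<le> \<psi> k) bs)"
  by (simp add: card_image length_filter_conv_card)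
 finally show ?thesis .
qed

text \<open>The first face cuts the letters at the vertices that join first, and the last face loses those that
 join last. In both cases there are fewer inner vertices left.\<close>

lemma outer_face_cell:
 assumes c: "cell_ok (Suc r) sh bs" and p: "packed (Suc r) bs" and i: "i = 0 \<or> i = Suc r"
 shows "\<exists>sh' bs'. cell_ok r sh' bs' \<and> sface M r i (cell (Suc r) sh bs) = cell r sh' bs' \<and> vol sh' < vol sh"
proof -
 let ?\<psi> = "coface r i"
 let ?P = "\<lambda>b. ?\<psi> 0 < b \<and> b \<le> ?\<psi> r"
 have "(\<Sum>l\<leftarrow>map (lact r ?\<psi>) (build (Suc r) sh bs). vertices_added r l) = length (filter ?P bs)"
  using c
 proof (induction sh arbitrary: bs)
  case (Cons s sh)
  note c = cell_ok_Cons[OF Cons.prems]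
  obtain n \<tau> where s: "s = (n, \<tau>)" by (cases s)
  have "length (filter ?P bs) = length (filter ?P (take (n - 1) bs)) + length (filter ?P (drop (n - 1) bs))"
   by (metis append_take_drop_id filter_append length_append)
  then show ?case
   using vertices_added_lact[OF coface_mono[of r i], of "take (fst s - 1) bs" n \<tau>] c Cons.IH[OF c(5)]
   by (simp add: s del: word_letter.simps)
 qed (simp add: cell_ok_def)
 moreover have "length (filter ?P bs) < length bs"
 proof -
  have "(if i = 0 then 1 else Suc r) \<in> set bs" using p by (auto simp: packed_def)
  moreover have "\<not> ?P (if i = 0 then 1 else Suc r)" using i by (auto simp: coface_def)
  ultimately show ?thesis by (rule length_filter_less)
 qed
 moreover have val: "\<forall>l\<in>set (map (lact r ?\<psi>) (build (Suc r) sh bs)). valid r l"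
  by (rule valid_map_lact[OF build_valid[OF c] coface_mono])
 moreover have "sface M r i (cell (Suc r) sh bs) = cls r (map (lact r ?\<psi>) (build (Suc r) sh bs))"
  unfolding sface_def cell_def by (rule sact_M[OF coface_mono build_valid[OF c]])
 moreover have "length bs = vol sh" using c by (simp add: cell_ok_def)
 ultimately show ?thesis using cls_is_cell[OF val] by fastforce
qed

section \<open>The matching on cells\<close>

definition lower_cells :: "nat => ((nat \<times> 's) list \<times> nat list) set" where
 "lower_cells r = {(sh, bs). cell_ok r sh bs \<and> packed r bs \<and> lower r bs}"

definition lower_cell :: "nat => (nat \<times> 's) list \<times> nat list => nat \<times> 's rigid_mor" where
 "lower_cell r = (\<lambda>(sh, bs). (r, cell r sh bs))"

definition upper_cell :: "nat => (nat \<times> 's) list \<times> nat list => nat \<times> 's rigid_mor" where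
 "upper_cell r = (\<lambda>(sh, bs). (Suc r, cell (Suc r) sh (split_block r bs)))"

text \<open>The cubic term exceeds the bound for \<^const>\<open>part_rank\<close> by so much that cells of smaller volume
 have smaller rank.\<close>

definition cell_rank :: "nat => (nat \<times> 's) list \<times> nat list => nat" where
 "cell_rank r = (\<lambda>(sh, bs). vol sh * vol sh * vol sh + part_rank r bs)"

lemma cell_ok_split_block:
 "[|cell_ok r sh bs; packed r bs; lower r bs|] ==> cell_ok (Suc r) sh (split_block r bs)"
 using packed_split_block[of r bs] by (simp add: cell_ok_def packed_def)

text \<open>Among the lower cells in the boundary of an upper cell its partner has the largest rank: the others
 come from merging different blocks (\<open>part_rank_decreases\<close>) or have smaller volume.\<close>

lemma cell_matching:
 "matching (chain_boundary M :: _ => _ \<Rightarrow>\<^sub>0 'k::{comm_ring,comm_monoid_mult})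
   (lower_cells r) (lower_cell r) (upper_cell r) (cell_rank r)"
proof
 show "inj_on (lower_cell r) (lower_cells r)"
  by (auto simp: inj_on_def lower_cells_def lower_cell_def dest: cell_inj)
 show "inj_on (upper_cell r) (lower_cells r)"
 proof (rule inj_onI, clarify)
  fix sh bs sh' bs' assume *: "(sh, bs) \<in> lower_cells r" "(sh', bs') \<in> lower_cells r"
   and "upper_cell r (sh, bs) = upper_cell r (sh', bs')"
  then have "sh = sh' \<and> split_block r bs = split_block r bs'"
   using cell_inj[OF cell_ok_split_block cell_ok_split_block] by (auto simp: lower_cells_def upper_cell_def)
  then show "sh = sh' \<and> bs = bs'" using split_block_inj[of r bs bs'] * by (auto simp: lower_cells_def)
 qed
next
 fix c assume "c \<in> lower_cells r"
 then obtain sh bs where c: "c = (sh, bs)" "cell_ok r sh bs" "packed r bs" "lower r bs" by (auto simp: lower_cells_def)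
 let ?u = "cell (Suc r) sh (split_block r bs)"
 note ok = cell_ok_split_block[OF c(2-4)] and pk = packed_split_block[OF c(3,4)]
 have rows: "lookup (chain_boundary M (upper_cell r c)) (r, c')
   = (\<Sum>i\<le>Suc r. sgn_pow i (if (r, sface M r i ?u) \<in> nondegenerate M \<and> sface M r i ?u = c' then 1 else 0 :: 'k))" for c'
  unfolding c(1) upper_cell_def case_prod_conv chain_boundary.simps lookup_sum lookup_sgn_pow
  by (intro sum.cong HOL.refl arg_cong[of _ _ "sgn_pow _"]) (auto simp: nchain_def lookup_gen)
 obtain j where j: "1 \<le> j" "j \<le> r" "merge j (split_block r bs) = bs" using merge_split_block[OF c(3,4)] by blast
 have fj: "sface M r j ?u = cell r sh bs" using inner_face_cell(1)[OF ok j(1,2)] j(3) by simp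
 have other: "sface M r i ?u \<noteq> cell r sh bs" if "i \<le> Suc r" "i \<noteq> j" for i
 proof (cases "i = 0 \<or> i = Suc r")
  case True
  then obtain sh' bs' where "cell_ok r sh' bs'" "sface M r i ?u = cell r sh' bs'" "vol sh' < vol sh"
   using outer_face_cell[OF ok pk True] by blast
  then show ?thesis using cell_inj[OF _ c(2)] by fastforce
 next
  case False
  then have i: "1 \<le> i" "i \<le> r" using that by auto
  have "merge i (split_block r bs) \<noteq> bs" using merge_index_unique[OF pk i j(1,2)] that(2) j(3) by auto
  then show ?thesis using inner_face_cell[OF ok i] cell_inj[OF _ c(2)] by metis
 qed
 have "(r, cell r sh bs) \<in> nondegenerate M" using c nondegenerate_cell_iff by blast
 have "lookup (chain_boundary M (upper_cell r c)) (lower_cell r c) = sgn_pow j (1 :: 'k)"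
 proof -
  have "lookup (chain_boundary M (upper_cell r c)) (r, cell r sh bs)
    = (\<Sum>i\<in>{j}. sgn_pow i (if (r, sface M r i ?u) \<in> nondegenerate M \<and> sface M r i ?u = cell r sh bs then 1 else 0 :: 'k))"
   unfolding rows by (rule sum.mono_neutral_right) (use j other in auto)
  also have "\<dots> = sgn_pow j 1" using fj \<open>(r, cell r sh bs) \<in> nondegenerate M\<close> by simp
  finally show ?thesis by (simp add: lower_cell_def c(1))
 qed
 moreover have "sgn_pow j (1 :: 'k) * sgn_pow j 1 = 1" by (simp add: sgn_pow_def)
 ultimately show "\<exists>\<epsilon>. \<epsilon> * \<epsilon> = 1 \<and> lookup (chain_boundary M (upper_cell r c)) (lower_cell r c) = (\<epsilon> :: 'k)"
  by metis
 fix c' assume "c' \<in> lower_cells r" and neq: "c' \<noteq> c"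
  and nz: "lookup (chain_boundary M (upper_cell r c)) (lower_cell r c') \<noteq> (0 :: 'k)"
 then obtain sh' bs' where c': "c' = (sh', bs')" "cell_ok r sh' bs'" "packed r bs'" "lower r bs'"
  by (auto simp: lower_cells_def)
 have "\<exists>i\<le>Suc r. sface M r i ?u = cell r sh' bs'"
 proof (rule ccontr)
  assume "\<not> (\<exists>i\<le>Suc r. sface M r i ?u = cell r sh' bs')"
  then have "lookup (chain_boundary M (upper_cell r c)) (r, cell r sh' bs') = (0 :: 'k)"
   unfolding rows by (intro sum.neutral) auto
  then show False using nz by (simp add: lower_cell_def c'(1))
 qed
 then obtain i where i: "i \<le> Suc r" "sface M r i ?u = cell r sh' bs'" by blast
 show "cell_rank r c' < cell_rank r c"
 proof (cases "i = 0 \<or> i = Suc r")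
  case True
  then obtain sh2 bs2 where "cell_ok r sh2 bs2" "sface M r i ?u = cell r sh2 bs2" "vol sh2 < vol sh"
   using outer_face_cell[OF ok pk True] by blast
  then have lt: "vol sh' < vol sh" using cell_inj[OF _ c'(2)] i(2) by metis
  have "part_rank r bs' \<le> vol sh' * vol sh'" using part_rank_bound[of r bs'] c'(2) by (simp add: cell_ok_def)
  then have "cell_rank r c' \<le> vol sh' * vol sh' * vol sh' + vol sh' * vol sh'" by (simp add: cell_rank_def c'(1))
  also have "\<dots> = vol sh' * vol sh' * Suc (vol sh')" by simp
  also have "\<dots> < vol sh * vol sh * vol sh"
  proof -
   have "vol sh' * vol sh' * Suc (vol sh') \<le> vol sh' * vol sh' * vol sh" using lt by (intro mult_le_mono) auto
   also have "\<dots> < vol sh * vol sh * vol sh" using lt by (simp add: mult_strict_mono)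
   finally show ?thesis .
  qed
  finally show ?thesis by (simp add: cell_rank_def c(1))
 next
  case False
  then have i': "1 \<le> i" "i \<le> r" using i(1) by auto
  have "sh' = sh \<and> bs' = merge i (split_block r bs)"
   using cell_inj[OF c'(2) inner_face_cell(2)[OF ok i']] inner_face_cell(1)[OF ok i'] i(2) by simp
  then show ?thesis
   using part_rank_decreases[OF c(3,4) i'] neq c c' by (simp add: cell_rank_def)
 qed
qed

end

section \<open>Fundamental chains of cubes\<close>

abbreviation Pow_nerve :: "(nat => nat set) sset" where
 "Pow_nerve \<equiv> nerve UNIV"

text \<open>Unions make the nerve of the subsets of \<open>nat\<close> a simplicial monoid, in which the fundamental
 chain of a cube is the product of its edges.\<close>

definition join :: "nat => (nat => nat set) => (nat => nat set) => nat => nat set" where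
 "join r U V = (\<lambda>t\<in>{..r}. U t \<union> V t)"

definition bottom :: "nat => nat set" where
 "bottom = (\<lambda>t\<in>{..0}. {})"

lemma in_keys_genD: "a \<in> keys (gen b) ==> a = b"
 using keys_gen by fastforce

lemma pairing_join:
 fixes P Q R :: "nat set set"
 assumes "\<And>A B. [|A \<in> P; B \<in> Q|] ==> A \<union> C \<union> B \<in> R"
 shows "pairing (nerve P) (nerve Q) (nerve R) (\<lambda>r U V. \<lambda>t\<in>{..r}. U t \<union> C \<union> V t)"
 unfolding pairing_def spx_nerve sact_nerve
proof (intro conjI simplicial_set_nerve allI ballI)
 fix n U V assume UV: "U \<in> chains_in P n" "V \<in> chains_in Q n"
 show "(\<lambda>t\<in>{..n}. U t \<union> C \<union> V t) \<in> chains_in R n"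
 proof (rule chains_in_restrict)
  fix s t assume "s \<le> t" "t \<le> n"
  then show "U s \<union> C \<union> V s \<subseteq> U t \<union> C \<union> V t"
   using chains_inD(2)[OF UV(1), of s t] chains_inD(2)[OF UV(2), of s t] by blast
 qed (use assms chains_inD(1)[OF UV(1)] chains_inD(1)[OF UV(2)] in simp)
 fix k \<theta> assume "\<theta> \<in> mono_maps k n"
 then show "compose {..k} (\<lambda>t\<in>{..n}. U t \<union> C \<union> V t) \<theta> = (\<lambda>t\<in>{..k}. compose {..k} U \<theta> t \<union> C \<union> compose {..k} V \<theta> t)"
  by (auto simp: compose_def fun_eq_iff dest: mono_mapsD)
qed

lemma bottom_chain: "{} \<in> P ==> bottom \<in> chains_in P 0"
 unfolding bottom_def by (rule chains_in_restrict) auto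

lemma join_pairing: "pairing Pow_nerve Pow_nerve Pow_nerve join"
 using pairing_join[of UNIV UNIV "{}" UNIV] by (simp add: join_def[abs_def])

interpretation join: simplicial_monoid Pow_nerve join bottom
proof
 show "pairing Pow_nerve Pow_nerve Pow_nerve join" by (rule join_pairing)
 show "bottom \<in> spx Pow_nerve 0" by (simp add: spx_nerve bottom_chain)
 fix n U assume U: "U \<in> spx Pow_nerve n"
 show "join n (sact Pow_nerve n 0 (const_op n) bottom) U = U" "join n U (sact Pow_nerve n 0 (const_op n) bottom) = U"
  using chains_inD(3)[OF U[unfolded spx_nerve]]
  by (auto simp: join_def sact_nerve bottom_def const_op_def compose_def fun_eq_iff not_le)
qed (auto simp: join_def fun_eq_iff)

abbreviation jmul :: "(nat \<times> (nat => nat set) \<Rightarrow>\<^sub>0 'k) => (nat \<times> (nat => nat set) \<Rightarrow>\<^sub>0 'k)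
  => (nat \<times> (nat => nat set) \<Rightarrow>\<^sub>0 'k::{comm_ring,comm_monoid_mult})" where
 "jmul \<equiv> bilin join.sh"

definition edge :: "nat => nat => nat set" where
 "edge i = (\<lambda>t\<in>{..1}. if t = 0 then {} else {i})"

definition point :: "nat set => nat => nat set" where
 "point A = (\<lambda>t\<in>{..0}. A)"

fun cube :: "nat list => (nat \<times> (nat => nat set) \<Rightarrow>\<^sub>0 'k::{comm_ring,comm_monoid_mult})" where
 "cube [] = gen (0, bottom)"
| "cube (i # l) = jmul (gen (1, edge i)) (cube l)"

lemma edge_chain: "edge i \<in> spx Pow_nerve 1"
 unfolding edge_def spx_nerve by (rule chains_in_restrict) auto

lemma edge_nondegenerate: "(1, edge i) \<in> nondegenerate Pow_nerve"
proof -
 have "\<not> degenerate Pow_nerve 1 (edge i)"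
 proof
  assume "degenerate Pow_nerve 1 (edge i)"
  then obtain \<tau> where "edge i = compose {..1} \<tau> (codegeneracy 0 0)"
   by (auto simp: degenerate_def sact_nerve)
  then have "edge i 0 = edge i 1" by (simp add: compose_def codegeneracy_def)
  then show False by (simp add: edge_def)
 qed
 then show ?thesis using edge_chain by (simp add: nondegenerate_def)
qed

lemma gen_edge_gr: "gen (1, edge i) \<in> gr_chains Pow_nerve 1"
 using edge_nondegenerate[of i] by (auto simp: gr_chains_def dest!: in_keys_genD)

lemma vertex_nondegenerate: "(0, v) \<in> nondegenerate T \<longleftrightarrow> v \<in> spx T 0"
 by (simp add: nondegenerate_def degenerate_def)

lemma cube_gr: "cube l \<in> gr_chains Pow_nerve (int (length l))"
proof (induction l)
 case Nil
 show ?case using join.unit by (auto simp: gr_chains_def vertex_nondegenerate dest!: in_keys_genD)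
next
 case (Cons i l)
 show ?case using join.gr_chains_bilin[OF gen_edge_gr Cons] by simp
qed

lemma cube_nchains: "cube l \<in> nchains Pow_nerve"
 by (rule gr_nchains[OF cube_gr])

lemma point_chain: "point A \<in> spx Pow_nerve 0"
 unfolding point_def spx_nerve by (rule chains_in_restrict) auto

lemma boundary_edge: "lin (chain_boundary Pow_nerve) (gen (1, edge i)) = gen (0, point {i}) - gen (0, bottom)"
proof -
 have "sface Pow_nerve 0 0 (edge i) = point {i}" "sface Pow_nerve 0 1 (edge i) = bottom"
  by (auto simp: sface_def sact_nerve compose_def coface_def edge_def point_def bottom_def fun_eq_iff)
 then show ?thesis
  using point_chain join.unit by (simp add: nchain_def vertex_nondegenerate sgn_pow_def)
qed

text \<open>By the Leibniz rule each direction contributes the difference of the two ends of its edge.\<close>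

lemma boundary_cube:
 "lin (chain_boundary Pow_nerve) (cube l :: _ \<Rightarrow>\<^sub>0 'k::{comm_ring,comm_monoid_mult}) = (\<Sum>j<length l. sgn_pow j
   (jmul (cube (take j l)) (jmul (gen (0, point {l ! j})) (cube (drop (Suc j) l)))
   - cube (take j l @ drop (Suc j) l)))"
proof (induction l)
 case Nil
 show ?case by simp
next
 case (Cons i l)
 let ?d = "lin (chain_boundary Pow_nerve)"
 let ?h = "\<lambda>j. jmul (cube (take j l)) (jmul (gen (0, point {l ! j})) (cube (drop (Suc j) l)))
   - cube (take j l @ drop (Suc j) l) :: _ \<Rightarrow>\<^sub>0 'k"
 have "?d (jmul (gen (1, edge i)) (cube l)) = jmul (?d (gen (1, edge i))) (cube l)
   + sgn_pow 1 (jmul (gen (1, edge i)) (?d (cube l :: _ \<Rightarrow>\<^sub>0 'k)))"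
  by (rule join.shuffle_boundary_chains) (simp_all only: of_nat_1 gen_edge_gr cube_nchains)
 then have "?d (cube (i # l) :: _ \<Rightarrow>\<^sub>0 'k) = jmul (gen (0, point {i}) - gen (0, bottom)) (cube l) - jmul (gen (1, edge i)) (?d (cube l))"
  unfolding cube.simps boundary_edge by (simp add: sgn_pow_def del: bilin_gen_left)
 also have "jmul (gen (0, point {i}) - gen (0, bottom)) (cube l) = jmul (gen (0, point {i})) (cube l) - cube l"
  by (simp only: bilin_diff join.unit_mul(1)[OF cube_nchains])
 also have "jmul (gen (1, edge i)) (?d (cube l)) = (\<Sum>j<length l. sgn_pow j (jmul (gen (1, edge i)) (?h j)))"
  unfolding Cons by (simp only: bilin_sum bilin_sgn_pow)
 also have "\<dots> = (\<Sum>j<length l. sgn_pow j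
   (jmul (cube (i # take j l)) (jmul (gen (0, point {l ! j})) (cube (drop (Suc j) l)))
   - cube (i # take j l @ drop (Suc j) l)))"
 proof (rule sum.cong[OF HOL.refl])
  fix j
  have v: "gen (0, point {l ! j}) \<in> gr_chains Pow_nerve 0"
   using point_chain by (auto simp: gr_chains_def vertex_nondegenerate dest!: in_keys_genD)
  have "jmul (gen (0, point {l ! j})) (cube (drop (Suc j) l)) \<in> nchains Pow_nerve"
   by (rule gr_nchains[OF join.gr_chains_bilin[OF v cube_gr]])
  note assoc = join.shuffle_assoc_chains[OF gr_nchains[OF gen_edge_gr] cube_nchains this]
  show "sgn_pow j (jmul (gen (1, edge i)) (?h j)) = sgn_pow j
   (jmul (cube (i # take j l)) (jmul (gen (0, point {l ! j})) (cube (drop (Suc j) l)))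
   - cube (i # take j l @ drop (Suc j) l))"
   by (simp only: cube.simps bilin_diff assoc)
 qed
 also have first: "jmul (gen (0, point {i})) (cube l)
   = jmul (cube []) (jmul (gen (0, point {i})) (cube l) :: _ \<Rightarrow>\<^sub>0 'k)"
 proof -
  have "gen (0, point {i}) \<in> gr_chains Pow_nerve 0"
   using point_chain by (auto simp: gr_chains_def vertex_nondegenerate dest!: in_keys_genD)
  note one = join.unit_mul(1)[OF gr_nchains[OF join.gr_chains_bilin[OF this cube_gr]]]
  show ?thesis by (simp only: cube.simps one)
 qed
 finally show ?case
  by (simp add: sum.lessThan_Suc_shift sgn_pow_Suc sum_negf del: sum.lessThan_Suc cube.simps bilin_gen_left)
qed

text \<open>The coefficients of products are computed below by showing that a single pair contributes.\<close>

lemma lookup_bilin_single: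
 assumes "\<And>a b. [|a \<in> keys P; b \<in> keys Q; (a, b) \<noteq> (a0, b0)|]
   ==> lookup (f a b) z = 0"
 shows "lookup (bilin f P Q) z
  = lookup P a0 * (lookup Q b0 * lookup (f a0 b0) z)"
proof -
 have in0: "lookup (lin (f a) Q) z = (if a = a0 then lookup Q b0 * lookup (f a0 b0) z else 0)"
  if a: "a \<in> keys P" for a
 proof -
  have "lookup (lin (f a) Q) z = (\<Sum>b\<in>keys Q. lookup Q b * lookup (f a b) z)"
   by (rule lookup_lin)
  also have "\<dots> = (\<Sum>b\<in>keys Q. if a = a0 \<and> b = b0 then lookup Q b0 * lookup (f a0 b0) z else 0)"
   by (rule sum.cong) (use assms[OF a] in auto)
  also have "\<dots> = (if a = a0 then lookup Q b0 * lookup (f a0 b0) z else 0)"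
   by (cases "b0 \<in> keys Q") (auto simp: in_keys_iff)
  finally show ?thesis .
 qed
 have "lookup (bilin f P Q) z
   = (\<Sum>a\<in>keys P. lookup P a * lookup (lin (f a) Q) z)"
  by (simp add: bilin_def lookup_lin)
 also have "\<dots> = (\<Sum>a\<in>keys P. if a = a0
   then lookup P a0 * (lookup Q b0 * lookup (f a0 b0) z) else 0)"
  by (rule sum.cong) (auto simp: in0)
 also have "\<dots> = lookup P a0 * (lookup Q b0 * lookup (f a0 b0) z)"
  by (cases "a0 \<in> keys P") (auto simp: in_keys_iff)
 finally show ?thesis .
qed

lemma lookup_shuffle:
 "lookup (shuffle X Y Z m (p, \<sigma>) (q, \<tau>)) z
  = (\<Sum>\<mu>\<in>shuffle_sets p q. sgn_pow (shuffle_sign \<mu> ({..<p + q} - \<mu>))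
    (if z \<in> nondegenerate Z \<and> z = (p + q, pair_simplex X Y m (p + q) p (count_op (p + q) \<mu>) \<sigma>
      q (count_op (p + q) ({..<p + q} - \<mu>)) \<tau>) then 1 else 0))"
 unfolding shuffle_def case_prod_conv lookup_sum lookup_sgn_pow
 by (intro sum.cong HOL.refl arg_cong[of _ _ "sgn_pow _"]) (auto simp: nchain_def lookup_gen)

lemma keys_shuffle_pair:
 assumes "z \<in> keys (shuffle X Y Z m (p, \<sigma>) (q, \<tau>))"
 obtains \<mu> where "\<mu> \<in> shuffle_sets p q" "z \<in> nondegenerate Z"
  "z = (p + q, pair_simplex X Y m (p + q) p (count_op (p + q) \<mu>) \<sigma> q (count_op (p + q) ({..<p + q} - \<mu>)) \<tau>)"
proof -
 have "\<exists>\<mu>\<in>shuffle_sets p q. z \<in> nondegenerate Z \<and>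
  z = (p + q, pair_simplex X Y m (p + q) p (count_op (p + q) \<mu>) \<sigma> q (count_op (p + q) ({..<p + q} - \<mu>)) \<tau>)"
 proof (rule ccontr)
  assume "\<not> ?thesis"
  then have "lookup (shuffle X Y Z m (p, \<sigma>) (q, \<tau>)) z = (0 :: 'b)"
   unfolding lookup_shuffle by (intro sum.neutral) auto
  then show False using assms by (simp add: in_keys_iff)
 qed
 then show ?thesis using that by blast
qed

lemma keys_cube:
 assumes "(q, V) \<in> keys (cube l :: _ \<Rightarrow>\<^sub>0 'k::{comm_ring,comm_monoid_mult})"
 shows "q = length l" "V \<in> chains_in (Pow (set l)) q" "(q, V) \<in> nondegenerate Pow_nerve"
proof -
 show "q = length l" "(q, V) \<in> nondegenerate Pow_nerve"
  using gr_chainsD[OF cube_gr assms] by auto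
 show "V \<in> chains_in (Pow (set l)) q"
  using assms
 proof (induction l arbitrary: q V)
  case Nil
  then have "(q, V) = (0, bottom)" by (auto dest: in_keys_genD)
  then show ?case by (simp add: bottom_chain)
 next
  case (Cons i l)
  have "keys (cube (i # l) :: _ \<Rightarrow>\<^sub>0 'k) \<subseteq> {(q, V). V \<in> chains_in (Pow (set (i # l))) q}"
   unfolding cube.simps
  proof (rule keys_bilin)
   fix a b :: "nat \<times> (nat => nat set)"
   assume a1: "a \<in> keys (gen (1, edge i) :: _ \<Rightarrow>\<^sub>0 'k)" and b: "b \<in> keys (cube l :: _ \<Rightarrow>\<^sub>0 'k)"
   have a: "a = (1, edge i)" by (rule in_keys_genD[OF a1])
   obtain p W where bp: "b = (p, W)" by (cases b)
   have W: "W \<in> chains_in (Pow (set l)) p" using Cons.IH b bp by blast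
   show "keys (join.sh a b :: _ \<Rightarrow>\<^sub>0 'k) \<subseteq> {(q, V). V \<in> chains_in (Pow (set (i # l))) q}"
   proof
    fix z assume "z \<in> keys (join.sh a b :: _ \<Rightarrow>\<^sub>0 'k)"
    then obtain \<mu> where \<mu>: "\<mu> \<in> shuffle_sets 1 p"
     and z: "z = (1 + p, pair_simplex Pow_nerve Pow_nerve join (1 + p) 1 (count_op (1 + p) \<mu>) (edge i) p (count_op (1 + p) ({..<1 + p} - \<mu>)) W)"
     unfolding a bp by (rule keys_shuffle_pair)
    note D = shuffle_setsD[OF \<mu>]
    have E: "edge i \<in> chains_in {{}, {i}} 1" unfolding edge_def by (rule chains_in_restrict) auto
    have "join (1 + p) (compose {..1 + p} (edge i) (count_op (1 + p) \<mu>))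
      (compose {..1 + p} W (count_op (1 + p) ({..<1 + p} - \<mu>))) \<in> chains_in (Pow (set (i # l))) (1 + p)"
     unfolding join_def
     by (rule chains_in_restrict)
      (use chains_inD(1,2)[OF compose_chains_in[OF E D(5)]] chains_inD(1,2)[OF compose_chains_in[OF W D(6)]] in \<open>fastforce+\<close>)
    then show "z \<in> {(q, V). V \<in> chains_in (Pow (set (i # l))) q}"
     by (simp add: z pair_simplex_def sact_nerve)
   qed
  qed
  then show ?case using Cons.prems by auto
 qed
qed

text \<open>The maximal chain that adds the points from the last to the first.\<close>

definition rev_flag :: "nat list => nat => nat set" where
 "rev_flag l = (\<lambda>t\<in>{..length l}. set (drop (length l - t) l))"

lemma rev_flag_chain: "rev_flag l \<in> chains_in (Pow (set l)) (length l)"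
 unfolding rev_flag_def
 by (rule chains_in_restrict) (auto dest: in_set_dropD intro: subsetD[OF set_drop_subset_set_drop, rotated])

text \<open>The flag arises from exactly one shuffle in each of the products.\<close>

lemma lookup_cube_rev_flag:
 assumes "distinct l"
 shows "\<exists>\<epsilon>. \<epsilon> * \<epsilon> = (1 :: 'k::{comm_ring,comm_monoid_mult}) \<and> lookup (cube l) (length l, rev_flag l) = \<epsilon>"
 using assms
proof (induction l)
 case Nil
 have "rev_flag [] = bottom" by (auto simp: rev_flag_def bottom_def fun_eq_iff)
 then show ?case by (simp add: lookup_gen)
next
 case (Cons i l)
 define q where "q = length l"
 define \<mu>0 where "\<mu>0 = {q}"
 have \<mu>0: "\<mu>0 \<in> shuffle_sets 1 q" by (simp add: \<mu>0_def shuffle_sets_def)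
 let ?ps = "\<lambda>\<mu> V. pair_simplex Pow_nerve Pow_nerve join (1 + q) 1 (count_op (1 + q) \<mu>) (edge i) q (count_op (1 + q) ({..<1 + q} - \<mu>)) V"
 have ps: "?ps \<mu> V t = (if cnt \<mu> t = 0 then {} else {i}) \<union> V (cnt ({..<1 + q} - \<mu>) t)"
  if \<mu>: "\<mu> \<in> shuffle_sets 1 q" and t: "t \<le> 1 + q" for \<mu> V t
 proof -
  have "cnt \<mu> t \<le> 1" using cnt_mono[OF t, of \<mu>] cnt_total[OF shuffle_setsD(1)[OF \<mu>]] shuffle_setsD(2)[OF \<mu>] by simp
  then show ?thesis using t
   by (auto simp: pair_simplex_def join_def sact_nerve compose_def count_op_cnt edge_def)
 qed
 have flag: "rev_flag (i # l) t = (if t \<le> q then rev_flag l t else insert i (set l))" if "t \<le> Suc q" for t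
  using that by (auto simp: rev_flag_def q_def Suc_diff_le le_Suc_eq)
 have uniq: "\<mu> = \<mu>0 \<and> V = rev_flag l"
  if \<mu>: "\<mu> \<in> shuffle_sets 1 q" and V: "V \<in> chains_in (Pow (set l)) q" and eq: "rev_flag (i # l) = ?ps \<mu> V" for \<mu> V
 proof -
  have "i \<notin> rev_flag (i # l) q" using Cons.prems flag[of q] rev_flag_chain[of l]
   by (auto simp: q_def rev_flag_def)
  then have "cnt \<mu> q = 0" using ps[OF \<mu>, of q V] eq by (auto split: if_splits)
  then have "\<forall>u\<in>\<mu>. \<not> u < q" using cnt_less_iff[of _ \<mu> q] by auto
  then have "\<mu> \<subseteq> {q}" using shuffle_setsD(1)[OF \<mu>] by fastforce
  then have m: "\<mu> = \<mu>0" using shuffle_setsD(2)[OF \<mu>] unfolding \<mu>0_def by (metis card.empty subset_singletonD zero_neq_one)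
  have "V t = rev_flag l t" if "t \<le> q" for t
  proof -
   have "cnt \<mu>0 t = 0" using that by (auto simp: cnt_def \<mu>0_def)
   moreover have "cnt ({..<1 + q} - \<mu>0) t = t" using cnt_complement[of t "1 + q" \<mu>0] that calculation by simp
   ultimately show ?thesis using ps[OF \<mu>, of t V] fun_cong[OF eq, of t] flag[of t] that m by simp
  qed
  then have "V = rev_flag l"
   by (intro chains_in_eqI[OF V rev_flag_chain[of l, folded q_def]])
  then show ?thesis using m by simp
 qed
 have eq0: "rev_flag (i # l) = ?ps \<mu>0 (rev_flag l)"
 proof
  fix t show "rev_flag (i # l) t = ?ps \<mu>0 (rev_flag l) t"
  proof (cases "t \<le> 1 + q")
   case True
   have c0: "cnt \<mu>0 t = (if t \<le> q then 0 else 1)"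
   proof -
    have "{u \<in> \<mu>0. u < t} = (if t \<le> q then {} else {q})" by (auto simp: \<mu>0_def)
    then show ?thesis by (simp add: cnt_def)
   qed
   then have c1: "cnt ({..<1 + q} - \<mu>0) t = (if t \<le> q then t else q)"
    using cnt_complement[OF True, of \<mu>0] True by auto
   have "rev_flag l q = set l" by (simp add: rev_flag_def q_def)
   then show ?thesis using ps[OF \<mu>0 True, of "rev_flag l"] flag[of t] True c0 c1 by auto
  next
   case False
   then show ?thesis by (simp add: rev_flag_def q_def pair_simplex_def join_def)
  qed
 qed
 have nd: "(1 + q, rev_flag (i # l)) \<in> nondegenerate Pow_nerve"
 proof -
  have "\<not> degenerate Pow_nerve (1 + q) (rev_flag (i # l))"
  proof
   assume "degenerate Pow_nerve (1 + q) (rev_flag (i # l))"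
   then obtain m j \<tau> where "1 + q = Suc m" "j \<le> m" "rev_flag (i # l) = compose {..1 + q} \<tau> (codegeneracy m j)"
    by (auto simp: degenerate_def sact_nerve)
   then have j: "rev_flag (i # l) j = rev_flag (i # l) (Suc j)" "Suc j \<le> 1 + q"
    by (auto simp: compose_def codegeneracy_def)
   then have "card (rev_flag (i # l) j) = card (rev_flag (i # l) (Suc j))" by simp
   moreover have "card (rev_flag (i # l) t) = t" if "t \<le> 1 + q" for t
    using that Cons.prems distinct_card[of "drop (Suc q - t) (i # l)"] by (simp add: rev_flag_def q_def del: drop_Suc_Cons)
   ultimately show False using j(2) by simp
  qed
  moreover have "rev_flag (i # l) \<in> spx Pow_nerve (1 + q)"
   using rev_flag_chain[of "i # l"] by (auto simp: spx_nerve q_def chains_in_def)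
  ultimately show ?thesis by (simp add: nondegenerate_def)
 qed
 let ?z = "(Suc q, rev_flag (i # l))"
 have single: "lookup (join.sh a b :: _ \<Rightarrow>\<^sub>0 'k) ?z = 0"
  if ab: "a \<in> keys (gen (1, edge i) :: _ \<Rightarrow>\<^sub>0 'k)" "b \<in> keys (cube l :: _ \<Rightarrow>\<^sub>0 'k)"
   "(a, b) \<noteq> ((1, edge i), (q, rev_flag l))" for a b
 proof -
  have a: "a = (1, edge i)" by (rule in_keys_genD[OF ab(1)])
  obtain V where b: "b = (q, V)" "V \<in> chains_in (Pow (set l)) q"
   using keys_cube[where l = l and 'k = 'k] ab(2) unfolding q_def by (cases b) blast
  have "rev_flag (i # l) \<noteq> ?ps \<mu> V" if "\<mu> \<in> shuffle_sets 1 q" for \<mu>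
   using uniq[OF that b(2)] ab(3) a b(1) by auto
  then show ?thesis unfolding a b(1) lookup_shuffle by (intro sum.neutral) auto
 qed
 have one: "lookup (join.sh (1, edge i) (q, rev_flag l) :: _ \<Rightarrow>\<^sub>0 'k) ?z
   = sgn_pow (shuffle_sign \<mu>0 ({..<1 + q} - \<mu>0)) 1"
 proof -
  have "lookup (join.sh (1, edge i) (q, rev_flag l) :: _ \<Rightarrow>\<^sub>0 'k) ?z
   = (\<Sum>\<mu>\<in>{\<mu>0}. sgn_pow (shuffle_sign \<mu> ({..<1 + q} - \<mu>))
     (if ?z \<in> nondegenerate Pow_nerve \<and> ?z = (1 + q, ?ps \<mu> (rev_flag l)) then 1 else 0))"
   unfolding lookup_shuffle
  proof (rule sum.mono_neutral_right)
   show "\<forall>\<mu>\<in>shuffle_sets 1 q - {\<mu>0}. sgn_pow (shuffle_sign \<mu> ({..<1 + q} - \<mu>))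
     (if ?z \<in> nondegenerate Pow_nerve \<and> ?z = (1 + q, ?ps \<mu> (rev_flag l)) then 1 else 0 :: 'k) = 0"
   proof
    fix \<mu> assume "\<mu> \<in> shuffle_sets 1 q - {\<mu>0}"
    then have "rev_flag (i # l) \<noteq> ?ps \<mu> (rev_flag l)"
     using uniq[OF _ rev_flag_chain[of l, folded q_def]] by blast
    then show "sgn_pow (shuffle_sign \<mu> ({..<1 + q} - \<mu>))
     (if ?z \<in> nondegenerate Pow_nerve \<and> ?z = (1 + q, ?ps \<mu> (rev_flag l)) then 1 else 0 :: 'k) = 0" by simp
   qed
  qed (use \<mu>0 in simp_all)
  also have "\<dots> = sgn_pow (shuffle_sign \<mu>0 ({..<1 + q} - \<mu>0)) 1"
   using nd eq0 by simp
  finally show ?thesis .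
 qed
 obtain \<epsilon> :: 'k where \<epsilon>: "\<epsilon> * \<epsilon> = 1" "lookup (cube l) (q, rev_flag l) = \<epsilon>"
  using Cons unfolding q_def by auto
 have "lookup (cube (i # l)) (length (i # l), rev_flag (i # l))
   = (1 :: 'k) * (\<epsilon> * sgn_pow (shuffle_sign \<mu>0 ({..<1 + q} - \<mu>0)) 1)"
  using lookup_bilin_single[of "gen (1, edge i)" "cube l" "(1, edge i)" "(q, rev_flag l)" join.sh ?z, OF single] \<epsilon>(2) one
  by (simp add: lookup_gen q_def del: bilin_gen_left)
 moreover have "(\<epsilon> * sgn_pow s 1) * (\<epsilon> * sgn_pow s 1) = 1" for s using \<epsilon>(1) by (simp add: sgn_pow_def)
 ultimately show ?case by simp
qed

definition image_chain :: "(nat => nat) => nat => (nat => nat set) => nat => nat set" where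
 "image_chain f r U = (\<lambda>t\<in>{..r}. f ` U t)"

lemma image_chain_simplicial: "simplicial_on Pow_nerve Pow_nerve (image_chain f)"
 unfolding simplicial_on_def spx_nerve sact_nerve
proof (intro conjI allI ballI)
 fix n U assume U: "U \<in> chains_in UNIV n"
 show "image_chain f n U \<in> chains_in UNIV n"
  unfolding image_chain_def by (rule chains_in_restrict) (use chains_inD(2)[OF U] in \<open>auto intro: image_mono\<close>)
 fix k \<theta> assume "\<theta> \<in> mono_maps k n"
 then show "image_chain f k (compose {..k} U \<theta>) = compose {..k} (image_chain f n U) \<theta>"
  by (auto simp: image_chain_def compose_def fun_eq_iff dest: mono_mapsD)
qed

lemma push_image_cube:
 "push Pow_nerve (image_chain f) (cube l) = (cube (map f l) :: _ \<Rightarrow>\<^sub>0 'k::{comm_ring,comm_monoid_mult})"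
proof (induction l)
 case Nil
 have "image_chain f 0 bottom = bottom" by (auto simp: image_chain_def bottom_def fun_eq_iff)
 then have "push Pow_nerve (image_chain f) (nchain Pow_nerve (0, bottom)) = (nchain Pow_nerve (0, bottom) :: _ \<Rightarrow>\<^sub>0 'k)"
  by (simp add: push_nchain[OF image_chain_simplicial join.unit])
 then show ?case by (simp add: join.nchain_unit)
next
 case (Cons i l)
 have "image_chain f 1 (edge i) = edge (f i)" by (auto simp: image_chain_def edge_def fun_eq_iff)
 then have "push Pow_nerve (image_chain f) (nchain Pow_nerve (1, edge i)) = (nchain Pow_nerve (1, edge (f i)) :: _ \<Rightarrow>\<^sub>0 'k)"
  by (simp only: push_nchain[OF image_chain_simplicial edge_chain])
 then have "push Pow_nerve (image_chain f) (gen (1, edge i)) = (gen (1, edge (f i)) :: _ \<Rightarrow>\<^sub>0 'k)"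
  by (simp only: nchain_nondegenerate[OF edge_nondegenerate])
 moreover have "push Pow_nerve (image_chain f) (jmul (gen (1, edge i)) (cube l))
   = jmul (push Pow_nerve (image_chain f) (gen (1, edge i))) (push Pow_nerve (image_chain f) (cube l :: _ \<Rightarrow>\<^sub>0 'k))"
  by (rule shuffle_natural_chain[OF join_pairing join_pairing image_chain_simplicial image_chain_simplicial
     image_chain_simplicial _ gr_nchains[OF gen_edge_gr] cube_nchains])
   (auto simp: image_chain_def join_def fun_eq_iff)
 ultimately show ?case using Cons by (simp del: bilin_gen_left)
qed

lemma nondegenerate_sub_nerve:
 assumes "(r, U) \<in> nondegenerate Pow_nerve" "U \<in> chains_in P r"
 shows "(r, U) \<in> nondegenerate (nerve P)"
proof -
 have "simplicial_on (nerve P) Pow_nerve (\<lambda>n U. U)"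
  by (auto simp: simplicial_on_def spx_nerve sact_nerve chains_in_def)
 from degenerate_map[OF this, of r U] show ?thesis
  using assms by (auto simp: nondegenerate_def spx_nerve)
qed

lemma cube_nchains_sub:
 "set l \<subseteq> A ==> (cube l :: _ \<Rightarrow>\<^sub>0 'k::{comm_ring,comm_monoid_mult}) \<in> nchains (nerve (Pow A))"
proof -
 assume A: "set l \<subseteq> A"
 have "z \<in> nondegenerate (nerve (Pow A))"
  if "z \<in> keys (cube l :: _ \<Rightarrow>\<^sub>0 'k)" for z
 proof -
  obtain r U where z: "z = (r, U)" by (cases z)
  note k = keys_cube[OF that[unfolded z]]
  have "U \<in> chains_in (Pow A) r" using k(2) A by (auto simp: chains_in_def)
  then show ?thesis unfolding z by (rule nondegenerate_sub_nerve[OF k(3)])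
 qed
 then show "(cube l :: _ \<Rightarrow>\<^sub>0 'k) \<in> nchains (nerve (Pow A))" by (auto simp: nchains_def)
qed

lemma push_id: "c \<in> nchains T ==> push T (\<lambda>n \<sigma>. \<sigma>) c = (c :: _ \<Rightarrow>\<^sub>0 'k::{comm_ring,comm_monoid_mult})"
proof -
 assume c: "c \<in> nchains T"
 have "push T (\<lambda>n \<sigma>. \<sigma>) c = lin gen c"
  unfolding push_def by (rule lin_cong) (use c in \<open>auto simp: nchains_def nchain_nondegenerate\<close>)
 then show ?thesis by (simp add: lin_gen_eq)
qed

lemma bilin_shuffle_nchains:
 "(bilin (shuffle X Y Z m) a b :: _ \<Rightarrow>\<^sub>0 'k::{comm_ring,comm_monoid_mult}) \<in> nchains Z"
 unfolding nchains_def mem_Collect_eq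
proof (rule keys_bilin)
 fix s t show "keys (shuffle X Y Z m s t :: _ \<Rightarrow>\<^sub>0 'k) \<subseteq> nondegenerate Z"
  using keys_shuffle[of X Y Z m "fst s" "snd s" "fst t" "snd t"] by auto
qed

lemma lookup_lin_single:
 assumes "\<And>b. [|b \<in> keys Q; b \<noteq> b0|] ==> lookup (f b) z = 0"
 shows "lookup (lin f Q) z = lookup Q b0 * lookup (f b0) z"
proof -
 have "lookup (lin f Q) z = (\<Sum>b\<in>keys Q. lookup Q b * lookup (f b) z)"
  by (rule lookup_lin)
 also have "\<dots> = (\<Sum>b\<in>keys Q. if b = b0 then lookup Q b0 * lookup (f b0) z else 0)"
  by (rule sum.cong) (use assms in auto)
 also have "\<dots> = lookup Q b0 * lookup (f b0) z"
  by (cases "b0 \<in> keys Q") (auto simp: in_keys_iff)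
 finally show ?thesis .
qed

definition clamp :: "nat => nat => nat set => nat set" where
 "clamp a b A = (A \<inter> {a..b}) \<union> {a, b}"

sublocale reduced \<subseteq> G: simplicial_monoid M mul one
 by (rule simplicial_monoid_M)

context reduced
begin

abbreviation gmul :: "(nat \<times> 's rigid_mor \<Rightarrow>\<^sub>0 'k) => (nat \<times> 's rigid_mor \<Rightarrow>\<^sub>0 'k)
  => (nat \<times> 's rigid_mor \<Rightarrow>\<^sub>0 'k::{comm_ring,comm_monoid_mult})" where
 "gmul \<equiv> bilin G.sh"

definition cube_letter :: "nat => 's => nat => nat => nat => (nat => nat set) => 's rletter" where
 "cube_letter n \<sigma> a b r U = ((n, \<sigma>), a, b, \<lambda>t\<in>{..r}. clamp a b (U t))"

text \<open>The cube of paths from \<open>a\<close> to \<open>b\<close> in \<open>\<sigma>\<close>. It is extended to all chains of subsets by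
 the retraction \<open>clamp\<close>, so that all cubes have the same source.\<close>

definition cube_map :: "nat => 's => nat => nat => nat => (nat => nat set) => 's rigid_mor" where
 "cube_map n \<sigma> a b r U = cls r [cube_letter n \<sigma> a b r U]"

lemma valid_cube_letter:
 assumes "\<sigma> \<in> spx S n" "a \<le> b" "b \<le> n" "U \<in> chains_in UNIV r"
 shows "valid r (cube_letter n \<sigma> a b r U)"
proof -
 have "(\<lambda>t\<in>{..r}. clamp a b (U t)) \<in> chains_in (cube_poset a b) r"
  by (rule chains_in_restrict) (use assms chains_inD(2)[OF assms(4)] in \<open>fastforce simp: clamp_def cube_poset_def\<close>)+
 then show ?thesis using assms by (simp add: valid.simps cube_letter_def)
qed

lemma cube_map_simplicial:
 assumes "\<sigma> \<in> spx S n" "a \<le> b" "b \<le> n"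
 shows "simplicial_on Pow_nerve M (cube_map n \<sigma> a b)"
 unfolding simplicial_on_def spx_nerve sact_nerve
proof (intro conjI allI ballI)
 fix r U assume U: "U \<in> chains_in UNIV r"
 have v: "\<forall>l\<in>set [cube_letter n \<sigma> a b r U]. valid r l" using valid_cube_letter[OF assms U] by simp
 show "cube_map n \<sigma> a b r U \<in> spx M r" unfolding cube_map_def spx_M using v by blast
 fix k \<theta> assume \<theta>: "\<theta> \<in> mono_maps k r"
 have "lact k \<theta> (cube_letter n \<sigma> a b r U) = cube_letter n \<sigma> a b k (compose {..k} U \<theta>)"
  using \<theta> by (auto simp: cube_letter_def compose_def fun_eq_iff dest: mono_mapsD)
 then show "cube_map n \<sigma> a b k (compose {..k} U \<theta>) = sact M k r \<theta> (cube_map n \<sigma> a b r U)"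
  unfolding cube_map_def sact_M[OF \<theta> v] by simp
qed

lemma cube_map_arrow:
 assumes \<sigma>: "\<sigma> \<in> spx S n" and \<theta>: "restrict f {..m} \<in> mono_maps m n" and ab: "a \<le> b" "b \<le> m"
  and f: "\<And>v. f v \<in> {f a..f b} \<longleftrightarrow> v \<in> {a..b}" and U: "U \<in> chains_in UNIV r"
 shows "cube_map m (sact S m n (restrict f {..m}) \<sigma>) a b r U = cube_map n \<sigma> (f a) (f b) r (image_chain f r U)"
proof -
 let ?\<theta> = "restrict f {..m}"
 have v: "valid r (cube_letter m (sact S m n ?\<theta> \<sigma>) a b r U)"
  by (rule valid_cube_letter[OF act_closed[OF S \<theta> \<sigma>] ab U])
 have "?\<theta> ` clamp a b A = clamp (f a) (f b) (f ` A)" for A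
 proof -
  have "?\<theta> ` clamp a b A = f ` clamp a b A"
   by (rule image_cong) (use ab in \<open>auto simp: clamp_def\<close>)
  also have "\<dots> = clamp (f a) (f b) (f ` A)"
   using f unfolding clamp_def by blast
  finally show ?thesis .
 qed
 then have "(\<lambda>q\<in>{..r}. ?\<theta> ` (\<lambda>t\<in>{..r}. clamp a b (U t)) q) = (\<lambda>t\<in>{..r}. clamp (f a) (f b) (image_chain f r U t))"
  by (auto simp: fun_eq_iff image_chain_def)
 moreover have "?\<theta> a = f a" "?\<theta> b = f b" using ab by auto
 ultimately have "eqv r [cube_letter m (sact S m n ?\<theta> \<sigma>) a b r U] [cube_letter n \<sigma> (f a) (f b) r (image_chain f r U)]"
  using eqv_arrow[OF \<sigma> \<theta> v[unfolded cube_letter_def]] unfolding cube_letter_def by simp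
 then show ?thesis unfolding cube_map_def using cls_eq_iff v by simp
qed

lemma push_cube_map_arrow:
 assumes \<sigma>: "\<sigma> \<in> spx S n" and \<theta>: "restrict f {..m} \<in> mono_maps m n" and ab: "a \<le> b" "b \<le> m"
  and f: "\<And>v. f v \<in> {f a..f b} \<longleftrightarrow> v \<in> {a..b}"
 shows "push M (cube_map m (sact S m n (restrict f {..m}) \<sigma>) a b) (cube l)
  = (push M (cube_map n \<sigma> (f a) (f b)) (cube (map f l)) :: _ \<Rightarrow>\<^sub>0 'k::{comm_ring,comm_monoid_mult})"
proof -
 have "f a \<le> f b" "f b \<le> n"
  using mono_mapsD(1)[OF \<theta>, of b] mono_mapsD(2)[OF \<theta>, of a b] ab by auto
 note s = cube_map_simplicial[OF \<sigma> this]
 have "push M (cube_map n \<sigma> (f a) (f b)) (cube (map f l))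
   = push M (\<lambda>r. cube_map n \<sigma> (f a) (f b) r \<circ> image_chain f r) (cube l :: _ \<Rightarrow>\<^sub>0 'k)"
  unfolding push_image_cube[symmetric] by (rule push_push[OF s image_chain_simplicial cube_nchains])
 also have "\<dots> = push M (cube_map m (sact S m n (restrict f {..m}) \<sigma>) a b) (cube l)"
 proof (rule push_cong)
  fix q U assume "(q, U) \<in> keys (cube l :: _ \<Rightarrow>\<^sub>0 'k)"
  then have "U \<in> chains_in UNIV q" using nchains_keysD[OF cube_nchains] by (simp add: spx_nerve)
  from cube_map_arrow[OF \<sigma> \<theta> ab f this]
  show "(cube_map n \<sigma> (f a) (f b) q \<circ> image_chain f q) U = cube_map m (sact S m n (restrict f {..m}) \<sigma>) a b q U" by simp
 qed
 finally show ?thesis ..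
qed

definition fund :: "nat => 's => (nat \<times> 's rigid_mor \<Rightarrow>\<^sub>0 'k::{comm_ring,comm_monoid_mult})" where
 "fund n \<sigma> = push M (cube_map n \<sigma> 0 n) (cube [1..<n])"

lemma fund_front:
 assumes "\<sigma> \<in> spx S n" "i \<le> n"
 shows "fund i (front_face S n i \<sigma>) = push M (cube_map n \<sigma> 0 i) (cube [1..<i])"
 using push_cube_map_arrow[of \<sigma> n "\<lambda>t. t" i 0 i "[1..<i]"] assms mono_maps_restrict[of i "\<lambda>t. t" n]
 unfolding fund_def front_face_def by simp

lemma fund_last:
 assumes "\<sigma> \<in> spx S n" "i \<le> n"
 shows "fund (n - i) (last_face S n (n - i) \<sigma>) = push M (cube_map n \<sigma> i n) (cube [Suc i..<n])"
proof -
 have "map (\<lambda>t. t + i) [1..<n - i] = [Suc i..<n]"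
  by (rule nth_equalityI) auto
 moreover have "restrict (\<lambda>t. t + i) {..n - i} \<in> mono_maps (n - i) n"
  by (rule mono_maps_restrict) (use assms in auto)
 moreover have "(\<lambda>t\<in>{..n - i}. t + (n - (n - i))) = restrict (\<lambda>t. t + i) {..n - i}" using assms by auto
 ultimately show ?thesis
  using push_cube_map_arrow[of \<sigma> n "\<lambda>t. t + i" "n - i" 0 "n - i" "[1..<n - i]"] assms
  unfolding fund_def last_face_def by (simp add: le_diff_conv2)
qed

lemma fund_face:
 assumes "\<sigma> \<in> spx S (Suc m)" "1 \<le> i" "i \<le> m"
 shows "fund m (sface S m i \<sigma>) = push M (cube_map (Suc m) \<sigma> 0 (Suc m)) (cube ([1..<i] @ [Suc i..<Suc m]))"
proof -
 let ?f = "\<lambda>t. if t < i then t else Suc t"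
 have "[1..<m] = [1..<i] @ [i..<m]" using assms upt_add_eq_append[of 1 i "m - i"] by simp
 moreover have "map ?f [1..<i] = [1..<i]" by (rule map_idI) auto
 moreover have "map ?f [i..<m] = map Suc [i..<m]" by (rule map_cong) auto
 ultimately have "map ?f [1..<m] = [1..<i] @ [Suc i..<Suc m]" by (simp add: map_Suc_upt del: upt_Suc)
 moreover have "restrict ?f {..m} \<in> mono_maps m (Suc m)"
  by (rule mono_maps_restrict) auto
 moreover have "?f v \<in> {?f 0..?f m} \<longleftrightarrow> v \<in> {0..m}" for v using assms by auto
 ultimately show ?thesis
  using push_cube_map_arrow[of \<sigma> "Suc m" ?f m 0 m "[1..<m]"] assms
  unfolding fund_def sface_def coface_def by (simp del: upt_Suc)
qed

lemma cube_map_join: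
 assumes \<sigma>: "\<sigma> \<in> spx S n" and i: "i \<le> n" and U: "U \<in> chains_in (Pow {..i}) r" and V: "V \<in> chains_in (Pow {i..}) r"
 shows "cube_map n \<sigma> 0 n r (\<lambda>t\<in>{..r}. U t \<union> {i} \<union> V t) = mul r (cube_map n \<sigma> 0 i r U) (cube_map n \<sigma> i n r V)"
proof -
 have UV: "U \<in> chains_in UNIV r" "V \<in> chains_in UNIV r" using U V by (auto simp: chains_in_def)
 have vU: "valid r (cube_letter n \<sigma> 0 i r U)" by (rule valid_cube_letter[OF \<sigma> _ i UV(1)]) simp
 have vV: "valid r (cube_letter n \<sigma> i n r V)" by (rule valid_cube_letter[OF \<sigma> i _ UV(2)]) simp
 have "mul r (cube_map n \<sigma> 0 i r U) (cube_map n \<sigma> i n r V) = cls r [cube_letter n \<sigma> 0 i r U, cube_letter n \<sigma> i n r V]"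
  unfolding cube_map_def using mul_cls[of "[cube_letter n \<sigma> 0 i r U]" r "[cube_letter n \<sigma> i n r V]"] vU vV by simp
 also have "\<dots> = cube_map n \<sigma> 0 n r (\<lambda>t\<in>{..r}. U t \<union> {i} \<union> V t)"
 proof -
  have "clamp 0 i (U t) \<union> clamp i n (V t) = clamp 0 n (U t \<union> {i} \<union> V t)" if "t \<le> r" for t
   using chains_inD(1)[OF U that] chains_inD(1)[OF V that] i by (fastforce simp: clamp_def)
  then have "(\<lambda>t\<in>{..r}. (\<lambda>t\<in>{..r}. clamp 0 i (U t)) t \<union> (\<lambda>t\<in>{..r}. clamp i n (V t)) t)
    = (\<lambda>t\<in>{..r}. clamp 0 n ((\<lambda>t\<in>{..r}. U t \<union> {i} \<union> V t) t))" by (auto simp: fun_eq_iff)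
  then show ?thesis
   using eqv_comp[OF vU[unfolded cube_letter_def] vV[unfolded cube_letter_def]] cls_eq_iff vU vV
   unfolding cube_map_def cube_letter_def by simp
 qed
 finally show ?thesis ..
qed

lemma push_cube_product:
 assumes \<sigma>: "\<sigma> \<in> spx S n" and i: "i \<le> n" and l: "set l \<subseteq> {..i}" "set l' \<subseteq> {i..}"
 shows "push M (cube_map n \<sigma> 0 n) (jmul (cube l) (jmul (gen (0, point {i})) (cube l')))
  = gmul (push M (cube_map n \<sigma> 0 i) (cube l)) (push M (cube_map n \<sigma> i n) (cube l' :: _ \<Rightarrow>\<^sub>0 'k::{comm_ring,comm_monoid_mult}))"
proof -
 let ?X = "nerve (Pow {..i})" and ?Y = "nerve (Pow {i..})"
 let ?m = "\<lambda>r U V. \<lambda>t\<in>{..r}. U t \<union> {i} \<union> V t"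
 let ?add = "\<lambda>r V. \<lambda>t\<in>{..r}. {i} \<union> V t"
 have P: "pairing ?X ?Y Pow_nerve ?m" by (rule pairing_join) auto
 have sub: "simplicial_on (nerve P) Pow_nerve (\<lambda>n U. U)" for P
  by (auto simp: simplicial_on_def spx_nerve sact_nerve chains_in_def)
 have add: "simplicial_on ?Y Pow_nerve ?add"
  unfolding simplicial_on_def spx_nerve sact_nerve
 proof (intro conjI allI ballI)
  fix r V assume V: "V \<in> chains_in (Pow {i..}) r"
  show "?add r V \<in> chains_in UNIV r"
   by (rule chains_in_restrict) (use chains_inD(2)[OF V] in auto)
  fix k \<theta> assume "\<theta> \<in> mono_maps k r"
  then show "?add k (compose {..k} V \<theta>) = compose {..k} (?add r V) \<theta>"
   by (auto simp: compose_def fun_eq_iff dest: mono_mapsD)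
 qed
 have restr: "simplicial_on (nerve P) M f" if "simplicial_on Pow_nerve M f" for P f
  using that by (auto simp: simplicial_on_def spx_nerve sact_nerve chains_in_def)
 note c = cube_nchains_sub[OF l(1), where 'k = 'k] cube_nchains_sub[OF l(2), where 'k = 'k]
 have "push Pow_nerve (\<lambda>n U. U) (bilin (shuffle ?X ?Y Pow_nerve ?m) (cube l) (cube l'))
   = jmul (push Pow_nerve (\<lambda>n U. U) (cube l)) (push Pow_nerve ?add (cube l' :: _ \<Rightarrow>\<^sub>0 'k))"
  by (rule shuffle_natural_chain[OF P join_pairing sub add sub _ c]) (auto simp: join_def fun_eq_iff)
 moreover have "push Pow_nerve ?add (cube l') = jmul (gen (0, point {i})) (cube l' :: _ \<Rightarrow>\<^sub>0 'k)"
 proof -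
  have "nchain Pow_nerve (q, ?add q V) = (join.sh (0, point {i}) (q, V) :: _ \<Rightarrow>\<^sub>0 'k)"
   if "(q, V) \<in> keys (cube l' :: _ \<Rightarrow>\<^sub>0 'k)" for q V
  proof -
   have "join q (sact Pow_nerve q 0 (\<lambda>t\<in>{..q}. 0) (point {i})) V = ?add q V"
    by (auto simp: join_def sact_nerve point_def compose_def fun_eq_iff)
   then show ?thesis
    by (simp add: shuffle_vertex_left[OF nchains_keysD[OF cube_nchains that] simplicial_set_nerve])
  qed
  then show ?thesis unfolding push_def bilin_gen_left by (intro lin_cong) auto
 qed
 ultimately have "jmul (cube l) (jmul (gen (0, point {i})) (cube l')) = bilin (shuffle ?X ?Y Pow_nerve ?m) (cube l) (cube l' :: _ \<Rightarrow>\<^sub>0 'k)"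
  by (simp only: push_id[OF bilin_shuffle_nchains] push_id[OF cube_nchains])
 moreover have "push M (cube_map n \<sigma> 0 n) (bilin (shuffle ?X ?Y Pow_nerve ?m) (cube l) (cube l'))
   = gmul (push M (cube_map n \<sigma> 0 i) (cube l)) (push M (cube_map n \<sigma> i n) (cube l' :: _ \<Rightarrow>\<^sub>0 'k))"
 proof (rule shuffle_natural_chain[OF P G.mult _ _ _ _ c])
  show "simplicial_on ?X M (cube_map n \<sigma> 0 i)" by (rule restr[OF cube_map_simplicial[OF \<sigma> _ i]]) simp
  show "simplicial_on ?Y M (cube_map n \<sigma> i n)" by (rule restr[OF cube_map_simplicial[OF \<sigma> i]]) simp
  show "simplicial_on Pow_nerve M (cube_map n \<sigma> 0 n)" by (rule cube_map_simplicial[OF \<sigma>]) auto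
  show "cube_map n \<sigma> 0 n r (?m r U V) = mul r (cube_map n \<sigma> 0 i r U) (cube_map n \<sigma> i n r V)"
   if "U \<in> spx ?X r" "V \<in> spx ?Y r" for r U V
   by (rule cube_map_join[OF \<sigma> i]) (use that in \<open>simp_all add: spx_nerve\<close>)
 qed
 ultimately show ?thesis by simp
qed

text \<open>The boundary of a cube: the two faces in the direction of the inner vertex \<open>i\<close> are the cube of
 the face opposite to \<open>i\<close> and the product of the cubes of the front and the last face at \<open>i\<close>.\<close>

theorem boundary_fund:
 assumes \<sigma>: "\<sigma> \<in> spx S (Suc m)"
 shows "lin (chain_boundary M) (fund (Suc m) \<sigma>) = (\<Sum>j<m. sgn_pow j
   (gmul (fund (Suc j) (front_face S (Suc m) (Suc j) \<sigma>)) (fund (m - j) (last_face S (Suc m) (m - j) \<sigma>))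
   - fund m (sface S m (Suc j) \<sigma>)) :: _ \<Rightarrow>\<^sub>0 'k::{comm_ring,comm_monoid_mult})"
proof -
 let ?n = "Suc m" and ?p = "push M (cube_map (Suc m) \<sigma> 0 (Suc m))"
 have s: "simplicial_on Pow_nerve M (cube_map ?n \<sigma> 0 ?n)" by (rule cube_map_simplicial[OF \<sigma>]) auto
 have "lin (chain_boundary M) (fund ?n \<sigma>) = ?p (lin (chain_boundary Pow_nerve) (cube [1..<?n] :: _ \<Rightarrow>\<^sub>0 'k))"
  unfolding fund_def by (rule push_boundary_chain[OF simplicial_set_nerve simplicial_set_M s cube_nchains, symmetric])
 also have "\<dots> = (\<Sum>j<m. sgn_pow j (?p (jmul (cube (take j [1..<?n])) (jmul (gen (0, point {[1..<?n] ! j})) (cube (drop (Suc j) [1..<?n]))))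
   - ?p (cube (take j [1..<?n] @ drop (Suc j) [1..<?n]))))"
  unfolding boundary_cube push_def lin_sum lin_sgn_pow lin_diff by (simp del: upt_Suc bilin_gen_left cube.simps)
 also have "\<dots> = (\<Sum>j<m. sgn_pow j
   (gmul (fund (Suc j) (front_face S ?n (Suc j) \<sigma>)) (fund (m - j) (last_face S ?n (m - j) \<sigma>))
   - fund m (sface S m (Suc j) \<sigma>)))"
 proof (rule sum.cong[OF HOL.refl])
  fix j assume "j \<in> {..<m}"
  then have j: "j < m" by simp
  have t: "take j [1..<?n] = [1..<Suc j]" "[1..<?n] ! j = Suc j" "drop (Suc j) [1..<?n] = [Suc (Suc j)..<?n]"
   using j by (simp_all del: upt_Suc add: take_upt)
  have "?p (jmul (cube [1..<Suc j]) (jmul (gen (0, point {Suc j})) (cube [Suc (Suc j)..<?n])))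
    = gmul (fund (Suc j) (front_face S ?n (Suc j) \<sigma>)) (fund (?n - Suc j) (last_face S ?n (?n - Suc j) \<sigma>) :: _ \<Rightarrow>\<^sub>0 'k)"
   unfolding fund_front[OF \<sigma> Suc_leI[OF less_SucI[OF j]]] fund_last[OF \<sigma> Suc_leI[OF less_SucI[OF j]]]
   by (rule push_cube_product[OF \<sigma>]) (use j in auto)
  moreover have "?p (cube ([1..<Suc j] @ [Suc (Suc j)..<?n])) = (fund m (sface S m (Suc j) \<sigma>) :: _ \<Rightarrow>\<^sub>0 'k)"
   by (rule fund_face[OF \<sigma>, symmetric]) (use j in auto)
  ultimately show "sgn_pow j (?p (jmul (cube (take j [1..<?n])) (jmul (gen (0, point {[1..<?n] ! j})) (cube (drop (Suc j) [1..<?n]))))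
   - ?p (cube (take j [1..<?n] @ drop (Suc j) [1..<?n]))) = sgn_pow j
   (gmul (fund (Suc j) (front_face S ?n (Suc j) \<sigma>)) (fund (m - j) (last_face S ?n (m - j) \<sigma>))
   - fund m (sface S m (Suc j) \<sigma>) :: _ \<Rightarrow>\<^sub>0 'k)"
   unfolding t by simp
 qed
 finally show ?thesis .
qed

lemma fund_gr: "(fund n \<sigma> :: _ \<Rightarrow>\<^sub>0 'k::{comm_ring,comm_monoid_mult}) \<in> gr_chains M (int (n - 1))"
 unfolding gr_chains_def mem_Collect_eq fund_def push_def
proof (rule keys_lin, clarify)
 fix r U k c assume "(r, U) \<in> keys (cube [1..<n] :: _ \<Rightarrow>\<^sub>0 'k)"
  and k: "(k, c) \<in> keys (nchain M (r, cube_map n \<sigma> 0 n r U) :: _ \<Rightarrow>\<^sub>0 'k)"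
 then have "r = n - 1" using keys_cube(1)[of r U "[1..<n]"] by simp
 then show "(k, c) \<in> nondegenerate M \<and> int k = int (n - 1)" using keys_nchain[of M "(r, cube_map n \<sigma> 0 n r U)"] k by auto
qed

lemma degenerate_cls:
 assumes l: "valid r (s, a, b, W)" and t: "t < r" "W t = W (Suc t)"
 shows "degenerate M r (cls r [(s, a, b, W)])"
proof -
 define e where "e = restrict (\<lambda>u. if u = t then Suc t else u) {..r}"
 have e: "e \<in> mono_maps r r" unfolding e_def
  by (rule mono_maps_restrict) (use t in \<open>auto simp: le_eq_less_or_eq Suc_le_eq\<close>)
 obtain n \<sigma> where s: "s = (n, \<sigma>)" by (cases s)
 have "compose {..r} W e = W"
  using t chains_inD(3)[OF validD(4)[OF l[unfolded s]]] by (auto simp: compose_def e_def fun_eq_iff not_le)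
 then have "sact M r r e (cls r [(s, a, b, W)]) = cls r [(s, a, b, W)]"
  using sact_M[OF e, of "[(s, a, b, W)]"] l by simp
 moreover have "cls r [(s, a, b, W)] \<in> spx M r" using l by (auto simp: spx_M intro!: exI[of _ "[(s, a, b, W)]"])
 then have "degenerate M r (sact M r r e (cls r [(s, a, b, W)]))"
  by (rule degenerate_act[OF simplicial_set_M e _ t(1)]) (use t in \<open>auto simp: e_def\<close>)
 ultimately show ?thesis by simp
qed

text \<open>The cube of a degenerate simplex factors through the cube of a simplex of smaller dimension, which
 is a point if that simplex is a vertex.\<close>

lemma fund_degenerate:
 assumes d: "degenerate S n \<sigma>"
 shows "fund n \<sigma> = (if n = 1 then nchain M (0, one) else 0 :: _ \<Rightarrow>\<^sub>0 'k::{comm_ring,comm_monoid_mult})"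
proof -
 obtain m i \<tau> where n: "n = Suc m" and i: "i \<le> m" and \<tau>: "\<tau> \<in> spx S m"
  and \<sigma>: "\<sigma> = sact S n m (codegeneracy m i) \<tau>" using d unfolding degenerate_def by blast
 let ?c = "codegeneracy m i"
 have c: "?c \<in> mono_maps n m" using codegeneracy_mono[OF i] n by simp
 have \<sigma>S: "\<sigma> \<in> spx S n" using degenerate_spx[OF S d] .
 have c0: "?c 0 = 0" "?c n = m" using i n by (auto simp: codegeneracy_def)
 have eq: "cube_map n \<sigma> 0 n r U = cls r [((m, \<tau>), 0, m, \<lambda>q\<in>{..r}. ?c ` (\<lambda>t\<in>{..r}. clamp 0 n (U t)) q)]"
  "valid r ((m, \<tau>), 0, m, \<lambda>q\<in>{..r}. ?c ` (\<lambda>t\<in>{..r}. clamp 0 n (U t)) q)"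
  if U: "U \<in> chains_in UNIV r" for r U
 proof -
  have v: "valid r ((n, sact S n m ?c \<tau>), 0, n, \<lambda>t\<in>{..r}. clamp 0 n (U t))"
   using valid_cube_letter[OF \<sigma>S _ _ U, of 0 n] by (simp add: cube_letter_def \<sigma>)
  show "valid r ((m, \<tau>), 0, m, \<lambda>q\<in>{..r}. ?c ` (\<lambda>t\<in>{..r}. clamp 0 n (U t)) q)"
   using valid_arrow[OF \<tau> c v] by (simp add: c0)
  show "cube_map n \<sigma> 0 n r U = cls r [((m, \<tau>), 0, m, \<lambda>q\<in>{..r}. ?c ` (\<lambda>t\<in>{..r}. clamp 0 n (U t)) q)]"
   using eqv_arrow[OF \<tau> c v] v cls_eq_iff by (simp add: cube_map_def cube_letter_def \<sigma> c0)
 qed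
 show ?thesis
 proof (cases "m = 0")
  case True
  have U: "bottom \<in> chains_in UNIV 0" by (rule bottom_chain) simp
  have "?c ` A \<subseteq> {0}" if "A \<subseteq> {..1}" for A
   using mono_mapsD(1)[OF c] that True n by auto
  then have "?c ` clamp 0 n (bottom 0) = {0}" using True n c0 by (simp add: clamp_def bottom_def)
  then have "(\<lambda>q\<in>{..0}. ?c ` (\<lambda>t\<in>{..0}. clamp 0 n (bottom t)) q) = (\<lambda>t\<in>{..0}. {0})" by (auto simp: fun_eq_iff)
  then have "cube_map n \<sigma> 0 n 0 bottom = cls 0 [((0, \<tau>), 0, 0, \<lambda>t\<in>{..0}. {0})]"
   using eq(1)[OF U] True by simp
  also have "\<dots> = cls 0 []"
   using eqv_ident[of \<tau> 0 0 0] \<tau> True valid_ident[of \<tau> 0 0 0] cls_eq_iff by simp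
  finally have "cube_map n \<sigma> 0 n 0 bottom = one" by (simp add: one_cls)
  then show ?thesis using True n by (simp add: fund_def push_def)
 next
  case False
  have "fund n \<sigma> = lin (\<lambda>_. 0 :: _ \<Rightarrow>\<^sub>0 'k) (cube [1..<n] :: _ \<Rightarrow>\<^sub>0 'k)"
   unfolding fund_def push_def
  proof (rule lin_cong)
   fix z assume z: "z \<in> keys (cube [1..<n] :: _ \<Rightarrow>\<^sub>0 'k)"
   obtain r U where zr: "z = (r, U)" by (cases z)
   have r: "r = m" using keys_cube(1)[OF z[unfolded zr]] n by simp
   have U: "U \<in> chains_in UNIV r" using nchains_keysD[OF cube_nchains z[unfolded zr]] by (simp add: spx_nerve)
   define W where "W = (\<lambda>q\<in>{..r}. ?c ` (\<lambda>t\<in>{..r}. clamp 0 n (U t)) q)"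
   note v = eq(2)[OF U, folded W_def]
   have "\<exists>t<r. W t = W (Suc t)"
   proof (rule ccontr)
    assume neg: "\<not> (\<exists>t<r. W t = W (Suc t))"
    have "t \<le> r ==> t + 2 \<le> card (W t)" for t
    proof (induction t)
     case 0
     have "{0, m} \<subseteq> W 0" using validD(7,8)[OF v, of 0] by simp
     then show ?case using card_mono[OF validD(12)[OF v, of 0], of "{0, m}"] False by simp
    next
     case (Suc t)
     have "W t \<subset> W (Suc t)" using neg Suc.prems chains_inD(2)[OF validD(4)[OF v], of t "Suc t"] by auto
     from psubset_card_mono[OF validD(12)[OF v Suc.prems] this] show ?case using Suc by simp
    qed
    from this[of r] have "m + 2 \<le> card (W r)" using r by simp
    moreover have "card (W r) \<le> card {0..m}" by (rule card_mono) (use validD(6)[OF v, of r] in auto)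
    ultimately show False by simp
   qed
   then obtain t where "t < r" "W t = W (Suc t)" by blast
   from degenerate_cls[OF v this] show "(case z of (n', \<sigma>') => nchain M (n', cube_map n \<sigma> 0 n n' \<sigma>')) = (0 :: _ \<Rightarrow>\<^sub>0 'k)"
    unfolding zr case_prod_conv eq(1)[OF U] W_def[symmetric] by (rule nchain_degenerate)
  qed
  then show ?thesis using False n by simp
 qed
qed

text \<open>A nondegenerate simplex of dimension \<open>n - 1\<close> has a time for each of the \<open>n - 1\<close> inner
 vertices, so none is missing at the end or present at the start.\<close>

lemma cube_letter_normal:
 assumes \<sigma>: "(n, \<sigma>) \<in> nondegenerate S" "0 < n" and U: "U \<in> chains_in UNIV (n - 1)"
  and nd: "\<not> degenerate M (n - 1) (cube_map n \<sigma> 0 n (n - 1) U)"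
 shows "normal (n - 1) (cube_letter n \<sigma> 0 n (n - 1) U)"
proof -
 let ?r = "n - 1"
 have \<sigma>S: "\<sigma> \<in> spx S n" using \<sigma>(1) by (simp add: nondegenerate_def)
 have v: "valid ?r (cube_letter n \<sigma> 0 n ?r U)" by (rule valid_cube_letter[OF \<sigma>S _ _ U]) auto
 let ?W = "\<lambda>t. clamp 0 n (U t)"
 obtain sh bs where c: "cell_ok ?r sh bs" "cube_map n \<sigma> 0 n ?r U = cell ?r sh bs"
  "vol sh \<le> (\<Sum>l\<leftarrow>[cube_letter n \<sigma> 0 n ?r U]. vertices_added ?r l)"
  using cls_is_cell[of "[cube_letter n \<sigma> 0 n ?r U]" ?r] v unfolding cube_map_def by auto
 have "packed ?r bs" using nd degenerate_cell_iff[OF c(1)] c(2) by simp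
 then have "card {1..?r} \<le> length bs" unfolding packed_def by (metis card_length)
 then have "n - 1 \<le> card (?W ?r - ?W 0)"
  using c(1,3) by (simp add: cell_ok_def cube_letter_def vertices_added_def)
 moreover have "?W ?r - ?W 0 \<subseteq> {1..<n}" by (auto simp: clamp_def Suc_le_eq)
 moreover have "card {1..<n} = n - 1" by simp
 ultimately have eq: "?W ?r - ?W 0 = {1..<n}"
  by (metis card_seteq finite_atLeastLessThan)
 have W: "?W t \<subseteq> {0..n}" "{0, n} \<subseteq> ?W t" for t by (auto simp: clamp_def)
 have "?W 0 \<inter> {1..<n} = {}" unfolding eq[symmetric] by blast
 then have "v \<in> {0, n}" if "v \<in> ?W 0" for v using that subsetD[OF W(1) that] by (cases "v = 0") auto
 then have "?W 0 = {0, n}" using W(2)[of 0] by blast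
 moreover have "?W ?r = {0..n}"
 proof (intro equalityI subsetI)
  fix v assume "v \<in> {0..n}"
  then consider "v = 0" | "v = n" | "v \<in> {1..<n}" by fastforce
  then show "v \<in> ?W ?r"
  proof cases
   case 3
   then show ?thesis unfolding eq[symmetric] by blast
  qed (use W(2)[of ?r] in auto)
 qed (use W(1)[of ?r] in blast)
 ultimately show ?thesis using v \<sigma> by (simp add: cube_letter_def nondegenerate_def)
qed

lemma fund_keys:
 assumes \<sigma>: "(n, \<sigma>) \<in> nondegenerate S" "0 < n"
  and z: "(r, c) \<in> keys (fund n \<sigma> :: _ \<Rightarrow>\<^sub>0 'k::{comm_ring,comm_monoid_mult})"
 shows "r = n - 1 \<and> (\<exists>bs. cell_ok (n - 1) [(n, \<sigma>)] bs \<and> packed (n - 1) bs \<and> c = cell (n - 1) [(n, \<sigma>)] bs)"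
proof -
 have "keys (fund n \<sigma> :: _ \<Rightarrow>\<^sub>0 'k)
   \<subseteq> {(n - 1, cell (n - 1) [(n, \<sigma>)] bs) | bs. cell_ok (n - 1) [(n, \<sigma>)] bs \<and> packed (n - 1) bs}"
  unfolding fund_def push_def
 proof (rule keys_lin, clarify)
  fix q U k d assume "(q, U) \<in> keys (cube [1..<n] :: _ \<Rightarrow>\<^sub>0 'k)"
   and k: "(k, d) \<in> keys (nchain M (q, cube_map n \<sigma> 0 n q U) :: _ \<Rightarrow>\<^sub>0 'k)"
  then have q: "q = n - 1" and U: "U \<in> chains_in UNIV (n - 1)"
   using keys_cube(1)[of q U "[1..<n]"] nchains_keysD[OF cube_nchains, of q U "[1..<n]"] by (auto simp: spx_nerve)
  have kd: "k = n - 1" "d = cube_map n \<sigma> 0 n (n - 1) U" "(k, d) \<in> nondegenerate M"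
   using k keys_nchain[of M "(q, cube_map n \<sigma> 0 n q U)"] q by auto
  then have "normal (n - 1) (cube_letter n \<sigma> 0 n (n - 1) U)"
   by (intro cube_letter_normal[OF \<sigma> U]) (simp add: nondegenerate_def)
  then obtain sh bs where "cell_ok (n - 1) sh bs" "[cube_letter n \<sigma> 0 n (n - 1) U] = build (n - 1) sh bs"
   using normal_is_build[of "[cube_letter n \<sigma> 0 n (n - 1) U]" "n - 1"] by auto
  note b = this
  then obtain s where s: "sh = [s]" by (cases sh; cases "tl sh") auto
  have "s = (n, \<sigma>)" using b(2) s by (cases s) (auto simp: cube_letter_def)
  then have "cell_ok (n - 1) [(n, \<sigma>)] bs" "d = cell (n - 1) [(n, \<sigma>)] bs"
   using b s kd(2) by (auto simp: cell_def cube_map_def)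
  moreover from this have "packed (n - 1) bs" using kd(1,3) degenerate_cell_iff by (auto simp: nondegenerate_def)
  ultimately show "\<exists>bs. (k, d) = (n - 1, cell (n - 1) [(n, \<sigma>)] bs) \<and> cell_ok (n - 1) [(n, \<sigma>)] bs \<and> packed (n - 1) bs"
   using kd(1) by blast
 qed
 then show ?thesis using z by auto
qed

definition top_cell :: "(nat \<times> 's) list => nat \<times> 's rigid_mor" where
 "top_cell sh = (vol sh, cell (vol sh) sh (rev [1..<Suc (vol sh)]))"

lemma top_cell_ok: "is_shape sh ==> cell_ok (vol sh) sh (rev [1..<Suc (vol sh)])" "packed r (rev [1..<Suc r])"
 by (auto simp: cell_ok_def packed_def)

lemma fund_top:
 assumes \<sigma>: "(n, \<sigma>) \<in> nondegenerate S" "0 < n"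
 shows "\<exists>\<epsilon>. \<epsilon> * \<epsilon> = (1 :: 'k::{comm_ring,comm_monoid_mult}) \<and> lookup (fund n \<sigma>) (top_cell [(n, \<sigma>)]) = \<epsilon>"
proof -
 let ?r = "n - 1" and ?F = "rev_flag [1..<n]"
 have sh: "is_shape [(n, \<sigma>)]" using \<sigma> by (simp add: is_shape_def)
 have FU: "?F \<in> chains_in UNIV ?r" using rev_flag_chain[of "[1..<n]"] by (auto simp: chains_in_def)
 have flag: "?F t = {n - t..<n}" if "t \<le> ?r" for t
 proof -
  have "1 + (n - 1 - t) = n - t" using that \<sigma>(2) by simp
  then show ?thesis using that by (simp add: rev_flag_def)
 qed
 have letter: "cube_letter n \<sigma> 0 n ?r ?F = word_letter ?r (n, \<sigma>) (rev [1..<n])"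
 proof -
  have "clamp 0 n {n - t..<n} = {0, n} \<union> {v \<in> {1..<n}. rev [1..<n] ! (v - 1) \<le> t}" if "t \<le> ?r" for t
  proof -
   have "rev [1..<n] ! (v - 1) = n - v" if v: "v \<in> {1..<n}" for v
   proof -
    have "rev [1..<n] ! (v - 1) = [1..<n] ! (n - 1 - Suc (v - 1))"
     using v by (subst rev_nth) auto
    also have "n - 1 - Suc (v - 1) = n - 1 - v" using v by auto
    also have "[1..<n] ! (n - 1 - v) = 1 + (n - 1 - v)" by (rule nth_upt) (use v in auto)
    finally show ?thesis using v by auto
   qed
   then have "{v \<in> {1..<n}. rev [1..<n] ! (v - 1) \<le> t} = {v \<in> {1..<n}. n - v \<le> t}" by auto
   moreover have "{n - t..<n} \<inter> {0..n} = {v \<in> {1..<n}. n - v \<le> t}"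
   proof (rule set_eqI)
    fix v show "v \<in> {n - t..<n} \<inter> {0..n} \<longleftrightarrow> v \<in> {v \<in> {1..<n}. n - v \<le> t}"
     using that \<sigma>(2) by simp linarith
   qed
   ultimately show ?thesis by (simp only: clamp_def Un_commute)
  qed
  then show ?thesis using flag by (simp add: cube_letter_def fun_eq_iff)
 qed
 have top: "top_cell [(n, \<sigma>)] = (?r, cube_map n \<sigma> 0 n ?r ?F)"
  using \<sigma>(2) letter by (simp add: top_cell_def cell_def cube_map_def del: word_letter.simps upt_Suc)
 have nd: "top_cell [(n, \<sigma>)] \<in> nondegenerate M"
  unfolding top_cell_def nondegenerate_cell_iff using top_cell_ok(1)[OF sh] top_cell_ok(2) by blast
 have other: "lookup (case b of (q, U) => nchain M (q, cube_map n \<sigma> 0 n q U)) (top_cell [(n, \<sigma>)]) = (0 :: 'k)"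
  if bk: "b \<in> keys (cube [1..<n] :: _ \<Rightarrow>\<^sub>0 'k)" and bF: "b \<noteq> (?r, ?F)" for b
 proof -
  obtain q U where b: "b = (q, U)" by (cases b)
  have q: "q = ?r" using keys_cube(1)[OF bk[unfolded b]] by simp
  have U: "U \<in> chains_in (Pow {1..<n}) ?r" using keys_cube(2)[OF bk[unfolded b]] q by simp
  have UU: "U \<in> chains_in UNIV ?r" using U by (auto simp: chains_in_def)
  have "cube_map n \<sigma> 0 n ?r U \<noteq> cube_map n \<sigma> 0 n ?r ?F"
  proof
   assume eq: "cube_map n \<sigma> 0 n ?r U = cube_map n \<sigma> 0 n ?r ?F"
   have "\<not> degenerate M ?r (cube_map n \<sigma> 0 n ?r ?F)" using nd top by (simp add: nondegenerate_def)
   then have N: "normal ?r (cube_letter n \<sigma> 0 n ?r U)" "normal ?r (cube_letter n \<sigma> 0 n ?r ?F)"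
    using cube_letter_normal[OF \<sigma>] UU FU eq by auto
   have "nf ?r [cube_letter n \<sigma> 0 n ?r U] = nf ?r [cube_letter n \<sigma> 0 n ?r ?F]"
    using eq N normal_valid cls_eq_iff_nf[of "[cube_letter n \<sigma> 0 n ?r U]" ?r "[cube_letter n \<sigma> 0 n ?r ?F]"]
    by (simp add: cube_map_def)
   then have l: "cube_letter n \<sigma> 0 n ?r U = cube_letter n \<sigma> 0 n ?r ?F" using nf_normal N by simp
   have "U t = ?F t" if t: "t \<le> ?r" for t
   proof -
    have "clamp 0 n (U t) = clamp 0 n (?F t)"
     using l t by (simp add: cube_letter_def fun_eq_iff) metis
    then have "clamp 0 n (U t) - {0, n} = clamp 0 n (?F t) - {0, n}" by simp
    moreover have inner: "clamp 0 n A - {0, n} = A" if A: "A \<subseteq> {1..<n}" for A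
    proof -
     have "{1..<n} \<subseteq> {0..n}" "{1..<n} \<inter> {0, n} = {}" by auto
     then have "A \<inter> {0..n} = A" "A \<inter> {0, n} = {}" using A by blast+
     then show ?thesis unfolding clamp_def by blast
    qed
    moreover have "U t \<subseteq> {1..<n}" using chains_inD(1)[OF U t] by blast
    moreover have "?F t \<subseteq> {1..<n}" unfolding flag[OF t] using t \<sigma>(2) by auto
    ultimately show ?thesis by simp
   qed
   then have "U = ?F" by (rule chains_in_eqI[OF U FU])
   then show False using bF b q by simp
  qed
  then have "top_cell [(n, \<sigma>)] \<noteq> (q, cube_map n \<sigma> 0 n q U)" using top q by auto
  then have "top_cell [(n, \<sigma>)] \<notin> keys (nchain M (q, cube_map n \<sigma> 0 n q U) :: _ \<Rightarrow>\<^sub>0 'k)"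
   using keys_nchain[of M "(q, cube_map n \<sigma> 0 n q U)"] by blast
  then show ?thesis unfolding b by (simp add: in_keys_iff)
 qed
 have "lookup (fund n \<sigma>) (top_cell [(n, \<sigma>)])
   = lookup (cube [1..<n]) (?r, ?F) * (lookup (nchain M (?r, cube_map n \<sigma> 0 n ?r ?F)) (top_cell [(n, \<sigma>)]) :: 'k)"
 proof -
  have "lookup (lin (\<lambda>(q, U). nchain M (q, cube_map n \<sigma> 0 n q U)) (cube [1..<n])) (top_cell [(n, \<sigma>)])
   = lookup (cube [1..<n]) (?r, ?F)
     * (lookup (case (?r, ?F) of (q, U) => nchain M (q, cube_map n \<sigma> 0 n q U)) (top_cell [(n, \<sigma>)]) :: 'k)"
   by (rule lookup_lin_single) (rule other)
  then show ?thesis unfolding fund_def push_def by (simp only: case_prod_conv)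
 qed
 also have "\<dots> = lookup (cube [1..<n]) (?r, ?F)"
  using nd by (simp add: top nchain_nondegenerate lookup_gen)
 finally show ?thesis using lookup_cube_rev_flag[of "[1..<n]", where 'k = 'k] by simp
qed

end

section \<open>Chains of words\<close>

context simplicial_monoid
begin

lemma unit_gr: "(gen (0, e) :: _ \<Rightarrow>\<^sub>0 'k::{comm_ring,comm_monoid_mult}) \<in> gr_chains M 0"
 using unit by (auto simp: gr_chains_def vertex_nondegenerate dest!: in_keys_genD)

end

lemma birth_opI:
 assumes \<psi>: "\<psi> \<in> mono_maps k r" "\<psi> k = r" and b: "b \<le> r" and c: "c \<le> k"
  and iff: "\<And>t. t \<le> k ==> b \<le> \<psi> t \<longleftrightarrow> c \<le> t"
 shows "birth_op \<psi> b = c"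
 using birth_op[OF \<psi> b] iff c by (metis le_antisym order_refl)

lemma rev_upt_split: "rev [1..<Suc (p + q)] = map (\<lambda>b. b + q) (rev [1..<Suc p]) @ rev [1..<Suc q]"
proof -
 have "[1..<Suc (p + q)] = [1..<Suc q] @ map (\<lambda>b. b + q) [1..<Suc p]"
  by (rule nth_equalityI) (auto simp: nth_append simp del: upt_Suc)
 then show ?thesis by (simp add: rev_map del: upt_Suc)
qed

definition shuffle_births :: "nat => nat => nat set => nat list => nat list => nat list" where
 "shuffle_births p q \<mu> bs bs' = map (birth_op (count_op (p + q) \<mu>)) bs
   @ map (birth_op (count_op (p + q) ({..<p + q} - \<mu>))) bs'"

text \<open>The top cell adds the vertices one at a time from the last to the first. Hence in a shuffle of two
 cells that is a top cell all steps of the second factor precede those of the first.\<close>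

lemma top_split:
 assumes \<mu>: "\<mu> \<in> shuffle_sets p q" and bs: "length bs = p" "set bs \<subseteq> {1..p}" and bs': "length bs' = q" "packed q bs'"
 shows "shuffle_births p q \<mu> bs bs'
   = rev [1..<Suc (p + q)]
   \<longleftrightarrow> \<mu> = {q..<p + q} \<and> bs = rev [1..<Suc p] \<and> bs' = rev [1..<Suc q]" (is "?eq \<longleftrightarrow> _")
proof -
 let ?\<nu> = "{..<p + q} - \<mu>"
 note D = shuffle_setsD[OF \<mu>]
 have \<mu>end: "count_op (p + q) \<mu> (p + q) = p" using D cnt_total[OF D(1)] by (simp add: count_op_cnt)
 have \<nu>end: "count_op (p + q) ?\<nu> (p + q) = q" using D cnt_total[of ?\<nu> "p + q"] by (simp add: count_op_cnt)
 have split: "?eq \<longleftrightarrow> map (birth_op (count_op (p + q) \<mu>)) bs = map (\<lambda>b. b + q) (rev [1..<Suc p])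
   \<and> map (birth_op (count_op (p + q) ?\<nu>)) bs' = rev [1..<Suc q]"
  unfolding rev_upt_split shuffle_births_def using bs(1) by (intro append_eq_append_conv) simp
 have births: "map (birth_op (count_op (p + q) \<mu>)) bs = map (\<lambda>b. b + q) bs"
   "map (birth_op (count_op (p + q) ?\<nu>)) bs' = bs'" if m: "\<mu> = {q..<p + q}"
 proof -
  have c\<mu>: "cnt \<mu> t = t - q" if "t \<le> p + q" for t
  proof -
   have "{u \<in> \<mu>. u < t} = {q..<t}" using that m by auto
   then show ?thesis by (simp add: cnt_def)
  qed
  show "map (birth_op (count_op (p + q) \<mu>)) bs = map (\<lambda>b. b + q) bs"
  proof (rule map_cong[OF HOL.refl])
   fix b assume "b \<in> set bs"
   then have b: "1 \<le> b" "b \<le> p" using bs(2) by auto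
   show "birth_op (count_op (p + q) \<mu>) b = b + q"
    by (rule birth_opI[OF D(5) \<mu>end b(2)]) (use b in \<open>auto simp: count_op_cnt c\<mu>\<close>)
  qed
  show "map (birth_op (count_op (p + q) ?\<nu>)) bs' = bs'"
  proof (rule map_idI)
   fix b assume "b \<in> set bs'"
   then have b: "1 \<le> b" "b \<le> q" using bs'(2) by (auto simp: packed_def)
   have "cnt ?\<nu> t = t - (t - q)" if "t \<le> p + q" for t
    using cnt_complement[OF that, of \<mu>] c\<mu>[OF that] by simp
   then show "birth_op (count_op (p + q) ?\<nu>) b = b"
    by (intro birth_opI[OF D(6) \<nu>end b(2)]) (use b in \<open>auto simp: count_op_cnt\<close>)
  qed
 qed
 show ?thesis
 proof
  assume ?eq
  then have R: "map (birth_op (count_op (p + q) ?\<nu>)) bs' = rev [1..<Suc q]"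
   and L: "map (birth_op (count_op (p + q) \<mu>)) bs = map (\<lambda>b. b + q) (rev [1..<Suc p])" using split by auto
  have "q \<le> cnt ?\<nu> q"
  proof (cases "q = 0")
   case False
   then have "q \<in> set bs'" using bs'(2) by (simp add: packed_def)
   then have "birth_op (count_op (p + q) ?\<nu>) q \<in> set (rev [1..<Suc q])" unfolding R[symmetric] by simp
   then have "birth_op (count_op (p + q) ?\<nu>) q \<le> q" by (auto simp del: upt_Suc)
   moreover have "birth_op (count_op (p + q) ?\<nu>) q \<le> q \<longleftrightarrow> q \<le> count_op (p + q) ?\<nu> q"
    by (rule birth_op(1)[OF D(6) \<nu>end order_refl]) simp
   moreover have "count_op (p + q) ?\<nu> q = cnt ?\<nu> q" by (simp add: count_op_cnt)
   ultimately show ?thesis by (simp only:)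
  qed simp
  then have "card {..<q} \<le> card {u \<in> ?\<nu>. u < q}" by (simp add: cnt_def)
  then have "{u \<in> ?\<nu>. u < q} = {..<q}" by (intro card_seteq) auto
  then have "{..<q} \<subseteq> ?\<nu>" by blast
  then have "{..<q} = ?\<nu>" using D(4) by (intro card_subset_eq) auto
  then have "\<mu> = {..<p + q} - {..<q}" using D(1) by blast
  then have m: "\<mu> = {q..<p + q}" by auto
  have "bs = rev [1..<Suc p]"
   using L unfolding births(1)[OF m] by (rule map_injective) (simp add: inj_on_def)
  then show "\<mu> = {q..<p + q} \<and> bs = rev [1..<Suc p] \<and> bs' = rev [1..<Suc q]"
   using m R births(2)[OF m] by simp
 next
  assume "\<mu> = {q..<p + q} \<and> bs = rev [1..<Suc p] \<and> bs' = rev [1..<Suc q]"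
  then show ?eq unfolding split using births by simp
 qed
qed

context reduced
begin

lemma shuffle_cells:
 assumes a: "cell_ok p sh bs" and b: "cell_ok q sh' bs'" and \<mu>: "\<mu> \<in> shuffle_sets p q"
 shows "pair_simplex M M mul (p + q) p (count_op (p + q) \<mu>) (cell p sh bs) q (count_op (p + q) ({..<p + q} - \<mu>)) (cell q sh' bs')
   = cell (p + q) (sh @ sh') (shuffle_births p q \<mu> bs bs')"
  "cell_ok (p + q) (sh @ sh') (shuffle_births p q \<mu> bs bs')"
proof -
 let ?\<nu> = "{..<p + q} - \<mu>"
 note D = shuffle_setsD[OF \<mu>]
 have ends: "count_op (p + q) \<mu> 0 = 0" "count_op (p + q) \<mu> (p + q) = p"
  "count_op (p + q) ?\<nu> 0 = 0" "count_op (p + q) ?\<nu> (p + q) = q"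
  using D cnt_total[OF D(1)] cnt_total[of ?\<nu> "p + q"] by (simp_all add: count_op_cnt)
 note A = act_cell[OF D(5) ends(1,2) a] act_cell[OF D(6) ends(3,4) b]
 show "pair_simplex M M mul (p + q) p (count_op (p + q) \<mu>) (cell p sh bs) q (count_op (p + q) ?\<nu>) (cell q sh' bs')
   = cell (p + q) (sh @ sh') (shuffle_births p q \<mu> bs bs')"
  unfolding pair_simplex_def A(1) A(3) shuffle_births_def by (rule mul_cell(1)[OF A(2,4)])
 show "cell_ok (p + q) (sh @ sh') (shuffle_births p q \<mu> bs bs')"
  unfolding shuffle_births_def by (rule mul_cell(2)[OF A(2,4)])
qed

lemma keys_shuffle_cells:
 assumes a: "cell_ok p sh bs" and b: "cell_ok q sh' bs'"
  and z: "z \<in> keys (G.sh (p, cell p sh bs) (q, cell q sh' bs') :: _ \<Rightarrow>\<^sub>0 'k::{comm_ring,comm_monoid_mult})"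
 shows "\<exists>\<mu>\<in>shuffle_sets p q. \<exists>cs. cs = shuffle_births p q \<mu> bs bs'
   \<and> z = (p + q, cell (p + q) (sh @ sh') cs) \<and> cell_ok (p + q) (sh @ sh') cs \<and> packed (p + q) cs"
 using z
proof (rule keys_shuffle_pair)
 fix \<mu> assume \<mu>: "\<mu> \<in> shuffle_sets p q" and nd: "z \<in> nondegenerate M"
  and zeq: "z = (p + q, pair_simplex M M mul (p + q) p (count_op (p + q) \<mu>) (cell p sh bs) q (count_op (p + q) ({..<p + q} - \<mu>)) (cell q sh' bs'))"
 note C = shuffle_cells[OF a b \<mu>]
 have "packed (p + q) (shuffle_births p q \<mu> bs bs')"
  using nd degenerate_cell_iff[OF C(2)] unfolding zeq C(1) by (simp add: nondegenerate_def)
 then show ?thesis using \<mu> zeq C by auto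
qed

definition cells_of :: "nat => (nat \<times> 's) list set => (nat \<times> 's rigid_mor) set" where
 "cells_of r W = {(r, cell r sh bs) | sh bs. sh \<in> W \<and> vol sh = r \<and> cell_ok r sh bs \<and> packed r bs}"

lemma cells_of_mono: "V \<subseteq> W ==> cells_of r V \<subseteq> cells_of r W"
 by (auto simp: cells_of_def)

lemma keys_gmul_cells:
 assumes P: "keys P \<subseteq> cells_of p V" and Q: "keys Q \<subseteq> cells_of q W"
 shows "keys (gmul P Q :: _ \<Rightarrow>\<^sub>0 'k::{comm_ring,comm_monoid_mult}) \<subseteq> cells_of (p + q) {v @ w | v w. v \<in> V \<and> w \<in> W}"
proof (rule keys_bilin)
 fix a b assume a: "a \<in> keys P" and b: "b \<in> keys Q"
 obtain v bs where a: "a = (p, cell p v bs)" "cell_ok p v bs" "v \<in> V" "vol v = p"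
  using P a by (auto simp: cells_of_def)
 obtain w bs' where b: "b = (q, cell q w bs')" "cell_ok q w bs'" "w \<in> W" "vol w = q"
  using Q b by (auto simp: cells_of_def)
 show "keys (G.sh a b :: _ \<Rightarrow>\<^sub>0 'k) \<subseteq> cells_of (p + q) {v @ w | v w. v \<in> V \<and> w \<in> W}"
 proof
  fix z assume "z \<in> keys (G.sh a b :: _ \<Rightarrow>\<^sub>0 'k)"
  from keys_shuffle_cells[OF a(2) b(2) this[unfolded a(1) b(1)]]
  obtain cs where "z = (p + q, cell (p + q) (v @ w) cs)" "cell_ok (p + q) (v @ w) cs" "packed (p + q) cs" by blast
  then show "z \<in> cells_of (p + q) {v @ w | v w. v \<in> V \<and> w \<in> W}"
   using a b unfolding cells_of_def by (intro CollectI exI[of _ "v @ w"] exI[of _ cs]) auto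
 qed
qed

lemma top_cell_nondegenerate: "is_shape w ==> top_cell w \<in> nondegenerate M"
 unfolding top_cell_def nondegenerate_cell_iff using top_cell_ok(1) top_cell_ok(2) by blast

lemma top_cell_in_cells_of:
 assumes w: "is_shape w" and z: "top_cell w \<in> cells_of r W"
 shows "w \<in> W" "vol w = r"
proof -
 obtain sh bs where sh: "top_cell w = (r, cell r sh bs)" "sh \<in> W" "vol sh = r" "cell_ok r sh bs"
  using z by (auto simp: cells_of_def)
 show r: "vol w = r" using sh(1) by (simp add: top_cell_def)
 have "cell r w (rev [1..<Suc r]) = cell r sh bs" using sh(1) r by (simp add: top_cell_def)
 then show "w \<in> W" using cell_inj[OF top_cell_ok(1)[OF w, unfolded r] sh(4)] sh(2) by blast
qed

lemma lookup_gmul_top: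
 fixes P Q :: "_ \<Rightarrow>\<^sub>0 'k::{comm_ring,comm_monoid_mult}"
 assumes v: "is_shape v" "vol v = p" and w: "is_shape w" "vol w = q"
  and P: "keys P \<subseteq> cells_of p {v}" and Q: "keys Q \<subseteq> cells_of q W"
 shows "\<exists>\<epsilon>. \<epsilon> * \<epsilon> = 1 \<and> lookup (gmul P Q) (top_cell (v @ w))
  = lookup P (top_cell v) * (lookup Q (top_cell w) * \<epsilon>)"
proof -
 have vw: "is_shape (v @ w)" using v w by (auto simp: is_shape_def)
 have topeq: "top_cell (v @ w) = (p + q, cell (p + q) (v @ w) (rev [1..<Suc (p + q)]))"
  using v w by (simp add: top_cell_def)
 have ok: "cell_ok (p + q) (v @ w) (rev [1..<Suc (p + q)])"
  using top_cell_ok(1)[OF vw] v w by simp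
 have single: "a = top_cell v \<and> b = top_cell w"
  if ab: "a \<in> keys P" "b \<in> keys Q"
   and nz: "lookup (G.sh a b :: _ \<Rightarrow>\<^sub>0 'k) (top_cell (v @ w)) \<noteq> 0" for a b
 proof -
  obtain bs where a: "a = (p, cell p v bs)" "cell_ok p v bs" "packed p bs"
   using P ab(1) by (auto simp: cells_of_def)
  obtain w' bs' where b: "b = (q, cell q w' bs')" "cell_ok q w' bs'" "packed q bs'" "vol w' = q"
   using Q ab(2) by (auto simp: cells_of_def)
  have "top_cell (v @ w) \<in> keys (G.sh (p, cell p v bs) (q, cell q w' bs') :: _ \<Rightarrow>\<^sub>0 'k)"
   using nz by (simp add: in_keys_iff a b)
  from keys_shuffle_cells[OF a(2) b(2) this]
  obtain \<mu> where \<mu>: "\<mu> \<in> shuffle_sets p q"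
   and eq: "top_cell (v @ w) = (p + q, cell (p + q) (v @ w') (shuffle_births p q \<mu> bs bs'))"
   and ok': "cell_ok (p + q) (v @ w') (shuffle_births p q \<mu> bs bs')"
   by blast
  have "v @ w = v @ w' \<and> rev [1..<Suc (p + q)] = shuffle_births p q \<mu> bs bs'"
   by (rule cell_inj[OF ok ok']) (use eq topeq in simp)
  moreover have "length bs = p" "set bs \<subseteq> {1..p}" "length bs' = q" using a b v by (auto simp: cell_ok_def)
  ultimately have "w' = w" "bs = rev [1..<Suc p]" "bs' = rev [1..<Suc q]"
   using top_split[OF \<mu> _ _ _ b(3), of bs] by auto
  then show ?thesis using a b v w by (simp add: top_cell_def)
 qed
 \<comment> \<open>the shuffle in which the second factor runs first\<close>
 define \<mu>0 where "\<mu>0 = {q..<p + q}"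
 have \<mu>0: "\<mu>0 \<in> shuffle_sets p q" by (auto simp: \<mu>0_def shuffle_sets_def)
 have okv: "cell_ok p v (rev [1..<Suc p])" and okw: "cell_ok q w (rev [1..<Suc q])"
  using top_cell_ok(1)[OF v(1)] top_cell_ok(1)[OF w(1)] v w by simp_all
 let ?ps = "\<lambda>\<mu>. pair_simplex M M mul (p + q) p (count_op (p + q) \<mu>) (cell p v (rev [1..<Suc p])) q (count_op (p + q) ({..<p + q} - \<mu>)) (cell q w (rev [1..<Suc q]))"
 have ps: "top_cell (v @ w) = (p + q, ?ps \<mu>) \<longleftrightarrow> \<mu> = \<mu>0" if \<mu>: "\<mu> \<in> shuffle_sets p q" for \<mu>
 proof -
  let ?cs = "shuffle_births p q \<mu> (rev [1..<Suc p]) (rev [1..<Suc q])"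
  note C = shuffle_cells[OF okv okw \<mu>]
  have "top_cell (v @ w) = (p + q, ?ps \<mu>) \<longleftrightarrow> rev [1..<Suc (p + q)] = ?cs"
   unfolding topeq C(1) using cell_inj[OF ok C(2)] by (auto simp del: upt_Suc)
  also have "\<dots> \<longleftrightarrow> ?cs = rev [1..<Suc (p + q)]" by (rule eq_commute)
  also have "\<dots> \<longleftrightarrow> \<mu> = \<mu>0"
   unfolding \<mu>0_def
   by (subst top_split[OF \<mu>]) (use top_cell_ok(2) in \<open>auto simp del: upt_Suc simp: top_cell_ok(2)\<close>)
  finally show ?thesis .
 qed
 have one: "lookup (G.sh (top_cell v) (top_cell w) :: _ \<Rightarrow>\<^sub>0 'k) (top_cell (v @ w))
   = sgn_pow (shuffle_sign \<mu>0 ({..<p + q} - \<mu>0)) 1"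
 proof -
  have "lookup (G.sh (top_cell v) (top_cell w) :: _ \<Rightarrow>\<^sub>0 'k) (top_cell (v @ w))
   = (\<Sum>\<mu>\<in>shuffle_sets p q. sgn_pow (shuffle_sign \<mu> ({..<p + q} - \<mu>))
     (if top_cell (v @ w) \<in> nondegenerate M \<and> top_cell (v @ w) = (p + q, ?ps \<mu>) then 1 else 0))"
   using v w by (simp only: top_cell_def[of v] top_cell_def[of w] lookup_shuffle)
  also have "\<dots> = (\<Sum>\<mu>\<in>shuffle_sets p q. if \<mu> = \<mu>0 then sgn_pow (shuffle_sign \<mu>0 ({..<p + q} - \<mu>0)) 1 else 0)"
  proof (rule sum.cong[OF HOL.refl])
   fix \<mu> assume m: "\<mu> \<in> shuffle_sets p q"
   show "sgn_pow (shuffle_sign \<mu> ({..<p + q} - \<mu>)) (if top_cell (v @ w) \<in> nondegenerate M \<and> top_cell (v @ w) = (p + q, ?ps \<mu>) then 1 else 0)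
    = (if \<mu> = \<mu>0 then sgn_pow (shuffle_sign \<mu>0 ({..<p + q} - \<mu>0)) 1 else 0 :: 'k)"
    unfolding ps[OF m] using top_cell_nondegenerate[OF vw] by simp
  qed
  also have "\<dots> = sgn_pow (shuffle_sign \<mu>0 ({..<p + q} - \<mu>0)) 1" using \<mu>0 by simp
  finally show ?thesis .
 qed
 have "lookup (gmul P Q) (top_cell (v @ w)) = lookup P (top_cell v)
   * (lookup Q (top_cell w) * lookup (G.sh (top_cell v) (top_cell w)) (top_cell (v @ w)))"
  by (rule lookup_bilin_single) (use single in blast)
 moreover have "sgn_pow s 1 * sgn_pow s 1 = (1 :: 'k)" for s by (simp add: sgn_pow_def)
 ultimately show ?thesis unfolding one by blast
qed

definition letter_chain :: "nat \<times> 's => (nat \<times> 's rigid_mor \<Rightarrow>\<^sub>0 'k::{comm_ring,comm_monoid_mult})" where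
 "letter_chain s = sgn_pow (fst s - 1) (fund (fst s) (snd s)) - (if fst s = 1 then gen (0, one) else 0)"

fun word_chain :: "(nat \<times> 's) list => (nat \<times> 's rigid_mor \<Rightarrow>\<^sub>0 'k::{comm_ring,comm_monoid_mult})" where
 "word_chain [] = gen (0, one)"
| "word_chain (s # w) = gmul (letter_chain s) (word_chain w)"

lemma letter_chain_gr: "(letter_chain s :: _ \<Rightarrow>\<^sub>0 'k::{comm_ring,comm_monoid_mult}) \<in> gr_chains M (int (fst s - 1))"
 using fund_gr[of "fst s" "snd s", where 'k = 'k] G.unit_gr[where 'k = 'k]
  keys_diff[of "sgn_pow (fst s - 1) (fund (fst s) (snd s)) :: _ \<Rightarrow>\<^sub>0 'k" "gen (0, one)"]
 unfolding letter_chain_def gr_chains_def mem_Collect_eq keys_sgn_pow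
 by (cases "fst s = 1") (auto simp: keys_sgn_pow)

lemma word_chain_gr: "(word_chain w :: _ \<Rightarrow>\<^sub>0 'k::{comm_ring,comm_monoid_mult}) \<in> gr_chains M (int (vol w))"
proof (induction w)
 case Nil
 show ?case using G.unit_gr by simp
next
 case (Cons s w)
 then show ?case using G.gr_chains_bilin[OF letter_chain_gr Cons] by simp
qed

lemmas letter_chain_nchains = gr_nchains[OF letter_chain_gr]
lemmas word_chain_nchains = gr_nchains[OF word_chain_gr]

lemma word_chain_single: "word_chain [s] = letter_chain s"
 using G.unit_mul(2)[OF letter_chain_nchains] by (simp del: bilin_gen_right)

lemma word_chain_append:
 "word_chain (u @ v) = gmul (word_chain u) (word_chain v :: _ \<Rightarrow>\<^sub>0 'k::{comm_ring,comm_monoid_mult})"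
proof (induction u)
 case Nil
 show ?case by (simp add: G.unit_mul(1)[OF word_chain_nchains] del: bilin_gen_left)
next
 case (Cons s u)
 then show ?case by (simp add: G.shuffle_assoc_chains[OF letter_chain_nchains word_chain_nchains word_chain_nchains])
qed

lemma word_chain_Cons: "word_chain (s # w) = sgn_pow (fst s - 1) (gmul (fund (fst s) (snd s)) (word_chain w))
  - (if fst s = 1 then word_chain w else 0 :: _ \<Rightarrow>\<^sub>0 'k::{comm_ring,comm_monoid_mult})"
 by (simp add: letter_chain_def bilin_diff bilin_sgn_pow G.unit_mul(1)[OF word_chain_nchains] del: bilin_gen_left)

lemma keys_fund_cells:
 assumes "s \<in> nondegenerate S" "0 < fst s"
 shows "keys (fund (fst s) (snd s) :: _ \<Rightarrow>\<^sub>0 'k::{comm_ring,comm_monoid_mult}) \<subseteq> cells_of (fst s - 1) {[s]}"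
proof (clarify)
 fix r c assume "(r, c) \<in> keys (fund (fst s) (snd s) :: _ \<Rightarrow>\<^sub>0 'k)"
 from fund_keys[OF _ assms(2) this] assms(1) show "(r, c) \<in> cells_of (fst s - 1) {[s]}"
  by (auto simp: cells_of_def)
qed

text \<open>Constant loops shorten the word but keep its volume, since edges have no inner vertices.\<close>

lemma word_chain_keys:
 assumes "is_shape w"
 shows "keys (word_chain w :: _ \<Rightarrow>\<^sub>0 'k::{comm_ring,comm_monoid_mult})
  \<subseteq> cells_of (vol w) {w'. w' = w \<or> length w' < length w}"
 using assms
proof (induction w)
 case Nil
 have "(0, one) = (0, cell 0 [] [])" by (simp add: cell_def one_cls)
 moreover have "cell_ok 0 [] []" "packed 0 []" by (auto simp: cell_ok_def is_shape_def packed_def)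
 ultimately have "(0, one) \<in> cells_of 0 {[]}" unfolding cells_of_def by force
 then show ?case by (auto dest!: in_keys_genD)
next
 case (Cons s w)
 have s: "s \<in> nondegenerate S" "0 < fst s" and w: "is_shape w" using Cons.prems by (auto simp: is_shape_def)
 let ?W = "{w'. w' = s # w \<or> length w' < length (s # w)}"
 note IH = Cons.IH[OF w]
 have "keys (gmul (fund (fst s) (snd s)) (word_chain w) :: _ \<Rightarrow>\<^sub>0 'k)
   \<subseteq> cells_of (fst s - 1 + vol w) {v @ w' | v w'. v \<in> {[s]} \<and> w' \<in> {w'. w' = w \<or> length w' < length w}}"
  by (rule keys_gmul_cells[OF keys_fund_cells[OF s] IH])
 also have "\<dots> \<subseteq> cells_of (vol (s # w)) ?W" unfolding vol_simps by (rule cells_of_mono) auto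
 finally have 1: "keys (gmul (fund (fst s) (snd s)) (word_chain w) :: _ \<Rightarrow>\<^sub>0 'k) \<subseteq> cells_of (vol (s # w)) ?W" .
 have 2: "keys (word_chain w :: _ \<Rightarrow>\<^sub>0 'k) \<subseteq> cells_of (vol (s # w)) ?W" if "fst s = 1"
 proof -
  have "{w'. w' = w \<or> length w' < length w} \<subseteq> ?W" by auto
  from order_trans[OF IH cells_of_mono[OF this]] show ?thesis using that by simp
 qed
 show ?case
  using 1 2 keys_diff[of "sgn_pow (fst s - 1) (gmul (fund (fst s) (snd s)) (word_chain w)) :: _ \<Rightarrow>\<^sub>0 'k" "word_chain w"]
  unfolding word_chain_Cons keys_sgn_pow by (cases "fst s = 1") (auto simp: keys_sgn_pow)
qed

lemma word_chain_top:
 assumes "is_shape w"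
 shows "\<exists>\<epsilon>. \<epsilon> * \<epsilon> = (1 :: 'k::{comm_ring,comm_monoid_mult}) \<and> lookup (word_chain w) (top_cell w) = \<epsilon>"
 using assms
proof (induction w)
 case Nil
 have "top_cell [] = (0, one)" by (simp add: top_cell_def cell_def one_cls)
 then show ?case by (simp add: lookup_gen)
next
 case (Cons s w)
 have s: "s \<in> nondegenerate S" "0 < fst s" and w: "is_shape w" using Cons.prems by (auto simp: is_shape_def)
 obtain \<epsilon>1 :: 'k where 1: "\<epsilon>1 * \<epsilon>1 = 1" "lookup (fund (fst s) (snd s)) (top_cell [s]) = \<epsilon>1"
  using fund_top[of "fst s" "snd s", where 'k = 'k] s by auto
 obtain \<epsilon>2 :: 'k where 2: "\<epsilon>2 * \<epsilon>2 = 1" "lookup (word_chain w) (top_cell w) = \<epsilon>2"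
  using Cons.IH[OF w] by blast
 have "is_shape [s]" using s by (simp add: is_shape_def)
 from lookup_gmul_top[OF this _ w HOL.refl keys_fund_cells[OF s, where 'k = 'k] word_chain_keys[OF w, where 'k = 'k]]
 obtain \<epsilon>3 :: 'k where 3: "\<epsilon>3 * \<epsilon>3 = 1"
  "lookup (gmul (fund (fst s) (snd s)) (word_chain w)) (top_cell (s # w)) = \<epsilon>1 * (\<epsilon>2 * \<epsilon>3)"
  using 1 2 by auto
 have 4: "lookup (word_chain w :: _ \<Rightarrow>\<^sub>0 'k) (top_cell (s # w)) = 0"
 proof (rule ccontr)
  assume "\<not> ?thesis"
  then have "top_cell (s # w) \<in> cells_of (vol w) {w'. w' = w \<or> length w' < length w}"
   using word_chain_keys[OF w, where 'k = 'k] by (auto simp: in_keys_iff)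
  from top_cell_in_cells_of(1)[OF Cons.prems this] show False by simp
 qed
 have "lookup (word_chain (s # w)) (top_cell (s # w)) = sgn_pow (fst s - 1) (\<epsilon>1 * (\<epsilon>2 * \<epsilon>3))"
  unfolding word_chain_Cons by (simp add: lookup_minus lookup_sgn_pow 3 4)
 moreover have "(\<epsilon>1 * (\<epsilon>2 * \<epsilon>3)) * (\<epsilon>1 * (\<epsilon>2 * \<epsilon>3)) = 1"
 proof -
  have "(\<epsilon>1 * (\<epsilon>2 * \<epsilon>3)) * (\<epsilon>1 * (\<epsilon>2 * \<epsilon>3)) = (\<epsilon>1 * \<epsilon>1) * ((\<epsilon>2 * \<epsilon>2) * (\<epsilon>3 * \<epsilon>3))" by (simp only: ac_simps)
  then show ?thesis using 1 2 3 by simp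
 qed
 then have "sgn_pow n (\<epsilon>1 * (\<epsilon>2 * \<epsilon>3)) * sgn_pow n (\<epsilon>1 * (\<epsilon>2 * \<epsilon>3)) = 1" for n by (simp add: sgn_pow_def)
 ultimately show ?case by simp
qed

definition shapes :: "nat => (nat \<times> 's) list set" where
 "shapes r = {w. is_shape w \<and> vol w = r}"

text \<open>By their top cells, words are triangular with respect to length.\<close>

lemma word_matching:
 "matching (word_chain :: _ => _ \<Rightarrow>\<^sub>0 'k::{comm_ring,comm_monoid_mult}) (shapes r) top_cell (\<lambda>w. w) length"
proof
 show "inj_on top_cell (shapes r)"
 proof (rule inj_onI)
  fix v w assume v: "v \<in> shapes r" and w: "w \<in> shapes r" and eq: "top_cell v = top_cell w"
  have "cell_ok r v (rev [1..<Suc r])" "cell_ok r w (rev [1..<Suc r])" "cell r v (rev [1..<Suc r]) = cell r w (rev [1..<Suc r])"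
   using v w eq top_cell_ok(1)[of v] top_cell_ok(1)[of w] by (auto simp: shapes_def top_cell_def simp del: upt_Suc)
  from cell_inj[OF this] show "v = w" by simp
 qed
 show "\<exists>\<epsilon>. \<epsilon> * \<epsilon> = (1 :: 'k) \<and> lookup (word_chain w) (top_cell w) = \<epsilon>" if "w \<in> shapes r" for w
  by (rule word_chain_top) (use that in \<open>simp add: shapes_def\<close>)
 show "length v < length w" if vw: "w \<in> shapes r" "v \<in> shapes r" "v \<noteq> w"
  and nz: "lookup (word_chain w :: _ \<Rightarrow>\<^sub>0 'k) (top_cell v) \<noteq> 0" for v w
 proof -
  have "top_cell v \<in> cells_of (vol w) {w'. w' = w \<or> length w' < length w}"
   using nz word_chain_keys[of w, where 'k = 'k] vw(1) by (auto simp: in_keys_iff shapes_def)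
  from top_cell_in_cells_of(1)[OF _ this] vw show ?thesis by (auto simp: shapes_def)
 qed
qed simp

end

section \<open>The comparison map\<close>

lemma concat_mul_assoc: "concat_mul (concat_mul p q) r = concat_mul p (concat_mul q r)"
 by (simp add: concat_mul_def bilin_def lin_lin)

lemma concat_mul_unit: "concat_mul (gen []) p = p" "concat_mul p (gen []) = p"
 by (simp_all add: concat_mul_def lin_gen_eq)

lemma cobar_map_word_append:
 "cobar_map_word \<phi> (u @ v) = concat_mul (cobar_map_word \<phi> u) (cobar_map_word \<phi> v)"
 by (induction u) (simp_all add: concat_mul_unit concat_mul_assoc)

lemma cobar_map_concat_mul:
 "lin (cobar_map_word \<phi>) (concat_mul p q) = concat_mul (lin (cobar_map_word \<phi>) p) (lin (cobar_map_word \<phi>) q)"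
 by (simp add: concat_mul_def lin_bilin bilin_lin_lin cobar_map_word_append[unfolded concat_mul_def])

lemma sum_atMost_ends:
 fixes h :: "nat => 'a::ab_group_add"
 shows "(\<Sum>p\<le>Suc m. h p) = h 0 + (\<Sum>j<m. h (Suc j)) + h (Suc m)"
 by (simp add: sum.atMost_shift)

context reduced
begin

lemma compare_concat_mul:
 "lin word_chain (concat_mul p q) = gmul (lin word_chain p) (lin word_chain q :: _ \<Rightarrow>\<^sub>0 'k::{comm_ring,comm_monoid_mult})"
 by (simp add: concat_mul_def lin_bilin bilin_lin_lin word_chain_append)

lemma letter_chain_degenerate:
 assumes "degenerate S n \<sigma>"
 shows "letter_chain (n, \<sigma>) = (0 :: _ \<Rightarrow>\<^sub>0 'k::{comm_ring,comm_monoid_mult})"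
 by (simp add: letter_chain_def fund_degenerate[OF assms] G.nchain_unit)

lemma lin_letter_nchain:
 assumes "\<sigma> \<in> spx S n"
 shows "lin (\<lambda>b. if 0 < fst b then letter_chain b else 0) (nchain S (n, \<sigma>))
  = (if 0 < n then letter_chain (n, \<sigma>) else 0 :: _ \<Rightarrow>\<^sub>0 'k::{comm_ring,comm_monoid_mult})"
 using lin_nchain[OF assms, of "\<lambda>b. if 0 < fst b then letter_chain b else 0 :: _ \<Rightarrow>\<^sub>0 'k"]
 by (simp add: letter_chain_degenerate)

lemma front_face_in: "\<sigma> \<in> spx S n ==> p \<le> n ==> front_face S n p \<sigma> \<in> spx S p"
 unfolding front_face_def by (rule act_closed[OF S mono_maps_restrict]) auto

lemma last_face_in: "\<sigma> \<in> spx S n ==> q \<le> n ==> last_face S n q \<sigma> \<in> spx S q"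
 unfolding last_face_def by (rule act_closed[OF S mono_maps_restrict]) auto

lemma compare_dif_gen:
 assumes \<sigma>: "\<sigma> \<in> spx S (Suc m)"
 shows "lin word_chain (cobar_dif_gen (chain_coalg S) (Suc m, \<sigma>)) =
   - (\<Sum>i\<le>Suc m. sgn_pow i (if 0 < m then letter_chain (m, sface S m i \<sigma>) else 0))
   + (\<Sum>j<m. sgn_pow (Suc j) (gmul (letter_chain (Suc j, front_face S (Suc m) (Suc j) \<sigma>))
     (letter_chain (m - j, last_face S (Suc m) (m - j) \<sigma>))) :: _ \<Rightarrow>\<^sub>0 'k::{comm_ring,comm_monoid_mult})"
proof -
 let ?l = "\<lambda>b. if 0 < fst b then letter_chain b else 0 :: _ \<Rightarrow>\<^sub>0 'k"
 let ?n = "Suc m"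
 have "lin word_chain (lin (\<lambda>b. if 0 < fst b then gen [b] else 0) (chain_boundary S (?n, \<sigma>)) :: _ \<Rightarrow>\<^sub>0 'k)
   = lin ?l (chain_boundary S (?n, \<sigma>))"
  unfolding lin_lin by (rule lin_cong) (simp add: word_chain_single del: word_chain.simps)
 also have "\<dots> = (\<Sum>i\<le>?n. sgn_pow i (if 0 < m then letter_chain (m, sface S m i \<sigma>) else 0))"
  unfolding chain_boundary.simps lin_sum lin_sgn_pow lin_letter_nchain[OF sface_closed[OF S \<sigma>]] by (rule HOL.refl)
 finally have 1: "lin word_chain (lin (\<lambda>b. if 0 < fst b then gen [b] else 0) (chain_boundary S (?n, \<sigma>)) :: _ \<Rightarrow>\<^sub>0 'k)
   = (\<Sum>i\<le>?n. sgn_pow i (if 0 < m then letter_chain (m, sface S m i \<sigma>) else 0))" .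
 let ?c = "\<lambda>(b, b'). if 0 < fst b \<and> 0 < fst b' then sgn_pow (fst b) (gen [b, b']) else 0 :: _ \<Rightarrow>\<^sub>0 'k"
 have summand: "lin word_chain (lin ?c (bilin (\<lambda>s t. gen (s, t)) (nchain S (p, \<tau>)) (nchain S (q, \<rho>)) :: _ \<Rightarrow>\<^sub>0 'k))
   = sgn_pow p (gmul (lin ?l (nchain S (p, \<tau>))) (lin ?l (nchain S (q, \<rho>))))" for p q \<tau> \<rho>
 proof -
  have "lin word_chain (lin ?c (bilin (\<lambda>s t. gen (s, t)) (nchain S (p, \<tau>)) (nchain S (q, \<rho>)) :: _ \<Rightarrow>\<^sub>0 'k))
    = bilin (\<lambda>s t. lin word_chain (?c (s, t))) (nchain S (p, \<tau>)) (nchain S (q, \<rho>))"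
   by (simp add: lin_bilin)
  also have "\<dots> = bilin (\<lambda>s t. sgn_pow p (gmul (?l s) (?l t))) (nchain S (p, \<tau>)) (nchain S (q, \<rho>))"
  proof (rule bilin_cong)
   fix s t assume "s \<in> keys (nchain S (p, \<tau>) :: _ \<Rightarrow>\<^sub>0 'k)"
   then have "fst s = p" using keys_nchain[of S "(p, \<tau>)"] by auto
   moreover have "word_chain [s, t] = (gmul (letter_chain s) (letter_chain t) :: _ \<Rightarrow>\<^sub>0 'k)"
    by (simp only: word_chain.simps(2)[of s "[t]"] word_chain_single)
   ultimately show "lin word_chain (?c (s, t)) = sgn_pow p (gmul (?l s) (?l t))"
    by (simp add: lin_sgn_pow del: word_chain.simps)
  qed
  also have "\<dots> = sgn_pow p (gmul (lin ?l (nchain S (p, \<tau>))) (lin ?l (nchain S (q, \<rho>))))"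
   unfolding bilin_lin_lin unfolding bilin_def lin_sgn_pow_fun by (rule HOL.refl)
  finally show ?thesis .
 qed
 have "lin word_chain (lin ?c (alexander_whitney S (?n, \<sigma>)))
   = (\<Sum>p\<le>?n. sgn_pow p (gmul (if 0 < p then letter_chain (p, front_face S ?n p \<sigma>) else 0)
     (if 0 < ?n - p then letter_chain (?n - p, last_face S ?n (?n - p) \<sigma>) else 0)))"
  unfolding alexander_whitney_def case_prod_conv lin_sum summand
  by (rule sum.cong[OF HOL.refl]) (simp add: lin_letter_nchain front_face_in[OF \<sigma>] last_face_in[OF \<sigma>])
 also have "\<dots> = (\<Sum>j<m. sgn_pow (Suc j) (gmul (letter_chain (Suc j, front_face S ?n (Suc j) \<sigma>))
     (letter_chain (m - j, last_face S ?n (m - j) \<sigma>))))"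
  unfolding sum_atMost_ends by simp
 finally have 2: "lin word_chain (lin ?c (alexander_whitney S (?n, \<sigma>)))
   = (\<Sum>j<m. sgn_pow (Suc j) (gmul (letter_chain (Suc j, front_face S ?n (Suc j) \<sigma>))
     (letter_chain (m - j, last_face S ?n (m - j) \<sigma>))))" .
 have "cobar_dif_gen (chain_coalg S) (?n, \<sigma>) = - lin (\<lambda>b. if 0 < fst b then gen [b] else 0) (chain_boundary S (?n, \<sigma>))
   + lin ?c (alexander_whitney S (?n, \<sigma>))"
  unfolding cobar_dif_gen_def chain_coalg_def by (simp cong: if_cong)
 then show ?thesis by (simp only: lin_add lin_minus 1 2)
qed

text \<open>In \<open>letter_chain\<close> the loop of an edge is replaced by its difference from the constant loop.
 The terms that this correction produces in the products of front and last faces cancel the two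
 outer faces, which do not occur in the boundary of the cube.\<close>

lemma compare_boundary_letter:
 assumes \<sigma>: "\<sigma> \<in> spx S (Suc m)"
 shows "lin (chain_boundary M) (letter_chain (Suc m, \<sigma>))
  = (lin word_chain (cobar_dif_gen (chain_coalg S) (Suc m, \<sigma>)) :: _ \<Rightarrow>\<^sub>0 'k::{comm_ring,comm_monoid_mult})"
proof (cases m)
 case 0
 then show ?thesis
  using boundary_fund[OF \<sigma>, where 'k = 'k] unfolding compare_dif_gen[OF \<sigma>]
  by (simp add: letter_chain_def lin_diff)
next
 case (Suc k)
 define F :: "nat => nat \<times> 's rigid_mor \<Rightarrow>\<^sub>0 'k" where "F j = fund (Suc j) (front_face S (Suc m) (Suc j) \<sigma>)" for j
 define L :: "nat => nat \<times> 's rigid_mor \<Rightarrow>\<^sub>0 'k" where "L j = fund (m - j) (last_face S (Suc m) (m - j) \<sigma>)" for j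
 define f :: "nat => nat \<times> 's rigid_mor \<Rightarrow>\<^sub>0 'k" where "f j = fund m (sface S m (Suc j) \<sigma>)" for j
 define u :: "nat \<times> 's rigid_mor \<Rightarrow>\<^sub>0 'k" where "u = gen (0, one)"
 define c where "c = (if k = 0 then u else 0)"
 have FL: "F j \<in> nchains M" "L j \<in> nchains M" for j
  unfolding F_def L_def by (rule gr_nchains[OF fund_gr])+
 have u: "gmul u a = a" "gmul a u = a" if "a \<in> nchains M" for a
  unfolding u_def by (rule G.unit_mul[OF that])+
 have uu: "gmul u u = u" unfolding u_def by (rule G.unit_mul(1)[OF gr_nchains[OF G.unit_gr]])
 have "front_face S (Suc m) m \<sigma> = sface S m (Suc m) \<sigma>"
 proof -
  have "coface m (Suc m) = (\<lambda>t\<in>{..m}. t)" by (auto simp: coface_def fun_eq_iff)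
  then show ?thesis by (simp add: front_face_def sface_def)
 qed
 then have front: "letter_chain (m, sface S m (Suc m) \<sigma>) = sgn_pow k (F k) - c"
  using Suc by (simp add: letter_chain_def F_def c_def u_def)
 have "last_face S (Suc m) m \<sigma> = sface S m 0 \<sigma>"
 proof -
  have "coface m 0 = (\<lambda>t\<in>{..m}. t + (Suc m - m))" by (auto simp: coface_def fun_eq_iff)
  then show ?thesis by (simp add: last_face_def sface_def)
 qed
 then have last: "letter_chain (m, sface S m 0 \<sigma>) = sgn_pow k (L 0) - c"
  using Suc by (simp add: letter_chain_def L_def c_def u_def)
 have inner: "letter_chain (m, sface S m (Suc j) \<sigma>) = sgn_pow k (f j) - c" if "j < m" for j
  using Suc by (simp add: letter_chain_def f_def c_def u_def)
 have product: "sgn_pow (Suc j) (gmul (letter_chain (Suc j, front_face S (Suc m) (Suc j) \<sigma>))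
     (letter_chain (m - j, last_face S (Suc m) (m - j) \<sigma>)))
   = sgn_pow (m + j) (gmul (F j) (L j)) + (if j = 0 then sgn_pow k (L 0) else 0) + (if j = k then F k else 0)
    - (if j = 0 then c else 0)"
  if j: "j < m" for j
 proof -
  have jk: "j \<le> k" "m - j = Suc (k - j)" using j Suc by auto
  have l: "letter_chain (Suc j, front_face S (Suc m) (Suc j) \<sigma>) = sgn_pow j (F j) - (if j = 0 then u else 0)"
   "letter_chain (m - j, last_face S (Suc m) (m - j) \<sigma>) = sgn_pow (k - j) (L j) - (if j = k then u else 0)"
   using jk by (auto simp: letter_chain_def F_def L_def u_def)
  have "sgn_pow (Suc j + (k - j + j)) a = sgn_pow (m + j) a" for a :: "_ \<Rightarrow>\<^sub>0 'k"
   by (rule sgn_pow_cong) (use jk Suc in auto)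
  then have main: "sgn_pow (Suc j) (gmul (sgn_pow j (F j)) (sgn_pow (k - j) (L j))) = sgn_pow (m + j) (gmul (F j) (L j))"
   by (simp only: bilin_sgn_pow sgn_pow_sgn_pow)
  have "sgn_pow (Suc j) (gmul (sgn_pow j (F j)) (if j = k then u else 0)) = - (if j = k then F k else 0)"
   by (simp add: u(2)[OF FL(1)] bilin_sgn_pow sgn_pow_sgn_pow) (simp add: sgn_pow_def)
  moreover have "sgn_pow (Suc j) (gmul (if j = 0 then u else 0) (sgn_pow (k - j) (L j))) = - (if j = 0 then sgn_pow k (L 0) else 0)"
   by (simp add: u(1)[OF FL(2)] bilin_sgn_pow sgn_pow_sgn_pow) (simp add: sgn_pow_def)
  moreover have "sgn_pow (Suc j) (gmul (if j = 0 then u else 0) (if j = k then u else 0)) = - (if j = 0 then c else 0)"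
   by (simp add: uu c_def sgn_pow_Suc)
  ultimately show ?thesis
   unfolding l bilin_diff sgn_pow_diff main by simp
 qed
 have T2: "(\<Sum>j<m. sgn_pow (Suc j) (gmul (letter_chain (Suc j, front_face S (Suc m) (Suc j) \<sigma>))
     (letter_chain (m - j, last_face S (Suc m) (m - j) \<sigma>))))
   = (\<Sum>j<m. sgn_pow (m + j) (gmul (F j) (L j))) + sgn_pow k (L 0) + F k - c"
 proof -
  have "(\<Sum>j<m. sgn_pow (Suc j) (gmul (letter_chain (Suc j, front_face S (Suc m) (Suc j) \<sigma>))
     (letter_chain (m - j, last_face S (Suc m) (m - j) \<sigma>))))
   = (\<Sum>j<m. sgn_pow (m + j) (gmul (F j) (L j)) + (if j = 0 then sgn_pow k (L 0) else 0) + (if j = k then F k else 0)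
    - (if j = 0 then c else 0))"
   by (rule sum.cong[OF HOL.refl]) (rule product, simp)
  also have "\<dots> = (\<Sum>j<m. sgn_pow (m + j) (gmul (F j) (L j))) + sgn_pow k (L 0) + F k - c"
   using Suc by (simp add: sum.distrib sum_subtractf del: sum.lessThan_Suc)
  finally show ?thesis .
 qed
 have corr: "(\<Sum>j<m. sgn_pow (Suc j) c) = - c"
  using Suc by (simp add: c_def sgn_pow_Suc)
 have "(\<Sum>j<m. sgn_pow (Suc j) (sgn_pow k (f j) - c)) = (\<Sum>j<m. sgn_pow (m + j) (f j)) - (\<Sum>j<m. sgn_pow (Suc j) c)"
  unfolding sgn_pow_diff sum_subtractf sgn_pow_sgn_pow using Suc by (simp add: add.commute)
 then have T1: "(\<Sum>i\<le>Suc m. sgn_pow i (if 0 < m then letter_chain (m, sface S m i \<sigma>) else 0))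
   = (sgn_pow k (L 0) - c) + ((\<Sum>j<m. sgn_pow (m + j) (f j)) + c) + (F k - c)"
 proof -
  assume mid: "(\<Sum>j<m. sgn_pow (Suc j) (sgn_pow k (f j) - c)) = (\<Sum>j<m. sgn_pow (m + j) (f j)) - (\<Sum>j<m. sgn_pow (Suc j) c)"
  have "sgn_pow (Suc m) (sgn_pow k (F k) - c) = F k - c"
   using Suc by (simp add: sgn_pow_Suc sgn_pow_diff sgn_pow_sgn_pow c_def) (simp add: sgn_pow_def)
  moreover have "0 < m" using Suc by simp
  ultimately show ?thesis
   unfolding sum_atMost_ends by (simp add: front last inner mid corr cong: sum.cong_simp)
 qed
 have "lin (chain_boundary M) (letter_chain (Suc m, \<sigma>)) = sgn_pow m (\<Sum>j<m. sgn_pow j (gmul (F j) (L j) - f j))"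
 proof -
  have "lin (chain_boundary M) (letter_chain (Suc m, \<sigma>)) = (sgn_pow m (lin (chain_boundary M) (fund (Suc m) \<sigma>)) :: _ \<Rightarrow>\<^sub>0 'k)"
   using Suc by (simp add: letter_chain_def lin_sgn_pow)
  then show ?thesis by (simp only: boundary_fund[OF \<sigma>] F_def L_def f_def)
 qed
 also have "\<dots> = (\<Sum>j<m. sgn_pow (m + j) (gmul (F j) (L j))) - (\<Sum>j<m. sgn_pow (m + j) (f j))"
  by (simp only: sgn_pow_sum sgn_pow_sgn_pow sgn_pow_diff sum_subtractf)
 finally show ?thesis unfolding compare_dif_gen[OF \<sigma>] T1 T2 by simp
qed

lemma compare_boundary_word:
 assumes "is_shape w"
 shows "lin (chain_boundary M) (word_chain w)
  = (lin word_chain (cobar_dif_word (chain_coalg S) w) :: _ \<Rightarrow>\<^sub>0 'k::{comm_ring,comm_monoid_mult})"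
 using assms
proof (induction w)
 case Nil
 show ?case by simp
next
 case (Cons s w)
 have w: "is_shape w" using Cons.prems by (simp add: is_shape_def)
 obtain m \<sigma> where s: "s = (Suc m, \<sigma>)" "\<sigma> \<in> spx S (Suc m)"
  using Cons.prems by (cases s; cases "fst s") (auto simp: is_shape_def nondegenerate_def)
 have "lin (chain_boundary M) (word_chain (s # w)) = gmul (lin (chain_boundary M) (letter_chain s)) (word_chain w)
   + sgn_pow (fst s - 1) (gmul (letter_chain s) (lin (chain_boundary M) (word_chain w :: _ \<Rightarrow>\<^sub>0 'k)))"
  unfolding word_chain.simps by (rule G.shuffle_boundary_chains[OF letter_chain_gr word_chain_nchains])
 also have "lin (chain_boundary M) (letter_chain s) = (lin word_chain (cobar_dif_gen (chain_coalg S) s) :: _ \<Rightarrow>\<^sub>0 'k)"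
  unfolding s(1) by (rule compare_boundary_letter[OF s(2)])
 also note Cons.IH[OF w]
 also have "gmul (lin word_chain (cobar_dif_gen (chain_coalg S) s)) (word_chain w)
   + sgn_pow (fst s - 1) (gmul (letter_chain s) (lin word_chain (cobar_dif_word (chain_coalg S) w)))
   = (lin word_chain (cobar_dif_word (chain_coalg S) (s # w)) :: _ \<Rightarrow>\<^sub>0 'k)"
  by (simp add: lin_add lin_sgn_pow compare_concat_mul word_chain_single chain_coalg_def
    del: word_chain.simps bilin_gen_left bilin_gen_right)
 finally show ?case .
qed

lemma compare_inj:
 fixes p q :: "_ \<Rightarrow>\<^sub>0 'k::{comm_ring,comm_monoid_mult}"
 assumes p: "keys p \<subseteq> shapes r" and q: "keys q \<subseteq> shapes r"
  and eq: "lin word_chain p = (lin word_chain q :: _ \<Rightarrow>\<^sub>0 'k)"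
 shows "p = q"
proof -
 have "p - q = 0"
 proof (rule matching.matching_injective[OF word_matching])
  show "keys (p - q) \<subseteq> (\<lambda>w. w) ` shapes r" using keys_diff[of p q] p q by auto
  show "lookup (lin word_chain (p - q)) (top_cell c) = 0" for c by (simp add: lin_diff eq)
 qed
 then show ?thesis by simp
qed

lemma compare_keys:
 assumes p: "keys p \<subseteq> shapes r"
 shows "keys (lin word_chain p :: _ \<Rightarrow>\<^sub>0 'k::{comm_ring,comm_monoid_mult}) \<subseteq> cells_of r UNIV"
proof (rule keys_lin)
 fix w assume "w \<in> keys p"
 then have w: "is_shape w" "vol w = r" using p by (auto simp: shapes_def)
 show "keys (word_chain w :: _ \<Rightarrow>\<^sub>0 'k) \<subseteq> cells_of r UNIV"
  using order_trans[OF word_chain_keys[OF w(1)] cells_of_mono[OF subset_UNIV]] w(2) by simp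
qed

text \<open>The births in a cell that occurs in a product of cubes are pairwise distinct.\<close>

lemma compare_no_lower:
 assumes p: "keys p \<subseteq> shapes r" and c: "c \<in> lower_cells r"
 shows "lookup (lin word_chain p :: _ \<Rightarrow>\<^sub>0 'k::{comm_ring,comm_monoid_mult}) (lower_cell r c) = 0"
proof (rule ccontr)
 assume "\<not> ?thesis"
 then have "lower_cell r c \<in> cells_of r UNIV" using compare_keys[OF p] by (auto simp: in_keys_iff)
 then obtain sh bs where sh: "lower_cell r c = (r, cell r sh bs)" "vol sh = r" "cell_ok r sh bs" "packed r bs"
  by (auto simp: cells_of_def)
 obtain sh' bs' where c': "c = (sh', bs')" "cell_ok r sh' bs'" "lower r bs'" using c by (auto simp: lower_cells_def)
 have "cell r sh' bs' = cell r sh bs" using sh(1) c'(1) by (simp add: lower_cell_def)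
 then have "bs' = bs" using cell_inj[OF c'(2) sh(3)] by simp
 moreover have "distinct bs"
  by (rule card_distinct) (use sh in \<open>simp add: packed_def cell_ok_def\<close>)
 ultimately show False using distinct_not_lower c'(3) by blast
qed

lemma gr_chains_diff:
 "[|a \<in> gr_chains T i; b \<in> gr_chains T i|] ==> (a - b :: _ \<Rightarrow>\<^sub>0 'k::{comm_ring,comm_monoid_mult}) \<in> gr_chains T i"
 using keys_diff[of a b] by (auto simp: gr_chains_def)

lemma compare_gr:
 assumes p: "keys p \<subseteq> shapes r"
 shows "(lin word_chain p :: _ \<Rightarrow>\<^sub>0 'k::{comm_ring,comm_monoid_mult}) \<in> gr_chains M (int r)"
 unfolding gr_chains_def mem_Collect_eq
proof (rule keys_lin)
 fix w assume "w \<in> keys p"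
 then have "vol w = r" using p by (auto simp: shapes_def)
 then show "keys (word_chain w :: _ \<Rightarrow>\<^sub>0 'k) \<subseteq> {(n, \<sigma>) \<in> nondegenerate M. int n = int r}"
  using word_chain_gr[of w, where 'k = 'k] by (simp add: gr_chains_def)
qed

text \<open>The cells of dimension \<open>r\<close> are the lower ones, the top cells of words, and the upper ones that
 are matched with a lower one of dimension \<open>r - 1\<close>.\<close>

lemma decompose_without_lower:
 fixes z :: "_ \<Rightarrow>\<^sub>0 'k::{comm_ring,comm_monoid_mult}"
 assumes z: "z \<in> gr_chains M (int r)" and low: "\<And>c. c \<in> lower_cells r ==> lookup z (lower_cell r c) = 0"
 shows "\<exists>p. keys p \<subseteq> shapes r
  \<and> (\<forall>s\<in>keys (z - lin word_chain p). \<exists>r'. r = Suc r' \<and> s \<in> upper_cell r' ` lower_cells r')"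
proof -
 obtain p :: "_ \<Rightarrow>\<^sub>0 'k" where p': "keys p \<subseteq> (\<lambda>w. w) ` shapes r"
  and top: "\<forall>w\<in>shapes r. lookup (z - lin word_chain p) (top_cell w) = 0"
  using matching.matching_surjective[OF word_matching[of r, where 'k = 'k], of z] by blast
 have p: "keys p \<subseteq> shapes r" using p' by simp
 have "\<exists>r'. r = Suc r' \<and> s \<in> upper_cell r' ` lower_cells r'" if s: "s \<in> keys (z - lin word_chain p)" for s
 proof -
  have nz: "lookup (z - lin word_chain p) s \<noteq> 0" using s by (simp add: in_keys_iff)
  obtain c where sc: "s = (r, c)" "(r, c) \<in> nondegenerate M"
   using s gr_chains_diff[OF z compare_gr[OF p]] by (cases s) (auto simp: gr_chains_def)
  obtain sh bs where c: "cell_ok r sh bs" "packed r bs" "c = cell r sh bs" using sc(2) nondegenerate_cell_iff by blast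
  have "\<not> lower r bs"
  proof
   assume "lower r bs"
   then have l: "(sh, bs) \<in> lower_cells r" using c by (simp add: lower_cells_def)
   have "s = lower_cell r (sh, bs)" by (simp add: sc c lower_cell_def)
   then show False using nz low[OF l] compare_no_lower[OF p l] by (simp add: lookup_minus)
  qed
  moreover have "\<not> critical r bs"
  proof
   assume "critical r bs"
   then have bs: "bs = rev [1..<Suc r]" using critical_iff c(2) by simp
   have "vol sh = length bs" using c(1) by (simp add: cell_ok_def)
   then have "vol sh = r" unfolding bs by (simp del: upt_Suc)
   then have "sh \<in> shapes r" "s = top_cell sh" using c bs sc by (auto simp: shapes_def cell_ok_def top_cell_def)
   then show False using nz top by auto
  qed
  ultimately obtain r' b where b: "r = Suc r'" "packed r' b" "lower r' b" "bs = split_block r' b"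
   using packed_cases[OF c(2)] by blast
  have "(sh, b) \<in> lower_cells r'" using c b by (auto simp: lower_cells_def cell_ok_def packed_def)
  moreover have "s = upper_cell r' (sh, b)" using sc c b by (simp add: upper_cell_def)
  ultimately show ?thesis using b(1) by blast
 qed
 then show ?thesis using p by blast
qed

text \<open>A chain of upper cells is determined by the coefficients of its boundary at the lower cells.\<close>

lemma upper_zero:
 fixes u :: "_ \<Rightarrow>\<^sub>0 'k::{comm_ring,comm_monoid_mult}"
 assumes keys: "\<forall>s\<in>keys u. \<exists>r'. r = Suc r' \<and> s \<in> upper_cell r' ` lower_cells r'"
  and bd: "\<And>r' c. [|r = Suc r'; c \<in> lower_cells r'|] ==> lookup (lin (chain_boundary M) u) (lower_cell r' c) = 0"
 shows "u = 0"
proof (cases r)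
 case 0
 then have "s \<notin> keys u" for s using keys by (cases s) fastforce
 then have "keys u = {}" by blast
 then show ?thesis by (simp only: keys_eq_empty)
next
 case (Suc r')
 show ?thesis
  by (rule matching.matching_injective[OF cell_matching[of r']]) (use keys bd Suc in auto)
qed

lemma remove_lower:
 fixes w :: "_ \<Rightarrow>\<^sub>0 'k::{comm_ring,comm_monoid_mult}"
 shows "\<exists>y. y \<in> gr_chains M (int (Suc r)) \<and> (\<forall>c\<in>lower_cells r. lookup (w - lin (chain_boundary M) y) (lower_cell r c) = 0)"
proof -
 obtain y :: "_ \<Rightarrow>\<^sub>0 'k" where y: "keys y \<subseteq> upper_cell r ` lower_cells r"
  "\<forall>c\<in>lower_cells r. lookup (w - lin (chain_boundary M) y) (lower_cell r c) = 0"
  using matching.matching_surjective[OF cell_matching[of r, where 'k = 'k], of w] by blast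
 have "upper_cell r c \<in> {(n, \<sigma>) \<in> nondegenerate M. int n = int (Suc r)}" if c: "c \<in> lower_cells r" for c
 proof -
  obtain sh bs where "c = (sh, bs)" "cell_ok r sh bs" "packed r bs" "lower r bs" using c by (auto simp: lower_cells_def)
  then have "c = (sh, bs)" "cell_ok (Suc r) sh (split_block r bs)" "packed (Suc r) (split_block r bs)"
   using cell_ok_split_block packed_split_block by blast+
  then have "(Suc r, cell (Suc r) sh (split_block r bs)) \<in> nondegenerate M" using nondegenerate_cell_iff by blast
  then show ?thesis using \<open>c = (sh, bs)\<close> by (simp add: upper_cell_def)
 qed
 then have "upper_cell r ` lower_cells r \<subseteq> {(n, \<sigma>) \<in> nondegenerate M. int n = int (Suc r)}" by (rule image_subsetI)
 from order_trans[OF y(1) this] have "y \<in> gr_chains M (int (Suc r))" by (simp only: gr_chains_def mem_Collect_eq)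
 then show ?thesis using y(2) by blast
qed

end

section \<open>The cobar construction and the quasi-isomorphism\<close>

context reduced
begin

definition deg_words :: "int => (nat \<times> 's) list set" where
 "deg_words i = {w. is_shape w \<and> int (vol w) = i}"

lemma deg_words_nat: "deg_words (int r) = shapes r"
 by (simp add: deg_words_def shapes_def)

lemma cobar_words_eq:
 "cobar_words (chain_coalg S :: (nat \<times> 's, 'k::{comm_ring,comm_monoid_mult}) dg_coalg) i = deg_words i"
proof -
 have "(\<Sum>b\<leftarrow>w. int (fst b) - 1) = int (vol w)" if "\<forall>b\<in>set w. 0 < fst b" for w :: "(nat \<times> 's) list"
  using that by (induction w) (simp_all add: of_nat_diff Suc_leI)
 then show ?thesis by (auto simp: cobar_words_def chain_coalg_def is_shape_def deg_words_def)
qed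

lemma deg_words_cases:
 assumes "keys a \<subseteq> deg_words i"
 obtains "a = 0" | r where "i = int r" "keys a \<subseteq> shapes r"
proof (cases "i < 0")
 case True
 then have "keys a = {}" using assms by (auto simp: deg_words_def)
 then show ?thesis using that(1) by (simp only: keys_eq_empty)
next
 case False
 then obtain r where "i = int r" by (metis nonneg_int_cases not_less)
 then show ?thesis using that(2)[of r] assms deg_words_nat by simp
qed

lemma keys_concat_mul:
 assumes "keys p \<subseteq> deg_words i" "keys q \<subseteq> deg_words j"
 shows "keys (concat_mul p q :: _ \<Rightarrow>\<^sub>0 'k::{comm_ring,comm_monoid_mult}) \<subseteq> deg_words (i + j)"
 unfolding concat_mul_def
proof (rule keys_bilin)
 fix u v assume "u \<in> keys p" "v \<in> keys q"
 then have "u @ v \<in> deg_words (i + j)" using assms by (auto simp: deg_words_def is_shape_def)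
 then show "keys (gen (u @ v) :: _ \<Rightarrow>\<^sub>0 'k) \<subseteq> deg_words (i + j)"
  using keys_gen by fastforce
qed

lemma keys_gen_deg_words: "w \<in> deg_words i ==> keys (gen w :: _ \<Rightarrow>\<^sub>0 'k::{comm_ring,comm_monoid_mult}) \<subseteq> deg_words i"
 using keys_gen by fastforce

lemma keys_cobar_dif_gen:
 assumes s: "s \<in> nondegenerate S" "0 < fst s"
 shows "keys (cobar_dif_gen (chain_coalg S) s :: _ \<Rightarrow>\<^sub>0 'k::{comm_ring,comm_monoid_mult}) \<subseteq> deg_words (int (fst s) - 2)"
proof -
 obtain n \<sigma> where sn: "s = (n, \<sigma>)" by (cases s)
 have 1: "keys (lin (\<lambda>b. if 0 < fst b then gen [b] else 0) (chain_boundary S s) :: _ \<Rightarrow>\<^sub>0 'k) \<subseteq> deg_words (int n - 2)"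
 proof (rule keys_lin)
  fix b assume "b \<in> keys (chain_boundary S s :: _ \<Rightarrow>\<^sub>0 'k)"
  then have b: "b \<in> nondegenerate S" "n = Suc (fst b)" using keys_chain_boundary[of S n \<sigma>] sn by auto
  then have "[b] \<in> deg_words (int n - 2)" if "0 < fst b"
   using that by (auto simp: deg_words_def is_shape_def of_nat_diff)
  then show "keys (if 0 < fst b then gen [b] else 0 :: _ \<Rightarrow>\<^sub>0 'k) \<subseteq> deg_words (int n - 2)"
   using keys_gen_deg_words by auto
 qed
 have aw: "keys (alexander_whitney S s :: _ \<Rightarrow>\<^sub>0 'k)
   \<subseteq> {(b, b'). b \<in> nondegenerate S \<and> b' \<in> nondegenerate S \<and> fst b + fst b' = n}"
  unfolding alexander_whitney_def sn case_prod_conv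
 proof (intro keys_sum_subset keys_bilin)
  fix p b b' assume p: "p \<in> {..n}" and k: "b \<in> keys (nchain S (p, front_face S n p \<sigma>) :: _ \<Rightarrow>\<^sub>0 'k)"
   "b' \<in> keys (nchain S (n - p, last_face S n (n - p) \<sigma>) :: _ \<Rightarrow>\<^sub>0 'k)"
  from subsetD[OF keys_nchain k(1)] subsetD[OF keys_nchain k(2)] p
  have "b \<in> nondegenerate S" "b' \<in> nondegenerate S" "fst b + fst b' = n" by auto
  then show "keys (gen (b, b') :: _ \<Rightarrow>\<^sub>0 'k)
    \<subseteq> {(b, b'). b \<in> nondegenerate S \<and> b' \<in> nondegenerate S \<and> fst b + fst b' = n}"
   using keys_gen by fastforce
 qed
 have 2: "keys (lin (\<lambda>(b, b'). if 0 < fst b \<and> 0 < fst b' then sgn_pow (fst b) (gen [b, b']) else 0)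
   (alexander_whitney S s) :: _ \<Rightarrow>\<^sub>0 'k) \<subseteq> deg_words (int n - 2)"
 proof (rule keys_lin, clarify)
  fix b b' w assume "(b, b') \<in> keys (alexander_whitney S s :: _ \<Rightarrow>\<^sub>0 'k)"
   and w: "w \<in> keys (if 0 < fst b \<and> 0 < fst b' then sgn_pow (fst b) (gen [b, b']) else 0 :: _ \<Rightarrow>\<^sub>0 'k)"
  then have b: "b \<in> nondegenerate S" "b' \<in> nondegenerate S" "fst b + fst b' = n" using aw by auto
  have pos: "0 < fst b" "0 < fst b'" and wb: "w = [b, b']"
   using w in_keys_genD by (auto simp: keys_sgn_pow split: if_splits)
  show "w \<in> deg_words (int n - 2)"
   unfolding wb using b pos by (auto simp: deg_words_def is_shape_def of_nat_diff)
 qed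
 have eq: "cobar_dif_gen (chain_coalg S) s = - lin (\<lambda>b. if 0 < fst b then gen [b] else 0) (chain_boundary S s)
   + (lin (\<lambda>(b, b'). if 0 < fst b \<and> 0 < fst b' then sgn_pow (fst b) (gen [b, b']) else 0) (alexander_whitney S s) :: _ \<Rightarrow>\<^sub>0 'k)"
  unfolding cobar_dif_gen_def chain_coalg_def by (simp cong: if_cong)
 show ?thesis unfolding eq by (rule keys_add_subset) (use 1 2 in \<open>simp_all only: keys_minus sn fst_conv\<close>)
qed

lemma keys_cobar_dif_word:
 assumes "is_shape w"
 shows "keys (cobar_dif_word (chain_coalg S) w :: _ \<Rightarrow>\<^sub>0 'k::{comm_ring,comm_monoid_mult}) \<subseteq> deg_words (int (vol w) - 1)"
 using assms
proof (induction w)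
 case Nil
 show ?case by simp
next
 case (Cons s w)
 have s: "s \<in> nondegenerate S" "0 < fst s" and w: "is_shape w" using Cons.prems by (auto simp: is_shape_def)
 have ww: "w \<in> deg_words (int (vol w))" "[s] \<in> deg_words (int (fst s - 1))"
  using s w by (auto simp: deg_words_def is_shape_def)
 have "int (fst s) - 2 + int (vol w) = int (vol (s # w)) - 1" "int (fst s - 1) + (int (vol w) - 1) = int (vol (s # w)) - 1"
  using s(2) by (simp_all add: of_nat_diff Suc_leI)
 then show ?case
  using keys_concat_mul[OF keys_cobar_dif_gen[OF s, where 'k = 'k] keys_gen_deg_words[OF ww(1)]]
   keys_concat_mul[OF keys_gen_deg_words[OF ww(2)] Cons.IH[OF w]]
  unfolding cobar_dif_word.simps by (intro keys_add_subset) (simp_all only: keys_sgn_pow)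
qed

lemma keys_cobar_dif:
 assumes "keys a \<subseteq> deg_words i"
 shows "keys (lin (cobar_dif_word (chain_coalg S)) a :: _ \<Rightarrow>\<^sub>0 'k::{comm_ring,comm_monoid_mult}) \<subseteq> deg_words (i - 1)"
proof (rule keys_lin)
 fix w assume "w \<in> keys a"
 then have "is_shape w" "int (vol w) = i" using assms by (auto simp: deg_words_def)
 then show "keys (cobar_dif_word (chain_coalg S) w :: _ \<Rightarrow>\<^sub>0 'k) \<subseteq> deg_words (i - 1)"
  using keys_cobar_dif_word by blast
qed

lemma compare_eqI:
 fixes p q :: "_ \<Rightarrow>\<^sub>0 'k::{comm_ring,comm_monoid_mult}"
 assumes p: "keys p \<subseteq> deg_words i" and q: "keys q \<subseteq> deg_words i"
  and eq: "lin word_chain p = (lin word_chain q :: _ \<Rightarrow>\<^sub>0 'k)"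
 shows "p = q"
proof (cases "i < 0")
 case True
 then have "keys p = {}" "keys q = {}" using p q by (auto simp: deg_words_def)
 then have "p = 0" "q = 0" by (simp_all only: keys_eq_empty)
 then show ?thesis by simp
next
 case False
 then obtain r where "i = int r" by (metis nonneg_int_cases not_less)
 then show ?thesis using compare_inj[of p r q] assms deg_words_nat by simp
qed

lemma compare_gr_chains:
 assumes "keys a \<subseteq> deg_words i"
 shows "(lin word_chain a :: _ \<Rightarrow>\<^sub>0 'k::{comm_ring,comm_monoid_mult}) \<in> gr_chains M i"
 using assms
proof (rule deg_words_cases)
 assume "a = 0"
 then show ?thesis by (simp add: gr_chains_def)
next
 fix r assume "i = int r" "keys a \<subseteq> shapes r"
 then show ?thesis using compare_gr[of a r] by simp
qed

lemma compare_dif: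
 assumes "keys a \<subseteq> deg_words i"
 shows "lin word_chain (lin (cobar_dif_word (chain_coalg S)) a)
   = (lin (chain_boundary M) (lin word_chain a) :: _ \<Rightarrow>\<^sub>0 'k::{comm_ring,comm_monoid_mult})"
 unfolding lin_lin
 by (rule lin_cong) (use assms in \<open>auto simp: deg_words_def compare_boundary_word[symmetric]\<close>)

lemma cobar_simps:
 "Gr (cobar (chain_coalg S) :: ('k::{comm_ring,comm_monoid_mult}, _) dg_alg) i = {p. keys p \<subseteq> deg_words i}"
 "Zero (cobar (chain_coalg S) :: ('k, _) dg_alg) = 0"
 "Add (cobar (chain_coalg S) :: ('k, _) dg_alg) = (+)"
 "Scale (cobar (chain_coalg S) :: ('k, _) dg_alg) = scale"
 "One (cobar (chain_coalg S) :: ('k, _) dg_alg) = gen []"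
 "Mul (cobar (chain_coalg S) :: ('k, _) dg_alg) = concat_mul"
 "Dif (cobar (chain_coalg S) :: ('k, _) dg_alg) = lin (cobar_dif_word (chain_coalg S))"
 by (simp_all add: cobar_def cobar_words_eq)

text \<open>The identities that involve the differential are inherited from the chains on the loop monoid,
 because the comparison map is injective and multiplicative.\<close>

theorem dga_cobar: "dga (cobar (chain_coalg S) :: ('k::{comm_ring,comm_monoid_mult}, _) dg_alg)"
proof
 fix i j l :: int and a b c :: "(nat \<times> 's) list \<Rightarrow>\<^sub>0 'k" and r s :: 'k
 let ?A = "cobar (chain_coalg S) :: ('k, _) dg_alg"
 let ?D = "lin (cobar_dif_word (chain_coalg S)) :: _ => _ \<Rightarrow>\<^sub>0 'k"
 note simps = cobar_simps Neg_def
 show "Zero ?A \<in> Gr ?A i" by (simp add: simps)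
 show "a \<in> Gr ?A i ==> b \<in> Gr ?A i ==> Add ?A a b \<in> Gr ?A i" by (simp add: simps keys_add_subset)
 show "a \<in> Gr ?A i ==> Scale ?A r a \<in> Gr ?A i" using keys_scale[of r a] by (auto simp: simps)
 show "Add ?A (Add ?A a b) c = Add ?A a (Add ?A b c)" by (simp add: simps add.assoc)
 show "Add ?A a b = Add ?A b a" by (simp add: simps add.commute)
 show "Add ?A (Zero ?A) a = a" by (simp add: simps)
 show "Add ?A a (Neg ?A a) = Zero ?A" by (simp add: simps)
 show "Scale ?A r (Add ?A a b) = Add ?A (Scale ?A r a) (Scale ?A r b)" by (simp add: simps scale_add)
 show "Scale ?A (r + s) a = Add ?A (Scale ?A r a) (Scale ?A s a)" by (simp add: simps add_scale)
 show "Scale ?A (r * s) a = Scale ?A r (Scale ?A s a)" by (simp add: simps scale_scale)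
 show "Scale ?A 1 a = a" by (simp add: simps)
 show "a \<in> Gr ?A i ==> b \<in> Gr ?A j ==> Mul ?A a b \<in> Gr ?A (i + j)" by (simp add: simps keys_concat_mul)
 show "Mul ?A (Add ?A a b) c = Add ?A (Mul ?A a c) (Mul ?A b c)" by (simp add: simps concat_mul_def bilin_add)
 show "Mul ?A a (Add ?A b c) = Add ?A (Mul ?A a b) (Mul ?A a c)" by (simp add: simps concat_mul_def bilin_add)
 show "Mul ?A (Scale ?A r a) b = Scale ?A r (Mul ?A a b)" by (simp add: simps concat_mul_def bilin_scale)
 show "Mul ?A a (Scale ?A r b) = Scale ?A r (Mul ?A a b)" by (simp add: simps concat_mul_def bilin_scale)
 show "Mul ?A (Mul ?A a b) c = Mul ?A a (Mul ?A b c)" by (simp add: simps concat_mul_assoc)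
 show "One ?A \<in> Gr ?A 0"
  using keys_gen_deg_words[of "[]" 0, where 'k = 'k] by (simp add: simps deg_words_def is_shape_def)
 show "Mul ?A (One ?A) a = a" "Mul ?A a (One ?A) = a" by (simp_all add: simps concat_mul_unit)
 show "a \<in> Gr ?A i ==> Dif ?A a \<in> Gr ?A (i - 1)" by (simp add: simps keys_cobar_dif)
 show "Dif ?A (Add ?A a b) = Add ?A (Dif ?A a) (Dif ?A b)" by (simp add: simps lin_add)
 show "Dif ?A (Scale ?A r a) = Scale ?A r (Dif ?A a)" by (simp add: simps lin_scale)
 show "Dif ?A (Dif ?A a) = Zero ?A" if "a \<in> Gr ?A i"
 proof -
  have a: "keys a \<subseteq> deg_words i" using that by (simp add: simps)
  have "lin word_chain (?D (?D a)) = lin (chain_boundary M) (lin (chain_boundary M) (lin word_chain a))"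
   by (simp only: compare_dif[OF a] compare_dif[OF keys_cobar_dif[OF a]])
  also have "\<dots> = lin word_chain 0"
   by (simp add: G.boundary_boundary_chains[OF gr_nchains[OF compare_gr_chains[OF a]]])
  finally have "?D (?D a) = 0"
   by (rule compare_eqI[OF keys_cobar_dif[OF keys_cobar_dif[OF a]], rotated]) simp
  then show ?thesis by (simp add: simps)
 qed
 show "Dif ?A (Mul ?A a b) = Add ?A (Mul ?A (Dif ?A a) b)
     (if even i then Mul ?A a (Dif ?A b) else Neg ?A (Mul ?A a (Dif ?A b)))"
  if ab: "a \<in> Gr ?A i" "b \<in> Gr ?A j"
 proof -
  have a: "keys a \<subseteq> deg_words i" and b: "keys b \<subseteq> deg_words j" using ab by (simp_all add: simps)
  from a show ?thesis
  proof (rule deg_words_cases)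
   assume "a = 0" then show ?thesis by (simp add: simps concat_mul_def)
  next
   fix p assume i: "i = int p" and "keys a \<subseteq> shapes p"
   have "?D (concat_mul a b) = concat_mul (?D a) b + sgn_pow p (concat_mul a (?D b))"
   proof (rule compare_eqI)
    show "keys (?D (concat_mul a b)) \<subseteq> deg_words (i + j - 1)"
     by (rule keys_cobar_dif[OF keys_concat_mul[OF a b]])
    show "keys (concat_mul (?D a) b + sgn_pow p (concat_mul a (?D b))) \<subseteq> deg_words (i + j - 1)"
     using keys_concat_mul[OF keys_cobar_dif[OF a] b] keys_concat_mul[OF a keys_cobar_dif[OF b]]
     by (intro keys_add_subset) (simp_all add: keys_sgn_pow algebra_simps)
    have "lin word_chain (?D (concat_mul a b)) = lin (chain_boundary M) (gmul (lin word_chain a) (lin word_chain b))"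
     by (simp only: compare_dif[OF keys_concat_mul[OF a b]] compare_concat_mul)
    also have "\<dots> = gmul (lin (chain_boundary M) (lin word_chain a)) (lin word_chain b)
      + sgn_pow p (gmul (lin word_chain a) (lin (chain_boundary M) (lin word_chain b)))"
     using compare_gr_chains[OF a] i by (intro G.shuffle_boundary_chains gr_nchains[OF compare_gr_chains[OF b]]) simp
    finally show "lin word_chain (?D (concat_mul a b)) = lin word_chain (concat_mul (?D a) b + sgn_pow p (concat_mul a (?D b)))"
     by (simp only: lin_add lin_sgn_pow compare_concat_mul compare_dif[OF a] compare_dif[OF b])
   qed
   then show ?thesis by (simp add: simps i sgn_pow_def)
  qed
 qed
qed

lemma dga_hom_compare:
 "dga_hom (cobar (chain_coalg S)) (chain_dga M mul one :: ('k::{comm_ring,comm_monoid_mult}, _) dg_alg) (lin word_chain)"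
 unfolding dga_hom_def cobar_simps chain_dga_def
 by (auto simp: compare_gr_chains lin_add lin_scale compare_concat_mul compare_dif G.nchain_unit)

text \<open>Subtracting a boundary removes the lower cells from a chain. What is left is the image of a chain of
 words plus upper cells, and if its boundary is the image of a chain of words, then the upper part is
 zero by \<open>upper_zero\<close>.\<close>

theorem homology_iso_compare:
 "homology_iso (cobar (chain_coalg S)) (chain_dga M mul one :: ('k::{comm_ring,comm_monoid_mult}, _) dg_alg) (lin word_chain)"
 unfolding homology_iso_def
proof (intro conjI allI ballI impI)
 let ?A = "cobar (chain_coalg S) :: ('k, _) dg_alg" and ?B = "chain_dga M mul one :: ('k, _) dg_alg"
 let ?D = "lin (cobar_dif_word (chain_coalg S)) :: _ => _ \<Rightarrow>\<^sub>0 'k"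
 let ?d = "lin (chain_boundary M) :: _ => _ \<Rightarrow>\<^sub>0 'k"
 have no_lower: "lookup (lin word_chain p) (lower_cell r c) = 0"
  if "keys p \<subseteq> deg_words (int r)" "c \<in> lower_cells r" for p :: "_ \<Rightarrow>\<^sub>0 'k" and r c
  using compare_no_lower that by (simp add: deg_words_nat)
 fix i
 show "\<exists>a\<in>Gr ?A (i + 1). z = Dif ?A a"
  if z: "z \<in> cycles ?A i" and ex: "\<exists>b\<in>Gr ?B (i + 1). lin word_chain z = Dif ?B b" for z
 proof -
  have zk: "keys z \<subseteq> deg_words i" using z by (simp add: cycles_def cobar_simps)
  then show ?thesis
  proof (rule deg_words_cases)
   assume "z = 0"
   then show ?thesis by (intro bexI[of _ 0]) (simp_all add: cobar_simps)
  next
   fix r assume i: "i = int r"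
   obtain b where b: "b \<in> gr_chains M (int (Suc r))" "lin word_chain z = ?d b"
    using ex i by (auto simp: chain_dga_def add.commute)
   obtain y :: "_ \<Rightarrow>\<^sub>0 'k" where y: "y \<in> gr_chains M (int (Suc (Suc r)))"
    "\<forall>c\<in>lower_cells (Suc r). lookup (b - ?d y) (lower_cell (Suc r) c) = 0"
    using remove_lower by blast
   have bdy: "b - ?d y \<in> gr_chains M (int (Suc r))"
    using G.gr_chains_boundary[OF y(1)] by (intro gr_chains_diff[OF b(1)]) simp
   obtain a where a: "keys a \<subseteq> shapes (Suc r)"
    and u: "\<forall>s\<in>keys (b - ?d y - lin word_chain a). \<exists>r'. Suc r = Suc r' \<and> s \<in> upper_cell r' ` lower_cells r'"
    using decompose_without_lower[OF bdy] y(2) by blast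
   have aw: "keys a \<subseteq> deg_words (int (Suc r))" using a by (simp only: deg_words_nat)
   have Da: "keys (?D a) \<subseteq> deg_words (int r)" using keys_cobar_dif[OF aw] by simp
   have "?d (b - ?d y - lin word_chain a) = lin word_chain z - lin word_chain (?D a)"
    by (simp add: lin_diff b(2) compare_dif[OF aw] G.boundary_boundary_chains[OF gr_nchains[OF y(1)]])
   then have "b - ?d y - lin word_chain a = 0"
    using no_lower[OF zk[unfolded i]] no_lower[OF Da]
    by (intro upper_zero[OF u]) (simp add: lookup_minus)
   then have "lin word_chain z - lin word_chain (?D a) = 0"
    using \<open>?d (b - ?d y - lin word_chain a) = lin word_chain z - lin word_chain (?D a)\<close> by simp
   then have "z = ?D a" by (intro compare_eqI[OF zk[unfolded i] Da]) simp
   then show ?thesis using aw i by (intro bexI[of _ a]) (simp_all add: cobar_simps add.commute)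
  qed
 qed
 show "\<exists>z\<in>cycles ?A i. \<exists>b\<in>Gr ?B (i + 1). w = Add ?B (lin word_chain z) (Dif ?B b)"
  if "w \<in> cycles ?B i" for w
 proof (cases "i < 0")
  case True
  have "w \<in> gr_chains M i" using that by (simp add: cycles_def chain_dga_def)
  then have "keys w = {}" using True by (auto simp: gr_chains_def)
  then have "w = 0" by (simp only: keys_eq_empty)
  then show ?thesis
   by (intro bexI[of _ 0]) (simp_all add: cobar_simps cycles_def chain_dga_def gr_chains_def)
 next
  case False
  then obtain r where i: "i = int r" by (metis nonneg_int_cases not_less)
  have w: "w \<in> gr_chains M (int r)" "?d w = 0" using that i by (simp_all add: cycles_def chain_dga_def)
  obtain y :: "_ \<Rightarrow>\<^sub>0 'k" where y: "y \<in> gr_chains M (int (Suc r))"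
   "\<forall>c\<in>lower_cells r. lookup (w - ?d y) (lower_cell r c) = 0"
   using remove_lower by blast
  have wy: "w - ?d y \<in> gr_chains M (int r)"
   using G.gr_chains_boundary[OF y(1)] by (intro gr_chains_diff[OF w(1)]) simp
  obtain a where a: "keys a \<subseteq> shapes r"
   and u: "\<forall>s\<in>keys (w - ?d y - lin word_chain a). \<exists>r'. r = Suc r' \<and> s \<in> upper_cell r' ` lower_cells r'"
   using decompose_without_lower[OF wy] y(2) by blast
  have aw: "keys a \<subseteq> deg_words (int r)" using a by (simp only: deg_words_nat)
  have bd: "?d (w - ?d y - lin word_chain a) = - lin word_chain (?D a)"
   by (simp add: lin_diff w(2) compare_dif[OF aw] G.boundary_boundary_chains[OF gr_nchains[OF y(1)]])
  have u0: "w - ?d y - lin word_chain a = 0"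
  proof (rule upper_zero[OF u])
   fix r' c assume r: "r = Suc r'" and c: "c \<in> lower_cells r'"
   have "keys (?D a) \<subseteq> deg_words (int r')" using keys_cobar_dif[OF aw] r by simp
   from no_lower[OF this c] show "lookup (?d (w - ?d y - lin word_chain a)) (lower_cell r' c) = 0"
    by (simp add: bd)
  qed
  have "lin word_chain (?D a) = lin word_chain 0" using bd u0 by simp
  then have "?D a = 0" by (rule compare_eqI[OF keys_cobar_dif[OF aw], rotated]) simp
  moreover have "w = lin word_chain a + ?d y" using u0 by (simp add: algebra_simps)
  ultimately show ?thesis
   using y(1) aw i
   by (intro bexI[of _ a] bexI[of _ y]) (simp_all add: cycles_def cobar_simps chain_dga_def add.commute)
 qed
qed

end

section \<open>Functoriality\<close>

locale reduced_map = S: reduced S x + T: reduced T y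
 for S :: "'s sset" and x and T :: "'t sset" and y +
 fixes f :: "nat => 's => 't"
 assumes f: "f \<in> simplicial_maps S T"
begin

fun letter_map :: "'s rletter => 't rletter" where
 "letter_map ((n, \<sigma>), a, b, U) = ((n, f n \<sigma>), a, b, U)"

lemma valid_letter_map: "S.valid r l ==> T.valid r (letter_map l)"
 using simplicial_mapsD(1)[OF f] by (cases l rule: letter_map.cases) (simp add: S.valid.simps T.valid.simps)

lemma valid_map_letter_map: "\<forall>l\<in>set w. S.valid r l ==> \<forall>l\<in>set (map letter_map w). T.valid r l"
 using valid_letter_map by auto

lemma eqv_map:
 assumes "S.eqv r w w'"
 shows "T.eqv r (map letter_map w) (map letter_map w')"
 using assms unfolding S.eqv_def
proof (induction rule: colim_eq.induct)
 case (rule s t u v)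
 have val: "\<forall>l\<in>set (u @ s @ v). S.valid r l" using rule(2) by (simp only: S.colim_path_iff)
 have vs: "\<forall>l\<in>set s. S.valid r l" using val by auto
 have vT: "\<forall>l\<in>set (map letter_map s). T.valid r l" by (rule valid_map_letter_map[OF vs])
 have "T.eqv r (map letter_map s) (map letter_map t)"
  using rule(1) vs
 proof (cases rule: S.eqv_cases)
  case (arr m n \<theta> \<sigma> a b U)
  have "f m (sact S m n \<theta> \<sigma>) = sact T m n \<theta> (f n \<sigma>)" by (rule simplicial_mapsD(2)[OF f arr(2,1)])
  then show ?thesis
   using T.eqv_arrow[OF simplicial_mapsD(1)[OF f arr(1)] arr(2), of r a b U] vT by (simp add: arr)
 next
  case (cmp j a b c U V)
  obtain n \<sigma> where j: "j = (n, \<sigma>)" by (cases j)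
  show ?thesis using T.eqv_comp[of r "(n, f n \<sigma>)" a b U c V] vT by (simp add: cmp j)
 next
  case (idt n \<sigma> a)
  then show ?thesis using T.eqv_ident[OF simplicial_mapsD(1)[OF f idt(1)] idt(2)] by simp
 qed
 then have "T.eqv r (map letter_map u @ map letter_map s @ map letter_map v)
    (map letter_map u @ map letter_map t @ map letter_map v)"
  by (rule T.eqv_context) (use val valid_letter_map in auto)
 then show ?case by simp
next
 case (refl w)
 then have "\<forall>l\<in>set w. S.valid r l" by (simp only: S.colim_path_iff)
 then show ?case using valid_letter_map by (intro T.eqv_refl) auto
next
 case (sym v w)
 then show ?case by (blast intro: T.eqv_sym)
next
 case (trans u v w)
 then show ?case by (blast intro: T.eqv_trans)
qed

abbreviation loop_map :: "nat => 's rigid_mor => 't rigid_mor" where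
 "loop_map \<equiv> rigid_map T f T.X T.X"

lemma loop_map_cls:
 assumes w: "\<forall>l\<in>set w. S.valid r l"
 shows "loop_map r (S.cls r w) = T.cls r (map letter_map w)"
proof -
 have "(\<lambda>((n, \<sigma>), i, j, U). ((n, f n \<sigma>), i, j, U)) = letter_map"
  by (rule ext) (auto split: prod.split)
 then have "loop_map r (S.cls r w) = (\<Union>w\<in>map letter_map ` S.cls r w. T.cls r w)"
  by (simp only: rigid_map_def T.Image_colim_rel)
 also have "\<dots> = T.cls r (map letter_map w)"
 proof (rule T.UN_cls)
  show "map letter_map ` S.cls r w \<noteq> {}" using S.eqv_refl w by (auto simp: S.cls_def)
  show "T.eqv r (map letter_map w) v" if "v \<in> map letter_map ` S.cls r w" for v
   using that eqv_map by (auto simp: S.cls_def)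
 qed
 finally show ?thesis .
qed

lemma loop_map_simplicial: "simplicial_on S.M T.M loop_map"
 unfolding simplicial_on_def
proof (intro conjI allI ballI)
 fix n c assume "c \<in> spx S.M n"
 then obtain w where c: "c = S.cls n w" and w: "\<forall>l\<in>set w. S.valid n l" by (auto simp: S.spx_M)
 show "loop_map n c \<in> spx T.M n"
  unfolding c loop_map_cls[OF w] T.spx_M using valid_map_letter_map[OF w] by blast
next
 fix k n \<theta> c assume \<theta>: "\<theta> \<in> mono_maps k n" and "c \<in> spx S.M n"
 then obtain w where c: "c = S.cls n w" and w: "\<forall>l\<in>set w. S.valid n l" by (auto simp: S.spx_M)
 have "letter_map (S.lact k \<theta> l) = T.lact k \<theta> (letter_map l)" for l
  by (cases l rule: letter_map.cases) simp
 then show "loop_map k (sact S.M k n \<theta> c) = sact T.M k n \<theta> (loop_map n c)"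
  unfolding c loop_map_cls[OF w] S.sact_M[OF \<theta> w] T.sact_M[OF \<theta> valid_map_letter_map[OF w]]
   loop_map_cls[OF S.valid_map_lact[OF w \<theta>]] by (simp add: o_def)
qed

lemma loop_map_mul:
 assumes "c \<in> spx S.M n" "d \<in> spx S.M n"
 shows "loop_map n (S.mul n c d) = T.mul n (loop_map n c) (loop_map n d)"
proof -
 obtain u v where u: "c = S.cls n u" "\<forall>l\<in>set u. S.valid n l" and v: "d = S.cls n v" "\<forall>l\<in>set v. S.valid n l"
  using assms by (auto simp: S.spx_M)
 have uv: "\<forall>l\<in>set (u @ v). S.valid n l" using u v by auto
 show ?thesis
  unfolding u(1) v(1) S.mul_cls[OF u(2) v(2)] loop_map_cls[OF uv] loop_map_cls[OF u(2)] loop_map_cls[OF v(2)]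
   T.mul_cls[OF valid_map_letter_map[OF u(2)] valid_map_letter_map[OF v(2)]] by simp
qed

lemma loop_map_one: "loop_map 0 S.one = T.one"
 using loop_map_cls[of "[]" 0] by (simp add: S.one_cls T.one_cls)

lemma Gamma_map_push: "Gamma_map T y f = (push T.M loop_map :: _ => _ \<Rightarrow>\<^sub>0 'k::{comm_ring,comm_monoid_mult})"
 by (simp add: fun_eq_iff Gamma_map_def push_def Let_def)

lemma dga_hom_loop_map:
 "dga_hom (chain_dga S.M S.mul S.one) (chain_dga T.M T.mul T.one :: ('k::{comm_ring,comm_monoid_mult}, _) dg_alg) (push T.M loop_map)"
 by (rule dga_hom_push[OF S.simplicial_monoid_M T.simplicial_monoid_M loop_map_simplicial loop_map_mul loop_map_one])

lemma push_gmul: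
 assumes "a \<in> nchains S.M" "b \<in> nchains S.M"
 shows "push T.M loop_map (S.gmul a b) = (T.gmul (push T.M loop_map a) (push T.M loop_map b) :: _ \<Rightarrow>\<^sub>0 'k::{comm_ring,comm_monoid_mult})"
 by (rule shuffle_natural_chain[where a = loop_map and b = loop_map and c = loop_map and m = S.mul and m' = T.mul,
    OF S.G.mult T.G.mult loop_map_simplicial loop_map_simplicial loop_map_simplicial _ assms])
  (rule loop_map_mul)

lemma push_one: "push T.M loop_map (gen (0, S.one)) = (gen (0, T.one) :: _ \<Rightarrow>\<^sub>0 'k::{comm_ring,comm_monoid_mult})"
proof -
 have "push T.M loop_map (nchain S.M (0, S.one)) = (nchain T.M (0, T.one) :: _ \<Rightarrow>\<^sub>0 'k)"
  by (simp only: push_nchain[OF loop_map_simplicial S.G.unit] loop_map_one)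
 then show ?thesis by (simp only: S.G.nchain_unit T.G.nchain_unit)
qed

lemma push_fund:
 assumes \<sigma>: "\<sigma> \<in> spx S n"
 shows "push T.M loop_map (S.fund n \<sigma>) = (T.fund n (f n \<sigma>) :: _ \<Rightarrow>\<^sub>0 'k::{comm_ring,comm_monoid_mult})"
proof -
 have "push T.M loop_map (S.fund n \<sigma>) = push T.M (\<lambda>r. loop_map r \<circ> S.cube_map n \<sigma> 0 n r) (cube [1..<n] :: _ \<Rightarrow>\<^sub>0 'k)"
  unfolding S.fund_def by (rule push_push[OF loop_map_simplicial S.cube_map_simplicial[OF \<sigma>] cube_nchains]) auto
 also have "\<dots> = T.fund n (f n \<sigma>)"
  unfolding T.fund_def
 proof (rule push_cong)
  fix r U assume "(r, U) \<in> keys (cube [1..<n] :: _ \<Rightarrow>\<^sub>0 'k)"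
  then have "U \<in> chains_in UNIV r" using nchains_keysD[OF cube_nchains] by (simp add: spx_nerve)
  then have v: "\<forall>l\<in>set [S.cube_letter n \<sigma> 0 n r U]. S.valid r l" using S.valid_cube_letter[OF \<sigma>, of 0 n U r] by simp
  show "(loop_map r \<circ> S.cube_map n \<sigma> 0 n r) U = T.cube_map n (f n \<sigma>) 0 n r U"
   unfolding o_apply S.cube_map_def T.cube_map_def loop_map_cls[OF v]
   by (simp add: S.cube_letter_def T.cube_letter_def)
 qed
 finally show ?thesis .
qed

lemma push_letter_chain:
 assumes "\<sigma> \<in> spx S n"
 shows "push T.M loop_map (S.letter_chain (n, \<sigma>)) = (T.letter_chain (n, f n \<sigma>) :: _ \<Rightarrow>\<^sub>0 'k::{comm_ring,comm_monoid_mult})"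
proof -
 have lin: "push T.M loop_map (a - b) = push T.M loop_map a - (push T.M loop_map b :: _ \<Rightarrow>\<^sub>0 'k)"
  "push T.M loop_map (sgn_pow k a) = sgn_pow k (push T.M loop_map a :: _ \<Rightarrow>\<^sub>0 'k)"
  "push T.M loop_map 0 = (0 :: _ \<Rightarrow>\<^sub>0 'k)" for a b k
  by (simp_all add: push_def lin_diff lin_sgn_pow)
 show ?thesis by (simp add: S.letter_chain_def T.letter_chain_def lin push_fund[OF assms] push_one)
qed

abbreviation letter_image :: "nat \<times> 's => (nat \<times> 't \<Rightarrow>\<^sub>0 'k::{comm_ring,comm_monoid_mult})" where
 "letter_image \<equiv> (\<lambda>(n, \<sigma>). nchain T (n, f n \<sigma>))"

lemma push_word_chain:
 assumes "S.is_shape w"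
 shows "push T.M loop_map (S.word_chain w)
  = (lin T.word_chain (cobar_map_word letter_image w) :: _ \<Rightarrow>\<^sub>0 'k::{comm_ring,comm_monoid_mult})"
 using assms
proof (induction w)
 case Nil
 show ?case by (simp add: push_one)
next
 case (Cons s w)
 obtain n \<sigma> where s: "s = (n, \<sigma>)" by (cases s)
 have \<sigma>: "\<sigma> \<in> spx S n" and w: "S.is_shape w" using Cons.prems by (auto simp: S.is_shape_def s nondegenerate_def)
 have "lin T.word_chain (lin (\<lambda>c. gen [c]) (nchain T (n, f n \<sigma>)) :: _ \<Rightarrow>\<^sub>0 'k) = lin T.letter_chain (nchain T (n, f n \<sigma>) :: _ \<Rightarrow>\<^sub>0 'k)"
  unfolding lin_lin by (rule lin_cong) (simp add: T.word_chain_single del: T.word_chain.simps)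
 also have "\<dots> = T.letter_chain (n, f n \<sigma>)"
  by (rule lin_nchain[where f = T.letter_chain, OF simplicial_mapsD(1)[OF f \<sigma>] T.letter_chain_degenerate])
 also have "\<dots> = push T.M loop_map (S.letter_chain (n, \<sigma>))" by (simp only: push_letter_chain[OF \<sigma>])
 finally have "lin T.word_chain (lin (\<lambda>c. gen [c]) (nchain T (n, f n \<sigma>)) :: _ \<Rightarrow>\<^sub>0 'k) = push T.M loop_map (S.letter_chain (n, \<sigma>))" .
 then show ?case
  by (simp add: s T.compare_concat_mul push_gmul[OF S.letter_chain_nchains S.word_chain_nchains] Cons.IH[OF w]
    del: bilin_gen_left bilin_gen_right)
qed

lemma compare_natural:
 assumes "keys a \<subseteq> S.deg_words i"
 shows "lin T.word_chain (lin (cobar_map_word letter_image) a)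
  = (push T.M loop_map (lin S.word_chain a) :: _ \<Rightarrow>\<^sub>0 'k::{comm_ring,comm_monoid_mult})"
 unfolding push_def lin_lin
 by (rule lin_cong) (use assms in \<open>auto simp: S.deg_words_def push_word_chain[symmetric, unfolded push_def]\<close>)

lemma keys_cobar_map_word:
 "S.is_shape w ==> keys (cobar_map_word letter_image w :: _ \<Rightarrow>\<^sub>0 'k::{comm_ring,comm_monoid_mult}) \<subseteq> T.deg_words (int (vol w))"
proof (induction w)
 case Nil
 show ?case using T.keys_gen_deg_words[of "[]" 0, where 'k = 'k] by (simp add: T.deg_words_def T.is_shape_def)
next
 case (Cons s w)
 obtain n \<sigma> where s: "s = (n, \<sigma>)" by (cases s)
 have n: "0 < n" and w: "S.is_shape w" using Cons.prems by (auto simp: S.is_shape_def s)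
 have "keys (lin (\<lambda>c. gen [c]) (letter_image s) :: _ \<Rightarrow>\<^sub>0 'k) \<subseteq> T.deg_words (int (n - 1))"
 proof (rule keys_lin)
  fix c assume "c \<in> keys (letter_image s :: _ \<Rightarrow>\<^sub>0 'k)"
  then have "c \<in> keys (nchain T (n, f n \<sigma>) :: _ \<Rightarrow>\<^sub>0 'k)" by (simp add: s)
  from subsetD[OF keys_nchain this] have "[c] \<in> T.deg_words (int (n - 1))"
   using n by (auto simp: T.deg_words_def T.is_shape_def)
  then show "keys (gen [c] :: _ \<Rightarrow>\<^sub>0 'k) \<subseteq> T.deg_words (int (n - 1))" by (rule T.keys_gen_deg_words)
 qed
 from T.keys_concat_mul[OF this Cons.IH[OF w]] show ?case by (simp add: s)
qed

lemma keys_cobar_map: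
 assumes "keys a \<subseteq> S.deg_words i"
 shows "keys (lin (cobar_map_word letter_image) a :: _ \<Rightarrow>\<^sub>0 'k::{comm_ring,comm_monoid_mult}) \<subseteq> T.deg_words i"
proof (rule keys_lin)
 fix w assume "w \<in> keys a"
 then have "S.is_shape w" "int (vol w) = i" using assms by (auto simp: S.deg_words_def)
 then show "keys (cobar_map_word letter_image w :: _ \<Rightarrow>\<^sub>0 'k) \<subseteq> T.deg_words i"
  using keys_cobar_map_word by blast
qed

text \<open>The differentials are compared after the injective comparison map, where the claim is that maps of
 loop monoids commute with boundaries.\<close>

lemma dga_hom_cobar_map:
 "dga_hom (cobar (chain_coalg S)) (cobar (chain_coalg T) :: ('k::{comm_ring,comm_monoid_mult}, _) dg_alg)
   (lin (cobar_map_word letter_image))"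
proof -
 have "lin (cobar_map_word letter_image) (lin (cobar_dif_word (chain_coalg S)) a)
   = (lin (cobar_dif_word (chain_coalg T)) (lin (cobar_map_word letter_image) a) :: _ \<Rightarrow>\<^sub>0 'k)"
  if a: "keys a \<subseteq> S.deg_words i" for a i
 proof (rule T.compare_eqI)
  note Da = S.keys_cobar_dif[OF a] and fa = keys_cobar_map[OF a]
  show "keys (lin (cobar_map_word letter_image) (lin (cobar_dif_word (chain_coalg S)) a) :: _ \<Rightarrow>\<^sub>0 'k) \<subseteq> T.deg_words (i - 1)"
   by (rule keys_cobar_map[OF Da])
  show "keys (lin (cobar_dif_word (chain_coalg T)) (lin (cobar_map_word letter_image) a) :: _ \<Rightarrow>\<^sub>0 'k) \<subseteq> T.deg_words (i - 1)"
   by (rule T.keys_cobar_dif[OF fa])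
  have "push T.M loop_map (lin (chain_boundary S.M) (lin S.word_chain a))
    = (lin (chain_boundary T.M) (push T.M loop_map (lin S.word_chain a)) :: _ \<Rightarrow>\<^sub>0 'k)"
   by (rule push_boundary_chain[OF S.simplicial_set_M T.simplicial_set_M loop_map_simplicial gr_nchains[OF S.compare_gr_chains[OF a]]])
  then show "lin T.word_chain (lin (cobar_map_word letter_image) (lin (cobar_dif_word (chain_coalg S)) a))
    = (lin T.word_chain (lin (cobar_dif_word (chain_coalg T)) (lin (cobar_map_word letter_image) a)) :: _ \<Rightarrow>\<^sub>0 'k)"
   by (simp only: compare_natural[OF Da] S.compare_dif[OF a] T.compare_dif[OF fa] compare_natural[OF a])
 qed
 then show ?thesis
  unfolding dga_hom_def S.cobar_simps T.cobar_simps
  by (auto simp: keys_cobar_map lin_add lin_scale cobar_map_concat_mul)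
qed

end

lemma reduced_mapI:
 "[|reduced S x; reduced T y; f \<in> simplicial_maps S T|] ==> reduced_map S x T y f"
 by (simp add: reduced_map_def reduced_map_axioms_def)

lemma identity_simplicial_map: "simplicial_set S ==> (\<lambda>n. restrict id (spx S n)) \<in> simplicial_maps S S"
 by (auto simp: simplicial_maps_def act_closed)

lemma compose_simplicial_maps:
 assumes S: "simplicial_set S" and f: "f \<in> simplicial_maps S T" and g: "g \<in> simplicial_maps T U"
 shows "(\<lambda>n. compose (spx S n) (g n) (f n)) \<in> simplicial_maps S U"
proof -
 have "compose (spx S n) (g n) (f n) \<in> spx S n \<rightarrow>\<^sub>E spx U n" for n
  using simplicial_mapsD(1)[OF f] simplicial_mapsD(1)[OF g] by (auto simp: compose_def)
 then show ?thesis
  using act_closed[OF S] simplicial_mapsD[OF f] simplicial_mapsD[OF g]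
  by (auto simp: simplicial_maps_def compose_eq)
qed

context reduced
begin

lemma Gamma_map_identity:
 assumes a: "a \<in> gr_chains M i"
 shows "Gamma_map S x (\<lambda>n. restrict id (spx S n)) a = (a :: _ \<Rightarrow>\<^sub>0 'k::{comm_ring,comm_monoid_mult})"
proof -
 interpret m: reduced_map S x S x "\<lambda>n. restrict id (spx S n)"
  by (intro reduced_mapI identity_simplicial_map S reduced_axioms)
 have "push M m.loop_map a = push M (\<lambda>n c. c) a"
 proof (rule push_cong)
  fix r c assume "(r, c) \<in> keys a"
  then have "c \<in> spx M r" by (rule gr_chainsD(2)[OF a])
  then obtain w where c: "c = cls r w" and w: "\<forall>l\<in>set w. valid r l" by (auto simp: spx_M)
  have "m.letter_map l = l" if "valid r l" for l
   using that by (cases l rule: m.letter_map.cases) (simp add: valid.simps)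
  then have "map m.letter_map w = w" using w by (simp add: map_idI)
  then show "m.loop_map r c = c" unfolding c m.loop_map_cls[OF w] by simp
 qed
 then show ?thesis by (simp add: m.Gamma_map_push push_id[OF gr_nchains[OF a]])
qed

lemma Gamma_map_compose:
 assumes f: "reduced_map S x T y f" and g: "reduced_map T y U z g" and a: "a \<in> gr_chains M i"
 shows "Gamma_map U z (\<lambda>n. compose (spx S n) (g n) (f n)) a
  = (Gamma_map U z g (Gamma_map T y f a) :: _ \<Rightarrow>\<^sub>0 'k::{comm_ring,comm_monoid_mult})"
proof -
 interpret f: reduced_map S x T y f by fact
 interpret g: reduced_map T y U z g by fact
 interpret h: reduced_map S x U z "\<lambda>n. compose (spx S n) (g n) (f n)"
  by (rule reduced_mapI[OF reduced_axioms g.T.reduced_axioms compose_simplicial_maps[OF S f.f g.f]])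
 have "push g.T.M g.loop_map (push f.T.M f.loop_map a) = push g.T.M (\<lambda>r. g.loop_map r \<circ> f.loop_map r) a"
  by (rule push_push[OF g.loop_map_simplicial f.loop_map_simplicial gr_nchains[OF a]])
 also have "\<dots> = push g.T.M h.loop_map a"
 proof (rule push_cong)
  fix r c assume "(r, c) \<in> keys a"
  then have "c \<in> spx M r" by (rule gr_chainsD(2)[OF a])
  then obtain w where c: "c = cls r w" and w: "\<forall>l\<in>set w. valid r l" by (auto simp: spx_M)
  have "h.letter_map l = g.letter_map (f.letter_map l)" if "valid r l" for l
   using that by (cases l rule: f.letter_map.cases) (simp add: valid.simps compose_eq)
  then have eq: "map h.letter_map w = map g.letter_map (map f.letter_map w)" using w by simp
  show "(g.loop_map r \<circ> f.loop_map r) c = h.loop_map r c"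
   unfolding o_apply c f.loop_map_cls[OF w] g.loop_map_cls[OF f.valid_map_letter_map[OF w]] h.loop_map_cls[OF w] eq by (rule HOL.refl)
 qed
 finally show ?thesis by (simp add: f.Gamma_map_push g.Gamma_map_push h.Gamma_map_push)
qed

lemma cobar_map_identity:
 assumes a: "keys a \<subseteq> deg_words i"
 shows "lin (cobar_map_word (\<lambda>(n, \<sigma>). nchain S (n, restrict id (spx S n) \<sigma>))) a = (a :: _ \<Rightarrow>\<^sub>0 'k::{comm_ring,comm_monoid_mult})"
proof -
 have "cobar_map_word (\<lambda>(n, \<sigma>). nchain S (n, restrict id (spx S n) \<sigma>)) w = (gen w :: _ \<Rightarrow>\<^sub>0 'k)" if "is_shape w" for w
  using that
 proof (induction w)
  case (Cons s w)
  obtain n \<sigma> where s: "s = (n, \<sigma>)" by (cases s)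
  have "(n, \<sigma>) \<in> nondegenerate S" "is_shape w" using Cons.prems by (auto simp: is_shape_def s)
  then show ?case
   using Cons.IH by (simp add: s nondegenerate_spx nchain_nondegenerate concat_mul_def)
 qed simp
 then have "lin (cobar_map_word (\<lambda>(n, \<sigma>). nchain S (n, restrict id (spx S n) \<sigma>))) a = lin gen a"
  using a by (intro lin_cong) (auto simp: deg_words_def)
 then show ?thesis by (simp add: lin_gen_eq)
qed

lemma cobar_map_compose:
 assumes f: "f \<in> simplicial_maps S T" and g: "g \<in> simplicial_maps T U" and a: "keys a \<subseteq> deg_words i"
 shows "lin (cobar_map_word (\<lambda>(n, \<sigma>). nchain U (n, compose (spx S n) (g n) (f n) \<sigma>))) a
  = (lin (cobar_map_word (\<lambda>(n, \<sigma>). nchain U (n, g n \<sigma>))) (lin (cobar_map_word (\<lambda>(n, \<sigma>). nchain T (n, f n \<sigma>))) a)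
    :: _ \<Rightarrow>\<^sub>0 'k::{comm_ring,comm_monoid_mult})"
proof -
 let ?f = "\<lambda>(n, \<sigma>). nchain T (n, f n \<sigma>) :: _ \<Rightarrow>\<^sub>0 'k" and ?g = "\<lambda>(n, \<sigma>). nchain U (n, g n \<sigma>) :: _ \<Rightarrow>\<^sub>0 'k"
  and ?h = "\<lambda>(n, \<sigma>). nchain U (n, compose (spx S n) (g n) (f n) \<sigma>) :: _ \<Rightarrow>\<^sub>0 'k"
 have "cobar_map_word ?h w = lin (cobar_map_word ?g) (cobar_map_word ?f w)" if "is_shape w" for w
  using that
 proof (induction w)
  case (Cons s w)
  obtain n \<sigma> where s: "s = (n, \<sigma>)" by (cases s)
  have \<sigma>: "\<sigma> \<in> spx S n" and w: "is_shape w" using Cons.prems by (auto simp: is_shape_def s nondegenerate_def)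
  have "lin (cobar_map_word ?g) (lin (\<lambda>c. gen [c]) (?f s)) = lin (\<lambda>c. gen [c]) (lin ?g (?f s))"
   unfolding lin_lin by (rule lin_cong) (simp add: concat_mul_unit)
  moreover have "push U g (nchain T (n, f n \<sigma>)) = (nchain U (n, g n (f n \<sigma>)) :: _ \<Rightarrow>\<^sub>0 'k)"
   by (rule push_nchain[OF simplicial_maps_on[OF g] simplicial_mapsD(1)[OF f \<sigma>]])
  then have "lin ?g (?f s) = nchain U (n, g n (f n \<sigma>))" by (simp add: s push_def)
  ultimately have "lin (cobar_map_word ?g) (lin (\<lambda>c. gen [c]) (?f s)) = lin (\<lambda>c. gen [c]) (?h s)"
   using \<sigma> by (simp add: s compose_def)
  then show ?case using Cons.IH[OF w] by (simp only: cobar_map_word.simps cobar_map_concat_mul)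
 qed simp
 then show ?thesis
  unfolding lin_lin by (intro lin_cong) (use a in \<open>auto simp: deg_words_def\<close>)
qed

end

section \<open>The weak equivalence\<close>

lemma reduced_ssetsD:
 assumes "S \<in> reduced_ssets"
 shows "reduced S (the_elem (spx S 0))"
proof -
 obtain x where x: "simplicial_set S" "spx S 0 = {x}" using assms by (auto simp: reduced_ssets_def)
 show ?thesis by (rule reduced.intro) (simp_all add: x)
qed

lemma is_dga_functor_cobar:
 "is_dga_functor (cobar_functor :: ('s, 'k::{comm_ring,comm_monoid_mult}, (nat \<times> 's) list \<Rightarrow>\<^sub>0 'k) dga_functor)"
 unfolding is_dga_functor_def cobar_functor_def dga_functor.simps
proof (intro conjI ballI allI)
 fix S :: "'s sset" assume S: "S \<in> reduced_ssets"
 interpret S: reduced S "the_elem (spx S 0)" by (rule reduced_ssetsD[OF S])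
 show "dga (cobar (chain_coalg S) :: ('k, _) dg_alg)" by (rule S.dga_cobar)
 show "lin (cobar_map_word (\<lambda>(n, \<sigma>). nchain S (n, restrict id (spx S n) \<sigma>))) a = a"
  if "a \<in> Gr (cobar (chain_coalg S) :: ('k, _) dg_alg) i" for a i
  using that by (intro S.cobar_map_identity) (simp add: S.cobar_simps)
 fix T :: "'s sset" and f assume T: "T \<in> reduced_ssets" and f: "f \<in> simplicial_maps S T"
 interpret f: reduced_map S "the_elem (spx S 0)" T "the_elem (spx T 0)" f
  by (intro reduced_mapI reduced_ssetsD S T f)
 show "dga_hom (cobar (chain_coalg S)) (cobar (chain_coalg T) :: ('k, _) dg_alg) (lin (cobar_map_word (\<lambda>(n, \<sigma>). nchain T (n, f n \<sigma>))))"
  by (rule f.dga_hom_cobar_map)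
 fix U :: "'s sset" and g i a assume U: "U \<in> reduced_ssets" and g: "g \<in> simplicial_maps T U"
  and a: "a \<in> Gr (cobar (chain_coalg S) :: ('k, _) dg_alg) i"
 show "lin (cobar_map_word (\<lambda>(n, \<sigma>). nchain U (n, compose (spx S n) (g n) (f n) \<sigma>))) a
  = lin (cobar_map_word (\<lambda>(n, \<sigma>). nchain U (n, g n \<sigma>))) (lin (cobar_map_word (\<lambda>(n, \<sigma>). nchain T (n, f n \<sigma>))) a)"
  using a by (intro S.cobar_map_compose[OF f g]) (simp add: S.cobar_simps)
qed

lemma is_dga_functor_Gamma:
 "is_dga_functor (Gamma_functor :: ('s, 'k::{comm_ring,comm_monoid_mult}, nat \<times> 's rigid_mor \<Rightarrow>\<^sub>0 'k) dga_functor)"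
 unfolding is_dga_functor_def Gamma_functor_def dga_functor.simps
proof (intro conjI ballI allI)
 fix S :: "'s sset" assume S: "S \<in> reduced_ssets"
 interpret S: reduced S "the_elem (spx S 0)" by (rule reduced_ssetsD[OF S])
 show "dga (Gamma S (the_elem (spx S 0)) :: ('k, _) dg_alg)" unfolding S.Gamma_eq by (rule S.G.dga_chain_dga)
 show "Gamma_map S (the_elem (spx S 0)) (\<lambda>n. restrict id (spx S n)) a = a"
  if "a \<in> Gr (Gamma S (the_elem (spx S 0)) :: ('k, _) dg_alg) i" for a i
  using that by (intro S.Gamma_map_identity) (simp add: S.Gamma_eq chain_dga_def)
 fix T :: "'s sset" and f assume T: "T \<in> reduced_ssets" and f: "f \<in> simplicial_maps S T"
 interpret f: reduced_map S "the_elem (spx S 0)" T "the_elem (spx T 0)" f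
  by (intro reduced_mapI reduced_ssetsD S T f)
 show "dga_hom (Gamma S (the_elem (spx S 0))) (Gamma T (the_elem (spx T 0)) :: ('k, _) dg_alg) (Gamma_map T (the_elem (spx T 0)) f)"
  unfolding S.Gamma_eq f.T.Gamma_eq f.Gamma_map_push by (rule f.dga_hom_loop_map)
 fix U :: "'s sset" and g i a assume U: "U \<in> reduced_ssets" and g: "g \<in> simplicial_maps T U"
  and a: "a \<in> Gr (Gamma S (the_elem (spx S 0)) :: ('k, _) dg_alg) i"
 have gm: "reduced_map T (the_elem (spx T 0)) U (the_elem (spx U 0)) g"
  by (intro reduced_mapI reduced_ssetsD T U g)
 show "Gamma_map U (the_elem (spx U 0)) (\<lambda>n. compose (spx S n) (g n) (f n)) a
   = Gamma_map U (the_elem (spx U 0)) g (Gamma_map T (the_elem (spx T 0)) f a)"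
  using a by (intro S.Gamma_map_compose[OF f.reduced_map_axioms gm]) (simp add: S.Gamma_eq chain_dga_def)
qed

theorem proposition7p3:
  shows "naturally_weakly_equivalent
  (cobar_functor :: ('s, 'k::{comm_ring,comm_monoid_mult}, (nat \<times> 's) list \<Rightarrow>\<^sub>0 'k) dga_functor)
  (Gamma_functor :: ('s, 'k, nat \<times> 's rigid_mor \<Rightarrow>\<^sub>0 'k) dga_functor)"
proof (rule naturally_weakly_equivalentI[where \<eta> = "\<lambda>S. lin (reduced.word_chain S (the_elem (spx S 0)))"])
 show "is_dga_functor (cobar_functor :: ('s, 'k, (nat \<times> 's) list \<Rightarrow>\<^sub>0 'k) dga_functor)" by (rule is_dga_functor_cobar)
 show "is_dga_functor (Gamma_functor :: ('s, 'k, nat \<times> 's rigid_mor \<Rightarrow>\<^sub>0 'k) dga_functor)" by (rule is_dga_functor_Gamma)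
 fix S :: "'s sset" assume S: "S \<in> reduced_ssets"
 interpret S: reduced S "the_elem (spx S 0)" by (rule reduced_ssetsD[OF S])
 show "dga_hom (Fob cobar_functor S) (Fob Gamma_functor S :: ('k, _) dg_alg) (lin S.word_chain)"
  unfolding cobar_functor_def Gamma_functor_def dga_functor.simps S.Gamma_eq by (rule S.dga_hom_compare)
 show "homology_iso (Fob cobar_functor S) (Fob Gamma_functor S :: ('k, _) dg_alg) (lin S.word_chain)"
  unfolding cobar_functor_def Gamma_functor_def dga_functor.simps S.Gamma_eq by (rule S.homology_iso_compare)
next
 fix S T :: "'s sset" and f i and a :: "(nat \<times> 's) list \<Rightarrow>\<^sub>0 'k"
 assume S: "S \<in> reduced_ssets" and T: "T \<in> reduced_ssets" and f: "f \<in> simplicial_maps S T"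
  and a: "a \<in> Gr (Fob cobar_functor S) i"
 interpret f: reduced_map S "the_elem (spx S 0)" T "the_elem (spx T 0)" f
  by (intro reduced_mapI reduced_ssetsD S T f)
 have "keys a \<subseteq> f.S.deg_words i" using a by (simp add: cobar_functor_def f.S.cobar_simps)
 from f.compare_natural[OF this]
 show "lin f.T.word_chain (Fmap cobar_functor S T f a) = Fmap Gamma_functor S T f (lin f.S.word_chain a)"
  by (simp add: cobar_functor_def Gamma_functor_def f.Gamma_map_push)
qed

end
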